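(* Let $X$ be a compact Riemannian manifold and let $f\in\mathrm{Diff}^{\,1}(X)$ be an Anosov diffeomorphism. There exists a $C^1$-open neighborhood $\mathcal U$ of $f$ such that every sequence $\mathcal F=\{f_n\}_{n\in\mathbb Z}$ formed by elements of $\mathcal U$ satisfies the Lipschitz shadowing property. Moreover, for such $\mathcal F$: (1) for any $\beta>0$ there exists $\zeta>0$ such that any $\zeta$-pseudo-orbit $(x_n)_{n\in\mathbb Z}$ is $\beta$-shadowed by a unique point $x\in X$; (2) there exists $K>0$ such that, if $\varepsilon>0$ is small, then for any sequence $\mathcal G=\{g_n\}_n$ of elements of $\mathcal U$ with $|\|\mathcal F-\mathcal G\||<\varepsilon$ there exists a unique homeomorphism $h=h_{\mathcal F,\mathcal G}:X\to X$ such that $$d_{C^0}(h_{\mathcal F,\mathcal G},\mathrm{id})\le K\,|\|\mathcal F-\mathcal G\||$$ and $$h_{\mathcal G^{(n)},\mathcal F^{(n)}}\circ F_n=G_n\circ h_{\mathcal G,\mathcal F}\qquad\text{for all } n\in\mathbb Z_+,$$ where $h_{\mathcal F^{(n)},\mathcal G^{(n)}}:X\to X$ denotes the unique homeomorphism determined by the sequences $\mathcal F^{(n)}$ and $\mathcal G^{(n)}$. In particular, $d_{C^0}(h_{\mathcal F,\mathcal G},\mathrm{id})\to0$ as $|\|\mathcal F-\mathcal G\||\to0$.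
   Context: $\mathbb Z_+=\{0,1,2,\dots\}$. For a sequence $\mathcal F=\{f_n\}_{n\in\mathbb Z}$ of $C^1$ diffeomorphisms of $X$: $F_0=\mathrm{id}$, $F_n=f_{n-1}\circ\dots\circ f_1\circ f_0$ and $F_{-n}=f_{-n}^{-1}\circ\dots\circ f_{-2}^{-1}\circ f_{-1}^{-1}$ for $n\ge1$; the maps $G_n$ are defined likewise from $\mathcal G=\{g_n\}_{n\in\mathbb Z}$. For $k\in\mathbb Z$ the shifted sequence is $\mathcal F^{(k)}=\{f_{n+k}\}_{n\in\mathbb Z}$. The distance between sequences is $|\|\mathcal F-\mathcal G\||:=\sup_{n\in\mathbb Z}d_{C^1}(f_n,g_n)$, where $d_{C^1}$ is the usual $C^1$-distance; $d_{C^0}$ is the $C^0$-distance. In the notation $h_{\cdot,\cdot}$ the order of the two sequences matters: $h_{\mathcal G,\mathcal F}$ and $h_{\mathcal G^{(n)},\mathcal F^{(n)}}$ are the homeomorphisms attached to the pairs with the roles of the two sequences exchanged. Pseudo-orbits: for $\delta>0$, $(x_n)_{n=0}^k$ is a $\delta$-pseudo-orbit for $\mathcal F$ if $d(f_n(x_n),x_{n+1})<\delta$ for $0\le n\le k-1$; a bi-infinite sequence $(x_n)_{n\in\mathbb Z}$ is a $\delta$-pseudo-orbit if this inequality holds for all $n\in\mathbb Z$. A point $x\in X$ $\varepsilon$-shadows the pseudo-orbit if $d(F_n(x),x_n)<\varepsilon$ for all indices $n$ of the pseudo-orbit. $\mathcal F$ has the shadowing property if for every $\varepsilon>0$ there is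 $\delta>0$ such that every $\delta$-pseudo-orbit $(x_n)_{n=0}^k$ for $\mathcal F$ is $\varepsilon$-shadowed by some point $x\in X$. It has the Lipschitz shadowing property if there is a uniform constant $L>0$ such that one can choose $\delta=L\varepsilon$ in this definition.
   Formalization: In (1) the shadowing point is claimed unique only for β at most some β₀>0 (for β above the diameter every point shadows); existence holds for all β. In (2) the h of all shifted pairs, by every integer, are characterised jointly by the bound and the relation. *)

theory Defs
  imports "HOL-Analysis.Analysis"
begin

section \<open>Smooth manifolds\<close>

text \<open>The manifold is the whole type \<open>'a\<close>, modelled on the Euclidean space \<open>'e\<close>; a chart is a pair of
  an open domain and a coordinate map, whose values outside the domain are irrelevant.\<close>

type_synonym ('a, 'e) chart = "'a set \<times> ('a \<Rightarrow> 'e)"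

definition chart_inv :: "('a, 'e) chart \<Rightarrow> 'e \<Rightarrow> 'a" where
  "chart_inv c = inv_into (fst c) (snd c)"

definition is_chart :: "('a::topological_space, 'e::euclidean_space) chart \<Rightarrow> bool" where
  "is_chart c \<longleftrightarrow> open (fst c) \<and> open (snd c ` fst c) \<and>
     homeomorphism (fst c) (snd c ` fst c) (snd c) (chart_inv c)"

text \<open>\<open>Ck_on k f S\<close> is meant for open \<open>S\<close>: all iterated directional derivatives of \<open>f\<close> up to order \<open>k\<close>
  exist and are continuous on \<open>S\<close>.\<close>

primrec Ck_on :: "nat \<Rightarrow> ('e::euclidean_space \<Rightarrow> 'f::real_normed_vector) \<Rightarrow> 'e set \<Rightarrow> bool" where
  "Ck_on 0 f S \<longleftrightarrow> continuous_on S f"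
| "Ck_on (Suc k) f S \<longleftrightarrow> (\<forall>x\<in>S. f differentiable (at x)) \<and>
     (\<forall>v. Ck_on k (\<lambda>x. frechet_derivative f (at x) v) S)"

definition smooth_on :: "('e::euclidean_space \<Rightarrow> 'f::real_normed_vector) \<Rightarrow> 'e set \<Rightarrow> bool" where
  "smooth_on f S \<longleftrightarrow> (\<forall>k. Ck_on k f S)"

definition smooth_atlas :: "('a::topological_space, 'e::euclidean_space) chart set \<Rightarrow> bool" where
  "smooth_atlas A \<longleftrightarrow> (\<forall>c\<in>A. is_chart c) \<and> (\<Union>c\<in>A. fst c) = UNIV \<and>
     (\<forall>c\<in>A. \<forall>c'\<in>A. smooth_on (snd c' \<circ> chart_inv c) (snd c ` (fst c \<inter> fst c')))"


section \<open>Riemannian manifolds\<close>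

text \<open>Every tangent space is a copy of \<open>'e\<close>: a tangent vector at \<open>x\<close> is given by its coordinates in one
  chart around \<open>x\<close> that is selected once and for all, \<open>chart_at M x\<close>. In particular
  \<open>riem_metric M x\<close> is an inner product on \<open>'e\<close>, written in that chart.\<close>

record ('a, 'e) rspace =
  charts :: "('a, 'e) chart set"
  riem_metric :: "'a \<Rightarrow> 'e \<Rightarrow> 'e \<Rightarrow> real"

definition chart_at :: "('a, 'e) rspace \<Rightarrow> 'a \<Rightarrow> ('a, 'e) chart" where
  "chart_at M x = (SOME c. c \<in> charts M \<and> x \<in> fst c)"

text \<open>\<open>coord_change c c' x\<close> turns the \<open>c\<close>-coordinates of a tangent vector at \<open>x\<close> into its
  \<open>c'\<close>-coordinates.\<close>

definition coord_change ::
    "('a, 'e::euclidean_space) chart \<Rightarrow> ('a, 'e) chart \<Rightarrow> 'a \<Rightarrow> 'e \<Rightarrow> 'e" where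
  "coord_change c c' x = frechet_derivative (snd c' \<circ> chart_inv c) (at (snd c x))"

text \<open>The metric in an arbitrary chart \<open>c\<close>: \<open>metric_in M c y e\<^sub>i e\<^sub>j\<close> is the coefficient
  $g_{ij}(y)$ for \<open>y\<close> in the image of \<open>c\<close>.\<close>

definition metric_in ::
    "('a, 'e::euclidean_space) rspace \<Rightarrow> ('a, 'e) chart \<Rightarrow> 'e \<Rightarrow> 'e \<Rightarrow> 'e \<Rightarrow> real" where
  "metric_in M c y u v =
     (let x = chart_inv c y; T = coord_change c (chart_at M x) x
      in riem_metric M x (T u) (T v))"

definition inner_product :: "('e::euclidean_space \<Rightarrow> 'e \<Rightarrow> real) \<Rightarrow> bool" where
  "inner_product b \<longleftrightarrow> bilinear b \<and> (\<forall>u v. b u v = b v u) \<and> (\<forall>v. v \<noteq> 0 \<longrightarrow> 0 < b v v)"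

definition riemannian_manifold :: "('a::t2_space, 'e::euclidean_space) rspace \<Rightarrow> bool" where
  "riemannian_manifold M \<longleftrightarrow> smooth_atlas (charts M) \<and>
     (\<forall>x. inner_product (riem_metric M x)) \<and>
     (\<forall>c\<in>charts M. \<forall>u v. smooth_on (\<lambda>y. metric_in M c y u v) (snd c ` fst c))"

definition tnorm :: "('a, 'e) rspace \<Rightarrow> 'a \<Rightarrow> 'e \<Rightarrow> real" where
  "tnorm M x v = sqrt (riem_metric M x v v)"


section \<open>Riemannian distance\<close>

text \<open>The finite exceptional set may contain the endpoints, so only two-sided derivatives at interior
  parameters are involved.\<close>

definition pw_C1_curve ::
    "('a::topological_space, 'e::euclidean_space) rspace \<Rightarrow> (real \<Rightarrow> 'a) \<Rightarrow> bool" where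
  "pw_C1_curve M \<gamma> \<longleftrightarrow> continuous_on {0..1} \<gamma> \<and>
     (\<exists>S. finite S \<and> (\<forall>c\<in>charts M.
        (snd c \<circ> \<gamma>) C1_differentiable_on ({t\<in>{0..1}. \<gamma> t \<in> fst c} - S)))"

definition velocity :: "('a, 'e::euclidean_space) rspace \<Rightarrow> (real \<Rightarrow> 'a) \<Rightarrow> real \<Rightarrow> 'e" where
  "velocity M \<gamma> t = vector_derivative (snd (chart_at M (\<gamma> t)) \<circ> \<gamma>) (at t)"

definition curve_length :: "('a, 'e::euclidean_space) rspace \<Rightarrow> (real \<Rightarrow> 'a) \<Rightarrow> ennreal" where
  "curve_length M \<gamma> = (\<integral>\<^sup>+t\<in>{0..1}. ennreal (tnorm M (\<gamma> t) (velocity M \<gamma> t)) \<partial>lborel)"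

text \<open>Connectedness is not assumed: points in different components have distance \<open>\<infinity>\<close>.\<close>

definition rdist ::
    "('a::topological_space, 'e::euclidean_space) rspace \<Rightarrow> 'a \<Rightarrow> 'a \<Rightarrow> ennreal" where
  "rdist M p q = Inf {curve_length M \<gamma> |\<gamma>. pw_C1_curve M \<gamma> \<and> \<gamma> 0 = p \<and> \<gamma> 1 = q}"

definition C0_dist ::
    "('a::topological_space, 'e::euclidean_space) rspace \<Rightarrow> ('a \<Rightarrow> 'a) \<Rightarrow> ('a \<Rightarrow> 'a) \<Rightarrow> ennreal" where
  "C0_dist M f g = (SUP x. rdist M (f x) (g x))"


section \<open>Differentiable maps and Anosov diffeomorphisms\<close>

definition C1_map ::
    "('a::topological_space, 'e::euclidean_space) rspace \<Rightarrow> ('a \<Rightarrow> 'a) \<Rightarrow> bool" where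
  "C1_map M f \<longleftrightarrow> continuous_on UNIV f \<and>
     (\<forall>c\<in>charts M. \<forall>c'\<in>charts M.
        Ck_on 1 (snd c' \<circ> f \<circ> chart_inv c) (snd c ` (fst c \<inter> f -` fst c')))"

definition C1_diffeo ::
    "('a::topological_space, 'e::euclidean_space) rspace \<Rightarrow> ('a \<Rightarrow> 'a) \<Rightarrow> bool" where
  "C1_diffeo M f \<longleftrightarrow> bij f \<and> C1_map M f \<and> C1_map M (inv f)"

definition tmap ::
    "('a, 'e::euclidean_space) rspace \<Rightarrow> ('a \<Rightarrow> 'a) \<Rightarrow> 'a \<Rightarrow> 'e \<Rightarrow> 'e" where
  "tmap M f x = frechet_derivative (snd (chart_at M (f x)) \<circ> f \<circ> chart_inv (chart_at M x))
     (at (snd (chart_at M x) x))"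

text \<open>Continuity of the splitting is a consequence of the estimates and is not required.\<close>

definition anosov ::
    "('a::topological_space, 'e::euclidean_space) rspace \<Rightarrow> ('a \<Rightarrow> 'a) \<Rightarrow> bool" where
  "anosov M f \<longleftrightarrow> C1_diffeo M f \<and>
     (\<exists>(Es :: 'a \<Rightarrow> 'e set) (Eu :: 'a \<Rightarrow> 'e set) (C::real) (\<mu>::real). 0 < C \<and> 0 < \<mu> \<and> \<mu> < 1 \<and>
        (\<forall>x. subspace (Es x) \<and> subspace (Eu x) \<and>
             Es x \<inter> Eu x = {0} \<and> {u + v |u v. u \<in> Es x \<and> v \<in> Eu x} = UNIV \<and>
             tmap M f x ` Es x = Es (f x) \<and> tmap M f x ` Eu x = Eu (f x) \<and>
             (\<forall>n. \<forall>v\<in>Es x. tnorm M ((f ^^ n) x) (tmap M (f ^^ n) x v) \<le> C * \<mu> ^ n * tnorm M x v) \<and>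
             (\<forall>n. \<forall>v\<in>Eu x. tnorm M ((inv f ^^ n) x) (tmap M (inv f ^^ n) x v)
                             \<le> C * \<mu> ^ n * tnorm M x v)))"


section \<open>The distance on the tangent bundle and the C1-distance\<close>

text \<open>The difference of \<open>Df\<close> and \<open>Dg\<close> involves tangent vectors at different points. They are compared
  by the Riemannian distance of the Sasaki metric on the tangent bundle: the infimum over curves
  $(\gamma, V)$ in the tangent bundle of $\int \sqrt{|\dot\gamma|^2 + |\nabla_{\dot\gamma} V|^2}$, where
  $\nabla$ is the Levi-Civita connection. A curve in the tangent bundle is a curve \<open>\<gamma>\<close> with a field
  \<open>V\<close> along it, \<open>V t\<close> being a tangent vector at \<open>\<gamma> t\<close>.\<close>

definition field_coords ::
    "('a, 'e::euclidean_space) rspace \<Rightarrow> ('a, 'e) chart \<Rightarrow> (real \<Rightarrow> 'a) \<Rightarrow> (real \<Rightarrow> 'e) \<Rightarrow> real \<Rightarrow> 'e" where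
  "field_coords M c \<gamma> V t = coord_change (chart_at M (\<gamma> t)) c (\<gamma> t) (V t)"

definition pw_C1_tcurve ::
    "('a::topological_space, 'e::euclidean_space) rspace \<Rightarrow> (real \<Rightarrow> 'a) \<Rightarrow> (real \<Rightarrow> 'e) \<Rightarrow> bool" where
  "pw_C1_tcurve M \<gamma> V \<longleftrightarrow> pw_C1_curve M \<gamma> \<and>
     (\<exists>S. finite S \<and> (\<forall>c\<in>charts M.
        continuous_on {t\<in>{0..1}. \<gamma> t \<in> fst c} (field_coords M c \<gamma> V) \<and>
        field_coords M c \<gamma> V C1_differentiable_on ({t\<in>{0..1}. \<gamma> t \<in> fst c} - S)))"

text \<open>\<open>christoffel M c y u v\<close> is the vector with components $\Gamma^k_{ij}(y) u^i v^j$, defined by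
  the Koszul formula for the constant coordinate fields \<open>u\<close>, \<open>v\<close>, \<open>w\<close>.\<close>

definition christoffel ::
    "('a, 'e::euclidean_space) rspace \<Rightarrow> ('a, 'e) chart \<Rightarrow> 'e \<Rightarrow> 'e \<Rightarrow> 'e \<Rightarrow> 'e" where
  "christoffel M c y u v = (THE z. \<forall>w. 2 * metric_in M c y z w =
       frechet_derivative (\<lambda>y. metric_in M c y v w) (at y) u
     + frechet_derivative (\<lambda>y. metric_in M c y u w) (at y) v
     - frechet_derivative (\<lambda>y. metric_in M c y u v) (at y) w)"

definition cov_deriv ::
    "('a, 'e::euclidean_space) rspace \<Rightarrow> (real \<Rightarrow> 'a) \<Rightarrow> (real \<Rightarrow> 'e) \<Rightarrow> real \<Rightarrow> 'e" where
  "cov_deriv M \<gamma> V t = (let c = chart_at M (\<gamma> t) in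
     vector_derivative (field_coords M c \<gamma> V) (at t)
     + christoffel M c (snd c (\<gamma> t)) (velocity M \<gamma> t) (V t))"

definition sasaki_length ::
    "('a, 'e::euclidean_space) rspace \<Rightarrow> (real \<Rightarrow> 'a) \<Rightarrow> (real \<Rightarrow> 'e) \<Rightarrow> ennreal" where
  "sasaki_length M \<gamma> V =
     (\<integral>\<^sup>+t\<in>{0..1}. ennreal (sqrt ((tnorm M (\<gamma> t) (velocity M \<gamma> t))\<^sup>2
                              + (tnorm M (\<gamma> t) (cov_deriv M \<gamma> V t))\<^sup>2)) \<partial>lborel)"

definition tangent_dist ::
    "('a::topological_space, 'e::euclidean_space) rspace \<Rightarrow> 'a \<Rightarrow> 'e \<Rightarrow> 'a \<Rightarrow> 'e \<Rightarrow> ennreal" where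
  "tangent_dist M p v q w = Inf {sasaki_length M \<gamma> V |\<gamma> V.
     pw_C1_tcurve M \<gamma> V \<and> \<gamma> 0 = p \<and> V 0 = v \<and> \<gamma> 1 = q \<and> V 1 = w}"

text \<open>This dominates \<open>C0_dist\<close>, because the Sasaki length of \<open>(\<gamma>, V)\<close> is at least the length of \<open>\<gamma>\<close>.\<close>

definition C1_dist ::
    "('a::topological_space, 'e::euclidean_space) rspace \<Rightarrow> ('a \<Rightarrow> 'a) \<Rightarrow> ('a \<Rightarrow> 'a) \<Rightarrow> ennreal" where
  "C1_dist M f g =
     (SUP x. SUP v\<in>{v. tnorm M x v = 1}. tangent_dist M (f x) (tmap M f x v) (g x) (tmap M g x v))"

definition C1_open ::
    "('a::topological_space, 'e::euclidean_space) rspace \<Rightarrow> ('a \<Rightarrow> 'a) set \<Rightarrow> bool" where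
  "C1_open M U \<longleftrightarrow> U \<subseteq> {f. C1_diffeo M f} \<and>
     (\<forall>f\<in>U. \<exists>r>0. \<forall>g. C1_diffeo M g \<and> C1_dist M f g < ennreal r \<longrightarrow> g \<in> U)"


section \<open>Sequences of diffeomorphisms and shadowing\<close>

primrec forward_iter :: "(int \<Rightarrow> 'a \<Rightarrow> 'a) \<Rightarrow> nat \<Rightarrow> 'a \<Rightarrow> 'a" where
  "forward_iter F 0 = id"
| "forward_iter F (Suc n) = F (int n) \<circ> forward_iter F n"

primrec backward_iter :: "(int \<Rightarrow> 'a \<Rightarrow> 'a) \<Rightarrow> nat \<Rightarrow> 'a \<Rightarrow> 'a" where
  "backward_iter F 0 = id"
| "backward_iter F (Suc n) = inv (F (- int (Suc n))) \<circ> backward_iter F n"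

definition seq_iter :: "(int \<Rightarrow> 'a \<Rightarrow> 'a) \<Rightarrow> int \<Rightarrow> 'a \<Rightarrow> 'a" where
  "seq_iter F n = (if 0 \<le> n then forward_iter F (nat n) else backward_iter F (nat (- n)))"

definition seq_shift :: "int \<Rightarrow> (int \<Rightarrow> 'a \<Rightarrow> 'a) \<Rightarrow> int \<Rightarrow> 'a \<Rightarrow> 'a" where
  "seq_shift k F = (\<lambda>n. F (n + k))"

definition seq_dist ::
    "('a::topological_space, 'e::euclidean_space) rspace \<Rightarrow>
     (int \<Rightarrow> 'a \<Rightarrow> 'a) \<Rightarrow> (int \<Rightarrow> 'a \<Rightarrow> 'a) \<Rightarrow> ennreal" where
  "seq_dist M F G = (SUP n. C1_dist M (F n) (G n))"

definition fin_pseudo_orbit ::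
    "('a::topological_space, 'e::euclidean_space) rspace \<Rightarrow>
     (int \<Rightarrow> 'a \<Rightarrow> 'a) \<Rightarrow> real \<Rightarrow> nat \<Rightarrow> (nat \<Rightarrow> 'a) \<Rightarrow> bool" where
  "fin_pseudo_orbit M F \<delta> k x \<longleftrightarrow> (\<forall>n<k. rdist M (F (int n) (x n)) (x (Suc n)) < ennreal \<delta>)"

definition fin_shadows ::
    "('a::topological_space, 'e::euclidean_space) rspace \<Rightarrow>
     (int \<Rightarrow> 'a \<Rightarrow> 'a) \<Rightarrow> real \<Rightarrow> nat \<Rightarrow> 'a \<Rightarrow> (nat \<Rightarrow> 'a) \<Rightarrow> bool" where
  "fin_shadows M F \<epsilon> k p x \<longleftrightarrow> (\<forall>n\<le>k. rdist M (seq_iter F (int n) p) (x n) < ennreal \<epsilon>)"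

definition lipschitz_shadowing ::
    "('a::topological_space, 'e::euclidean_space) rspace \<Rightarrow> (int \<Rightarrow> 'a \<Rightarrow> 'a) \<Rightarrow> bool" where
  "lipschitz_shadowing M F \<longleftrightarrow>
     (\<exists>L>0. \<forall>\<epsilon>>0. \<forall>k x. fin_pseudo_orbit M F (L * \<epsilon>) k x \<longrightarrow> (\<exists>p. fin_shadows M F \<epsilon> k p x))"

definition pseudo_orbit ::
    "('a::topological_space, 'e::euclidean_space) rspace \<Rightarrow>
     (int \<Rightarrow> 'a \<Rightarrow> 'a) \<Rightarrow> real \<Rightarrow> (int \<Rightarrow> 'a) \<Rightarrow> bool" where
  "pseudo_orbit M F \<delta> x \<longleftrightarrow> (\<forall>n. rdist M (F n (x n)) (x (n + 1)) < ennreal \<delta>)"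

definition shadows ::
    "('a::topological_space, 'e::euclidean_space) rspace \<Rightarrow>
     (int \<Rightarrow> 'a \<Rightarrow> 'a) \<Rightarrow> real \<Rightarrow> 'a \<Rightarrow> (int \<Rightarrow> 'a) \<Rightarrow> bool" where
  "shadows M F \<epsilon> p x \<longleftrightarrow> (\<forall>n. rdist M (seq_iter F n p) (x n) < ennreal \<epsilon>)"


section \<open>The conjugating homeomorphisms\<close>

text \<open>The relation $h_{A^{(n)},B^{(n)}} \circ B_n = A_n \circ h_{A,B}$ involves the homeomorphisms of all
  shifted pairs, so these are characterised together: \<open>H m\<close> plays the role of
  $h_{A^{(m)},B^{(m)}}$, and the relation is imposed on every pair $(A^{(m)},B^{(m)})$,
  \<open>m\<close> an arbitrary integer, for all $n \ge 0$. Shifts by nonnegative \<open>m\<close> alone would not determine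
  \<open>H 0\<close>, which could still be changed along stable manifolds.\<close>

definition conj_family ::
    "('a::topological_space, 'e::euclidean_space) rspace \<Rightarrow> real \<Rightarrow>
     (int \<Rightarrow> 'a \<Rightarrow> 'a) \<Rightarrow> (int \<Rightarrow> 'a \<Rightarrow> 'a) \<Rightarrow> (int \<Rightarrow> 'a \<Rightarrow> 'a) \<Rightarrow> bool" where
  "conj_family M K A B H \<longleftrightarrow>
     (\<forall>m. (\<exists>k. homeomorphism UNIV UNIV (H m) k) \<and>
          C0_dist M (H m) id \<le> ennreal K * seq_dist M (seq_shift m A) (seq_shift m B)) \<and>
     (\<forall>m. \<forall>n::nat. H (m + int n) \<circ> seq_iter (seq_shift m B) (int n)
                    = seq_iter (seq_shift m A) (int n) \<circ> H m)"

definition is_conj_homeo ::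
    "('a::topological_space, 'e::euclidean_space) rspace \<Rightarrow> real \<Rightarrow>
     (int \<Rightarrow> 'a \<Rightarrow> 'a) \<Rightarrow> (int \<Rightarrow> 'a \<Rightarrow> 'a) \<Rightarrow> ('a \<Rightarrow> 'a) \<Rightarrow> bool" where
  "is_conj_homeo M K A B h \<longleftrightarrow> (\<exists>H. conj_family M K A B H \<and> H 0 = h)"

definition conj_homeo ::
    "('a::topological_space, 'e::euclidean_space) rspace \<Rightarrow> real \<Rightarrow>
     (int \<Rightarrow> 'a \<Rightarrow> 'a) \<Rightarrow> (int \<Rightarrow> 'a \<Rightarrow> 'a) \<Rightarrow> 'a \<Rightarrow> 'a" where
  "conj_homeo M K A B = (THE h. is_conj_homeo M K A B h)"

end

theory Submission
  imports Defs
begin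

text \<open>Let \<open>f\<close> be Anosov. Along a true orbit of \<open>f\<close> the equation \<open>v (n + 1) = Df v n + r n\<close> has exactly
  one bounded solution for every bounded \<open>r\<close>, with a bound that does not depend on the orbit, because
  the stable and unstable spaces form a uniform exponential dichotomy. A pseudo-orbit follows true
  orbits only on windows of bounded length; averaging the solution operators of the orbits through
  its points still gives an approximate right inverse of \<open>v \<mapsto> (v (n + 1) - Df v n)\<close>. Hence, in finitely
  many charts, correcting a pseudo-orbit of a sequence $C^1$-close to \<open>f\<close> to a true orbit is a
  fixed point problem for a contraction, and the correction is at most a multiple of the error;
  cutting off the difference of two nearby orbits to such windows shows that it vanishes.

  That a $C^1$-neighbourhood defined in charts is open for the distance taken in the tangent bundle
  rests on the invariance of the covariant derivative under changes of charts: a curve of small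
  Sasaki length moves little in the coordinates of a single chart.

  The conjugacy sends \<open>x\<close> to the unique point whose \<open>F\<close>-orbit stays close to the \<open>G\<close>-orbit of \<open>x\<close>. Its
  graph is closed, so it is continuous, and exchanging the two sequences gives its inverse.\<close>

text \<open>Only the norm of a solution operator has to be uniform: \<open>admissible\<close>
  records solvability in bounded sequences and forgets the stable and unstable spaces. No splitting
  is constructed for the maps of a sequence, nor along a pseudo-orbit, whose consecutive points lie
  on different orbits of f; both are treated as perturbations of exact orbits of f. The price is a
  balance of two errors: the boundary terms of an average or a cut-off over N steps cost a multiple
  of \<open>a / N\<close>, and comparing derivatives inside the window costs \<kappa>. So N and
  \<kappa> are fixed first, from the solution bound, and only then the closeness demanded of
  pseudo-orbits and neighbourhoods. Existence and uniqueness need separate arguments, because an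
  approximate right inverse says nothing about injectivity. Two more obstacles: lengths are
  integrals of functions not known to be measurable, so they are handled through the simple
  functions below them; and distances may be infinite, so that Lipschitz shadowing with large
  \<epsilon> becomes a question about components.\<close>

section \<open>Linear difference equations with bounded solutions\<close>

text \<open>Invertibility, with inverse bounded by \<open>C\<close>, of the operator that sends
  \<open>v\<close> to \<open>\<lambda>n. v (n + 1) - A n (v n)\<close> on bounded sequences; the
  last clause is injectivity. For a hyperbolic cocycle this replaces an exponential dichotomy
  without naming its spaces.\<close>

definition admissible :: "real \<Rightarrow> (int \<Rightarrow> 'e::euclidean_space \<Rightarrow> 'e) \<Rightarrow> bool" where
  "admissible C A \<longleftrightarrow> (\<forall>n. linear (A n)) \<and>
     (\<forall>r b. (\<forall>n. norm (r n) \<le> b) \<longrightarrow>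
        (\<exists>v. (\<forall>n. norm (v n) \<le> C * b) \<and> (\<forall>n. v (n + 1) = A n (v n) + r n))) \<and>
     (\<forall>z b. (\<forall>n. norm (z n) \<le> b) \<and> (\<forall>n. z (n + 1) = A n (z n)) \<longrightarrow> (\<forall>n. z n = 0))"

text \<open>\<open>admissible\<close> promises the bound for one solution only. Two bounded
  solutions differ by a bounded homogeneous one, which is 0, so the bound holds for every solution
  that is bounded at all, however weak \<open>b\<close> is.\<close>

lemma admissible_bound:
  assumes adm: "admissible C A" and v: "\<And>n. norm (v n) \<le> b" "\<And>n. v (n + 1) = A n (v n) + r n"
    and r: "\<And>n. norm (r n) \<le> d"
  shows "norm (v n) \<le> C * d"
proof -
  obtain u where u: "\<And>n. norm (u n) \<le> C * d" "\<And>n. u (n + 1) = A n (u n) + r n"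
    using adm r unfolding admissible_def by blast
  have lin: "linear (A n)" for n using adm unfolding admissible_def by blast
  have "norm (v n - u n) \<le> b + C * d" for n
    using norm_triangle_ineq4[of "v n" "u n"] v(1)[of n] u(1)[of n] by linarith
  moreover have "v (n + 1) - u (n + 1) = A n (v n - u n)" for n
    using v(2) u(2) linear_diff[OF lin] by simp
  ultimately have "\<forall>n. v n - u n = 0"
    using adm unfolding admissible_def by (elim conjE) (drule spec[of _ "\<lambda>n. v n - u n"], blast)
  then show ?thesis using u(1) by simp
qed

text \<open>\<open>L n\<close> is the evolution from time 0 to time \<open>n\<close>,
  \<open>L' n\<close> its inverse and \<open>P\<close> the stable projection at time 0, so
  \<open>L (n + 1) (L' n w)\<close> is one step at time \<open>n\<close>. The solution is given by
  the Green function: past inputs are carried forward along the stable part, future inputs back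
  along the unstable part with a minus sign. Each of the two geometric series contributes
  \<open>C / (1 - \<mu>)\<close>.\<close>

lemma dichotomy_admissible:
  fixes L L' :: "int \<Rightarrow> 'e::euclidean_space \<Rightarrow> 'e" and P :: "'e \<Rightarrow> 'e"
  assumes lin: "\<And>n. linear (L n)" "\<And>n. linear (L' n)" "linear P"
    and inv: "\<And>n w. L n (L' n w) = w" "\<And>n w. L' n (L n w) = w"
    and C: "0 \<le> C" and \<mu>: "0 < \<mu>" "\<mu> < 1"
    and st: "\<And>n k w. norm (L (n + int k) (P (L' n w))) \<le> C * \<mu> ^ k * norm w"
    and un: "\<And>n k w. norm (L n (L' (n + int k) w - P (L' (n + int k) w))) \<le> C * \<mu> ^ k * norm w"
  shows "admissible (2 * C / (1 - \<mu>)) (\<lambda>n w. L (n + 1) (L' n w))"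
proof -
  define Q where "Q w = w - P w" for w
  have linQ: "linear Q" unfolding Q_def using lin(3) by (intro linear_compose_sub linear_id[unfolded id_def])
  have un': "norm (L n (Q (L' (n + int k) w))) \<le> C * \<mu> ^ k * norm w" for n k w
    using un unfolding Q_def .
  let ?A = "\<lambda>n w. L (n + 1) (L' n w)"
  have linA: "linear (?A n)" for n
    using linear_compose[OF lin(2)[of n] lin(1)[of "n+1"]] by (simp add: o_def)
  have ex: "\<exists>v. (\<forall>n. norm (v n) \<le> 2 * C / (1 - \<mu>) * b) \<and> (\<forall>n. v (n + 1) = ?A n (v n) + r n)"
    if r: "\<And>n. norm (r n) \<le> b" for r b
  proof -
    \<comment> \<open>An input \<open>r m\<close> enters the solution at time \<open>m + 1\<close>.
      The stable term therefore travels \<open>k\<close> steps forward, the unstable one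
      \<open>k + 1\<close> steps back; its extra factor \<mu> is given away below.\<close>
    define s where "s n k = L n (P (L' (n - int k) (r (n - int k - 1))))" for n k
    define u where "u n k = L n (Q (L' (n + int k + 1) (r (n + int k))))" for n k
    have b: "0 \<le> b" using r[of 0] norm_ge_zero order_trans by blast
    have sb: "norm (s n k) \<le> C * b * \<mu> ^ k" for n k
    proof -
      have "norm (s n k) \<le> C * \<mu> ^ k * norm (r (n - int k - 1))"
        using st[where n="n - int k" and k=k] unfolding s_def by simp
      also have "\<dots> \<le> C * \<mu> ^ k * b" using r C \<mu> by (intro mult_left_mono) auto
      finally show ?thesis by (simp add: mult_ac)
    qed
    have ub: "norm (u n k) \<le> C * b * \<mu> ^ k" for n k
    proof -
      have "norm (u n k) \<le> C * \<mu> ^ Suc k * norm (r (n + int k))"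
        using un'[where n=n and k="Suc k" and w="r (n + int k)"] unfolding u_def by (simp add: algebra_simps)
      also have "\<dots> \<le> C * \<mu> ^ Suc k * b" using r C \<mu> by (intro mult_left_mono) auto
      also have "\<dots> \<le> C * b * \<mu> ^ k" using C b \<mu>
        by (simp add: mult_ac mult_left_le_one_le mult_left_mono)
      finally show ?thesis .
    qed
    have gs: "summable (\<lambda>k. C * b * \<mu> ^ k)" and gsum: "(\<Sum>k. C * b * \<mu> ^ k) = C * b / (1 - \<mu>)"
      using \<mu> by (auto intro!: summable_mult summable_geometric simp: suminf_mult suminf_geometric summable_geometric)
    have ss: "summable (s n)" and us: "summable (u n)" for n
      by (rule summable_comparison_test'[OF gs, of 0], use sb ub in auto)+
    have sn: "norm (suminf (s n)) \<le> C * b / (1 - \<mu>)" and unn: "norm (suminf (u n)) \<le> C * b / (1 - \<mu>)" for n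
      using norm_suminf_le[OF sb gs] norm_suminf_le[OF ub gs] gsum by simp_all
    define v where "v n = suminf (s n) - suminf (u n)" for n
    have Asum: "?A n (suminf f) = (\<Sum>k. ?A n (f k))" if "summable f" for n and f :: "nat \<Rightarrow> 'e"
      using bounded_linear.suminf[OF linear_conv_bounded_linear[THEN iffD1, OF linA[of n]] that] by simp
    have "v (n + 1) = ?A n (v n) + r n" for n
    proof -
      have 1: "suminf (s (n + 1)) = L (n + 1) (P (L' (n + 1) (r n))) + ?A n (suminf (s n))"
      proof -
        have "suminf (s (n + 1)) = s (n + 1) 0 + (\<Sum>k. s (n + 1) (Suc k))"
          using suminf_split_head[OF ss[of "n+1"]] by simp
        also have "(\<lambda>k. s (n + 1) (Suc k)) = (\<lambda>k. ?A n (s n k))"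
          by (simp add: s_def inv algebra_simps)
        finally show ?thesis by (simp add: Asum[OF ss]) (simp add: s_def)
      qed
      have 2: "?A n (suminf (u n)) = L (n + 1) (Q (L' (n + 1) (r n))) + suminf (u (n + 1))"
      proof -
        have "?A n (suminf (u n)) = (\<Sum>k. ?A n (u n k))" using Asum[OF us] .
        also have "\<dots> = ?A n (u n 0) + (\<Sum>k. ?A n (u n (Suc k)))"
        proof -
          have "summable (\<lambda>k. ?A n (u n k))"
            using bounded_linear.summable[OF linear_conv_bounded_linear[THEN iffD1, OF linA[of n]] us[of n]] .
          then show ?thesis using suminf_split_head by force
        qed
        also have "(\<lambda>k. ?A n (u n (Suc k))) = u (n + 1)"
          by (simp add: u_def inv algebra_simps fun_eq_iff)
        also have "?A n (u n 0) = L (n + 1) (Q (L' (n + 1) (r n)))" by (simp add: u_def inv)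
        finally show ?thesis .
      qed
      have 3: "r n = L (n + 1) (P (L' (n + 1) (r n))) + L (n + 1) (Q (L' (n + 1) (r n)))"
        unfolding Q_def by (simp add: linear_diff[OF lin(1)] inv)
      show ?thesis
        unfolding v_def linear_diff[OF linA] 1 2 using 3 by (simp add: algebra_simps)
    qed
    moreover have "C * b / (1 - \<mu>) + C * b / (1 - \<mu>) = 2 * C / (1 - \<mu>) * b"
      by (simp add: add_divide_distrib[symmetric])
    then have "norm (v n) \<le> 2 * C / (1 - \<mu>) * b" for n
      using norm_triangle_ineq4[of "suminf (s n)" "suminf (u n)"] sn[of n] unn[of n]
      unfolding v_def by linarith
    ultimately show ?thesis by blast
  qed
  have un0: "z n = 0" if z: "\<And>n. norm (z n) \<le> b" "\<And>n. z (n + 1) = ?A n (z n)" for z b n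
  proof -
    have b: "0 \<le> b" using z(1)[of 0] norm_ge_zero order_trans by blast
    have zL: "z n = L n (L' m (z m))" for n m
    proof (induction n rule: int_induct[where k=m])
      case base then show ?case by (simp add: inv)
    next
      case (step1 i) then show ?case by (simp add: z(2) inv)
    next
      case (step2 i)
      have "L i (L' m (z m)) = L i (L' (i - 1) (z (i - 1)))" using step2 z(2)[of "i - 1"] by simp
      then have "L' i (L i (L' m (z m))) = L' i (L i (L' (i - 1) (z (i - 1))))" by simp
      then have "L' m (z m) = L' (i - 1) (z (i - 1))" by (simp add: inv)
      then show ?case by (simp add: inv)
    qed
    \<comment> \<open>The stable part at time \<open>n\<close> is reached from time
      \<open>n - k\<close>, the unstable part from time \<open>n + k\<close>; boundedness there and
      contraction on the way force both to vanish as \<open>k\<close> grows.\<close>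
    have lim: "(\<lambda>k. C * \<mu> ^ k * b) \<longlonglongrightarrow> 0"
      using \<mu> by (auto intro!: tendsto_eq_intros LIMSEQ_power_zero)
    have "norm (L n (P (L' n (z n)))) \<le> C * \<mu> ^ k * b" for k
    proof -
      have "L' n (z n) = L' (n - int k) (z (n - int k))" using zL[of n "n - int k"] by (simp add: inv)
      then have "norm (L n (P (L' n (z n)))) \<le> C * \<mu> ^ k * norm (z (n - int k))"
        using st[where n="n - int k" and k=k] by simp
      also have "\<dots> \<le> C * \<mu> ^ k * b" using z(1) C \<mu> by (intro mult_left_mono) auto
      finally show ?thesis .
    qed
    then have "norm (L n (P (L' n (z n)))) \<le> 0" by (intro LIMSEQ_le_const[OF lim]) auto
    moreover have "norm (L n (Q (L' n (z n)))) \<le> C * \<mu> ^ k * b" for k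
    proof -
      have "L' n (z n) = L' (n + int k) (z (n + int k))" using zL[of n "n + int k"] by (simp add: inv)
      then have "norm (L n (Q (L' n (z n)))) \<le> C * \<mu> ^ k * norm (z (n + int k))"
        using un'[where n=n and k=k] by simp
      also have "\<dots> \<le> C * \<mu> ^ k * b" using z(1) C \<mu> by (intro mult_left_mono) auto
      finally show ?thesis .
    qed
    then have "norm (L n (Q (L' n (z n)))) \<le> 0" by (intro LIMSEQ_le_const[OF lim]) auto
    moreover have "z n = L n (P (L' n (z n))) + L n (Q (L' n (z n)))"
      unfolding Q_def by (simp add: linear_diff[OF lin(1)] inv)
    ultimately show ?thesis by simp
  qed
  show ?thesis unfolding admissible_def using linA ex un0 by blast
qed

text \<open>Banach's fixed point theorem for the sup norm, which enters only through the common
  bounds \<open>B\<close> and \<open>d\<close>. The limit is built entry by entry from the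
  telescoping series of the iterates of 0.\<close>

lemma sup_contraction_fixpoint:
  fixes \<Phi> :: "(int \<Rightarrow> 'e::euclidean_space) \<Rightarrow> int \<Rightarrow> 'e"
  assumes B: "0 \<le> B" and maps: "\<And>w n. (\<And>n. norm (w n) \<le> B) \<Longrightarrow> norm (\<Phi> w n) \<le> B"
    and contr: "\<And>w w' d n. (\<And>n. norm (w n) \<le> B) \<Longrightarrow> (\<And>n. norm (w' n) \<le> B) \<Longrightarrow>
       (\<And>n. norm (w n - w' n) \<le> d) \<Longrightarrow> norm (\<Phi> w n - \<Phi> w' n) \<le> d / 2"
  shows "\<exists>w. (\<forall>n. norm (w n) \<le> B) \<and> \<Phi> w = w"
proof -
  define W where "W k = (\<Phi> ^^ k) (\<lambda>_. 0)" for k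
  have WS: "W (Suc k) = \<Phi> (W k)" for k unfolding W_def by simp
  have Wb: "norm (W k n) \<le> B" for k n
  proof (induction k arbitrary: n)
    case 0 then show ?case using B by (simp add: W_def)
  next
    case (Suc k) then show ?case unfolding WS by (rule maps)
  qed
  define x where "x n k = W (Suc k) n - W k n" for n k
  have xb: "norm (x n k) \<le> 2 * B * (1 / 2) ^ k" for n k
  proof (induction k arbitrary: n)
    case 0 then show ?case using norm_triangle_ineq4[of "W 1 n" "W 0 n"] Wb[of 1 n] Wb[of 0 n] by (simp add: x_def)
  next
    case (Suc k)
    then have "norm (W (Suc k) n - W k n) \<le> 2 * B * (1 / 2) ^ k" for n unfolding x_def by simp
    from contr[OF Wb Wb this] show ?case unfolding x_def WS[of "Suc k"] WS[of k] by (simp add: field_simps)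
  qed
  have gs: "summable (\<lambda>k. 2 * B * (1 / 2 :: real) ^ k)" by (intro summable_mult summable_geometric) simp
  have xs: "summable (x n)" for n by (rule summable_comparison_test'[OF gs, of 0]) (rule xb)
  define w where "w n = suminf (x n)" for n
  have tele: "(\<Sum>i<k. x n i) = W k n" for n k
    unfolding x_def using sum_lessThan_telescope[of "\<lambda>k. W k n" k] by (simp add: W_def)
  have wW: "norm (w n - W k n) \<le> 4 * B * (1 / 2) ^ k" for n k
  proof -
    have "w n - W k n = (\<Sum>i. x n (i + k))"
      unfolding w_def tele[symmetric] using suminf_minus_initial_segment[OF xs[of n], of k] by simp
    also have "norm \<dots> \<le> (\<Sum>i. 2 * B * (1 / 2) ^ (i + k))"
      using gs by (intro norm_suminf_le xb) (rule summable_ignore_initial_segment)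
    also have "(\<lambda>i. 2 * B * (1 / 2 :: real) ^ (i + k)) = (\<lambda>i. (2 * B * (1 / 2) ^ k) * (1 / 2) ^ i)"
      by (simp add: power_add mult_ac)
    also have "(\<Sum>i. (2 * B * (1 / 2) ^ k) * (1 / 2 :: real) ^ i) = 4 * B * (1 / 2) ^ k"
      by (subst suminf_mult) (auto simp: suminf_geometric)
    finally show ?thesis .
  qed
  have lim: "(\<lambda>k. c * (1 / 2 :: real) ^ k) \<longlonglongrightarrow> 0" for c
    by (auto intro!: tendsto_eq_intros LIMSEQ_power_zero)
  have "(\<lambda>k. W k n - w n) \<longlonglongrightarrow> 0" for n
    by (rule Lim_null_comparison[OF _ lim[of "4 * B"]]) (use wW in \<open>auto simp: norm_minus_commute\<close>)
  then have Wl: "(\<lambda>k. W k n) \<longlonglongrightarrow> w n" for n by (rule LIM_zero_cancel)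
  have wb: "norm (w n) \<le> B" for n
    by (rule Lim_bounded[OF tendsto_norm[OF Wl], of 0]) (use Wb in auto)
  \<comment> \<open>Entrywise convergence would not allow passing to the limit inside
    \<open>\<Phi>\<close>, which may depend on all entries; the bound \<open>wW\<close> is uniform
    in the index, so \<open>contr\<close> applies to \<open>w\<close> and
    \<open>W k\<close>.\<close>
  have "(\<lambda>k. \<Phi> w n - W (Suc k) n) \<longlonglongrightarrow> 0" for n
  proof (rule Lim_null_comparison[OF _ lim[of "2 * B"]], intro always_eventually allI)
    fix k
    have "norm (\<Phi> w n - \<Phi> (W k) n) \<le> (4 * B * (1 / 2) ^ k) / 2" by (rule contr[OF wb Wb wW])
    then show "norm (\<Phi> w n - W (Suc k) n) \<le> 2 * B * (1 / 2) ^ k" by (simp add: WS)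
  qed
  moreover have "(\<lambda>k. \<Phi> w n - W (Suc k) n) \<longlonglongrightarrow> \<Phi> w n - w n" for n
    by (intro tendsto_intros LIMSEQ_Suc Wl)
  ultimately have "\<Phi> w n - w n = 0" for n by (rule LIMSEQ_unique[rotated])
  then show ?thesis using wb by (intro exI[of _ w]) auto
qed

text \<open>The averaged solution operator \<open>R0 w n = (1 / N) (\<Sum>i<N. R (n - i) w n)\<close> is an approximate right
  inverse of \<open>v \<mapsto> (v (n + 1) - A n (v n))\<close>: the averaging telescopes, up to an error of order \<open>1 / N\<close>.\<close>

lemma perturbed_solution:
  fixes A :: "int \<Rightarrow> 'e::euclidean_space \<Rightarrow> 'e" and A' :: "int \<Rightarrow> int \<Rightarrow> 'e \<Rightarrow> 'e"
  assumes adm: "\<And>j. admissible C (A' j)" and linA: "\<And>n. linear (A n)"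
    and C: "0 \<le> C" and a: "\<And>n w. norm (A n w) \<le> a * norm w" "\<And>j n w. norm (A' j n w) \<le> a * norm w" "0 \<le> a"
    and near: "\<And>j n w. j \<le> n \<Longrightarrow> n \<le> j + int N \<Longrightarrow> norm (A' j n w - A n w) \<le> \<kappa> * norm w"
    and N: "0 < N"
    and r0: "\<And>n. norm (r n 0) \<le> \<delta>"
    and rL: "\<And>n v w. norm v \<le> \<rho> \<Longrightarrow> norm w \<le> \<rho> \<Longrightarrow> norm (r n v - r n w) \<le> \<kappa> * norm (v - w)"
    and \<kappa>: "0 \<le> \<kappa>" and small: "C * (2 * \<kappa> + 2 * a / N) \<le> 1 / 2" and \<rho>: "2 * C * \<delta> \<le> \<rho>"
  shows "\<exists>v. (\<forall>n. norm (v n) \<le> 2 * C * \<delta>) \<and> (\<forall>n. v (n + 1) = A n (v n) + r n (v n))"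
proof -
  have linA': "linear (A' j n)" for j n using adm unfolding admissible_def by blast
  have \<delta>: "0 \<le> \<delta>" using r0 norm_ge_zero order_trans by blast
  \<comment> \<open>The choice asks for bounded solutions only; the constant \<open>C\<close>, for
    \<open>R\<close> and for differences of its values, comes back through
    \<open>admissible_bound\<close>. Working with differences also avoids showing that the chosen
    \<open>R j\<close> is linear.\<close>
  define R where "R j w = (SOME v. (\<exists>b. \<forall>n. norm (v n) \<le> b) \<and> (\<forall>n. v (n + 1) = A' j n (v n) + w n))"
    for j and w :: "int \<Rightarrow> 'e"
  have R: "(\<exists>b. \<forall>n. norm (R j w n) \<le> b) \<and> (\<forall>n. R j w (n + 1) = A' j n (R j w n) + w n)"
    if "\<And>n. norm (w n) \<le> d" for j w d
    unfolding R_def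
  proof (rule someI_ex[where P="\<lambda>v. (\<exists>b. \<forall>n. norm (v n) \<le> b) \<and> (\<forall>n. v (n + 1) = A' j n (v n) + w n)"])
    show "\<exists>v. (\<exists>b. \<forall>n. norm (v n) \<le> b) \<and> (\<forall>n. v (n + 1) = A' j n (v n) + w n)"
      using adm[of j] that unfolding admissible_def by blast
  qed
  have Req: "R j w (n + 1) = A' j n (R j w n) + w n" if "\<And>n. norm (w n) \<le> d" for j w d n
    using R[of w d j, OF that] by blast
  have Rb: "norm (R j w n) \<le> C * d" if w: "\<And>n. norm (w n) \<le> d" for j w d n
  proof -
    obtain b where b: "\<And>n. norm (R j w n) \<le> b" using R[of w d j, OF w] by blast
    show ?thesis by (rule admissible_bound[OF adm[of j] b _ w]) (rule Req[of w d j, OF w])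
  qed
  have Rd: "norm (R j w n - R j w' n) \<le> C * d"
    if "\<And>n. norm (w n) \<le> b" "\<And>n. norm (w' n) \<le> b" "\<And>n. norm (w n - w' n) \<le> d" for j w w' b d n
  proof (rule admissible_bound[OF adm[of j], where v="\<lambda>n. R j w n - R j w' n" and b="C * b + C * b" and r="\<lambda>n. w n - w' n"])
    show "norm (R j w n - R j w' n) \<le> C * b + C * b" for n
      using norm_triangle_ineq4[of "R j w n" "R j w' n"] Rb[of w b j n, OF that(1)] Rb[of w' b j n, OF that(2)] by linarith
    show "R j w (n + 1) - R j w' (n + 1) = A' j n (R j w n - R j w' n) + (w n - w' n)" for n
      unfolding Req[of w b j n, OF that(1)] Req[of w' b j n, OF that(2)] linear_diff[OF linA'] by simp
  qed (rule that(3))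
  define R0 where "R0 w n = (\<Sum>i<N. R (n - int i) w n) /\<^sub>R real N" for w n
  have avg: "norm ((\<Sum>i<N. x i) /\<^sub>R real N) \<le> d" if "\<And>i. i < N \<Longrightarrow> norm (x i) \<le> d" for x :: "nat \<Rightarrow> 'e" and d
    using sum_norm_bound[of "{..<N}" x d] that N by (simp add: field_simps)
  have R0b: "norm (R0 w n) \<le> C * d" if "\<And>n. norm (w n) \<le> d" for w d n
    unfolding R0_def by (intro avg Rb that)
  have R0d: "norm (R0 w n - R0 w' n) \<le> C * d"
    if "\<And>n. norm (w n) \<le> b" "\<And>n. norm (w' n) \<le> b" "\<And>n. norm (w n - w' n) \<le> d" for w w' b d n
  proof -
    have "R0 w n - R0 w' n = (\<Sum>i<N. R (n - int i) w n - R (n - int i) w' n) /\<^sub>R real N"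
      unfolding R0_def by (simp add: sum_subtractf scaleR_diff_right)
    then show ?thesis using avg[of "\<lambda>i. R (n - int i) w n - R (n - int i) w' n" "C * d"] Rd[of w b w' d, OF that] by simp
  qed
  \<comment> \<open>The defect of the averaged inverse: \<open>R0\<close> would be an exact right
    inverse if \<open>e\<close> were 0. Only the Lipschitz constant of \<open>e\<close> has to be
    small.\<close>
  define e where "e w n = R0 w (n + 1) - A n (R0 w n) - w n" for w n
  have ed: "norm (e w n - e w' n) \<le> C * (\<kappa> + 2 * a / N) * d"
    if "\<And>n. norm (w n) \<le> b" "\<And>n. norm (w' n) \<le> b" "\<And>n. norm (w n - w' n) \<le> d" for w w' b d n
  proof -
    define u where "u j n = R j w n - R j w' n" for j n
    have ub: "norm (u j n) \<le> C * d" for j n unfolding u_def by (rule Rd[of w b w' d, OF that])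
    have d: "0 \<le> d" using that(3)[of 0] norm_ge_zero order_trans by blast
    have us: "u j (n + 1) = A' j n (u j n) + (w n - w' n)" for j n
      unfolding u_def Req[of w b j n, OF that(1)] Req[of w' b j n, OF that(2)] linear_diff[OF linA'] by simp
    obtain N' where N': "N = Suc N'" using N gr0_implies_Suc by blast
    have 1: "R0 w n - R0 w' n = (\<Sum>i<N. u (n - int i) n) /\<^sub>R real N" for n
      unfolding R0_def u_def by (simp add: sum_subtractf scaleR_diff_right)
    \<comment> \<open>The averages at \<open>n + 1\<close> and at \<open>n\<close> share the
      starting points \<open>n - int i\<close> with \<open>i < N'\<close>. Only the new start
      \<open>n + 1\<close> and the discarded start \<open>n - int N'\<close> are left over; each
      costs \<open>a * (C * d)\<close>, which the division by \<open>N\<close> turns into the term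
      \<open>2 * a / N\<close>.\<close>
    have 2: "(\<Sum>i<N. u (n + 1 - int i) (n + 1))
       = real N *\<^sub>R (w n - w' n) + (A' (n + 1) n (u (n + 1) n) + (\<Sum>i<N'. A' (n - int i) n (u (n - int i) n)))"
    proof -
      have "(\<Sum>i<N. u (n + 1 - int i) (n + 1)) = (\<Sum>i<N. A' (n + 1 - int i) n (u (n + 1 - int i) n)) + real N *\<^sub>R (w n - w' n)"
        unfolding us by (simp add: sum.distrib sum_constant_scaleR)
      also have "(\<Sum>i<N. A' (n + 1 - int i) n (u (n + 1 - int i) n))
          = A' (n + 1) n (u (n + 1) n) + (\<Sum>i<N'. A' (n - int i) n (u (n - int i) n))"
        unfolding N' by (subst sum.lessThan_Suc_shift) simp
      finally show ?thesis by simp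
    qed
    have 3: "A n (\<Sum>i<N. u (n - int i) n) = (\<Sum>i<N'. A n (u (n - int i) n)) + A n (u (n - int N') n)"
      unfolding linear_sum[OF linA] N' by simp
    have "e w n - e w' n = (R0 w (n + 1) - R0 w' (n + 1)) - A n (R0 w n - R0 w' n) - (w n - w' n)"
      unfolding e_def by (simp add: linear_diff[OF linA])
    also have "\<dots> = (A' (n + 1) n (u (n + 1) n) + (\<Sum>i<N'. A' (n - int i) n (u (n - int i) n) - A n (u (n - int i) n))
        - A n (u (n - int N') n)) /\<^sub>R real N"
      unfolding 1 linear_scale[OF linA] 2 3 using N
      by (simp add: scaleR_right_distrib scaleR_right_diff_distrib sum_subtractf)
    finally have eq: "e w n - e w' n = (A' (n + 1) n (u (n + 1) n)
        + (\<Sum>i<N'. A' (n - int i) n (u (n - int i) n) - A n (u (n - int i) n)) - A n (u (n - int N') n)) /\<^sub>R real N" .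
    have t1: "norm (A' (n + 1) n (u (n + 1) n)) \<le> a * (C * d)"
      using a(2)[where w="u (n+1) n"] ub a(3) by (meson mult_left_mono order_trans)
    have t2: "norm (A n (u (n - int N') n)) \<le> a * (C * d)"
      using a(1)[where w="u (n - int N') n"] ub a(3) by (meson mult_left_mono order_trans)
    have "norm (A' (n - int i) n (u (n - int i) n) - A n (u (n - int i) n)) \<le> \<kappa> * (C * d)" if "i < N'" for i
    proof -
      have "norm (A' (n - int i) n (u (n - int i) n) - A n (u (n - int i) n)) \<le> \<kappa> * norm (u (n - int i) n)"
        using that N' by (intro near) auto
      then show ?thesis using ub \<kappa> by (meson mult_left_mono order_trans)
    qed
    then have "norm (\<Sum>i<N'. A' (n - int i) n (u (n - int i) n) - A n (u (n - int i) n)) \<le> real N' * (\<kappa> * (C * d))"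
      using sum_norm_bound[of "{..<N'}"] by (metis (no_types, lifting) card_lessThan lessThan_iff)
    also have "\<dots> \<le> real N * (\<kappa> * (C * d))" using N' \<kappa> C d by (intro mult_right_mono) auto
    finally have t3: "norm (\<Sum>i<N'. A' (n - int i) n (u (n - int i) n) - A n (u (n - int i) n)) \<le> real N * (\<kappa> * (C * d))" .
    have "norm (A' (n + 1) n (u (n + 1) n)
        + (\<Sum>i<N'. A' (n - int i) n (u (n - int i) n) - A n (u (n - int i) n)) - A n (u (n - int N') n))
        \<le> 2 * a * (C * d) + real N * (\<kappa> * (C * d))"
    proof -
      have tri: "norm (x + y - z) \<le> norm x + norm z + norm y" for x y z :: 'e
        using norm_triangle_ineq[of x y] norm_triangle_ineq4[of "x + y" z] by linarith
      have "2 * a * (C * d) + real N * (\<kappa> * (C * d)) = a * (C * d) + a * (C * d) + real N * (\<kappa> * (C * d))"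
        by simp
      then show ?thesis by (simp only:) (rule order_trans[OF tri], intro add_mono t1 t2 t3)
    qed
    moreover have "norm (x /\<^sub>R real N) = norm x / real N" for x :: 'e by (simp add: divide_inverse_commute)
    ultimately have "norm (e w n - e w' n) \<le> (2 * a * (C * d) + real N * (\<kappa> * (C * d))) / real N"
      unfolding eq by (simp only: divide_right_mono of_nat_0_le_iff)
    also have "\<dots> = C * (\<kappa> + 2 * a / N) * d" using N by (simp add: field_simps)
    finally show ?thesis .
  qed
  \<comment> \<open>With \<open>v = R0 w\<close> the equation
    \<open>v (n + 1) = A n (v n) + r n (v n)\<close> reads
    \<open>w n + e w n = r n (R0 w n)\<close>, so fixed points of \<open>\<Phi>\<close> yield
    solutions. On the ball of radius \<open>2 * \<delta>\<close> the value at 0 is at most \<delta>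
    and the contraction factor 1/2 adds at most another \<delta>.\<close>
  define \<Phi> where "\<Phi> w n = r n (R0 w n) - e w n" for w n
  have ctr: "norm (\<Phi> w n - \<Phi> w' n) \<le> d / 2"
    if w: "\<And>n. norm (w n) \<le> 2 * \<delta>" "\<And>n. norm (w' n) \<le> 2 * \<delta>" "\<And>n. norm (w n - w' n) \<le> d" for w w' d n
  proof -
    have d: "0 \<le> d" using w(3)[of 0] norm_ge_zero order_trans by blast
    have "norm (R0 w n) \<le> \<rho>" "norm (R0 w' n) \<le> \<rho>"
      using R0b[of w "2 * \<delta>" n, OF w(1)] R0b[of w' "2 * \<delta>" n, OF w(2)] \<rho> by (auto simp: mult_ac)
    then have "norm (r n (R0 w n) - r n (R0 w' n)) \<le> \<kappa> * norm (R0 w n - R0 w' n)" by (rule rL)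
    also have "\<dots> \<le> \<kappa> * (C * d)" using R0d[of w "2 * \<delta>" w' d n, OF w] \<kappa> by (intro mult_left_mono) auto
    finally have "norm (\<Phi> w n - \<Phi> w' n) \<le> \<kappa> * (C * d) + C * (\<kappa> + 2 * a / N) * d"
      using ed[of w "2 * \<delta>" w' d n, OF w] norm_triangle_ineq4[of "r n (R0 w n) - r n (R0 w' n)" "e w n - e w' n"]
      unfolding \<Phi>_def by (simp add: algebra_simps)
    also have "\<dots> = C * (2 * \<kappa> + 2 * a / N) * d" by (simp add: algebra_simps)
    also have "\<dots> \<le> 1 / 2 * d" using small d by (intro mult_right_mono) auto
    finally show ?thesis by simp
  qed
  have lin0: "e (\<lambda>_. 0) n = 0 \<and> R0 (\<lambda>_. 0) n = 0" for n
  proof -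
    have "R0 (\<lambda>_. 0) n = 0" for n using R0b[of "\<lambda>_. 0" 0 n] by simp
    then show ?thesis unfolding e_def by (simp add: linear_0[OF linA])
  qed
  have "\<exists>w. (\<forall>n. norm (w n) \<le> 2 * \<delta>) \<and> \<Phi> w = w"
  proof (rule sup_contraction_fixpoint)
    show "0 \<le> 2 * \<delta>" using \<delta> by simp
    fix w :: "int \<Rightarrow> 'e" and n assume w: "\<And>n. norm (w n) \<le> 2 * \<delta>"
    have "norm (\<Phi> w n - \<Phi> (\<lambda>_. 0) n) \<le> (2 * \<delta>) / 2"
      using w \<delta> by (intro ctr) auto
    moreover have "norm (\<Phi> (\<lambda>_. 0) n) \<le> \<delta>" unfolding \<Phi>_def using lin0 r0 by simp
    ultimately show "norm (\<Phi> w n) \<le> 2 * \<delta>"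
      using norm_triangle_sub[of "\<Phi> w n" "\<Phi> (\<lambda>_. 0) n"] by linarith
  qed (rule ctr)
  then obtain w where w: "\<And>n. norm (w n) \<le> 2 * \<delta>" "\<Phi> w = w" by blast
  have "norm (R0 w n) \<le> 2 * C * \<delta>" for n using R0b[of w "2 * \<delta>" n, OF w(1)] by (simp add: mult_ac)
  moreover have "R0 w (n + 1) = A n (R0 w n) + r n (R0 w n)" for n
    using fun_cong[OF w(2), of n] unfolding \<Phi>_def e_def by (simp add: algebra_simps)
  ultimately show ?thesis by blast
qed

text \<open>A localisation argument: at each time \<open>m\<close> the sequence \<open>d\<close> is
  cut off to a window of length \<open>2 * N\<close> around \<open>m\<close>, where one exact orbit
  is a good model. \<open>admissible_bound\<close> for that orbit halves the bound on
  \<open>d m\<close>; since \<open>m\<close> is arbitrary, the halving can be repeated.\<close>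

lemma perturbed_unique:
  fixes A :: "int \<Rightarrow> 'e::euclidean_space \<Rightarrow> 'e" and A' :: "int \<Rightarrow> int \<Rightarrow> 'e \<Rightarrow> 'e"
  assumes adm: "\<And>j. admissible C (A' j)"
    and C: "0 \<le> C" and a: "\<And>j n w. norm (A' j n w) \<le> a * norm w" "0 \<le> a"
    and near: "\<And>j n w. j \<le> n \<Longrightarrow> n \<le> j + 2 * int N \<Longrightarrow> norm (A' j n w - A n w) \<le> \<kappa> * norm w"
    and N: "0 < N" and \<kappa>: "0 \<le> \<kappa>" and small: "C * (2 * \<kappa> + 2 * a / N) \<le> 1 / 2"
    and d: "\<And>n. norm (d n) \<le> b" "\<And>n. norm (d (n + 1) - A n (d n)) \<le> \<kappa> * norm (d n)"
  shows "d n = 0"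
proof -
  have half: "norm (d m) \<le> b / 2" if b: "\<And>n. norm (d n) \<le> b" for b m
  proof -
    \<comment> \<open>The model orbit starts \<open>N\<close> steps before \<open>m\<close>, so that
      its window of validity is centred there and holds the support of the tent
      \<open>\<psi>\<close>, which is 1 at \<open>m\<close> and changes by at most
      \<open>1 / N\<close> per step.\<close>
    define j where "j = m - int N"
    have linA': "linear (A' j n)" for n using adm unfolding admissible_def by blast
    define \<psi> where "\<psi> n = max 0 (1 - \<bar>real_of_int (n - m)\<bar> / N)" for n
    have b0: "0 \<le> b" using b[of 0] norm_ge_zero order_trans by blast
    have \<psi>01: "0 \<le> \<psi> n" "\<psi> n \<le> 1" for n unfolding \<psi>_def using N by auto
    have \<psi>1: "\<bar>\<psi> (n + 1) - \<psi> n\<bar> \<le> 1 / N" for n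
    proof -
      have "\<bar>\<bar>real_of_int (n + 1 - m)\<bar> / N - \<bar>real_of_int (n - m)\<bar> / N\<bar> \<le> 1 / N"
        using N by (simp add: diff_divide_distrib[symmetric] divide_right_mono)
      then show ?thesis unfolding \<psi>_def by linarith
    qed
    have \<psi>s: "\<psi> n = 0" if "n \<le> j \<or> j + 2 * int N \<le> n" for n
    proof -
      have "1 \<le> \<bar>real_of_int (n - m)\<bar> / N" using that N unfolding j_def by (auto simp: field_simps)
      then show ?thesis unfolding \<psi>_def by simp
    qed
    define w where "w n = \<psi> n *\<^sub>R d n" for n
    define r where "r n = w (n + 1) - A' j n (w n)" for n
    have "norm (w m) \<le> C * ((2 * \<kappa> + a / N) * b)"
    proof (rule admissible_bound[OF adm[of j]])
      show "norm (w n) \<le> b" for n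
        unfolding w_def using mult_mono[of "\<psi> n" 1 "norm (d n)" b] \<psi>01[of n] b[of n] b0 by simp
      show "w (n + 1) = A' j n (w n) + r n" for n unfolding r_def by simp
      fix n
      \<comment> \<open>Product rule for the cut-off: the first two terms are small by hypothesis,
        the last one carries the slope of \<open>\<psi>\<close> and costs
        \<open>a / N\<close>.\<close>
      have r: "r n = \<psi> (n + 1) *\<^sub>R (d (n + 1) - A n (d n)) - \<psi> (n + 1) *\<^sub>R (A' j n (d n) - A n (d n))
          + (\<psi> (n + 1) - \<psi> n) *\<^sub>R A' j n (d n)"
        unfolding r_def w_def linear_scale[OF linA'] by (simp add: algebra_simps)
      have \<kappa>b: "\<kappa> * norm (d n) \<le> \<kappa> * b" using b \<kappa> by (intro mult_left_mono) auto
      have t1: "norm (\<psi> (n + 1) *\<^sub>R (d (n + 1) - A n (d n))) \<le> \<kappa> * b"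
        using mult_mono[of "\<psi> (n+1)" 1 "norm (d (n + 1) - A n (d n))" "\<kappa> * b"] \<psi>01[of "n+1"] d(2)[of n] \<kappa>b by simp
      have t2: "norm (\<psi> (n + 1) *\<^sub>R (A' j n (d n) - A n (d n))) \<le> \<kappa> * b"
      proof (cases "j \<le> n \<and> n \<le> j + 2 * int N")
        case True
        then show ?thesis
          using mult_mono[of "\<psi> (n+1)" 1 "norm (A' j n (d n) - A n (d n))" "\<kappa> * b"] \<psi>01[of "n+1"] near[of j n "d n"] \<kappa>b by simp
      next
        case False
        then have "\<psi> (n + 1) = 0" by (intro \<psi>s) auto
        then show ?thesis using \<kappa> b0 by simp
      qed
      have t3: "norm ((\<psi> (n + 1) - \<psi> n) *\<^sub>R A' j n (d n)) \<le> (1 / N) * (a * b)"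
        unfolding norm_scaleR
      proof (rule mult_mono)
        show "norm (A' j n (d n)) \<le> a * b" using a(1)[of j n "d n"] b a(2) by (meson mult_left_mono order_trans)
      qed (use \<psi>1 in auto)
      show "norm (r n) \<le> (2 * \<kappa> + a / N) * b"
      proof -
        have tri: "norm (x - y + z) \<le> norm x + norm y + norm z" for x y z :: 'e
          by (meson add_right_mono norm_triangle_ineq norm_triangle_ineq4 order_trans)
        have "norm (r n) \<le> \<kappa> * b + \<kappa> * b + (1 / N) * (a * b)"
          unfolding r by (rule order_trans[OF tri]) (intro add_mono t1 t2 t3)
        then show ?thesis by (simp add: algebra_simps)
      qed
    qed
    also have "\<dots> \<le> (C * (2 * \<kappa> + 2 * a / N)) * b"
    proof -
      have "2 * \<kappa> + a / N \<le> 2 * \<kappa> + 2 * a / N" using a(2) by (simp add: divide_right_mono)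
      then have "C * (2 * \<kappa> + a / N) * b \<le> C * (2 * \<kappa> + 2 * a / N) * b"
        using C b0 by (intro mult_right_mono mult_left_mono)
      then show ?thesis by (simp only: mult.assoc)
    qed
    also have "\<dots> \<le> 1 / 2 * b" using small b0 by (intro mult_right_mono) auto
    finally show ?thesis unfolding w_def \<psi>_def by simp
  qed
  have "norm (d n) \<le> b / 2 ^ k" for k n
  proof (induction k arbitrary: n)
    case 0 then show ?case using d(1) by simp
  next
    case (Suc k) then show ?case using half[of "b / 2 ^ k" n] by (simp add: field_simps)
  qed
  moreover have "(\<lambda>k. b / 2 ^ k) \<longlonglongrightarrow> 0"
    by (rule LIMSEQ_divide_realpow_zero) auto
  ultimately have "norm (d n) \<le> 0" by (intro LIMSEQ_le_const) auto
  then show ?thesis by simp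
qed

section \<open>Curves of small length\<close>

text \<open>A simple function below \<open>f\<close> is measurable, so the substitution rule holds
  for it; taking the supremum gives one inequality for arbitrary \<open>f\<close>. The other one is
  the same statement for the inverse substitution.\<close>

lemma nn_integral_lborel_affine_le:
  fixes f :: "real \<Rightarrow> ennreal" and c :: real
  assumes c: "c \<noteq> 0"
  shows "(\<integral>\<^sup>+x. f x \<partial>lborel) \<le> \<bar>c\<bar> * (\<integral>\<^sup>+x. f (t + c * x) \<partial>lborel)"
proof -
  have "integral\<^sup>S lborel g \<le> \<bar>c\<bar> * (\<integral>\<^sup>+x. f (t + c * x) \<partial>lborel)"
    if g: "simple_function lborel g" "g \<le> f" for g
  proof -
    have m: "g \<in> borel_measurable borel" using borel_measurable_simple_function[OF g(1)] by simp
    have "integral\<^sup>S lborel g = (\<integral>\<^sup>+x. g x \<partial>lborel)" using nn_integral_eq_simple_integral[OF g(1)] by simp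
    also have "\<dots> = \<bar>c\<bar> * (\<integral>\<^sup>+x. g (t + c * x) \<partial>lborel)" by (rule nn_integral_real_affine[OF m c])
    also have "\<dots> \<le> \<bar>c\<bar> * (\<integral>\<^sup>+x. f (t + c * x) \<partial>lborel)"
      using g(2) by (intro mult_left_mono nn_integral_mono) (auto simp: le_fun_def)
    finally show ?thesis .
  qed
  then show ?thesis unfolding nn_integral_def[of lborel f] by (intro SUP_least) auto
qed

text \<open>Speeds of curves are not known to be measurable, so \<open>nn_integral_real_affine\<close> does not apply.\<close>

lemma nn_integral_lborel_affine:
  fixes f :: "real \<Rightarrow> ennreal" and c :: real
  assumes c: "c \<noteq> 0"
  shows "(\<integral>\<^sup>+x. f x \<partial>lborel) = \<bar>c\<bar> * (\<integral>\<^sup>+x. f (t + c * x) \<partial>lborel)"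
proof (rule antisym[OF nn_integral_lborel_affine_le[OF c]])
  have "(\<integral>\<^sup>+x. f (t + c * x) \<partial>lborel) \<le> \<bar>1 / c\<bar> * (\<integral>\<^sup>+x. f (t + c * (- t / c + 1 / c * x)) \<partial>lborel)"
    by (rule nn_integral_lborel_affine_le) (use c in auto)
  also have "(\<lambda>x. f (t + c * (- t / c + 1 / c * x))) = f" using c by (simp add: field_simps)
  finally have "\<bar>c\<bar> * (\<integral>\<^sup>+x. f (t + c * x) \<partial>lborel) \<le> \<bar>c\<bar> * (\<bar>1 / c\<bar> * (\<integral>\<^sup>+x. f x \<partial>lborel))"
    by (rule mult_left_mono) simp
  also have "\<dots> = (\<integral>\<^sup>+x. f x \<partial>lborel)"
    using c by (simp add: mult.assoc[symmetric] ennreal_mult[symmetric])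
  finally show "\<bar>c\<bar> * (\<integral>\<^sup>+x. f (t + c * x) \<partial>lborel) \<le> (\<integral>\<^sup>+x. f x \<partial>lborel)" .
qed

text \<open>Shown for each simple function below \<open>f\<close>, where additivity is available;
  the pieces may overlap, as the two halves of a joined path do in one parameter.\<close>

lemma nn_integral_union_le:
  assumes A: "A \<in> sets M" "B \<in> sets M"
  shows "(\<integral>\<^sup>+x\<in>A \<union> B. f x \<partial>M) \<le> (\<integral>\<^sup>+x\<in>A. f x \<partial>M) + (\<integral>\<^sup>+x\<in>B. f x \<partial>M)"
proof -
  have "integral\<^sup>S M g \<le> (\<integral>\<^sup>+x\<in>A. f x \<partial>M) + (\<integral>\<^sup>+x\<in>B. f x \<partial>M)"
    if g: "simple_function M g" "g \<le> (\<lambda>x. f x * indicator (A \<union> B) x)" for g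
  proof -
    have m[measurable]: "g \<in> borel_measurable M" using borel_measurable_simple_function[OF g(1)] by simp
    have gAB: "g x \<le> f x * indicator (A \<union> B) x" for x using g(2) by (auto simp: le_fun_def)
    have g0: "g x \<le> g x * indicator A x + g x * indicator B x" for x
      using gAB[of x] by (cases "x \<in> A"; cases "x \<in> B") auto
    have "integral\<^sup>S M g = (\<integral>\<^sup>+x. g x \<partial>M)" using nn_integral_eq_simple_integral[OF g(1)] by simp
    also have "\<dots> \<le> (\<integral>\<^sup>+x. g x * indicator A x + g x * indicator B x \<partial>M)" by (intro nn_integral_mono g0)
    also have "\<dots> = (\<integral>\<^sup>+x\<in>A. g x \<partial>M) + (\<integral>\<^sup>+x\<in>B. g x \<partial>M)"
      using A by (intro nn_integral_add) auto
    also have "\<dots> \<le> (\<integral>\<^sup>+x\<in>A. f x \<partial>M) + (\<integral>\<^sup>+x\<in>B. f x \<partial>M)"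
    proof -
      have "g x * indicator A x \<le> f x * indicator A x" "g x * indicator B x \<le> f x * indicator B x" for x
        using gAB[of x] by (auto split: split_indicator)
      then show ?thesis by (intro add_mono nn_integral_mono)
    qed
    finally show ?thesis .
  qed
  then show ?thesis unfolding nn_integral_def[of M "\<lambda>x. f x * indicator (A \<union> B) x"] by (intro SUP_least) auto
qed

lemma nn_integral_cmult_le:
  fixes f :: "'a \<Rightarrow> ennreal" and c :: real
  assumes c: "0 < c"
  shows "(\<integral>\<^sup>+x. ennreal c * f x \<partial>M) \<le> ennreal c * (\<integral>\<^sup>+x. f x \<partial>M)"
proof -
  have cc: "ennreal c * ennreal (1 / c) = 1" using c by (simp add: ennreal_mult[symmetric])
  have "integral\<^sup>S M g \<le> ennreal c * (\<integral>\<^sup>+x. f x \<partial>M)"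
    if g: "simple_function M g" "g \<le> (\<lambda>x. ennreal c * f x)" for g
  proof -
    have m: "g \<in> borel_measurable M" using borel_measurable_simple_function[OF g(1)] .
    have le: "ennreal (1 / c) * g x \<le> f x" for x
    proof -
      have "ennreal (1 / c) * g x \<le> ennreal (1 / c) * (ennreal c * f x)"
        using g(2) by (intro mult_left_mono) (auto simp: le_fun_def)
      also have "\<dots> = f x" using cc by (simp add: mult.assoc[symmetric] mult.commute)
      finally show ?thesis .
    qed
    have "integral\<^sup>S M g = (\<integral>\<^sup>+x. g x \<partial>M)" using nn_integral_eq_simple_integral[OF g(1)] by simp
    also have "\<dots> = ennreal c * (ennreal (1 / c) * (\<integral>\<^sup>+x. g x \<partial>M))"
      using cc by (simp add: mult.assoc[symmetric])
    also have "ennreal (1 / c) * (\<integral>\<^sup>+x. g x \<partial>M) = (\<integral>\<^sup>+x. ennreal (1 / c) * g x \<partial>M)"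
      by (rule nn_integral_cmult[OF m, symmetric])
    also have "\<dots> \<le> (\<integral>\<^sup>+x. f x \<partial>M)" by (intro nn_integral_mono le)
    finally show ?thesis by (simp add: mult_left_mono)
  qed
  then show ?thesis unfolding nn_integral_def[of M "\<lambda>x. ennreal c * f x"] by (intro SUP_least) auto
qed

lemma AE_lborel_not_in_finite: "finite S \<Longrightarrow> AE t in lborel. t \<notin> (S :: real set)"
  by (rule AE_not_in[OF finite_imp_null_set_lborel])

text \<open>Measurability is in doubt only for the majorant \<open>\<sigma>\<close>; the derivative
  itself is continuous off finitely many points, so the fundamental theorem and the norm bound for
  integrals apply to it.\<close>

lemma norm_diff_le_nn_integral_derivative:
  fixes Z :: "real \<Rightarrow> 'z::euclidean_space"
  assumes ab: "a \<le> b" and Z: "continuous_on {a..b} Z" and S: "finite S"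
    and Z': "\<And>t. t \<in> {a<..<b} - S \<Longrightarrow> (Z has_vector_derivative Z' t) (at t)"
    and cont: "continuous_on ({a<..<b} - S) Z'"
    and le: "\<And>t. t \<in> {a<..<b} - S \<Longrightarrow> norm (Z' t) \<le> \<sigma> t"
  shows "ennreal (norm (Z b - Z a)) \<le> (\<integral>\<^sup>+t\<in>{a..b}. ennreal (\<sigma> t) \<partial>lborel)"
proof (cases "(\<integral>\<^sup>+t\<in>{a..b}. ennreal (\<sigma> t) \<partial>lborel) = \<infinity>")
  case False
  \<comment> \<open>Extension by 0 makes the derivative a Borel function on the whole line; it is
    integrable because the case of an infinite right-hand side was split off.\<close>
  define D where "D t = (if t \<in> {a<..<b} - S then Z' t else 0)" for t
  have op: "open ({a<..<b} - S)" using S by (intro open_Diff finite_imp_closed) auto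
  have [measurable]: "D \<in> borel_measurable borel"
    unfolding D_def using op cont by (intro borel_measurable_continuous_on_if) auto
  have le': "(\<integral>\<^sup>+t. ennreal (norm (D t)) \<partial>lborel) \<le> (\<integral>\<^sup>+t\<in>{a..b}. ennreal (\<sigma> t) \<partial>lborel)"
    using le by (intro nn_integral_mono) (auto simp: D_def split: split_indicator intro!: ennreal_leI)
  then have D: "integrable lborel D"
    using False by (intro integrableI_bounded) (auto simp: less_top)
  have "(D has_integral (Z b - Z a)) {a..b}"
    using S ab Z Z' by (intro fundamental_theorem_of_calculus_interior_strong[of S]) (auto simp: D_def)
  then have "(D has_integral (Z b - Z a)) UNIV"
    by (rule has_integral_on_superset) (auto simp: D_def)
  moreover have "(D has_integral (integral\<^sup>L lborel D)) UNIV" using D by (rule has_integral_integral_lborel)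
  ultimately have "Z b - Z a = integral\<^sup>L lborel D" by (rule has_integral_unique)
  then have "ennreal (norm (Z b - Z a)) \<le> (\<integral>\<^sup>+t. ennreal (norm (D t)) \<partial>lborel)"
    using integral_norm_bound_ennreal[OF D] by simp
  with le' show ?thesis by (rule order_trans[rotated])
qed simp

text \<open>A continuity argument: the bound on \<open>Z'\<close> is available only while
  \<open>Z\<close> stays within \<open>r\<close> of its start, and the total length is too small to
  use up that distance. \<open>T\<close> is meant as the set of parameters at which a curve lies in
  a chart; \<open>cl\<close> excludes that the curve leaves the chart while its coordinates stay in
  the ball. The target space is arbitrary, so the argument serves points and tangent vectors
  alike.\<close>

lemma curve_trapped:
  fixes Z :: "real \<Rightarrow> 'z::euclidean_space"
  assumes t0: "t0 \<in> T" and T: "T \<subseteq> {0..1}" "openin (top_of_set {0..1}) T"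
    and Z: "continuous_on T Z" and S: "finite S"
    and Z': "\<And>t. t \<in> T \<inter> {0<..<1} - S \<Longrightarrow> (Z has_vector_derivative Z' t) (at t)"
    and cont: "continuous_on (T \<inter> {0<..<1} - S) Z'"
    and le: "\<And>t. t \<in> T \<inter> {0<..<1} - S \<Longrightarrow> norm (Z t - Z t0) \<le> r \<Longrightarrow> norm (Z' t) \<le> C * \<sigma> t"
    and cl: "closed {t \<in> T. norm (Z t - Z t0) \<le> r}"
    and C: "0 < C" and l: "0 \<le> l" "(\<integral>\<^sup>+t\<in>{0..1}. ennreal (\<sigma> t) \<partial>lborel) \<le> ennreal l" and Cl: "C * l < r"
    and t: "t \<in> {0..1}"
  shows "t \<in> T \<and> norm (Z t - Z t0) \<le> C * l"
proof -
  define G where "G = {t \<in> T. norm (Z t - Z t0) \<le> r}"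
  define G0 where "G0 = {t \<in> T. norm (Z t - Z t0) < r}"
  have seg: "norm (Z b - Z a) \<le> C * l" if ab: "a \<le> b" "{a..b} \<subseteq> G" for a b
  proof -
    have abT: "{a..b} \<subseteq> T" using ab unfolding G_def by blast
    have sub: "{a<..<b} - S \<subseteq> T \<inter> {0<..<1} - S"
    proof -
      have "{a..b} \<subseteq> {0..1}" using ab T unfolding G_def by blast
      then have "0 \<le> a" "b \<le> 1" using ab by auto
      then show ?thesis using abT by auto
    qed
    have cC: "continuous_on {a..b} (\<lambda>t. Z t /\<^sub>R C)"
      by (intro continuous_on_scaleR continuous_on_const continuous_on_subset[OF Z abT])
    have "ennreal (norm (Z b /\<^sub>R C - Z a /\<^sub>R C)) \<le> (\<integral>\<^sup>+t\<in>{a..b}. ennreal (\<sigma> t) \<partial>lborel)"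
    proof (rule norm_diff_le_nn_integral_derivative[where Z'="\<lambda>t. Z' t /\<^sub>R C" and S=S])
      show "((\<lambda>t. Z t /\<^sub>R C) has_vector_derivative Z' t /\<^sub>R C) (at t)" if "t \<in> {a<..<b} - S" for t
        using Z' that sub by (intro bounded_linear.has_vector_derivative[OF bounded_linear_scaleR_right]) auto
      show "continuous_on ({a<..<b} - S) (\<lambda>t. Z' t /\<^sub>R C)"
        by (rule continuous_on_scaleR[OF continuous_on_const continuous_on_subset[OF cont sub]])
      fix t assume t: "t \<in> {a<..<b} - S"
      then have "t \<in> G" using ab(2) by auto
      then have "norm (Z' t) \<le> C * \<sigma> t" using t sub unfolding G_def by (intro le) auto
      then show "norm (Z' t /\<^sub>R C) \<le> \<sigma> t" using C by (simp add: field_simps)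
    qed (use ab S cC in auto)
    also have "\<dots> \<le> (\<integral>\<^sup>+t\<in>{0..1}. ennreal (\<sigma> t) \<partial>lborel)"
    proof -
      have "{a..b} \<subseteq> {0..1}" using ab T unfolding G_def by blast
      then show ?thesis by (intro nn_integral_mono) (auto split: split_indicator)
    qed
    also note l(2)
    finally have "norm (Z b /\<^sub>R C - Z a /\<^sub>R C) \<le> l" using l(1) by simp
    moreover have "Z b /\<^sub>R C - Z a /\<^sub>R C = (1 / C) *\<^sub>R (Z b - Z a)"
      by (simp add: scaleR_diff_right inverse_eq_divide)
    ultimately have "norm (Z b - Z a) / C \<le> l" using C by simp
    then show ?thesis using C by (simp add: pos_divide_le_eq mult.commute)
  qed
  have r: "0 < r" using mult_nonneg_nonneg[of C l] C l Cl by linarith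
  have t0G: "t0 \<in> G0" using t0 r by (simp add: G0_def)
  \<comment> \<open>Take the bad parameter \<open>t1\<close> nearest to \<open>t0\<close>.
    Everything strictly between is good, so the closed segment lies in the closed set
    \<open>G\<close>; the length estimate there gives a distance of at most \<open>C * l < r\<close>
    at \<open>t1\<close>, so \<open>t1\<close> was good after all.\<close>
  have "{0..1} - G0 = {}"
  proof (rule ccontr)
    assume ne: "{0..1} - G0 \<noteq> {}"
    have "openin (top_of_set T) (T \<inter> Z -` ball (Z t0) r)"
      by (rule continuous_openin_preimage_gen[OF Z]) simp
    moreover have "T \<inter> Z -` ball (Z t0) r = G0" by (auto simp: G0_def dist_norm norm_minus_commute)
    ultimately have "openin (top_of_set {0..1}) G0" using T(2) openin_trans by metis
    then have "closed ({0..1} - G0)"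
      by (metis closed_atLeastAtMost closedin_closed_eq closedin_diff closedin_self topspace_euclidean_subtopology)
    then obtain t1 where t1: "t1 \<in> {0..1} - G0" "\<And>s. s \<in> {0..1} - G0 \<Longrightarrow> dist t0 t1 \<le> dist t0 s"
      using distance_attains_inf[of "{0..1} - G0" t0] ne by blast
    have ne01: "t1 \<noteq> t0" using t1 t0G by auto
    have in01: "t0 \<in> {0..1}" "t1 \<in> {0..1}" using t0 T t1 by auto
    have op: "open_segment t0 t1 \<subseteq> G0"
    proof
      fix s assume s: "s \<in> open_segment t0 t1"
      then have "dist t0 s < dist t0 t1" using dist_in_open_segment[of s t0 t1] by (simp add: dist_commute)
      moreover have "s \<in> {0..1}"
        using s in01 closed_segment_subset[of t0 "{0..1}" t1] open_closed_segment by blast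
      ultimately show "s \<in> G0" using t1(2)[of s] by auto
    qed
    have "closure (open_segment t0 t1) \<subseteq> G"
      using op cl by (intro closure_minimal) (auto simp: G0_def G_def)
    then have cs: "closed_segment t0 t1 \<subseteq> G" using ne01 by (simp add: closure_open_segment)
    have "norm (Z t1 - Z t0) \<le> C * l"
    proof (cases "t0 \<le> t1")
      case True then show ?thesis using seg[of t0 t1] cs by (simp add: closed_segment_eq_real_ivl)
    next
      case False then show ?thesis using seg[of t1 t0] cs by (simp add: closed_segment_eq_real_ivl norm_minus_commute)
    qed
    moreover have "t1 \<in> T" using cs unfolding G_def by auto
    ultimately have "t1 \<in> G0" using Cl unfolding G0_def by simp
    then show False using t1 by auto
  qed
  then have all: "{0..1} \<subseteq> G" by (auto simp: G0_def G_def)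
  have t01: "t0 \<in> {0..1}" using t0 T by auto
  have "norm (Z t - Z t0) \<le> C * l"
  proof (cases "t0 \<le> t")
    case True
    moreover have "{t0..t} \<subseteq> {0..1}" using t t01 by auto
    ultimately show ?thesis using all by (intro seg) (auto intro: subset_trans)
  next
    case False
    moreover have "{t..t0} \<subseteq> {0..1}" using t t01 by auto
    ultimately have "norm (Z t0 - Z t) \<le> C * l" using all by (intro seg) (auto intro: subset_trans)
    then show ?thesis by (simp add: norm_minus_commute)
  qed
  then show ?thesis using t all unfolding G_def by auto
qed

section \<open>Calculus in charts\<close>

text \<open>The mean value theorem twice: along \<open>u\<close> for the increment of
  \<open>f\<close> in direction \<open>v\<close>, then along \<open>v\<close> for the derivative of
  \<open>f\<close> in direction \<open>u\<close>. The second difference is symmetric in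
  \<open>u\<close> and \<open>v\<close>, its expression through \<open>E\<close> is not.\<close>

lemma second_difference_mean_value:
  fixes f :: "'e::real_normed_vector \<Rightarrow> real"
  assumes s: "0 < s" and box: "\<And>a b. 0 \<le> a \<Longrightarrow> a \<le> s \<Longrightarrow> 0 \<le> b \<Longrightarrow> b \<le> s \<Longrightarrow> x + a *\<^sub>R u + b *\<^sub>R v \<in> S"
    and D: "\<And>y. y \<in> S \<Longrightarrow> (f has_derivative D y) (at y)"
    and D2: "\<And>y. y \<in> S \<Longrightarrow> ((\<lambda>y. D y u) has_derivative E y) (at y)"
  shows "\<exists>a b. 0 \<le> a \<and> a \<le> s \<and> 0 \<le> b \<and> b \<le> s \<and>
    f (x + s *\<^sub>R u + s *\<^sub>R v) - f (x + s *\<^sub>R u) - f (x + s *\<^sub>R v) + f x = s * s * E (x + a *\<^sub>R u + b *\<^sub>R v) v"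
proof -
  have der: "((\<lambda>t. g (p + t *\<^sub>R w)) has_real_derivative G (p + t *\<^sub>R w) w) (at t)"
    if "(g has_derivative G (p + t *\<^sub>R w)) (at (p + t *\<^sub>R w))" for g :: "'e \<Rightarrow> real" and G p w t
  proof -
    have "((\<lambda>t. g (p + t *\<^sub>R w)) has_derivative (\<lambda>h. G (p + t *\<^sub>R w) (h *\<^sub>R w))) (at t)"
      by (rule has_derivative_compose[of "\<lambda>t. p + t *\<^sub>R w" "\<lambda>h. h *\<^sub>R w", OF _ that])
        (auto intro!: derivative_eq_intros)
    moreover have "G (p + t *\<^sub>R w) (h *\<^sub>R w) = G (p + t *\<^sub>R w) w * h" for h
      using linear_scale[OF has_derivative_linear[OF that]] by simp
    ultimately show ?thesis by (simp add: has_field_derivative_def)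
  qed
  define h where "h t = f ((x + s *\<^sub>R v) + t *\<^sub>R u) - f (x + t *\<^sub>R u)" for t
  have "\<exists>a>0. a < s \<and> h s - h 0 = (s - 0) * (D ((x + s *\<^sub>R v) + a *\<^sub>R u) u - D (x + a *\<^sub>R u) u)"
  proof (rule MVT2[OF s])
    fix t assume t: "0 \<le> t" "t \<le> s"
    have "(x + s *\<^sub>R v) + t *\<^sub>R u \<in> S" "x + t *\<^sub>R u \<in> S"
      using box[of t s] box[of t 0] t s by (auto simp: algebra_simps)
    then show "(h has_real_derivative (D ((x + s *\<^sub>R v) + t *\<^sub>R u) u - D (x + t *\<^sub>R u) u)) (at t)"
      unfolding h_def by (intro DERIV_diff der D)
  qed
  then obtain a where a: "0 < a" "a < s" "h s - h 0 = s * (D ((x + s *\<^sub>R v) + a *\<^sub>R u) u - D (x + a *\<^sub>R u) u)"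
    by auto
  define k where "k t = D ((x + a *\<^sub>R u) + t *\<^sub>R v) u" for t
  have "\<exists>b>0. b < s \<and> k s - k 0 = (s - 0) * E ((x + a *\<^sub>R u) + b *\<^sub>R v) v"
  proof (rule MVT2[OF s])
    fix t assume t: "0 \<le> t" "t \<le> s"
    have "(x + a *\<^sub>R u) + t *\<^sub>R v \<in> S" using box[of a t] t a by auto
    then show "(k has_real_derivative E ((x + a *\<^sub>R u) + t *\<^sub>R v) v) (at t)"
      unfolding k_def by (intro der D2)
  qed
  then obtain b where b: "0 < b" "b < s" "k s - k 0 = s * E ((x + a *\<^sub>R u) + b *\<^sub>R v) v" by auto
  have 1: "k s = D ((x + s *\<^sub>R v) + a *\<^sub>R u) u" "k 0 = D (x + a *\<^sub>R u) u" unfolding k_def by (simp_all add: algebra_simps)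
  have "f (x + s *\<^sub>R u + s *\<^sub>R v) - f (x + s *\<^sub>R u) - f (x + s *\<^sub>R v) + f x = h s - h 0"
    unfolding h_def by (simp add: algebra_simps)
  also have "\<dots> = s * s * E (x + a *\<^sub>R u + b *\<^sub>R v) v" using a(3) b(3) unfolding 1 by simp
  finally show ?thesis using a b by (intro exI[of _ a] exI[of _ b]) auto
qed

text \<open>Schwarz's theorem. The same second difference is \<open>s * s\<close> times either mixed
  derivative at points near \<open>x\<close>; by continuity both agree at \<open>x\<close>.
  Transition maps need this in the transformation law of the connection.\<close>

lemma symmetric_second_derivative_real:
  fixes f :: "'e::real_normed_vector \<Rightarrow> real"
  assumes S: "open S" "x \<in> S"
    and D: "\<And>y. y \<in> S \<Longrightarrow> (f has_derivative D y) (at y)"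
    and E: "\<And>y u. y \<in> S \<Longrightarrow> ((\<lambda>y. D y u) has_derivative E u y) (at y)"
    and cont: "\<And>u v. continuous_on S (\<lambda>y. E u y v)"
  shows "E u x v = E v x u"
proof (rule ccontr)
  assume ne: "E u x v \<noteq> E v x u"
  define e where "e = \<bar>E u x v - E v x u\<bar> / 2"
  have e: "0 < e" using ne by (simp add: e_def)
  have "\<forall>\<^sub>F y in at x within S. dist (E u y v) (E u x v) < e" "\<forall>\<^sub>F y in at x within S. dist (E v y u) (E v x u) < e"
    using cont S(2) e by (auto simp: continuous_on_def intro: tendstoD)
  then have "\<forall>\<^sub>F y in at x within S. dist (E u y v) (E u x v) < e \<and> dist (E v y u) (E v x u) < e"
    by (rule eventually_conj)
  then have "\<forall>\<^sub>F y in at x. dist (E u y v) (E u x v) < e \<and> dist (E v y u) (E v x u) < e"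
    by (simp only: at_within_open[OF S(2,1)])
  then obtain d1 where d1: "0 < d1" "\<And>y. y \<noteq> x \<Longrightarrow> dist y x < d1 \<Longrightarrow> dist (E u y v) (E u x v) < e \<and> dist (E v y u) (E v x u) < e"
    unfolding eventually_at by auto
  then have d1': "dist (E u y v) (E u x v) < e \<and> dist (E v y u) (E v x u) < e" if "dist y x < d1" for y
    using that e by (cases "y = x") auto
  obtain d2 where d2: "0 < d2" "ball x d2 \<subseteq> S" using S open_contains_ball by blast
  define d where "d = min d1 d2"
  have d: "0 < d" using d1 d2 by (simp add: d_def)
  \<comment> \<open>The parallelogram with sides \<open>s *\<^sub>R u\<close> and
    \<open>s *\<^sub>R v\<close> then stays in the ball of radius \<open>d\<close>; the 1 keeps the
    denominator positive.\<close>
  define s where "s = d / (2 * (norm u + norm v + 1))"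
  have nn: "0 < norm u + norm v + 1" by (smt (verit) norm_ge_zero)
  have s: "0 < s" using d nn by (simp add: s_def)
  have near: "dist (x + a *\<^sub>R u + b *\<^sub>R v) x < d" if "0 \<le> a" "a \<le> s" "0 \<le> b" "b \<le> s" for a b
  proof -
    have "norm (a *\<^sub>R u + b *\<^sub>R v) \<le> a * norm u + b * norm v"
      using that norm_triangle_ineq[of "a *\<^sub>R u" "b *\<^sub>R v"] by simp
    also have "\<dots> \<le> s * norm u + s * norm v" using that by (intro add_mono mult_right_mono) auto
    also have "\<dots> < s * (2 * (norm u + norm v + 1))" using s
      by (simp add: algebra_simps) (smt (verit) mult_nonneg_nonneg norm_ge_zero)
    also have "\<dots> = d" using nn by (simp add: s_def)
    finally show ?thesis by (simp add: dist_norm algebra_simps)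
  qed
  have inS: "x + a *\<^sub>R u + b *\<^sub>R v \<in> S" if "0 \<le> a" "a \<le> s" "0 \<le> b" "b \<le> s" for a b
    using near[OF that] d2 by (auto simp: d_def dist_commute subset_iff)
  obtain a b where ab: "0 \<le> a" "a \<le> s" "0 \<le> b" "b \<le> s"
    "f (x + s *\<^sub>R u + s *\<^sub>R v) - f (x + s *\<^sub>R u) - f (x + s *\<^sub>R v) + f x = s * s * E u (x + a *\<^sub>R u + b *\<^sub>R v) v"
    using second_difference_mean_value[OF s inS D E[of _ u]] by blast
  have inS': "x + a *\<^sub>R v + b *\<^sub>R u \<in> S" if "0 \<le> a" "a \<le> s" "0 \<le> b" "b \<le> s" for a b
    using inS[of b a] that by (simp add: algebra_simps)
  obtain a' b' where ab': "0 \<le> a'" "a' \<le> s" "0 \<le> b'" "b' \<le> s"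
    "f (x + s *\<^sub>R v + s *\<^sub>R u) - f (x + s *\<^sub>R v) - f (x + s *\<^sub>R u) + f x = s * s * E v (x + a' *\<^sub>R v + b' *\<^sub>R u) u"
    using second_difference_mean_value[OF s inS' D E[of _ v]] by blast
  have "f (x + s *\<^sub>R v + s *\<^sub>R u) - f (x + s *\<^sub>R v) - f (x + s *\<^sub>R u) + f x
    = f (x + s *\<^sub>R u + s *\<^sub>R v) - f (x + s *\<^sub>R u) - f (x + s *\<^sub>R v) + f x"
    by (simp add: algebra_simps)
  with ab(5) ab'(5) s have "E u (x + a *\<^sub>R u + b *\<^sub>R v) v = E v (x + a' *\<^sub>R v + b' *\<^sub>R u) u" by simp
  moreover have "dist (E u (x + a *\<^sub>R u + b *\<^sub>R v) v) (E u x v) < e"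
    using d1' near[OF ab(1-4)] by (auto simp: d_def)
  moreover have "dist (E v (x + a' *\<^sub>R v + b' *\<^sub>R u) u) (E v x u) < e"
    using d1' near[OF ab'(3,4,1,2)] by (auto simp: d_def algebra_simps)
  ultimately have "dist (E u x v) (E v x u) < e + e"
    using dist_triangle3[of "E u x v" "E v x u" "E u (x + a *\<^sub>R u + b *\<^sub>R v) v"] by simp
  then show False unfolding e_def dist_real_def by simp
qed

lemma symmetric_second_derivative:
  fixes f :: "'e::real_normed_vector \<Rightarrow> 'f::euclidean_space"
  assumes S: "open S" "x \<in> S"
    and D: "\<And>y. y \<in> S \<Longrightarrow> (f has_derivative D y) (at y)"
    and E: "\<And>y u. y \<in> S \<Longrightarrow> ((\<lambda>y. D y u) has_derivative E u y) (at y)"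
    and cont: "\<And>u v. continuous_on S (\<lambda>y. E u y v)"
  shows "E u x v = E v x u"
proof (rule euclidean_eqI)
  fix b :: 'f assume "b \<in> Basis"
  show "E u x v \<bullet> b = E v x u \<bullet> b"
    by (rule symmetric_second_derivative_real[where f="\<lambda>y. f y \<bullet> b" and D="\<lambda>y u. D y u \<bullet> b" and E="\<lambda>u y v. E u y v \<bullet> b", OF S])
      (auto intro!: has_derivative_inner_left D E continuous_intros cont)
qed

lemma Ck_on_SucD: "Ck_on (Suc k) f S \<Longrightarrow> x \<in> S \<Longrightarrow> (f has_derivative frechet_derivative f (at x)) (at x)"
  by (simp add: frechet_derivative_works[symmetric])

lemma smooth_on_has_derivative: "smooth_on f S \<Longrightarrow> x \<in> S \<Longrightarrow> (f has_derivative frechet_derivative f (at x)) (at x)"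
  unfolding smooth_on_def using Ck_on_SucD by blast

lemma smooth_on_derivative: "smooth_on f S \<Longrightarrow> smooth_on (\<lambda>x. frechet_derivative f (at x) v) S"
  unfolding smooth_on_def using Ck_on.simps(2) by blast

lemma smooth_on_continuous: "smooth_on f S \<Longrightarrow> continuous_on S f"
  unfolding smooth_on_def using Ck_on.simps(1) by blast

lemma C1_differentiable_on_subset: "f C1_differentiable_on T \<Longrightarrow> S \<subseteq> T \<Longrightarrow> f C1_differentiable_on S"
  unfolding C1_differentiable_on_def by (meson continuous_on_subset subsetD)

section \<open>Charts as homeomorphisms between open sets\<close>

context
  fixes c :: "('a::t2_space, 'e::euclidean_space) chart"
  assumes c: "is_chart c"
begin

lemma chart_open: "open (fst c)" "open (snd c ` fst c)"
  using c unfolding is_chart_def by auto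

lemma chart_cont: "continuous_on (fst c) (snd c)" "continuous_on (snd c ` fst c) (chart_inv c)"
  using c unfolding is_chart_def homeomorphism_def by auto

lemma chart_inv_left: "x \<in> fst c \<Longrightarrow> chart_inv c (snd c x) = x"
  using c unfolding is_chart_def homeomorphism_def by auto

lemma chart_inv_right: "y \<in> snd c ` fst c \<Longrightarrow> snd c (chart_inv c y) = y"
  using chart_inv_left by auto

lemma chart_inv_in: "y \<in> snd c ` fst c \<Longrightarrow> chart_inv c y \<in> fst c"
  using chart_inv_left by auto

lemma chart_image_eq: "y \<in> snd c ` (fst c \<inter> U) \<longleftrightarrow> y \<in> snd c ` fst c \<and> chart_inv c y \<in> U"
  using chart_inv_left by auto

lemma chart_open_image: "open U \<Longrightarrow> open (snd c ` (fst c \<inter> U))"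
proof -
  assume "open U"
  have "snd c ` (fst c \<inter> U) = snd c ` fst c \<inter> chart_inv c -` U"
    using chart_image_eq by auto
  then show ?thesis
    using continuous_on_open_vimage[OF chart_open(2)] chart_cont(2) \<open>open U\<close> by (metis Int_commute)
qed

lemma chart_vimage_open: "open V \<Longrightarrow> open (fst c \<inter> snd c -` V)"
  using continuous_on_open_vimage[OF chart_open(1)] chart_cont(1) by (auto simp: Int_commute)

lemma chart_compact: "compact Q \<Longrightarrow> Q \<subseteq> snd c ` fst c \<Longrightarrow> compact (chart_inv c ` Q)"
  using chart_cont(2) by (intro compact_continuous_image) (auto intro: continuous_on_subset)

text \<open>Closed in the manifold, not merely in the chart domain: the set is the image of a
  compact set in a Hausdorff space. This prevents a curve that stays in it from running out of the
  domain.\<close>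

lemma chart_compact_vimage:
  assumes "compact Q" "Q \<subseteq> snd c ` fst c"
  shows "closed {x \<in> fst c. snd c x \<in> Q}"
proof -
  have "{x \<in> fst c. snd c x \<in> Q} = chart_inv c ` Q"
    using assms chart_inv_left by (auto simp: chart_inv_in) (metis image_eqI)+
  then show ?thesis using chart_compact[OF assms] compact_imp_closed by simp
qed

end

section \<open>The Riemannian distance\<close>

locale riem =
  fixes M :: "('a::t2_space, 'e::euclidean_space) rspace"
  assumes riem: "riemannian_manifold M"
begin

abbreviation "gm \<equiv> metric_in M"
abbreviation "cc \<equiv> coord_change"
abbreviation "cat x \<equiv> chart_at M x"

lemma chart: "c \<in> charts M \<Longrightarrow> is_chart c"
  using riem unfolding riemannian_manifold_def smooth_atlas_def by auto

lemma cat: "cat x \<in> charts M" "x \<in> fst (cat x)"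
proof -
  have "\<exists>c. c \<in> charts M \<and> x \<in> fst c"
    using riem unfolding riemannian_manifold_def smooth_atlas_def by blast
  from someI_ex[OF this] show "cat x \<in> charts M" "x \<in> fst (cat x)" unfolding chart_at_def by auto
qed

definition transition :: "('a, 'e) chart \<Rightarrow> ('a, 'e) chart \<Rightarrow> 'e \<Rightarrow> 'e" where
  "transition c c' = snd c' \<circ> chart_inv c"

lemma transition_smooth: "c \<in> charts M \<Longrightarrow> c' \<in> charts M \<Longrightarrow> smooth_on (transition c c') (snd c ` (fst c \<inter> fst c'))"
  using riem unfolding riemannian_manifold_def smooth_atlas_def transition_def by auto

lemma cc_eq: "cc c c' x = frechet_derivative (transition c c') (at (snd c x))"
  unfolding coord_change_def transition_def ..

lemma transition_deriv:
  assumes "c \<in> charts M" "c' \<in> charts M" "x \<in> fst c" "x \<in> fst c'"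
  shows "(transition c c' has_derivative cc c c' x) (at (snd c x))"
  unfolding cc_eq using assms by (intro smooth_on_has_derivative[OF transition_smooth]) auto

lemma cc_linear:
  assumes "c \<in> charts M" "c' \<in> charts M" "x \<in> fst c" "x \<in> fst c'"
  shows "linear (cc c c' x)"
  using transition_deriv[OF assms] has_derivative_linear by blast

lemma transition_apply: "c \<in> charts M \<Longrightarrow> x \<in> fst c \<Longrightarrow> transition c c' (snd c x) = snd c' x"
  unfolding transition_def by (simp add: chart_inv_left chart)

lemma cc_comp:
  assumes c: "c \<in> charts M" "c' \<in> charts M" "c'' \<in> charts M" "x \<in> fst c" "x \<in> fst c'" "x \<in> fst c''"
  shows "cc c' c'' x (cc c c' x v) = cc c c'' x v"
proof -
  let ?O = "snd c ` (fst c \<inter> (fst c' \<inter> fst c''))"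
  have op: "open ?O"
    by (intro chart_open_image[OF chart[OF c(1)]] open_Int chart_open(1) chart c)
  have "((\<lambda>y. transition c' c'' (transition c c' y)) has_derivative (\<lambda>v. cc c' c'' x (cc c c' x v))) (at (snd c x))"
    using transition_deriv[OF c(1,2,4,5)] transition_deriv[OF c(2,3,5,6)] transition_apply[OF c(1,4)]
    by (intro has_derivative_compose[where f="transition c c'" and g="transition c' c''"]) auto
  then have "(transition c c'' has_derivative (\<lambda>v. cc c' c'' x (cc c c' x v))) (at (snd c x))"
  proof (rule has_derivative_transform_within_open[OF _ op])
    show "snd c x \<in> ?O" using c by auto
    fix y assume "y \<in> ?O"
    then obtain z where "y = snd c z" "z \<in> fst c" "z \<in> fst c'" by auto
    then show "transition c' c'' (transition c c' y) = transition c c'' y" using c by (simp add: transition_apply)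
  qed
  from has_derivative_unique[OF this transition_deriv[OF c(1,3,4,6)]] show ?thesis by (rule fun_cong)
qed

lemma cc_id: assumes "c \<in> charts M" "x \<in> fst c" shows "cc c c x v = v"
proof -
  have "((\<lambda>y. y) has_derivative (\<lambda>v. v)) (at (snd c x))" by (rule has_derivative_ident)
  then have "(transition c c has_derivative (\<lambda>v. v)) (at (snd c x))"
  proof (rule has_derivative_transform_within_open[OF _ chart_open(2)[OF chart[OF assms(1)]]])
    show "snd c x \<in> snd c ` fst c" using assms by auto
  qed (use assms in \<open>auto simp: transition_apply\<close>)
  from has_derivative_unique[OF this transition_deriv[OF assms(1,1,2,2)]] show ?thesis by (metis)
qed

lemma cc_inv:
  assumes "c \<in> charts M" "c' \<in> charts M" "x \<in> fst c" "x \<in> fst c'"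
  shows "cc c' c x (cc c c' x v) = v"
  using cc_comp[OF assms(1,2,1,3,4,3)] cc_id[OF assms(1,3)] by simp

lemma gm_eq:
  assumes "c \<in> charts M" "x \<in> fst c"
  shows "gm c (snd c x) u v = riem_metric M x (cc c (cat x) x u) (cc c (cat x) x v)"
  unfolding metric_in_def using assms by (simp add: chart_inv_left chart Let_def)

lemma gm_change:
  assumes "c \<in> charts M" "c' \<in> charts M" "x \<in> fst c" "x \<in> fst c'"
  shows "gm c (snd c x) u v = gm c' (snd c' x) (cc c c' x u) (cc c c' x v)"
  using assms cat[of x] by (simp add: gm_eq cc_comp)

lemma riem_inner: "inner_product (riem_metric M x)"
  using riem unfolding riemannian_manifold_def by auto

lemma gm_bilinear:
  assumes "c \<in> charts M" "x \<in> fst c"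
  shows "bilinear (gm c (snd c x))"
proof -
  have L: "linear (cc c (cat x) x)" using cc_linear assms cat by blast
  have B: "bilinear (riem_metric M x)" using riem_inner unfolding inner_product_def by auto
  have "linear (\<lambda>v. riem_metric M x (cc c (cat x) x u) (cc c (cat x) x v))"
       "linear (\<lambda>v. riem_metric M x (cc c (cat x) x v) (cc c (cat x) x u))" for u
    using B linear_compose[OF L] unfolding bilinear_def o_def by blast+
  then show ?thesis unfolding bilinear_def gm_eq[OF assms] by blast
qed

lemma gm_sym: "c \<in> charts M \<Longrightarrow> x \<in> fst c \<Longrightarrow> gm c (snd c x) u v = gm c (snd c x) v u"
  using riem_inner[of x] unfolding inner_product_def by (simp add: gm_eq)

lemma gm_pos:
  assumes "c \<in> charts M" "x \<in> fst c" "v \<noteq> 0"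
  shows "0 < gm c (snd c x) v v"
proof -
  have "cc c (cat x) x v \<noteq> 0"
  proof
    assume "cc c (cat x) x v = 0"
    then have "v = cc (cat x) c x 0" using cc_inv[OF assms(1) cat(1) assms(2) cat(2), of v] by simp
    then show False using linear_0[OF cc_linear[OF cat(1) assms(1) cat(2) assms(2)]] assms(3) by simp
  qed
  then show ?thesis using riem_inner[of x] unfolding inner_product_def by (simp add: gm_eq assms)
qed

definition chart_norm :: "('a, 'e) chart \<Rightarrow> 'e \<Rightarrow> 'e \<Rightarrow> real" where
  "chart_norm c y u = sqrt (gm c y u u)"

lemma tnorm_chart_norm:
  assumes "c \<in> charts M" "x \<in> fst c"
  shows "tnorm M x v = chart_norm c (snd c x) (cc (cat x) c x v)"
  unfolding tnorm_def chart_norm_def gm_eq[OF assms] using assms cat by (simp add: cc_inv)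

lemma tnorm_scale: "tnorm M x (a *\<^sub>R v) = \<bar>a\<bar> * tnorm M x v"
proof -
  have B: "bilinear (riem_metric M x)" using riem_inner unfolding inner_product_def by auto
  show ?thesis unfolding tnorm_def bilinear_lmul[OF B] bilinear_rmul[OF B]
    by (simp add: real_sqrt_mult mult.assoc[symmetric])
qed

lemma tnorm_nonneg: "0 \<le> tnorm M x v"
proof (cases "v = 0")
  case True
  have B: "bilinear (riem_metric M x)" using riem_inner unfolding inner_product_def by auto
  then show ?thesis using True by (simp add: tnorm_def bilinear_lzero)
next
  case False
  then show ?thesis using riem_inner[of x] unfolding inner_product_def tnorm_def by (simp add: less_imp_le)
qed

lemma gm_smooth: "c \<in> charts M \<Longrightarrow> smooth_on (\<lambda>y. gm c y u v) (snd c ` fst c)"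
  using riem unfolding riemannian_manifold_def by auto

lemma bilinear_expand:
  fixes B :: "'e \<Rightarrow> 'e \<Rightarrow> real"
  assumes "bilinear B"
  shows "B u v = (\<Sum>b\<in>Basis. \<Sum>b'\<in>Basis. (u \<bullet> b) * (v \<bullet> b') * B b b')"
proof -
  have "B u v = B (\<Sum>b\<in>Basis. (u \<bullet> b) *\<^sub>R b) (\<Sum>b\<in>Basis. (v \<bullet> b) *\<^sub>R b)"
    by (simp add: euclidean_representation)
  also have "\<dots> = (\<Sum>b\<in>Basis. \<Sum>b'\<in>Basis. (u \<bullet> b) * (v \<bullet> b') * B b b')"
    unfolding bilinear_sum[OF assms] sum.cartesian_product[symmetric]
    by (intro sum.cong refl) (simp add: bilinear_lmul[OF assms] bilinear_rmul[OF assms])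
  finally show ?thesis .
qed

lemma gm_cont:
  assumes "c \<in> charts M" "Q \<subseteq> snd c ` fst c"
  shows "continuous_on (Q \<times> UNIV) (\<lambda>(y, u). gm c y u u)"
proof -
  have c1: "continuous_on Q (\<lambda>y. gm c y b b')" for b b'
    using smooth_on_continuous[OF gm_smooth[OF assms(1)]] assms(2) continuous_on_subset by blast
  have "continuous_on (Q \<times> UNIV) (\<lambda>z. \<Sum>b\<in>Basis. \<Sum>b'\<in>Basis. (snd z \<bullet> b) * (snd z \<bullet> b') * gm c (fst z) b b')"
    by (intro continuous_intros continuous_on_compose2[OF c1]) auto
  then show ?thesis
  proof (rule continuous_on_eq)
    fix z assume z: "z \<in> Q \<times> (UNIV :: 'e set)"
    then obtain x where "fst z = snd c x" "x \<in> fst c" using assms(2) by auto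
    then show "(\<Sum>b\<in>Basis. \<Sum>b'\<in>Basis. (snd z \<bullet> b) * (snd z \<bullet> b') * gm c (fst z) b b') = (case z of (y, u) \<Rightarrow> gm c y u u)"
      using bilinear_expand[OF gm_bilinear[OF assms(1), of x], of "snd z" "snd z"] by (simp add: case_prod_unfold)
  qed
qed

lemma chart_norm_scale:
  assumes "c \<in> charts M" "y \<in> snd c ` fst c"
  shows "chart_norm c y (a *\<^sub>R u) = \<bar>a\<bar> * chart_norm c y u"
proof -
  have B: "bilinear (gm c y)" using assms(2) gm_bilinear[OF assms(1)] by auto
  show ?thesis unfolding chart_norm_def bilinear_lmul[OF B] bilinear_rmul[OF B]
    by (simp add: real_sqrt_mult mult.assoc[symmetric])
qed

text \<open>By homogeneity only unit vectors matter; on \<open>Q\<close> times the unit sphere the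
  Riemannian norm is continuous and positive, so it has a positive minimum and a maximum.\<close>

lemma chart_norm_compare:
  assumes c: "c \<in> charts M" and Q: "compact Q" "Q \<subseteq> snd c ` fst c"
  shows "\<exists>C>0. \<forall>y\<in>Q. \<forall>u. norm u \<le> C * chart_norm c y u \<and> chart_norm c y u \<le> C * norm u"
proof (cases "Q = {}")
  case True then show ?thesis by (intro exI[of _ 1]) auto
next
  case False
  let ?K = "Q \<times> sphere (0 :: 'e) 1" and ?h = "\<lambda>z. chart_norm c (fst z) (snd z)"
  have K: "compact ?K" "?K \<noteq> {}" using Q False by (auto intro: compact_Times)
  have cont: "continuous_on ?K ?h"
    unfolding chart_norm_def using continuous_on_subset[OF gm_cont[OF c Q(2)], of ?K]
    by (intro continuous_intros) (auto simp: case_prod_unfold)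
  obtain z1 where z1: "z1 \<in> ?K" "\<And>z. z \<in> ?K \<Longrightarrow> ?h z1 \<le> ?h z"
    using continuous_attains_inf[OF K cont] by blast
  obtain z2 where z2: "z2 \<in> ?K" "\<And>z. z \<in> ?K \<Longrightarrow> ?h z \<le> ?h z2"
    using continuous_attains_sup[OF K cont] by blast
  have hp: "0 < ?h z" if "z \<in> ?K" for z
  proof -
    have "snd z \<noteq> 0" "fst z \<in> snd c ` fst c" using that Q by auto
    then show ?thesis unfolding chart_norm_def using gm_pos[OF c] by auto
  qed
  define C where "C = max (1 / ?h z1) (?h z2)"
  have C: "0 < C" using hp[OF z2(1)] unfolding C_def by simp
  have "norm u \<le> C * chart_norm c y u \<and> chart_norm c y u \<le> C * norm u" if y: "y \<in> Q" for y u
  proof (cases "u = 0")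
    case True
    have "chart_norm c y (0 *\<^sub>R u) = 0" using chart_norm_scale[OF c, of y 0 u] y Q by auto
    then show ?thesis using True by simp
  next
    case False
    let ?u = "(1 / norm u) *\<^sub>R u"
    have k: "(y, ?u) \<in> ?K" using y False by simp
    have s: "chart_norm c y ?u = chart_norm c y u / norm u" using chart_norm_scale[OF c, of y "1 / norm u" u] y Q by auto
    have "?h z1 \<le> chart_norm c y u / norm u" "chart_norm c y u / norm u \<le> ?h z2" using z1(2)[OF k] z2(2)[OF k] s by auto
    moreover have "1 \<le> C * ?h z1"
    proof -
      have "1 / ?h z1 * ?h z1 \<le> C * ?h z1" using hp[OF z1(1)] unfolding C_def by (intro mult_right_mono) auto
      then show ?thesis using hp[OF z1(1)] by simp
    qed
    moreover have "?h z2 \<le> C" unfolding C_def by simp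
    ultimately have "1 \<le> C * (chart_norm c y u / norm u)" "chart_norm c y u / norm u \<le> C"
      using C by (meson mult_left_mono less_imp_le order_trans, meson order_trans)
    then show ?thesis using False by (simp add: field_simps)
  qed
  then show ?thesis using C by blast
qed

text \<open>The endpoints join the exceptional set because a two-sided derivative at 0 or 1 would
  see values of the curve outside \<open>{0..1}\<close>.\<close>

lemma pw_C1_curve_exceptions:
  assumes "pw_C1_curve M \<gamma>"
  shows "\<exists>S. finite S \<and> 0 \<in> S \<and> 1 \<in> S \<and>
    (\<forall>c\<in>charts M. (snd c \<circ> \<gamma>) C1_differentiable_on ({t\<in>{0..1}. \<gamma> t \<in> fst c} - S))"
proof -
  obtain S where S: "finite S" "\<forall>c\<in>charts M. (snd c \<circ> \<gamma>) C1_differentiable_on ({t\<in>{0..1}. \<gamma> t \<in> fst c} - S)"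
    using assms unfolding pw_C1_curve_def by blast
  show ?thesis
  proof (intro exI[of _ "S \<union> {0, 1}"] conjI ballI)
    fix c assume "c \<in> charts M"
    with S(2) have "(snd c \<circ> \<gamma>) C1_differentiable_on ({t\<in>{0..1}. \<gamma> t \<in> fst c} - S)" by blast
    then show "(snd c \<circ> \<gamma>) C1_differentiable_on ({t\<in>{0..1}. \<gamma> t \<in> fst c} - (S \<union> {0, 1}))"
      by (rule C1_differentiable_on_subset) auto
  qed (use S in auto)
qed

lemma curve_nbhd:
  fixes \<gamma> :: "real \<Rightarrow> 'a"
  assumes "continuous_on {0..1} \<gamma>" "open U" "t \<in> {0<..<1}" "\<gamma> t \<in> U"
  shows "\<exists>O'. open O' \<and> t \<in> O' \<and> O' \<subseteq> {0<..<1::real} \<and> \<gamma> ` O' \<subseteq> U"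
proof -
  have "open ({0<..<1} \<inter> \<gamma> -` U)"
    by (rule continuous_open_preimage[OF continuous_on_subset[OF assms(1)] _ assms(2)]) auto
  then show ?thesis using assms by (intro exI[of _ "{0<..<1} \<inter> \<gamma> -` U"]) auto
qed

text \<open>\<open>velocity\<close> refers to the chart selected at the current point, which may
  change abruptly with \<open>t\<close>. Estimates along a curve use one fixed chart
  \<open>c\<close> instead.\<close>

definition vel :: "('a, 'e) chart \<Rightarrow> (real \<Rightarrow> 'a) \<Rightarrow> real \<Rightarrow> 'e" where
  "vel c \<gamma> t = vector_derivative (snd c \<circ> \<gamma>) (at t)"

lemma velocity_vel: "velocity M \<gamma> t = vel (cat (\<gamma> t)) \<gamma> t"
  unfolding velocity_def vel_def ..

lemma vel_change:
  fixes \<gamma> :: "real \<Rightarrow> 'a"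
  assumes \<gamma>: "continuous_on {0..1} \<gamma>" and t: "t \<in> {0<..<1}"
    and c: "c \<in> charts M" "c' \<in> charts M" "\<gamma> t \<in> fst c" "\<gamma> t \<in> fst c'"
    and D: "((snd c \<circ> \<gamma>) has_vector_derivative v) (at t)"
  shows "((snd c' \<circ> \<gamma>) has_vector_derivative cc c c' (\<gamma> t) v) (at t)"
proof -
  have "open (fst c \<inter> fst c')" by (intro open_Int chart_open(1) chart c)
  then obtain O' where O': "open O'" "t \<in> O'" "\<gamma> ` O' \<subseteq> fst c \<inter> fst c'"
    using curve_nbhd[OF \<gamma> _ t, of "fst c \<inter> fst c'"] c by auto
  have "((transition c c' \<circ> (snd c \<circ> \<gamma>)) has_vector_derivative cc c c' (\<gamma> t) v) (at t)"
    by (rule vector_derivative_diff_chain_within[OF D]) (use transition_deriv[OF c] has_derivative_at_withinI in auto)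
  then show ?thesis
    by (rule has_vector_derivative_transform_within_open[OF _ O'(1,2)]) (use O'(3) c in \<open>auto simp: transition_apply image_subset_iff\<close>)
qed

lemma vel_has:
  fixes \<gamma> :: "real \<Rightarrow> 'a"
  assumes "continuous_on {0..1} \<gamma>" "t \<in> {0<..<1}" "c \<in> charts M" "c' \<in> charts M" "\<gamma> t \<in> fst c" "\<gamma> t \<in> fst c'"
    and "(snd c \<circ> \<gamma>) differentiable (at t)"
  shows "((snd c' \<circ> \<gamma>) has_vector_derivative vel c' \<gamma> t) (at t)" "vel c' \<gamma> t = cc c c' (\<gamma> t) (vel c \<gamma> t)"
proof -
  have "((snd c \<circ> \<gamma>) has_vector_derivative vel c \<gamma> t) (at t)"
    using assms(7) unfolding vel_def by (simp add: vector_derivative_works)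
  from vel_change[OF assms(1-6) this]
  show "((snd c' \<circ> \<gamma>) has_vector_derivative vel c' \<gamma> t) (at t)" "vel c' \<gamma> t = cc c c' (\<gamma> t) (vel c \<gamma> t)"
    by (simp_all add: vel_def vector_derivative_at)
qed

lemma tnorm_velocity:
  fixes \<gamma> :: "real \<Rightarrow> 'a"
  assumes "continuous_on {0..1} \<gamma>" "t \<in> {0<..<1}" "c \<in> charts M" "\<gamma> t \<in> fst c" "(snd c \<circ> \<gamma>) differentiable (at t)"
  shows "tnorm M (\<gamma> t) (velocity M \<gamma> t) = chart_norm c (snd c (\<gamma> t)) (vel c \<gamma> t)"
    "vel c \<gamma> t = cc (cat (\<gamma> t)) c (\<gamma> t) (velocity M \<gamma> t)"
proof -
  have 1: "velocity M \<gamma> t = cc c (cat (\<gamma> t)) (\<gamma> t) (vel c \<gamma> t)"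
    unfolding velocity_vel using assms cat by (intro vel_has(2)) auto
  then show "vel c \<gamma> t = cc (cat (\<gamma> t)) c (\<gamma> t) (velocity M \<gamma> t)"
    using assms cat by (simp add: cc_inv)
  with tnorm_chart_norm[OF assms(3,4)] show "tnorm M (\<gamma> t) (velocity M \<gamma> t) = chart_norm c (snd c (\<gamma> t)) (vel c \<gamma> t)" by simp
qed

lemma curve_domain_open:
  fixes \<gamma> :: "real \<Rightarrow> 'a"
  assumes "continuous_on {0..1} \<gamma>" "c \<in> charts M"
  shows "openin (top_of_set {0..1}) {t\<in>{0..1}. \<gamma> t \<in> fst c}"
  using continuous_openin_preimage_gen[OF assms(1) chart_open(1)[OF chart[OF assms(2)]]]
  by (simp add: vimage_def Int_def)

text \<open>The source of the closedness required by \<open>curve_trapped\<close>; it rests on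
  \<open>chart_compact_vimage\<close> and hence on the compactness of \<open>Q\<close>.\<close>

lemma curve_ball_closed:
  fixes \<gamma> :: "real \<Rightarrow> 'a"
  assumes "continuous_on {0..1} \<gamma>" "c \<in> charts M" "compact Q" "Q \<subseteq> snd c ` fst c"
  shows "closed {t\<in>{0..1}. \<gamma> t \<in> fst c \<and> snd c (\<gamma> t) \<in> Q}"
proof -
  have "closed ({0..1} \<inter> \<gamma> -` {x \<in> fst c. snd c x \<in> Q})"
    by (rule continuous_closed_preimage[OF assms(1) _ chart_compact_vimage[OF chart[OF assms(2)] assms(3,4)]]) (rule closed_atLeastAtMost)
  then show ?thesis by (simp add: vimage_def Int_def)
qed

lemma coord_curve_cont:
  fixes \<gamma> :: "real \<Rightarrow> 'a"
  assumes "continuous_on {0..1} \<gamma>" "c \<in> charts M"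
  shows "continuous_on {t\<in>{0..1}. \<gamma> t \<in> fst c} (snd c \<circ> \<gamma>)"
  using chart_cont(1)[OF chart[OF assms(2)]] assms(1)
  by (intro continuous_on_compose) (auto intro: continuous_on_subset)

end

section \<open>Reversed and joined curves; symmetry and triangle inequality of the distance\<close>

lemma C1_differentiable_on_affine:
  fixes f :: "real \<Rightarrow> 'z::real_normed_vector"
  assumes f: "f C1_differentiable_on T" and T': "\<And>t. t \<in> T' \<Longrightarrow> p + q * t \<in> T"
  shows "(\<lambda>t. f (p + q * t)) C1_differentiable_on T'"
proof -
  obtain D where D: "\<And>t. t \<in> T \<Longrightarrow> (f has_vector_derivative D t) (at t)" "continuous_on T D"
    using f unfolding C1_differentiable_on_def by blast
  have "((\<lambda>t. f (p + q * t)) has_vector_derivative q *\<^sub>R D (p + q * t)) (at t)" if "t \<in> T'" for t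
  proof -
    have "((\<lambda>t. p + q * t) has_vector_derivative q) (at t)"
      by (auto intro!: derivative_eq_intros)
    from vector_diff_chain_at[OF this D(1)[OF T'[OF that]]] show ?thesis by (simp add: o_def)
  qed
  moreover have "continuous_on T' (\<lambda>t. q *\<^sub>R D (p + q * t))"
    by (intro continuous_on_scaleR continuous_on_const continuous_on_compose2[OF D(2)] continuous_intros) (use T' in auto)
  ultimately show ?thesis unfolding C1_differentiable_on_def by (intro exI conjI ballI)
qed

lemma C1_differentiable_on_cong_open:
  assumes "f C1_differentiable_on T" "open V" "T \<subseteq> V" "\<And>t. t \<in> V \<Longrightarrow> f t = g t"
  shows "g C1_differentiable_on T"
proof -
  obtain D where D: "\<forall>t\<in>T. (f has_vector_derivative D t) (at t)" "continuous_on T D"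
    using assms(1) unfolding C1_differentiable_on_def by blast
  have "(g has_vector_derivative D t) (at t)" if "t \<in> T" for t
    by (rule has_vector_derivative_transform_within_open[OF D(1)[rule_format, OF that] assms(2) _ assms(4)])
      (use that assms(3) in auto)
  with D(2) show ?thesis unfolding C1_differentiable_on_def by (intro exI conjI ballI)
qed

text \<open>The two sets are separated by \<open>a\<close>, hence relatively open in their union,
  and continuity of the derivative can be checked on each. At \<open>a\<close> itself the derivative
  may jump.\<close>

lemma C1_differentiable_on_Un:
  assumes "f C1_differentiable_on S" "f C1_differentiable_on T" "S \<subseteq> {..<a}" "T \<subseteq> {a<..}"
  shows "f C1_differentiable_on (S \<union> T)"
proof -
  have "S = (S \<union> T) \<inter> {..<a}" "T = (S \<union> T) \<inter> {a<..}" using assms(3,4) by (auto dest: subsetD)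
  then have "openin (top_of_set (S \<union> T)) S" "openin (top_of_set (S \<union> T)) T"
    unfolding openin_open by (meson open_lessThan open_greaterThan)+
  then show ?thesis
    using assms(1,2) unfolding C1_differentiable_on_eq
    by (intro conjI continuous_on_Un_local_open) auto
qed

context riem
begin

lemma curve_diff:
  assumes "\<And>c. c \<in> charts M \<Longrightarrow> (snd c \<circ> \<gamma>) C1_differentiable_on ({t\<in>{0..1}. \<gamma> t \<in> fst c} - S)"
    and "t \<in> {0..1} - S" "c \<in> charts M" "\<gamma> t \<in> fst c"
  shows "(snd c \<circ> \<gamma>) differentiable (at t)"
proof -
  have "\<forall>t\<in>{t\<in>{0..1}. \<gamma> t \<in> fst c} - S. (snd c \<circ> \<gamma>) differentiable (at t)"
    using assms(1)[OF assms(3)] unfolding C1_differentiable_on_eq by (rule conjunct1)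
  then show ?thesis by (rule bspec) (use assms(2,4) in simp)
qed

text \<open>Agreement on a neighbourhood \<open>V\<close> is enough for derivatives, so the lemma
  also covers each half of a joined path.\<close>

lemma speed_affine:
  assumes d: "(snd (cat (\<gamma> (p + q * t))) \<circ> \<gamma>) differentiable (at (p + q * t))"
    and V: "open V" "t \<in> V" "\<And>s. s \<in> V \<Longrightarrow> \<gamma>' s = \<gamma> (p + q * s)"
  shows "velocity M \<gamma>' t = q *\<^sub>R velocity M \<gamma> (p + q * t)"
    "tnorm M (\<gamma>' t) (velocity M \<gamma>' t) = \<bar>q\<bar> * tnorm M (\<gamma> (p + q * t)) (velocity M \<gamma> (p + q * t))"
proof -
  let ?c = "cat (\<gamma> (p + q * t))"
  have "((\<lambda>t. p + q * t) has_vector_derivative q) (at t)" by (auto intro!: derivative_eq_intros)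
  from vector_diff_chain_at[OF this vector_derivative_works[THEN iffD1, OF d]]
  have "(((snd ?c \<circ> \<gamma>) \<circ> (\<lambda>t. p + q * t)) has_vector_derivative
      q *\<^sub>R vector_derivative (snd ?c \<circ> \<gamma>) (at (p + q * t))) (at t)" .
  then have "((snd ?c \<circ> \<gamma>') has_vector_derivative
      q *\<^sub>R vector_derivative (snd ?c \<circ> \<gamma>) (at (p + q * t))) (at t)"
    by (rule has_vector_derivative_transform_within_open[OF _ V(1,2)]) (simp add: V(3))
  then show 1: "velocity M \<gamma>' t = q *\<^sub>R velocity M \<gamma> (p + q * t)"
    unfolding velocity_def using V by (simp add: vector_derivative_at)
  show "tnorm M (\<gamma>' t) (velocity M \<gamma>' t) = \<bar>q\<bar> * tnorm M (\<gamma> (p + q * t)) (velocity M \<gamma> (p + q * t))"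
    unfolding 1 tnorm_scale using V by simp
qed

lemma pw_C1_curve_reverse:
  assumes "pw_C1_curve M \<gamma>"
  shows "pw_C1_curve M (\<lambda>t. \<gamma> (1 + (- 1) * t))"
proof -
  obtain S where S: "finite S" "0 \<in> S" "1 \<in> S"
    "\<And>c. c \<in> charts M \<Longrightarrow> (snd c \<circ> \<gamma>) C1_differentiable_on ({t\<in>{0..1}. \<gamma> t \<in> fst c} - S)"
    using pw_C1_curve_exceptions[OF assms] by blast
  have "continuous_on {0..1} (\<lambda>t. \<gamma> (1 + (- 1) * t))"
    by (rule continuous_on_compose2[of "{0..1}" \<gamma>])
      (use assms in \<open>auto simp: pw_C1_curve_def intro!: continuous_intros\<close>)
  moreover have "(snd c \<circ> (\<lambda>t. \<gamma> (1 + (- 1) * t))) C1_differentiable_on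
      ({t\<in>{0..1}. \<gamma> (1 + (- 1) * t) \<in> fst c} - (\<lambda>t. 1 - t) ` S)" if "c \<in> charts M" for c
    unfolding o_def by (rule C1_differentiable_on_affine[OF S(4)[OF that, unfolded o_def]]) (auto simp: image_iff)
  ultimately show ?thesis unfolding pw_C1_curve_def using S(1) by blast
qed

lemma curve_length_reverse:
  assumes "pw_C1_curve M \<gamma>"
  shows "curve_length M (\<lambda>t. \<gamma> (1 + (- 1) * t)) = curve_length M \<gamma>"
proof -
  obtain S where S: "finite S" "0 \<in> S" "1 \<in> S"
    "\<And>c. c \<in> charts M \<Longrightarrow> (snd c \<circ> \<gamma>) C1_differentiable_on ({t\<in>{0..1}. \<gamma> t \<in> fst c} - S)"
    using pw_C1_curve_exceptions[OF assms] by blast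
  let ?F = "\<lambda>t. ennreal (tnorm M (\<gamma> t) (velocity M \<gamma> t)) * indicator {0..1} t"
  have "curve_length M (\<lambda>t. \<gamma> (1 + (- 1) * t)) = (\<integral>\<^sup>+t. ?F (1 + (- 1) * t) \<partial>lborel)"
    unfolding curve_length_def
  proof (rule nn_integral_cong_AE)
    have "AE t in lborel. t \<notin> (\<lambda>t. 1 - t) ` S" using S(1) by (intro AE_lborel_not_in_finite) auto
    then show "AE t in lborel. ennreal (tnorm M (\<gamma> (1 + (- 1) * t)) (velocity M (\<lambda>t. \<gamma> (1 + (- 1) * t)) t)) * indicator {0..1} t
      = ?F (1 + (- 1) * t)"
    proof eventually_elim
      case (elim t)
      have nS: "1 + (- 1) * t \<notin> S" using elim by (auto simp: image_iff)
      show ?case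
      proof (cases "t \<in> {0..1}")
        case True
        then have "tnorm M (\<gamma> (1 + (- 1) * t)) (velocity M (\<lambda>t. \<gamma> (1 + (- 1) * t)) t)
          = \<bar>- 1\<bar> * tnorm M (\<gamma> (1 + (- 1) * t)) (velocity M \<gamma> (1 + (- 1) * t))"
          using nS by (intro speed_affine(2)[where V=UNIV] curve_diff[OF S(4)] cat) auto
        then show ?thesis using True by (simp add: indicator_def)
      qed (auto simp: indicator_def)
    qed
  qed
  also have "\<dots> = (\<integral>\<^sup>+t. ?F t \<partial>lborel)"
    using nn_integral_lborel_affine[of "- 1" ?F 1] by simp
  finally show ?thesis unfolding curve_length_def .
qed

lemma rdist_sym: "rdist M p q = rdist M q p"
proof -
  have "rdist M p q \<le> rdist M q p" for p q
    unfolding rdist_def[of M q p]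
  proof (rule Inf_greatest, clarify)
    fix \<gamma> assume \<gamma>: "pw_C1_curve M \<gamma>"
    show "rdist M (\<gamma> 1) (\<gamma> 0) \<le> curve_length M \<gamma>"
      unfolding rdist_def curve_length_reverse[OF \<gamma>, symmetric]
      by (rule Inf_lower) (use pw_C1_curve_reverse[OF \<gamma>] in force)
  qed
  then show ?thesis by (intro antisym)
qed

text \<open>An upper bound for the length is all that the triangle inequality asks for, and the
  one-sided integral rules for nonmeasurable speeds give just that.\<close>

lemma curve_length_join:
  assumes g: "pw_C1_curve M g1" "pw_C1_curve M g2" "g1 1 = g2 0"
  shows "pw_C1_curve M (g1 +++ g2) \<and> curve_length M (g1 +++ g2) \<le> curve_length M g1 + curve_length M g2"
proof -
  obtain S1 where S1: "finite S1" "0 \<in> S1" "1 \<in> S1"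
    "\<And>c. c \<in> charts M \<Longrightarrow> (snd c \<circ> g1) C1_differentiable_on ({t\<in>{0..1}. g1 t \<in> fst c} - S1)"
    using pw_C1_curve_exceptions[OF g(1)] by blast
  obtain S2 where S2: "finite S2" "0 \<in> S2" "1 \<in> S2"
    "\<And>c. c \<in> charts M \<Longrightarrow> (snd c \<circ> g2) C1_differentiable_on ({t\<in>{0..1}. g2 t \<in> fst c} - S2)"
    using pw_C1_curve_exceptions[OF g(2)] by blast
  define g where "g = g1 +++ g2"
  \<comment> \<open>The exceptional parameters of both pieces, rescaled to the halves. The corner
    1/2 is among them because \<open>1 \<in> S1\<close>.\<close>
  define S where "S = (\<lambda>s. s / 2) ` S1 \<union> (\<lambda>s. (s + 1) / 2) ` S2"
  have S: "finite S" using S1 S2 by (simp add: S_def)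
  have half: "1/2 \<in> S" using S1(3) by (force simp: S_def)
  have nS1: "0 + 2 * t \<notin> S1" and nS2: "- 1 + 2 * t \<notin> S2" if "t \<notin> S" for t
    using that unfolding S_def by (force simp: field_simps image_iff)+
  have g1: "g t = g1 (0 + 2 * t)" if "t \<in> {..<1/2}" for t using that by (simp add: g_def joinpaths_def)
  have g2: "g t = g2 (- 1 + 2 * t)" if "t \<in> {1/2<..}" for t using that by (simp add: g_def joinpaths_def)
  have cont: "continuous_on {0..1} g"
  proof -
    have "path (g1 +++ g2)"
      by (rule path_join_imp) (use g in \<open>auto simp: pw_C1_curve_def path_def pathfinish_def pathstart_def\<close>)
    then show ?thesis by (simp add: path_def g_def)
  qed
  have C1: "(snd c \<circ> g) C1_differentiable_on ({t\<in>{0..1}. g t \<in> fst c} - S)" if c: "c \<in> charts M" for c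
  proof -
    let ?T1 = "{t\<in>{0..1}. g t \<in> fst c} \<inter> {..<1/2} - S" and ?T2 = "{t\<in>{0..1}. g t \<in> fst c} \<inter> {1/2<..} - S"
    have "(\<lambda>t. (snd c \<circ> g1) (0 + 2 * t)) C1_differentiable_on ?T1"
    proof (rule C1_differentiable_on_affine[OF S1(4)[OF c]])
      fix t assume t: "t \<in> ?T1"
      then have "0 + 2 * t \<notin> S1" by (intro nS1) auto
      then show "0 + 2 * t \<in> {t \<in> {0..1}. g1 t \<in> fst c} - S1" using t g1[of t] by auto
    qed
    then have 1: "(snd c \<circ> g) C1_differentiable_on ?T1"
      by (rule C1_differentiable_on_cong_open[OF _ open_lessThan[of "1/2"]]) (auto simp: g1)
    have "(\<lambda>t. (snd c \<circ> g2) (- 1 + 2 * t)) C1_differentiable_on ?T2"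
    proof (rule C1_differentiable_on_affine[OF S2(4)[OF c]])
      fix t assume t: "t \<in> ?T2"
      then have "- 1 + 2 * t \<notin> S2" by (intro nS2) auto
      then show "- 1 + 2 * t \<in> {t \<in> {0..1}. g2 t \<in> fst c} - S2" using t g2[of t] by auto
    qed
    then have 2: "(snd c \<circ> g) C1_differentiable_on ?T2"
      by (rule C1_differentiable_on_cong_open[OF _ open_greaterThan[of "1/2"]]) (auto simp: g2)
    have "(snd c \<circ> g) C1_differentiable_on (?T1 \<union> ?T2)"
      by (rule C1_differentiable_on_Un[OF 1 2]) auto
    moreover have "{t\<in>{0..1}. g t \<in> fst c} - S \<subseteq> ?T1 \<union> ?T2"
    proof
      fix t assume t: "t \<in> {t\<in>{0..1}. g t \<in> fst c} - S"
      then have "t \<noteq> 1/2" using half by blast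
      then have "t < 1/2 \<or> 1/2 < t" by linarith
      then show "t \<in> ?T1 \<union> ?T2" using t by blast
    qed
    ultimately show ?thesis by (rule C1_differentiable_on_subset)
  qed
  let ?F1 = "\<lambda>t. ennreal (tnorm M (g1 t) (velocity M g1 t)) * indicator {0..1} t"
  let ?F2 = "\<lambda>t. ennreal (tnorm M (g2 t) (velocity M g2 t)) * indicator {0..1} t"
  let ?F = "\<lambda>t. ennreal (tnorm M (g t) (velocity M g t))"
  have AES: "AE t in lborel. t \<notin> S" by (rule AE_lborel_not_in_finite[OF S])
  have le: "(\<integral>\<^sup>+t. ennreal 2 * F (a + 2 * t) \<partial>lborel) \<le> (\<integral>\<^sup>+t. F t \<partial>lborel)" for F :: "real \<Rightarrow> ennreal" and a
    using nn_integral_cmult_le[of 2 lborel "\<lambda>t. F (a + 2 * t)"] nn_integral_lborel_affine[of 2 F a] by simp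
  have "(\<integral>\<^sup>+t\<in>{0..1/2}. ?F t \<partial>lborel) \<le> (\<integral>\<^sup>+t. ennreal 2 * ?F1 (0 + 2 * t) \<partial>lborel)"
  proof (rule nn_integral_mono_AE, use AES in eventually_elim)
    case (elim t)
    show ?case
    proof (cases "t \<in> {0..1/2}")
      case True
      moreover have "t \<noteq> 1/2" using elim half by blast
      ultimately have t: "t \<in> {..<1/2}" "0 + 2 * t \<in> {0..1} - S1" using nS1[OF elim] by auto
      have "tnorm M (g t) (velocity M g t) = \<bar>2\<bar> * tnorm M (g1 (0 + 2 * t)) (velocity M g1 (0 + 2 * t))"
        by (rule speed_affine(2)[OF curve_diff[OF S1(4) t(2)] open_lessThan[of "1/2"] t(1)]) (auto simp: cat g1)
      then show ?thesis using True by (simp add: indicator_def ennreal_mult'[of 2, simplified])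
    qed (auto simp: indicator_def)
  qed
  then have 1: "(\<integral>\<^sup>+t\<in>{0..1/2}. ?F t \<partial>lborel) \<le> curve_length M g1"
    unfolding curve_length_def using le by (rule order_trans)
  have "(\<integral>\<^sup>+t\<in>{1/2..1}. ?F t \<partial>lborel) \<le> (\<integral>\<^sup>+t. ennreal 2 * ?F2 (- 1 + 2 * t) \<partial>lborel)"
  proof (rule nn_integral_mono_AE, use AES in eventually_elim)
    case (elim t)
    show ?case
    proof (cases "t \<in> {1/2..1}")
      case True
      moreover have "t \<noteq> 1/2" using elim half by blast
      ultimately have t: "t \<in> {1/2<..}" "- 1 + 2 * t \<in> {0..1} - S2" using nS2[OF elim] by auto
      have "tnorm M (g t) (velocity M g t) = \<bar>2\<bar> * tnorm M (g2 (- 1 + 2 * t)) (velocity M g2 (- 1 + 2 * t))"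
        by (rule speed_affine(2)[OF curve_diff[OF S2(4) t(2)] open_greaterThan[of "1/2"] t(1)]) (auto simp: cat g2)
      then show ?thesis using True by (simp add: indicator_def ennreal_mult'[of 2, simplified])
    qed (auto simp: indicator_def)
  qed
  then have 2: "(\<integral>\<^sup>+t\<in>{1/2..1}. ?F t \<partial>lborel) \<le> curve_length M g2"
    unfolding curve_length_def using le by (rule order_trans)
  have "{0..1} = {0..1/2} \<union> {1/2..1::real}" by auto
  then have "curve_length M g \<le> (\<integral>\<^sup>+t\<in>{0..1/2}. ?F t \<partial>lborel) + (\<integral>\<^sup>+t\<in>{1/2..1}. ?F t \<partial>lborel)"
    unfolding curve_length_def using nn_integral_union_le[of "{0..1/2}" lborel "{1/2..1}" ?F] by simp
  also have "\<dots> \<le> curve_length M g1 + curve_length M g2" by (intro add_mono 1 2)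
  finally have "curve_length M g \<le> curve_length M g1 + curve_length M g2" .
  moreover have "pw_C1_curve M g" unfolding pw_C1_curve_def using cont S C1 by blast
  ultimately show ?thesis unfolding g_def by blast
qed

lemma rdist_less_curve:
  assumes "rdist M p q < l"
  obtains \<gamma> where "pw_C1_curve M \<gamma>" "\<gamma> 0 = p" "\<gamma> 1 = q" "curve_length M \<gamma> < l"
  using assms unfolding rdist_def Inf_less_iff by blast

lemma rdist_triangle: "rdist M p r \<le> rdist M p q + rdist M q r"
proof (rule ennreal_le_epsilon)
  fix e :: real assume fin: "rdist M p q + rdist M q r < top" and e: "0 < e"
  have lt: "x < x + ennreal (e / 2)" if "x < top" for x
    using that e by (cases x) (auto simp: ennreal_plus[symmetric] ennreal_lessI simp del: ennreal_plus)
  have "rdist M p q < top" "rdist M q r < top" using fin by (auto simp: less_top)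
  then obtain g1 g2 where g1: "pw_C1_curve M g1" "g1 0 = p" "g1 1 = q" "curve_length M g1 < rdist M p q + ennreal (e / 2)"
    and g2: "pw_C1_curve M g2" "g2 0 = q" "g2 1 = r" "curve_length M g2 < rdist M q r + ennreal (e / 2)"
    using rdist_less_curve[OF lt] by metis
  have j: "pw_C1_curve M (g1 +++ g2)" "curve_length M (g1 +++ g2) \<le> curve_length M g1 + curve_length M g2"
    using curve_length_join[OF g1(1) g2(1)] g1 g2 by auto
  have "rdist M p r \<le> curve_length M (g1 +++ g2)"
    unfolding rdist_def by (rule Inf_lower) (use j g1 g2 in \<open>auto simp: joinpaths_def\<close>)
  also have "\<dots> \<le> (rdist M p q + ennreal (e / 2)) + (rdist M q r + ennreal (e / 2))"
    using j(2) g1(4) g2(4) by (meson add_mono less_imp_le order_trans)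
  also have "\<dots> = rdist M p q + rdist M q r + (ennreal (e / 2) + ennreal (e / 2))" by (simp add: ac_simps)
  also have "ennreal (e / 2) + ennreal (e / 2) = ennreal e" using e by (simp add: ennreal_plus[symmetric] del: ennreal_plus)
  finally show "rdist M p r \<le> rdist M p q + rdist M q r + ennreal e" .
qed

end

lemma compact_thickening:
  fixes Q :: "'e::euclidean_space set"
  assumes "compact Q" "open U" "Q \<subseteq> U"
  shows "\<exists>r>0. \<exists>Q'. compact Q' \<and> Q' \<subseteq> U \<and> (\<forall>x\<in>Q. cball x r \<subseteq> Q')"
proof (cases "Q = {}")
  case True then show ?thesis by (intro exI[of _ 1]) auto
next
  case False
  obtain e where e: "0 < e" "(\<Union>x\<in>Q. cball x e) \<subseteq> U"
    using compact_subset_open_imp_cball_epsilon_subset[OF assms] by blast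
  have "compact {x + y |x y. x \<in> Q \<and> y \<in> cball 0 e}"
    by (rule compact_sums[OF assms(1) compact_cball])
  moreover have "{x + y |x y. x \<in> Q \<and> y \<in> cball 0 e} = (\<Union>x\<in>Q. cball x e)"
  proof (intro set_eqI iffI)
    fix z assume "z \<in> (\<Union>x\<in>Q. cball x e)"
    then obtain x where "x \<in> Q" "dist x z \<le> e" by auto
    then show "z \<in> {x + y |x y. x \<in> Q \<and> y \<in> cball 0 e}"
      by (intro CollectI exI[of _ x] exI[of _ "z - x"]) (auto simp: dist_norm norm_minus_commute)
  next
    fix z assume "z \<in> {x + y |x y. x \<in> Q \<and> y \<in> cball 0 e}"
    then obtain x y where "x \<in> Q" "z = x + y" "norm y \<le> e" by auto
    then show "z \<in> (\<Union>x\<in>Q. cball x e)" by (intro UN_I[of x]) (auto simp: dist_norm)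
  qed
  ultimately have "compact (\<Union>x\<in>Q. cball x e)" by simp
  then show ?thesis using e by (intro exI[of _ e] conjI exI[of _ "\<Union>x\<in>Q. cball x e"]) auto
qed

context riem
begin

text \<open>As long as the coordinates of a short curve from \<open>x\<close> stay in the compact
  thickening \<open>Q'\<close>, Euclidean speed is at most \<open>C\<close> times Riemannian speed,
  and \<open>C * l < r\<close> keeps them there by \<open>curve_trapped\<close>. That the endpoint
  lies in the chart domain is part of the gain.\<close>

lemma rdist_chart_lower:
  assumes c: "c \<in> charts M" and Q: "compact Q" "Q \<subseteq> snd c ` fst c"
  shows "\<exists>C>0. \<exists>\<delta>>0. \<forall>x y l. x \<in> fst c \<longrightarrow> snd c x \<in> Q \<longrightarrow> l < \<delta> \<longrightarrow> rdist M x y < ennreal l \<longrightarrow>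
    y \<in> fst c \<and> norm (snd c y - snd c x) \<le> C * l"
proof -
  obtain r Q' where r: "0 < r" "compact Q'" "Q' \<subseteq> snd c ` fst c" "\<And>x. x \<in> Q \<Longrightarrow> cball x r \<subseteq> Q'"
    using compact_thickening[OF Q(1) chart_open(2)[OF chart[OF c]] Q(2)] by blast
  obtain C where C: "0 < C" "\<And>y u. y \<in> Q' \<Longrightarrow> norm u \<le> C * chart_norm c y u"
    using chart_norm_compare[OF c r(2,3)] by blast
  have "y \<in> fst c \<and> norm (snd c y - snd c x) \<le> C * l"
    if x: "x \<in> fst c" "snd c x \<in> Q" and l: "l < r / C" and d: "rdist M x y < ennreal l" for x y l
  proof -
    obtain \<gamma> where \<gamma>: "pw_C1_curve M \<gamma>" "\<gamma> 0 = x" "\<gamma> 1 = y" "curve_length M \<gamma> < ennreal l"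
      by (rule rdist_less_curve[OF d])
    obtain S where S: "finite S" "0 \<in> S" "1 \<in> S"
      "\<forall>c\<in>charts M. (snd c \<circ> \<gamma>) C1_differentiable_on ({t\<in>{0..1}. \<gamma> t \<in> fst c} - S)"
      using pw_C1_curve_exceptions[OF \<gamma>(1)] by blast
    have cont: "continuous_on {0..1} \<gamma>" using \<gamma>(1) by (simp add: pw_C1_curve_def)
    have l0: "0 \<le> l" using d by (metis ennreal_neg linorder_le_cases not_less_zero)
    define T where "T = {t\<in>{0..1}. \<gamma> t \<in> fst c}"
    define Z where "Z = snd c \<circ> \<gamma>"
    have D: "\<forall>t\<in>T - S. Z differentiable (at t)" and DC: "continuous_on (T - S) (vel c \<gamma>)"
      using S(4) c unfolding C1_differentiable_on_eq Z_def T_def vel_def by auto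
    have sub: "T \<inter> {0<..<1} - S \<subseteq> T - S" by auto
    have "1 \<in> T \<and> norm (Z 1 - Z 0) \<le> C * l"
    proof (rule curve_trapped[where S=S and Z'="vel c \<gamma>" and r=r and \<sigma>="\<lambda>t. tnorm M (\<gamma> t) (velocity M \<gamma> t)"])
      show "0 \<in> T" "T \<subseteq> {0..1}" "1 \<in> {0..1::real}" using x \<gamma> by (auto simp: T_def)
      show "openin (top_of_set {0..1}) T" unfolding T_def by (rule curve_domain_open[OF cont c])
      show "continuous_on T Z" unfolding T_def Z_def by (rule coord_curve_cont[OF cont c])
      show "continuous_on (T \<inter> {0<..<1} - S) (vel c \<gamma>)" using DC sub by (rule continuous_on_subset)
      show "(Z has_vector_derivative vel c \<gamma> t) (at t)" if "t \<in> T \<inter> {0<..<1} - S" for t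
        using D that sub unfolding vel_def Z_def by (auto simp: vector_derivative_works)
      show "norm (vel c \<gamma> t) \<le> C * tnorm M (\<gamma> t) (velocity M \<gamma> t)"
        if t: "t \<in> T \<inter> {0<..<1} - S" and n: "norm (Z t - Z 0) \<le> r" for t
      proof -
        have "Z t \<in> cball (snd c x) r" using n \<gamma>(2) by (simp add: Z_def dist_norm norm_minus_commute)
        then have "Z t \<in> Q'" using r(4)[OF x(2)] by blast
        moreover have "tnorm M (\<gamma> t) (velocity M \<gamma> t) = chart_norm c (snd c (\<gamma> t)) (vel c \<gamma> t)"
          using t D by (intro tnorm_velocity(1)[OF cont _ c]) (auto simp: T_def Z_def)
        ultimately show ?thesis using C(2)[of "Z t" "vel c \<gamma> t"] by (simp add: Z_def)
      qed
      have "{t \<in> T. norm (Z t - Z 0) \<le> r} = {t\<in>{0..1}. \<gamma> t \<in> fst c \<and> snd c (\<gamma> t) \<in> cball (snd c x) r}"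
        using \<gamma>(2) by (auto simp: T_def Z_def dist_norm norm_minus_commute)
      then show "closed {t \<in> T. norm (Z t - Z 0) \<le> r}"
        using curve_ball_closed[OF cont c compact_cball, of "snd c x" r] r(3) r(4)[OF x(2)] by simp
      show "(\<integral>\<^sup>+t\<in>{0..1}. ennreal (tnorm M (\<gamma> t) (velocity M \<gamma> t)) \<partial>lborel) \<le> ennreal l"
        using \<gamma>(4) by (simp add: curve_length_def)
      show "C * l < r" using l C(1) by (simp add: field_simps)
    qed (use S C l0 in auto)
    then show ?thesis using \<gamma> by (simp add: T_def Z_def)
  qed
  then show ?thesis using C r by (intro exI[of _ C] conjI exI[of _ "r / C"]) auto
qed

text \<open>The straight segment in coordinates is a competitor; convexity keeps it in
  \<open>Q\<close>, where Riemannian speed is at most \<open>C\<close> times Euclidean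
  speed.\<close>

lemma rdist_chart_upper:
  assumes c: "c \<in> charts M" and Q: "compact Q" "convex Q" "Q \<subseteq> snd c ` fst c"
  shows "\<exists>C>0. \<forall>\<xi>\<in>Q. \<forall>\<eta>\<in>Q. rdist M (chart_inv c \<xi>) (chart_inv c \<eta>) \<le> ennreal (C * norm (\<eta> - \<xi>))"
proof -
  obtain C where C: "0 < C" "\<And>y u. y \<in> Q \<Longrightarrow> chart_norm c y u \<le> C * norm u"
    using chart_norm_compare[OF c Q(1,3)] by blast
  note ch = chart[OF c]
  have "rdist M (chart_inv c \<xi>) (chart_inv c \<eta>) \<le> ennreal (C * norm (\<eta> - \<xi>))" if \<xi>: "\<xi> \<in> Q" "\<eta> \<in> Q" for \<xi> \<eta>
  proof -
    define seg where "seg t = \<xi> + t *\<^sub>R (\<eta> - \<xi>)" for t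
    define \<gamma> where "\<gamma> t = chart_inv c (seg t)" for t
    have segQ: "seg t \<in> Q" if "t \<in> {0..1}" for t
    proof -
      have "seg t = (1 - t) *\<^sub>R \<xi> + t *\<^sub>R \<eta>" by (simp add: seg_def algebra_simps)
      then show ?thesis using convexD_alt[OF Q(2) \<xi>, of t] that by simp
    qed
    have segI: "seg t \<in> snd c ` fst c" if "t \<in> {0..1}" for t using segQ[OF that] Q(3) by blast
    have segd: "(seg has_vector_derivative (\<eta> - \<xi>)) (at t)" for t
      unfolding seg_def by (auto intro!: derivative_eq_intros)
    have segc: "continuous_on A seg" for A unfolding seg_def by (intro continuous_intros)
    have cont: "continuous_on {0..1} \<gamma>"
      unfolding \<gamma>_def by (rule continuous_on_compose2[OF chart_cont(2)[OF ch] segc]) (use segI in auto)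
    have transition: "(snd c' \<circ> \<gamma>) = (\<lambda>t. transition c c' (seg t))" for c' by (auto simp: \<gamma>_def transition_def)
    have C1: "(snd c' \<circ> \<gamma>) C1_differentiable_on ({t\<in>{0..1}. \<gamma> t \<in> fst c'} - {0, 1})" if c': "c' \<in> charts M" for c'
    proof -
      let ?D = "\<lambda>y. frechet_derivative (transition c c') (at y) (\<eta> - \<xi>)" and ?O = "snd c ` (fst c \<inter> fst c')"
      let ?T = "{t\<in>{0..1}. \<gamma> t \<in> fst c'} - {0, 1}"
      have inO: "seg t \<in> ?O" if "t \<in> ?T" for t
        using chart_image_eq[OF ch, of "seg t" "fst c'"] segI[of t] that by (auto simp: \<gamma>_def)
      have "((snd c' \<circ> \<gamma>) has_vector_derivative ?D (seg t)) (at t)" if "t \<in> ?T" for t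
        unfolding transition using vector_derivative_diff_chain_within[OF segd, of "transition c c'" "frechet_derivative (transition c c') (at (seg t))" t]
          smooth_on_has_derivative[OF transition_smooth[OF c c'] inO[OF that]] has_derivative_at_withinI
        by (auto simp: o_def)
      moreover have "continuous_on ?T (\<lambda>t. ?D (seg t))"
        by (rule continuous_on_compose2[OF smooth_on_continuous[OF smooth_on_derivative[OF transition_smooth[OF c c']]] segc])
          (use inO in auto)
      ultimately show ?thesis unfolding C1_differentiable_on_def by (intro exI[of _ "\<lambda>t. ?D (seg t)"] conjI ballI)
    qed
    have pw: "pw_C1_curve M \<gamma>" unfolding pw_C1_curve_def
      using cont C1 by (intro conjI exI[of _ "{0, 1}"]) auto
    have "rdist M (chart_inv c \<xi>) (chart_inv c \<eta>) \<le> curve_length M \<gamma>"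
      unfolding rdist_def using pw by (intro Inf_lower CollectI exI[of _ \<gamma>]) (auto simp: \<gamma>_def seg_def)
    also have "\<dots> \<le> (\<integral>\<^sup>+t\<in>{0..1::real}. ennreal (C * norm (\<eta> - \<xi>)) \<partial>lborel)"
      unfolding curve_length_def
    proof (rule nn_integral_mono_AE)
      have "AE t in lborel. t \<notin> {0, 1::real}" by (intro AE_lborel_not_in_finite) auto
      then show "AE t in lborel. ennreal (tnorm M (\<gamma> t) (velocity M \<gamma> t)) * indicator {0..1} t
          \<le> ennreal (C * norm (\<eta> - \<xi>)) * indicator {0..1} t"
      proof eventually_elim
        case (elim t)
        show ?case
        proof (cases "t \<in> {0..1}")
          case True
          then have t: "t \<in> {0<..<1}" using elim by auto
          have in1: "\<gamma> t \<in> fst c" "snd c (\<gamma> t) = seg t"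
            using segI[OF True] chart_inv_in[OF ch] chart_inv_right[OF ch] by (auto simp: \<gamma>_def)
          have "((snd c \<circ> \<gamma>) has_vector_derivative (\<eta> - \<xi>)) (at t)"
            by (rule has_vector_derivative_transform_within_open[OF segd open_greaterThanLessThan[of 0 1] t])
              (use segI chart_inv_right[OF ch] in \<open>auto simp: \<gamma>_def\<close>)
          then have "vel c \<gamma> t = \<eta> - \<xi>" "(snd c \<circ> \<gamma>) differentiable (at t)"
            by (auto simp: vel_def vector_derivative_at intro: differentiableI_vector)
          then have "tnorm M (\<gamma> t) (velocity M \<gamma> t) \<le> C * norm (\<eta> - \<xi>)"
            using tnorm_velocity(1)[OF cont t c in1(1)] C(2)[OF segQ[OF True]] in1 by simp
          then show ?thesis using True by (simp add: ennreal_leI)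
        qed simp
      qed
    qed
    also have "\<dots> = ennreal (C * norm (\<eta> - \<xi>))" by (simp add: nn_integral_cmult_indicator)
    finally show ?thesis .
  qed
  then show ?thesis using C(1) by blast
qed

lemma rdist_self: "rdist M x x = 0"
proof -
  note c = cat[of x]
  have "{snd (cat x) x} \<subseteq> snd (cat x) ` fst (cat x)" using c by auto
  from rdist_chart_upper[OF c(1) _ _ this] show ?thesis
    using c by (auto simp: chart_inv_left[OF chart])
qed

section \<open>Topology and compactness in terms of the Riemannian distance\<close>

lemma rdist_nbhd:
  assumes "0 < \<epsilon>" shows "\<exists>U. open U \<and> x \<in> U \<and> (\<forall>y\<in>U. rdist M x y < ennreal \<epsilon>)"
proof -
  define c where "c = cat x"
  have c: "c \<in> charts M" "x \<in> fst c" unfolding c_def by (rule cat)+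
  note ch = chart[OF c(1)]
  have "snd c x \<in> snd c ` fst c" using c by auto
  then obtain r where r: "0 < r" "cball (snd c x) r \<subseteq> snd c ` fst c"
    using chart_open(2)[OF ch] open_contains_cball by blast
  obtain C where C: "0 < C" "\<And>\<xi> \<eta>. \<xi> \<in> cball (snd c x) r \<Longrightarrow> \<eta> \<in> cball (snd c x) r \<Longrightarrow>
      rdist M (chart_inv c \<xi>) (chart_inv c \<eta>) \<le> ennreal (C * norm (\<eta> - \<xi>))"
    using rdist_chart_upper[OF c(1) compact_cball convex_cball r(2)] by blast
  define s where "s = min r (\<epsilon> / C)"
  have s: "0 < s" using r C assms by (simp add: s_def)
  define U where "U = fst c \<inter> snd c -` ball (snd c x) s"
  have "rdist M x y < ennreal \<epsilon>" if y: "y \<in> U" for y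
  proof -
    have n: "norm (snd c y - snd c x) < s" "y \<in> fst c" using y by (auto simp: U_def dist_norm norm_minus_commute)
    then have "rdist M (chart_inv c (snd c x)) (chart_inv c (snd c y)) \<le> ennreal (C * norm (snd c y - snd c x))"
      using r(1) by (intro C(2)) (auto simp: s_def dist_norm norm_minus_commute)
    moreover have "C * norm (snd c y - snd c x) < \<epsilon>"
    proof -
      have "C * norm (snd c y - snd c x) < C * s" using n C(1) by simp
      also have "\<dots> \<le> C * (\<epsilon> / C)" using C(1) by (intro mult_left_mono) (auto simp: s_def)
      finally show ?thesis using C(1) by simp
    qed
    ultimately show ?thesis using n c assms by (simp add: chart_inv_left[OF ch] ennreal_lessI le_less_trans)
  qed
  then show ?thesis
    using chart_vimage_open[OF ch open_ball] c s by (intro exI[of _ U]) (auto simp: U_def)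
qed

lemma rdist_ball_open: "open {y. rdist M x y < ennreal \<epsilon>}"
proof (subst open_subopen, safe)
  fix y assume y: "rdist M x y < ennreal \<epsilon>"
  then obtain b where b: "rdist M x y = ennreal b" "0 \<le> b" "b < \<epsilon>"
    by (metis ennreal_cases ennreal_less_iff less_top_ennreal order_less_trans ennreal_less_top)
  obtain U where U: "open U" "y \<in> U" "\<And>z. z \<in> U \<Longrightarrow> rdist M y z < ennreal (\<epsilon> - b)"
    using rdist_nbhd[of "\<epsilon> - b" y] b by auto
  have "rdist M x z < ennreal \<epsilon>" if "z \<in> U" for z
  proof -
    have "rdist M x z \<le> ennreal b + rdist M y z" using rdist_triangle[of x z y] b by simp
    also have "\<dots> < ennreal b + ennreal (\<epsilon> - b)" using U(3)[OF that] by (simp add: ennreal_add_left_cancel_less)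
    also have "\<dots> = ennreal \<epsilon>" using b by (simp add: ennreal_plus[symmetric] del: ennreal_plus)
    finally show ?thesis .
  qed
  then show "\<exists>T. open T \<and> y \<in> T \<and> T \<subseteq> {y. rdist M x y < ennreal \<epsilon>}" using U by blast
qed

lemma rdist_ball_in_open:
  assumes "open U" "x \<in> U" shows "\<exists>\<epsilon>>0. \<forall>y. rdist M x y < ennreal \<epsilon> \<longrightarrow> y \<in> U"
proof -
  define c where "c = cat x"
  have c: "c \<in> charts M" "x \<in> fst c" unfolding c_def by (rule cat)+
  note ch = chart[OF c(1)]
  have "open (snd c ` (fst c \<inter> U))" by (rule chart_open_image[OF ch assms(1)])
  moreover have "snd c x \<in> snd c ` (fst c \<inter> U)" using c assms by auto
  ultimately obtain r where r: "0 < r" "cball (snd c x) r \<subseteq> snd c ` (fst c \<inter> U)"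
    using open_contains_cball by blast
  have "{snd c x} \<subseteq> snd c ` fst c" using c by auto
  then obtain C \<delta> where C: "0 < C" "0 < \<delta>"
    "\<And>y l. l < \<delta> \<Longrightarrow> rdist M x y < ennreal l \<Longrightarrow> y \<in> fst c \<and> norm (snd c y - snd c x) \<le> C * l"
    using rdist_chart_lower[OF c(1), of "{snd c x}"] c(2) by auto
  define \<epsilon> where "\<epsilon> = min (\<delta> / 2) (r / C)"
  have "y \<in> U" if "rdist M x y < ennreal \<epsilon>" for y
  proof -
    have "\<epsilon> < \<delta>" using C by (simp add: \<epsilon>_def)
    from C(3)[OF this that] have y: "y \<in> fst c" "norm (snd c y - snd c x) \<le> C * \<epsilon>" by auto
    have "C * \<epsilon> \<le> C * (r / C)" using C by (intro mult_left_mono) (auto simp: \<epsilon>_def)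
    then have "snd c y \<in> cball (snd c x) r" using y C by (simp add: dist_norm norm_minus_commute)
    then have "snd c y \<in> snd c ` (fst c \<inter> U)" using r by blast
    then show ?thesis using chart_image_eq[OF ch] chart_inv_left[OF ch y(1)] by simp
  qed
  then show ?thesis using C r by (intro exI[of _ \<epsilon>]) (auto simp: \<epsilon>_def)
qed

text \<open>A Lebesgue number argument. The cover uses balls of half the good radius, so a point
  closer than the smallest of these radii to a point of such a ball stays in the ball of twice the
  radius.\<close>

lemma rdist_uniform:
  assumes cpt: "compact (UNIV :: 'a set)"
    and P: "\<And>x. \<exists>U. open U \<and> x \<in> U \<and> (\<forall>p\<in>U. \<forall>q\<in>U. P p q)"
  shows "\<exists>\<delta>>0. \<forall>p q. rdist M p q < ennreal \<delta> \<longrightarrow> P p q"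
proof -
  have "\<forall>x. \<exists>\<epsilon>>0. \<forall>p q. rdist M x p < ennreal (2 * \<epsilon>) \<longrightarrow> rdist M x q < ennreal (2 * \<epsilon>) \<longrightarrow> P p q"
  proof
    fix x
    obtain U where U: "open U" "x \<in> U" "\<forall>p\<in>U. \<forall>q\<in>U. P p q" using P[of x] by blast
    obtain \<epsilon> where "0 < \<epsilon>" "\<forall>y. rdist M x y < ennreal \<epsilon> \<longrightarrow> y \<in> U" using rdist_ball_in_open[OF U(1,2)] by blast
    then show "\<exists>\<epsilon>>0. \<forall>p q. rdist M x p < ennreal (2 * \<epsilon>) \<longrightarrow> rdist M x q < ennreal (2 * \<epsilon>) \<longrightarrow> P p q"
      using U by (intro exI[of _ "\<epsilon> / 2"]) auto
  qed
  then obtain e where e: "\<And>x. 0 < e x"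
    "\<And>x p q. rdist M x p < ennreal (2 * e x) \<Longrightarrow> rdist M x q < ennreal (2 * e x) \<Longrightarrow> P p q"
    unfolding choice_iff by blast
  have cov: "UNIV \<subseteq> (\<Union>x\<in>UNIV. {y. rdist M x y < ennreal (e x)})"
    using e(1) by (auto simp: rdist_self intro: exI)
  have "\<exists>K\<subseteq>UNIV. finite K \<and> UNIV \<subseteq> (\<Union>x\<in>K. {y. rdist M x y < ennreal (e x)})"
    by (rule compactE_image[OF cpt rdist_ball_open cov]) (intro exI conjI)
  then obtain K where K: "finite K" "UNIV \<subseteq> (\<Union>x\<in>K. {y. rdist M x y < ennreal (e x)})" by blast
  have Kne: "K \<noteq> {}" using K(2) by auto
  define \<delta> where "\<delta> = Min (e ` K)"
  have \<delta>: "0 < \<delta>" "\<And>x. x \<in> K \<Longrightarrow> \<delta> \<le> e x" using K(1) Kne e(1) by (auto simp: \<delta>_def)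
  have "P p q" if pq: "rdist M p q < ennreal \<delta>" for p q
  proof -
    obtain x where x: "x \<in> K" "rdist M x p < ennreal (e x)" using K(2) by auto
    have ee: "ennreal (e x) \<le> ennreal (2 * e x)" using e(1)[of x] by (simp add: ennreal_leI)
    have "rdist M x q \<le> rdist M x p + rdist M p q" by (rule rdist_triangle)
    also have "\<dots> < ennreal (e x) + ennreal (e x)"
      using x(2) less_le_trans[OF pq ennreal_leI[OF \<delta>(2)[OF x(1)]]] by (rule add_strict_mono)
    also have "\<dots> = ennreal (2 * e x)" using e(1)[of x] by (simp add: ennreal_plus[symmetric] del: ennreal_plus)
    finally show ?thesis using e(2)[OF less_le_trans[OF x(2) ee]] by blast
  qed
  then show ?thesis using \<delta>(1) by blast
qed

lemma rdist_bounded: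
  assumes cpt: "compact (UNIV :: 'a set)"
  shows "\<exists>D>0. \<forall>x y. rdist M x y < top \<longrightarrow> rdist M x y \<le> ennreal D"
proof -
  have cov: "UNIV \<subseteq> (\<Union>x\<in>UNIV. {y. rdist M x y < ennreal 1})" by (auto simp: rdist_self intro: exI)
  obtain K where K: "finite K" "UNIV \<subseteq> (\<Union>x\<in>K. {y. rdist M x y < ennreal 1})"
    using compactE_image[OF cpt _ cov] rdist_ball_open by metis
  \<comment> \<open>Distances between centres in different components are infinite;
    \<open>enn2real\<close> sends them to 0, so they drop out of the sum. The 2 added below pays for
    the way to the two centres.\<close>
  define D where "D = (\<Sum>a\<in>K. \<Sum>b\<in>K. enn2real (rdist M a b))"
  have D: "0 \<le> D" unfolding D_def by (intro sum_nonneg) auto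
  have "rdist M x y \<le> ennreal (D + 2)" if fin: "rdist M x y < top" for x y
  proof -
    have near: "\<exists>a\<in>K. rdist M a x < 1" for x using K(2) by auto
    then obtain a b where ab: "a \<in> K" "rdist M a x < 1" "b \<in> K" "rdist M b y < 1" by meson
    have fin1: "u < top" if "u < 1" for u :: ennreal
      using order_less_trans[OF that ennreal_one_less_top] .
    have "rdist M a b \<le> rdist M a x + (rdist M x y + rdist M y b)"
      using rdist_triangle[of a b x] rdist_triangle[of x b y] by (meson add_left_mono order_trans)
    also have "\<dots> < top" using fin1[OF ab(2)] fin1[OF ab(4)] fin rdist_sym[of y b] by simp
    finally have "rdist M a b = ennreal (enn2real (rdist M a b))" by (simp add: less_top)
    moreover have "enn2real (rdist M a b) \<le> D"
    proof -
      have "enn2real (rdist M a b) \<le> (\<Sum>b\<in>K. enn2real (rdist M a b))"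
        using K(1) ab by (intro member_le_sum) auto
      also have "\<dots> \<le> D" unfolding D_def using K(1) ab by (intro member_le_sum) (auto intro: sum_nonneg)
      finally show ?thesis .
    qed
    ultimately have abD: "rdist M a b \<le> ennreal D" by (metis ennreal_leI)
    have "rdist M x y \<le> rdist M x a + (rdist M a b + rdist M b y)"
      using rdist_triangle[of x y a] rdist_triangle[of a y b] by (meson add_left_mono order_trans)
    also have "\<dots> \<le> ennreal 1 + (ennreal D + ennreal 1)"
      using ab abD rdist_sym[of x a] by (intro add_mono) auto
    also have "\<dots> = ennreal (D + 2)" using D by (simp add: ennreal_plus[symmetric] del: ennreal_plus ennreal_1)
    finally show ?thesis .
  qed
  then show ?thesis using D by (intro exI[of _ "D + 2"]) auto
qed

text \<open>\<open>f\<close> is only continuous, so the image of a curve need not have a length.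
  Instead, the points at finite distance from \<open>f x\<close> form an open set with open
  complement, and the image of a curve is connected.\<close>

lemma rdist_finite_image:
  assumes f: "continuous_on UNIV f" and fin: "rdist M x y < top"
  shows "rdist M (f x) (f y) < top"
proof -
  obtain \<gamma> where \<gamma>: "pw_C1_curve M \<gamma>" "\<gamma> 0 = x" "\<gamma> 1 = y" by (rule rdist_less_curve[OF fin])
  define A where "A = {z. rdist M (f x) z < top}"
  have nb: "\<exists>U. open U \<and> z \<in> U \<and> (\<forall>w\<in>U. w \<in> A \<longleftrightarrow> z \<in> A)" for z
  proof -
    obtain U where U: "open U" "z \<in> U" "\<forall>w\<in>U. rdist M z w < ennreal 1" using rdist_nbhd[of 1 z] by auto
    have "w \<in> A \<longleftrightarrow> z \<in> A" if "w \<in> U" for w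
    proof -
      have 1: "rdist M z w < top"
        using order_less_trans[OF bspec[OF U(3) that] ennreal_less_top] .
      have "rdist M (f x) w \<le> rdist M (f x) z + rdist M z w" "rdist M (f x) z \<le> rdist M (f x) w + rdist M z w"
        using rdist_triangle[of "f x" w z] rdist_triangle[of "f x" z w] rdist_sym[of z w] by auto
      then show ?thesis using 1 unfolding A_def by (auto simp: less_top[symmetric] top_unique)
    qed
    then show ?thesis using U by blast
  qed
  have "\<exists>T. open T \<and> z \<in> T \<and> T \<subseteq> A" if "z \<in> A" for z
    using nb[of z] that by (meson subsetI)
  then have "open A" by (subst open_subopen) simp
  moreover have "\<exists>T. open T \<and> z \<in> T \<and> T \<subseteq> - A" if "z \<in> - A" for z
    using nb[of z] that by (meson ComplD ComplI subsetI)
  then have "open (- A)" by (subst open_subopen) simp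
  moreover have "connected (f ` \<gamma> ` {0..1})"
    using \<gamma>(1) unfolding pw_C1_curve_def
    by (intro connected_continuous_image) (auto intro: continuous_on_subset[OF f])
  moreover have "f x \<in> A" unfolding A_def by (simp add: rdist_self)
  moreover have "f x \<in> f ` \<gamma> ` {0..1}" "f y \<in> f ` \<gamma> ` {0..1}" using \<gamma> by force+
  ultimately have "f y \<in> A"
    using connectedD[of "f ` \<gamma> ` {0..1}" A "- A"] by blast
  then show ?thesis by (simp add: A_def)
qed

text \<open>Closedness in the product topology; it makes the relation between shadowing points
  closed and thereby the conjugacy continuous.\<close>

lemma rdist_le_closed: "closed {(p, q). rdist M p q \<le> l}"
proof -
  have "open (- {(p, q). rdist M p q \<le> l})"
  proof (subst open_subopen, intro ballI)
    fix z assume "z \<in> - {(p, q). rdist M p q \<le> l}"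
    then obtain p q where pq: "z = (p, q)" "\<not> rdist M p q \<le> l" by (cases z) auto
    have "\<exists>T. open T \<and> (p, q) \<in> T \<and> T \<subseteq> - {(p, q). rdist M p q \<le> l}"
    proof (rule ccontr)
      assume n: "\<not> ?thesis"
      have "rdist M p q \<le> l"
      proof (rule ennreal_le_epsilon)
        fix e :: real assume e: "0 < e"
        obtain U where U: "open U" "p \<in> U" "\<And>y. y \<in> U \<Longrightarrow> rdist M p y < ennreal (e / 2)"
          using rdist_nbhd[of "e / 2" p] e by auto
        obtain V where V: "open V" "q \<in> V" "\<And>y. y \<in> V \<Longrightarrow> rdist M q y < ennreal (e / 2)"
          using rdist_nbhd[of "e / 2" q] e by auto
        have "open (U \<times> V)" "(p, q) \<in> U \<times> V" using U V by (auto intro: open_Times)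
        then have "\<not> U \<times> V \<subseteq> - {(p, q). rdist M p q \<le> l}" using n by blast
        then obtain p' q' where pq': "p' \<in> U" "q' \<in> V" "rdist M p' q' \<le> l" by auto
        have "rdist M p q \<le> rdist M p p' + (rdist M p' q' + rdist M q' q)"
          using rdist_triangle[of p q p'] rdist_triangle[of p' q q'] by (meson add_left_mono order_trans)
        also have "\<dots> \<le> ennreal (e / 2) + (l + ennreal (e / 2))"
          using pq' U(3)[OF pq'(1)] V(3)[OF pq'(2)] rdist_sym[of q q'] by (intro add_mono) auto
        also have "\<dots> = l + (ennreal (e / 2) + ennreal (e / 2))" by (simp add: ac_simps)
        also have "ennreal (e / 2) + ennreal (e / 2) = ennreal e" using e by (simp add: ennreal_plus[symmetric] del: ennreal_plus)
        finally show "rdist M p q \<le> l + ennreal e" .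
      qed
      then show False using pq by simp
    qed
    then show "\<exists>T. open T \<and> z \<in> T \<and> T \<subseteq> - {(p, q). rdist M p q \<le> l}" using pq(1) by simp
  qed
  then show ?thesis by (simp add: closed_def)
qed

end

section \<open>The Levi-Civita connection and the distance on the tangent bundle\<close>

text \<open>The vector of values of \<open>B z\<close> on the basis depends linearly and, by
  positivity, injectively on \<open>z\<close>, hence surjectively in finite dimension. This gives
  the \<open>THE\<close> in \<open>christoffel\<close> its meaning.\<close>

lemma riesz_bilinear:
  fixes B :: "'e::euclidean_space \<Rightarrow> 'e \<Rightarrow> real"
  assumes B: "bilinear B" and pos: "\<And>v. v \<noteq> 0 \<Longrightarrow> 0 < B v v" and l: "linear l"
  shows "\<exists>!z. \<forall>w. B z w = l w"
proof -
  define T where "T z = (\<Sum>b\<in>Basis. B z b *\<^sub>R b)" for z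
  have Bl: "linear (\<lambda>z. B z w)" and Br: "linear (B z)" for z w using B unfolding bilinear_def by auto
  have T: "T z \<bullet> w = B z w" for z w
  proof -
    have "B z w = B z (\<Sum>b\<in>Basis. (w \<bullet> b) *\<^sub>R b)" by (simp add: euclidean_representation)
    also have "\<dots> = (\<Sum>b\<in>Basis. (w \<bullet> b) * B z b)" by (simp add: linear_sum[OF Br] linear_scale[OF Br])
    finally show ?thesis by (simp add: T_def inner_sum_left inner_commute[of w] mult.commute)
  qed
  have linT: "linear T"
    unfolding T_def by (intro linear_compose_sum ballI linear_compose[OF Bl, of "\<lambda>x. x *\<^sub>R _", unfolded o_def] linear_scaleR_left)
  have "inj T"
    unfolding linear_injective_0[OF linT]
  proof (intro allI impI)
    fix v assume "T v = 0"
    then have "B v v = 0" using T[of v v] by simp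
    then show "v = 0" using pos[of v] by force
  qed
  then have "surj T" by (rule linear_injective_imp_surjective[OF linT _ refl])
  define y where "y = (\<Sum>b\<in>Basis. l b *\<^sub>R b)"
  have y: "y \<bullet> w = l w" for w
  proof -
    have "l w = l (\<Sum>b\<in>Basis. (w \<bullet> b) *\<^sub>R b)" by (simp add: euclidean_representation)
    also have "\<dots> = (\<Sum>b\<in>Basis. (w \<bullet> b) * l b)" by (simp add: linear_sum[OF l] linear_scale[OF l])
    finally show ?thesis by (simp add: y_def inner_sum_left inner_commute[of w] mult.commute)
  qed
  obtain z where z: "T z = y" using \<open>surj T\<close> unfolding surj_def by (elim allE[of _ y]) auto
  show ?thesis
  proof
    show "\<forall>w. B z w = l w" using T[of z] y z by simp
    fix z' assume "\<forall>w. B z' w = l w"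
    then have "T z' \<bullet> w = y \<bullet> w" for w using T y by simp
    then have "T z' = y" by (rule euclidean_eqI)
    then show "z' = z" using injD[OF \<open>inj T\<close>, of z' z] z by simp
  qed
qed

context riem
begin

definition metric_deriv :: "('a, 'e) chart \<Rightarrow> 'e \<Rightarrow> 'e \<Rightarrow> 'e \<Rightarrow> 'e \<Rightarrow> real" where
  "metric_deriv c y v w = frechet_derivative (\<lambda>y. gm c y v w) (at y)"

lemma metric_deriv_has:
  assumes "c \<in> charts M" "y \<in> snd c ` fst c"
  shows "((\<lambda>y. gm c y v w) has_derivative metric_deriv c y v w) (at y)"
  unfolding metric_deriv_def by (rule smooth_on_has_derivative[OF gm_smooth[OF assms(1)] assms(2)])

lemma gm_bil: "c \<in> charts M \<Longrightarrow> y \<in> snd c ` fst c \<Longrightarrow> bilinear (gm c y)"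
  by (erule imageE) (simp add: gm_bilinear)

lemma metric_deriv_transform:
  assumes c: "c \<in> charts M" "y \<in> snd c ` fst c"
    and h: "(h has_derivative h') (at y)" "\<And>z. z \<in> snd c ` fst c \<Longrightarrow> h z = gm c z v w"
  shows "metric_deriv c y v w = h'"
proof -
  have "((\<lambda>y. gm c y v w) has_derivative h') (at y)"
    by (rule has_derivative_transform_within_open[OF h(1) chart_open(2)[OF chart[OF c(1)]] c(2) h(2)])
  from has_derivative_unique[OF metric_deriv_has[OF c] this] show ?thesis .
qed

lemma metric_deriv_linear:
  assumes c: "c \<in> charts M" "y \<in> snd c ` fst c"
  shows "linear (\<lambda>v. metric_deriv c y v w u)" "linear (\<lambda>w. metric_deriv c y v w u)" "linear (metric_deriv c y v w)"
proof -
  note D = metric_deriv_has[OF c] and B = gm_bil[OF c(1)]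
  show "linear (\<lambda>v. metric_deriv c y v w u)"
  proof (rule linearI)
    fix a b
    have "metric_deriv c y (a + b) w = (\<lambda>u. metric_deriv c y a w u + metric_deriv c y b w u)"
      by (rule metric_deriv_transform[OF c has_derivative_add[OF D[of a w] D[of b w]]]) (simp add: bilinear_ladd[OF B])
    then show "metric_deriv c y (a + b) w u = metric_deriv c y a w u + metric_deriv c y b w u" by simp
  next
    fix r a
    have "metric_deriv c y (r *\<^sub>R a) w = (\<lambda>u. r * metric_deriv c y a w u)"
      by (rule metric_deriv_transform[OF c has_derivative_mult_right[OF D[of a w]]]) (simp add: bilinear_lmul[OF B])
    then show "metric_deriv c y (r *\<^sub>R a) w u = r *\<^sub>R metric_deriv c y a w u" by simp
  qed
  show "linear (\<lambda>w. metric_deriv c y v w u)"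
  proof (rule linearI)
    fix a b
    have "metric_deriv c y v (a + b) = (\<lambda>u. metric_deriv c y v a u + metric_deriv c y v b u)"
      by (rule metric_deriv_transform[OF c has_derivative_add[OF D[of v a] D[of v b]]]) (simp add: bilinear_radd[OF B])
    then show "metric_deriv c y v (a + b) u = metric_deriv c y v a u + metric_deriv c y v b u" by simp
  next
    fix r a
    have "metric_deriv c y v (r *\<^sub>R a) = (\<lambda>u. r * metric_deriv c y v a u)"
      by (rule metric_deriv_transform[OF c has_derivative_mult_right[OF D[of v a]]]) (simp add: bilinear_rmul[OF B])
    then show "metric_deriv c y v (r *\<^sub>R a) u = r *\<^sub>R metric_deriv c y v a u" by simp
  qed
  show "linear (metric_deriv c y v w)" by (rule has_derivative_linear[OF D])
qed

lemma metric_deriv_bilinear: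
  assumes "c \<in> charts M" "y \<in> snd c ` fst c" shows "bilinear (\<lambda>v w. metric_deriv c y v w u)"
  unfolding bilinear_def using metric_deriv_linear[OF assms] by blast

text \<open>Differentiability of the metric is known for constant vectors; expanding both moving
  vectors in the basis turns the claim into the product rule.\<close>

lemma metric_chain:
  assumes c: "c \<in> charts M" "\<phi> y \<in> snd c ` fst c"
    and \<phi>: "(\<phi> has_derivative T) (at y)" and a: "(a has_derivative a') (at y)" and b: "(b has_derivative b') (at y)"
  shows "((\<lambda>z. gm c (\<phi> z) (a z) (b z)) has_derivative
    (\<lambda>u. metric_deriv c (\<phi> y) (a y) (b y) (T u) + gm c (\<phi> y) (a' u) (b y) + gm c (\<phi> y) (a y) (b' u))) (at y)"
proof -
  let ?G = "\<lambda>i j z. gm c (\<phi> z) i j"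
  have G: "(?G i j has_derivative (\<lambda>u. metric_deriv c (\<phi> y) i j (T u))) (at y)" for i j
    by (rule has_derivative_compose[OF \<phi> metric_deriv_has[OF c]])
  have "((\<lambda>z. \<Sum>i\<in>Basis. \<Sum>j\<in>Basis. (a z \<bullet> i) * (b z \<bullet> j) * ?G i j z) has_derivative
    (\<lambda>u. \<Sum>i\<in>Basis. \<Sum>j\<in>Basis. (a y \<bullet> i) * (b y \<bullet> j) * metric_deriv c (\<phi> y) i j (T u)
      + ((a y \<bullet> i) * (b' u \<bullet> j) + (a' u \<bullet> i) * (b y \<bullet> j)) * ?G i j y)) (at y)"
    by (intro has_derivative_sum has_derivative_mult has_derivative_inner_left G a b)
  moreover have "(\<Sum>i\<in>Basis. \<Sum>j\<in>Basis. (a y \<bullet> i) * (b y \<bullet> j) * metric_deriv c (\<phi> y) i j (T u)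
      + ((a y \<bullet> i) * (b' u \<bullet> j) + (a' u \<bullet> i) * (b y \<bullet> j)) * ?G i j y)
    = metric_deriv c (\<phi> y) (a y) (b y) (T u) + gm c (\<phi> y) (a' u) (b y) + gm c (\<phi> y) (a y) (b' u)" for u
    unfolding bilinear_expand[OF metric_deriv_bilinear[OF c], of "a y" "b y"]
      bilinear_expand[OF gm_bil[OF c], of "a' u" "b y"] bilinear_expand[OF gm_bil[OF c], of "a y" "b' u"]
    by (simp add: sum.distrib algebra_simps)
  ultimately have der: "((\<lambda>z. \<Sum>i\<in>Basis. \<Sum>j\<in>Basis. (a z \<bullet> i) * (b z \<bullet> j) * ?G i j z) has_derivative
    (\<lambda>u. metric_deriv c (\<phi> y) (a y) (b y) (T u) + gm c (\<phi> y) (a' u) (b y) + gm c (\<phi> y) (a y) (b' u))) (at y)"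
    by simp
  have "eventually (\<lambda>z. \<phi> z \<in> snd c ` fst c) (nhds y)"
  proof -
    have "isCont \<phi> y" using \<phi> by (rule has_derivative_continuous)
    then show ?thesis
      using topological_tendstoD[OF _ chart_open(2)[OF chart[OF c(1)]] c(2)] c(2)
      by (auto simp: isCont_def eventually_nhds_conv_at)
  qed
  then obtain S where S: "open S" "y \<in> S" "\<And>z. z \<in> S \<Longrightarrow> \<phi> z \<in> snd c ` fst c"
    unfolding eventually_nhds by blast
  show ?thesis
    by (rule has_derivative_transform_within_open[OF der S(1,2)])
      (simp add: bilinear_expand[OF gm_bil[OF c(1) S(3)], symmetric])
qed

definition koszul :: "('a, 'e) chart \<Rightarrow> 'e \<Rightarrow> 'e \<Rightarrow> 'e \<Rightarrow> 'e \<Rightarrow> real" where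
  "koszul c y u v w = metric_deriv c y v w u + metric_deriv c y u w v - metric_deriv c y u v w"

lemma koszul_linear:
  assumes "c \<in> charts M" "y \<in> snd c ` fst c"
  shows "linear (koszul c y u v)"
  unfolding koszul_def
  by (rule linearI)
    (simp_all add: linear_add[OF metric_deriv_linear(2)[OF assms]] linear_add[OF metric_deriv_linear(3)[OF assms]]
      linear_scale[OF metric_deriv_linear(2)[OF assms]] linear_scale[OF metric_deriv_linear(3)[OF assms]] algebra_simps)

lemma christoffel_eq:
  assumes c: "c \<in> charts M" "y \<in> snd c ` fst c"
  shows "2 * gm c y (christoffel M c y u v) w = koszul c y u v w"
    and "(\<And>w. 2 * gm c y z w = koszul c y u v w) \<Longrightarrow> z = christoffel M c y u v"
proof -
  have B2: "bilinear (\<lambda>a b. 2 * gm c y a b)"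
    unfolding bilinear_def using gm_bil[OF c]
    by (intro conjI allI linearI)
      (simp_all add: bilinear_ladd bilinear_radd bilinear_lmul bilinear_rmul algebra_simps)
  have pos: "0 < 2 * gm c y v v" if "v \<noteq> 0" for v using gm_pos[OF c(1)] c(2) that by auto
  have ch: "christoffel M c y u v = (THE z. \<forall>w. 2 * gm c y z w = koszul c y u v w)"
    unfolding christoffel_def koszul_def metric_deriv_def ..
  have ex: "\<exists>!z. \<forall>w. 2 * gm c y z w = koszul c y u v w"
    by (rule riesz_bilinear[OF B2 pos koszul_linear[OF c, of u v]])
  show "2 * gm c y (christoffel M c y u v) w = koszul c y u v w"
    unfolding ch using theI'[OF ex] by blast
  show "z = christoffel M c y u v" if "\<And>w. 2 * gm c y z w = koszul c y u v w"
    unfolding ch by (rule the1_equality[OF ex, symmetric]) (intro allI that)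
qed

text \<open>Reversing a curve changes the sign of its velocity and keeps the field along it; this
  sign is all that reversal needs from the connection.\<close>

lemma christoffel_minus:
  assumes c: "c \<in> charts M" "y \<in> snd c ` fst c"
  shows "christoffel M c y (- u) v = - christoffel M c y u v"
proof (rule christoffel_eq(2)[OF c, symmetric])
  fix w
  have "koszul c y (- u) v w = - koszul c y u v w"
    unfolding koszul_def
    using linear_neg[OF metric_deriv_linear(1)[OF c]] linear_neg[OF metric_deriv_linear(3)[OF c]] by simp
  then show "2 * gm c y (- christoffel M c y u v) w = koszul c y (- u) v w"
    using christoffel_eq(1)[OF c, of u v w] bilinear_lneg[OF gm_bil[OF c]] by simp
qed

definition transition_deriv2 :: "('a, 'e) chart \<Rightarrow> ('a, 'e) chart \<Rightarrow> 'e \<Rightarrow> 'e \<Rightarrow> 'e \<Rightarrow> 'e" where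
  "transition_deriv2 c c' y v = frechet_derivative (\<lambda>y. frechet_derivative (transition c c') (at y) v) (at y)"

context
  fixes c c' assumes c: "c \<in> charts M" "c' \<in> charts M"
begin

lemma ov_open: "open (snd c ` (fst c \<inter> fst c'))"
  by (rule chart_open_image[OF chart[OF c(1)] chart_open(1)[OF chart[OF c(2)]]])

lemma dtr_has: "y \<in> snd c ` (fst c \<inter> fst c') \<Longrightarrow> (transition c c' has_derivative frechet_derivative (transition c c') (at y)) (at y)"
  by (rule smooth_on_has_derivative[OF transition_smooth[OF c]])

lemma transition_deriv2_has: "y \<in> snd c ` (fst c \<inter> fst c') \<Longrightarrow>
    ((\<lambda>y. frechet_derivative (transition c c') (at y) v) has_derivative transition_deriv2 c c' y v) (at y)"
  unfolding transition_deriv2_def by (rule smooth_on_has_derivative[OF smooth_on_derivative[OF transition_smooth[OF c]]])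

lemma transition_deriv2_sym:
  assumes "y \<in> snd c ` (fst c \<inter> fst c')"
  shows "transition_deriv2 c c' y u v = transition_deriv2 c c' y v u"
proof (rule symmetric_second_derivative[OF ov_open assms dtr_has transition_deriv2_has])
  show "continuous_on (snd c ` (fst c \<inter> fst c')) (\<lambda>y. transition_deriv2 c c' y u v)" for u v
    unfolding transition_deriv2_def by (rule smooth_on_continuous[OF smooth_on_derivative[OF smooth_on_derivative[OF transition_smooth[OF c]]]])
qed

lemma transition_deriv2_linear:
  assumes "y \<in> snd c ` (fst c \<inter> fst c')"
  shows "linear (\<lambda>v. transition_deriv2 c c' y v u)"
proof -
  have "(\<lambda>v. transition_deriv2 c c' y v u) = transition_deriv2 c c' y u" by (rule ext) (rule transition_deriv2_sym[OF assms])
  then show ?thesis using has_derivative_linear[OF transition_deriv2_has[OF assms, of u]] by simp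
qed

text \<open>The classical inhomogeneous transformation law. Differentiating the metric identity
  between the two charts adds second-derivative terms of the transition map to each metric
  derivative; in the Koszul combination, by their symmetry, all cancel in pairs except one, which is
  doubled.\<close>

lemma christoffel_change:
  assumes x: "x \<in> fst c" "x \<in> fst c'"
  shows "christoffel M c' (snd c' x) (cc c c' x u) (cc c c' x v)
    = cc c c' x (christoffel M c (snd c x) u v) - transition_deriv2 c c' (snd c x) v u"
proof (rule christoffel_eq(2)[OF c(2), symmetric])
  let ?T = "cc c c' x" and ?y = "snd c x" and ?y' = "snd c' x"
  have yO: "?y \<in> snd c ` (fst c \<inter> fst c')" using x by auto
  have I: "?y \<in> snd c ` fst c" "?y' \<in> snd c' ` fst c'" using x by auto
  have Ty: "transition c c' ?y = ?y'" by (rule transition_apply[OF c(1) x(1)])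
  show "?y' \<in> snd c' ` fst c'" by fact
  have dgc: "metric_deriv c ?y v w u = metric_deriv c' ?y' (?T v) (?T w) (?T u)
      + gm c' ?y' (transition_deriv2 c c' ?y v u) (?T w) + gm c' ?y' (?T v) (transition_deriv2 c c' ?y w u)" for u v w
  proof -
    let ?h = "\<lambda>z. gm c' (transition c c' z) (frechet_derivative (transition c c') (at z) v) (frechet_derivative (transition c c') (at z) w)"
    have "(?h has_derivative (\<lambda>u. metric_deriv c' (transition c c' ?y) (frechet_derivative (transition c c') (at ?y) v) (frechet_derivative (transition c c') (at ?y) w) (?T u)
      + gm c' (transition c c' ?y) (transition_deriv2 c c' ?y v u) (frechet_derivative (transition c c') (at ?y) w)
      + gm c' (transition c c' ?y) (frechet_derivative (transition c c') (at ?y) v) (transition_deriv2 c c' ?y w u))) (at ?y)"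
      by (rule metric_chain[OF c(2) _ transition_deriv[OF c x] transition_deriv2_has[OF yO] transition_deriv2_has[OF yO]]) (use Ty I in auto)
    then have "((\<lambda>y. gm c y v w) has_derivative (\<lambda>u. metric_deriv c' ?y' (?T v) (?T w) (?T u)
      + gm c' ?y' (transition_deriv2 c c' ?y v u) (?T w) + gm c' ?y' (?T v) (transition_deriv2 c c' ?y w u))) (at ?y)"
      unfolding Ty cc_eq[symmetric]
    proof (rule has_derivative_transform_within_open[OF _ ov_open yO])
      fix z assume "z \<in> snd c ` (fst c \<inter> fst c')"
      then obtain p where p: "z = snd c p" "p \<in> fst c" "p \<in> fst c'" by auto
      show "?h z = gm c z v w"
        unfolding p(1) transition_apply[OF c(1) p(2)] cc_eq[symmetric] by (rule gm_change[OF c p(2,3), symmetric])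
    qed
    from has_derivative_unique[OF metric_deriv_has[OF c(1) I(1)] this] show ?thesis by (rule fun_cong)
  qed
  fix w'
  define w where "w = cc c' c x w'"
  have w': "w' = ?T w" unfolding w_def by (rule cc_inv[OF c(2,1) x(2,1), symmetric])
  note B = gm_bil[OF c(2) I(2)]
  have s: "gm c' ?y' a b = gm c' ?y' b a" for a b by (rule gm_sym[OF c(2) x(2)])
  have "koszul c ?y u v w = koszul c' ?y' (?T u) (?T v) (?T w) + 2 * gm c' ?y' (transition_deriv2 c c' ?y v u) (?T w)"
    unfolding koszul_def dgc using transition_deriv2_sym[OF yO, of u v] transition_deriv2_sym[OF yO, of w u] transition_deriv2_sym[OF yO, of w v]
      s[of "?T v"] s[of "?T u"] by simp
  moreover have "2 * gm c ?y (christoffel M c ?y u v) w = koszul c ?y u v w"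
    by (rule christoffel_eq(1)[OF c(1) I(1)])
  moreover have "gm c ?y (christoffel M c ?y u v) w = gm c' ?y' (?T (christoffel M c ?y u v)) (?T w)"
    by (rule gm_change[OF c x])
  ultimately show "2 * gm c' ?y' (?T (christoffel M c ?y u v) - transition_deriv2 c c' ?y v u) w'
      = koszul c' ?y' (?T u) (?T v) w'"
    unfolding w' by (simp add: bilinear_lsub[OF B])
qed

end

lemma metric_deriv_bound:
  assumes c: "c \<in> charts M" and Q: "compact Q" "Q \<subseteq> snd c ` fst c"
  shows "\<exists>K\<ge>0. \<forall>y\<in>Q. \<forall>u v w. \<bar>metric_deriv c y v w u\<bar> \<le> K * (norm u * norm v * norm w)"
proof -
  have "continuous_on Q (\<lambda>y. metric_deriv c y i j k)" for i j k
    unfolding metric_deriv_def using continuous_on_subset[OF smooth_on_continuous[OF smooth_on_derivative[OF gm_smooth[OF c]]] Q(2)] .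
  then have "bounded ((\<lambda>y. metric_deriv c y i j k) ` Q)" for i j k
    by (intro compact_imp_bounded compact_continuous_image Q)
  then have "\<exists>b. \<forall>y\<in>Q. \<bar>metric_deriv c y i j k\<bar> \<le> b" for i j k
    unfolding bounded_iff by auto
  then obtain b where b: "\<And>i j k y. y \<in> Q \<Longrightarrow> \<bar>metric_deriv c y i j k\<bar> \<le> b i j k" by metis
  define K where "K = (\<Sum>i\<in>Basis. \<Sum>j\<in>Basis. \<Sum>k\<in>Basis. \<bar>b i j k\<bar>)"
  have "\<bar>metric_deriv c y v w u\<bar> \<le> K * (norm u * norm v * norm w)" if y: "y \<in> Q" for y u v w
  proof -
    have I: "y \<in> snd c ` fst c" using y Q by auto
    have "metric_deriv c y i j u = (\<Sum>k\<in>Basis. (u \<bullet> k) * metric_deriv c y i j k)" for i j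
    proof -
      have "metric_deriv c y i j u = metric_deriv c y i j (\<Sum>k\<in>Basis. (u \<bullet> k) *\<^sub>R k)" by (simp add: euclidean_representation)
      also have "\<dots> = (\<Sum>k\<in>Basis. (u \<bullet> k) * metric_deriv c y i j k)"
        by (simp add: linear_sum[OF metric_deriv_linear(3)[OF c I]] linear_scale[OF metric_deriv_linear(3)[OF c I]])
      finally show ?thesis .
    qed
    then have "metric_deriv c y v w u = (\<Sum>i\<in>Basis. \<Sum>j\<in>Basis. \<Sum>k\<in>Basis. (v \<bullet> i) * (w \<bullet> j) * ((u \<bullet> k) * metric_deriv c y i j k))"
      unfolding bilinear_expand[OF metric_deriv_bilinear[OF c I], of v w] by (simp add: sum_distrib_left)
    also have "\<bar>\<dots>\<bar> \<le> (\<Sum>i\<in>Basis. \<Sum>j\<in>Basis. \<Sum>k\<in>Basis. \<bar>b i j k\<bar> * (norm u * norm v * norm w))"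
    proof (intro order_trans[OF sum_abs] sum_mono)
      fix i j k :: 'e assume ijk: "i \<in> Basis" "j \<in> Basis" "k \<in> Basis"
      have "\<bar>(v \<bullet> i) * (w \<bullet> j) * ((u \<bullet> k) * metric_deriv c y i j k)\<bar> = (\<bar>v \<bullet> i\<bar> * \<bar>w \<bullet> j\<bar> * \<bar>u \<bullet> k\<bar>) * \<bar>metric_deriv c y i j k\<bar>"
        by (simp add: abs_mult)
      also have "\<dots> \<le> (norm v * norm w * norm u) * \<bar>b i j k\<bar>"
        using b[OF y, of i j k] Basis_le_norm ijk
        by (intro mult_mono) (auto intro: order_trans[OF _ abs_ge_self])
      finally show "\<bar>(v \<bullet> i) * (w \<bullet> j) * ((u \<bullet> k) * metric_deriv c y i j k)\<bar> \<le> \<bar>b i j k\<bar> * (norm u * norm v * norm w)"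
        by (simp add: mult_ac)
    qed
    finally show ?thesis by (simp add: K_def sum_distrib_right)
  qed
  moreover have "0 \<le> K" unfolding K_def by (intro sum_nonneg) auto
  ultimately show ?thesis by blast
qed

text \<open>Pairing the Christoffel vector with itself in the Koszul formula bounds its squared norm
  by a multiple of its norm times \<open>norm u * norm v\<close>; one factor is then divided
  out.\<close>

lemma christoffel_bound:
  assumes c: "c \<in> charts M" and Q: "compact Q" "Q \<subseteq> snd c ` fst c"
  shows "\<exists>K\<ge>0. \<forall>y\<in>Q. \<forall>u v. norm (christoffel M c y u v) \<le> K * (norm u * norm v)"
proof -
  obtain C where C: "0 < C" "\<And>y u. y \<in> Q \<Longrightarrow> norm u \<le> C * chart_norm c y u" using chart_norm_compare[OF c Q] by blast
  obtain K where K: "0 \<le> K" "\<And>y u v w. y \<in> Q \<Longrightarrow> \<bar>metric_deriv c y v w u\<bar> \<le> K * (norm u * norm v * norm w)"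
    using metric_deriv_bound[OF c Q] by blast
  have "norm (christoffel M c y u v) \<le> (C\<^sup>2 * (2 * K)) * (norm u * norm v)" if y: "y \<in> Q" for y u v
  proof -
    have I: "y \<in> snd c ` fst c" using y Q by auto
    let ?z = "christoffel M c y u v"
    show ?thesis
    proof (cases "?z = 0")
      case True then show ?thesis using K(1) by simp
    next
      case False
      have g0: "0 < gm c y ?z ?z" using gm_pos[OF c _ False] I by auto
      have "(norm ?z)\<^sup>2 \<le> (C * chart_norm c y ?z)\<^sup>2" using C(2)[OF y] by (intro power_mono) auto
      also have "\<dots> = C\<^sup>2 * gm c y ?z ?z" using g0 by (simp add: chart_norm_def power_mult_distrib)
      also have "gm c y ?z ?z \<le> (3 * K / 2) * (norm u * norm v * norm ?z)"
        using christoffel_eq(1)[OF c I, of u v ?z] K(2)[OF y, of v ?z u] K(2)[OF y, of u ?z v] K(2)[OF y, of u v ?z]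
        unfolding koszul_def by (simp add: mult_ac abs_le_iff)
      also have "\<dots> \<le> (2 * K) * (norm u * norm v * norm ?z)" using K(1) by (intro mult_right_mono) auto
      finally have "(norm ?z)\<^sup>2 \<le> C\<^sup>2 * ((2 * K) * (norm u * norm v * norm ?z))"
        by (simp only: mult_left_mono zero_le_power2)
      then have "norm ?z * norm ?z \<le> (C\<^sup>2 * (2 * K) * (norm u * norm v)) * norm ?z"
        by (simp only: power2_eq_square mult_ac)
      then show ?thesis using False by simp
    qed
  qed
  then show ?thesis using K(1) by (intro exI[of _ "C\<^sup>2 * (2 * K)"]) auto
qed

end

section \<open>Covariant derivative and tangent curves in charts\<close>

context riem
begin

abbreviation "fc \<equiv> field_coords M"

lemma field_coords_change:
  assumes "c \<in> charts M" "c' \<in> charts M" "\<gamma> t \<in> fst c" "\<gamma> t \<in> fst c'"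
  shows "fc c' \<gamma> V t = cc c c' (\<gamma> t) (fc c \<gamma> V t)"
  unfolding field_coords_def using assms cat by (simp add: cc_comp)

lemma fc_cat: "fc (cat (\<gamma> t)) \<gamma> V t = V t"
  unfolding field_coords_def using cat by (simp add: cc_id)

definition cov :: "('a, 'e) chart \<Rightarrow> (real \<Rightarrow> 'a) \<Rightarrow> (real \<Rightarrow> 'e) \<Rightarrow> real \<Rightarrow> 'e" where
  "cov c \<gamma> V t = vector_derivative (fc c \<gamma> V) (at t) + christoffel M c (snd c (\<gamma> t)) (vel c \<gamma> t) (fc c \<gamma> V t)"

lemma cov_deriv_cov: "cov_deriv M \<gamma> V t = cov (cat (\<gamma> t)) \<gamma> V t"
  unfolding cov_deriv_def cov_def by (simp add: Let_def velocity_vel fc_cat)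

text \<open>Differentiating the coordinate change along the curve produces
  \<open>transition_deriv2\<close>, exactly the term by which the Christoffel vector fails to
  transform; in the sum the two cancel. So the covariant derivative changes charts like a tangent
  vector.\<close>

lemma cov_change:
  fixes \<gamma> :: "real \<Rightarrow> 'a"
  assumes \<gamma>: "continuous_on {0..1} \<gamma>" and t: "t \<in> {0<..<1}"
    and c: "c \<in> charts M" "c' \<in> charts M" "\<gamma> t \<in> fst c" "\<gamma> t \<in> fst c'"
    and d: "(snd c \<circ> \<gamma>) differentiable (at t)" "fc c \<gamma> V differentiable (at t)"
  shows "cov c' \<gamma> V t = cc c c' (\<gamma> t) (cov c \<gamma> V t)"
proof -
  let ?T = "cc c c' (\<gamma> t)" and ?y = "snd c (\<gamma> t)" and ?D = "\<lambda>y. frechet_derivative (transition c c') (at y)"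
  have yO: "?y \<in> snd c ` (fst c \<inter> fst c')" using c by auto
  have linT: "linear ?T" by (rule cc_linear[OF c])
  have "open (fst c \<inter> fst c')" by (intro open_Int chart_open(1) chart c)
  then obtain O' where O': "open O'" "t \<in> O'" "\<gamma> ` O' \<subseteq> fst c \<inter> fst c'"
    using curve_nbhd[OF \<gamma> _ t, of "fst c \<inter> fst c'"] c by auto
  define V' where "V' = vector_derivative (fc c \<gamma> V) (at t)"
  have V': "(fc c \<gamma> V has_vector_derivative V') (at t)"
    using d(2) unfolding V'_def by (simp add: vector_derivative_works)
  have g': "((snd c \<circ> \<gamma>) has_vector_derivative vel c \<gamma> t) (at t)"
    using d(1) unfolding vel_def by (simp add: vector_derivative_works)
  have Db: "((\<lambda>s. ?D (snd c (\<gamma> s)) b) has_vector_derivative transition_deriv2 c c' ?y b (vel c \<gamma> t)) (at t)" for b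
    using vector_derivative_diff_chain_within[OF g', of "\<lambda>y. ?D y b" "transition_deriv2 c c' ?y b"]
      transition_deriv2_has[OF c(1,2) yO, of b] has_derivative_at_withinI by (auto simp: o_def)
  \<comment> \<open>The coordinate change is known to be differentiable in the base point for each
    fixed vector, so the moving field is expanded in the basis first.\<close>
  have "((\<lambda>s. \<Sum>b\<in>Basis. (fc c \<gamma> V s \<bullet> b) *\<^sub>R ?D (snd c (\<gamma> s)) b) has_vector_derivative
    (\<Sum>b\<in>Basis. (fc c \<gamma> V t \<bullet> b) *\<^sub>R transition_deriv2 c c' ?y b (vel c \<gamma> t) + (V' \<bullet> b) *\<^sub>R ?D ?y b)) (at t)"
    by (intro has_vector_derivative_sum has_vector_derivative_scaleR Db
        bounded_linear.has_vector_derivative[OF bounded_linear_inner_left V', unfolded has_real_derivative_iff_has_vector_derivative[symmetric]])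
  moreover have "(\<Sum>b\<in>Basis. (fc c \<gamma> V t \<bullet> b) *\<^sub>R transition_deriv2 c c' ?y b (vel c \<gamma> t) + (V' \<bullet> b) *\<^sub>R ?D ?y b)
    = transition_deriv2 c c' ?y (fc c \<gamma> V t) (vel c \<gamma> t) + ?T V'"
  proof -
    have "transition_deriv2 c c' ?y (fc c \<gamma> V t) (vel c \<gamma> t) = transition_deriv2 c c' ?y (\<Sum>b\<in>Basis. (fc c \<gamma> V t \<bullet> b) *\<^sub>R b) (vel c \<gamma> t)"
      by (simp add: euclidean_representation)
    also have "\<dots> = (\<Sum>b\<in>Basis. (fc c \<gamma> V t \<bullet> b) *\<^sub>R transition_deriv2 c c' ?y b (vel c \<gamma> t))"
      by (simp add: linear_sum[OF transition_deriv2_linear[OF c(1,2) yO]] linear_scale[OF transition_deriv2_linear[OF c(1,2) yO]])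
    finally have 1: "transition_deriv2 c c' ?y (fc c \<gamma> V t) (vel c \<gamma> t) = (\<Sum>b\<in>Basis. (fc c \<gamma> V t \<bullet> b) *\<^sub>R transition_deriv2 c c' ?y b (vel c \<gamma> t))" .
    have "?T V' = ?T (\<Sum>b\<in>Basis. (V' \<bullet> b) *\<^sub>R b)" by (simp add: euclidean_representation)
    also have "\<dots> = (\<Sum>b\<in>Basis. (V' \<bullet> b) *\<^sub>R ?T b)"
      by (simp add: linear_sum[OF linT] linear_scale[OF linT])
    finally have 2: "?T V' = (\<Sum>b\<in>Basis. (V' \<bullet> b) *\<^sub>R ?D ?y b)" by (simp add: cc_eq)
    show ?thesis by (simp add: 1 2 sum.distrib)
  qed
  ultimately have der: "((\<lambda>s. \<Sum>b\<in>Basis. (fc c \<gamma> V s \<bullet> b) *\<^sub>R ?D (snd c (\<gamma> s)) b) has_vector_derivative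
    (transition_deriv2 c c' ?y (fc c \<gamma> V t) (vel c \<gamma> t) + ?T V')) (at t)" by simp
  have "(fc c' \<gamma> V has_vector_derivative (transition_deriv2 c c' ?y (fc c \<gamma> V t) (vel c \<gamma> t) + ?T V')) (at t)"
  proof (rule has_vector_derivative_transform_within_open[OF der O'(1,2)])
    fix s assume "s \<in> O'"
    then have s: "\<gamma> s \<in> fst c" "\<gamma> s \<in> fst c'" using O'(3) by auto
    note L = cc_linear[OF c(1,2) s]
    have "fc c' \<gamma> V s = cc c c' (\<gamma> s) (\<Sum>b\<in>Basis. (fc c \<gamma> V s \<bullet> b) *\<^sub>R b)"
      unfolding euclidean_representation by (rule field_coords_change[where \<gamma>=\<gamma> and t=s, OF c(1,2) s])
    also have "\<dots> = (\<Sum>b\<in>Basis. (fc c \<gamma> V s \<bullet> b) *\<^sub>R cc c c' (\<gamma> s) b)"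
      by (simp only: linear_sum[OF L] linear_scale[OF L])
    finally show "(\<Sum>b\<in>Basis. (fc c \<gamma> V s \<bullet> b) *\<^sub>R ?D (snd c (\<gamma> s)) b) = fc c' \<gamma> V s"
      by (simp only: cc_eq)
  qed
  then have vd: "vector_derivative (fc c' \<gamma> V) (at t) = transition_deriv2 c c' ?y (fc c \<gamma> V t) (vel c \<gamma> t) + ?T V'"
    by (rule vector_derivative_at)
  have vl: "vel c' \<gamma> t = ?T (vel c \<gamma> t)" by (rule vel_has(2)[OF \<gamma> t c d(1)])
  have fc': "fc c' \<gamma> V t = ?T (fc c \<gamma> V t)" by (rule field_coords_change[where \<gamma>=\<gamma> and t=t, OF c])
  show ?thesis
    unfolding cov_def vd vl fc' christoffel_change[OF c] linear_add[OF linT] V'_def[symmetric] by simp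
qed

lemma pw_C1_tcurve_exceptions:
  assumes "pw_C1_tcurve M \<gamma> V"
  shows "\<exists>S. finite S \<and> 0 \<in> S \<and> 1 \<in> S \<and> (\<forall>c\<in>charts M.
    (snd c \<circ> \<gamma>) C1_differentiable_on ({t\<in>{0..1}. \<gamma> t \<in> fst c} - S) \<and>
    continuous_on {t\<in>{0..1}. \<gamma> t \<in> fst c} (fc c \<gamma> V) \<and>
    fc c \<gamma> V C1_differentiable_on ({t\<in>{0..1}. \<gamma> t \<in> fst c} - S))"
proof -
  have "pw_C1_curve M \<gamma>" using assms unfolding pw_C1_tcurve_def by blast
  then obtain S1 where S1: "finite S1" "0 \<in> S1" "1 \<in> S1"
      "\<forall>c\<in>charts M. (snd c \<circ> \<gamma>) C1_differentiable_on ({t\<in>{0..1}. \<gamma> t \<in> fst c} - S1)"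
    using pw_C1_curve_exceptions by blast
  obtain S2 where S2: "finite S2" "\<forall>c\<in>charts M. continuous_on {t\<in>{0..1}. \<gamma> t \<in> fst c} (fc c \<gamma> V) \<and>
    fc c \<gamma> V C1_differentiable_on ({t\<in>{0..1}. \<gamma> t \<in> fst c} - S2)"
    using assms unfolding pw_C1_tcurve_def by blast
  show ?thesis
  proof (intro exI[of _ "S1 \<union> S2"] conjI ballI)
    fix c assume c: "c \<in> charts M"
    show "(snd c \<circ> \<gamma>) C1_differentiable_on ({t\<in>{0..1}. \<gamma> t \<in> fst c} - (S1 \<union> S2))"
      by (rule C1_differentiable_on_subset[OF S1(4)[rule_format, OF c]]) auto
    show "continuous_on {t\<in>{0..1}. \<gamma> t \<in> fst c} (fc c \<gamma> V)" using S2(2) c by blast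
    show "fc c \<gamma> V C1_differentiable_on ({t\<in>{0..1}. \<gamma> t \<in> fst c} - (S1 \<union> S2))"
      by (rule C1_differentiable_on_subset[OF S2(2)[rule_format, OF c, THEN conjunct2]]) auto
  qed (use S1 S2 in auto)
qed

text \<open>The trapping argument for the pair of base point and field. The coordinate derivative of
  the field is its covariant derivative minus a Christoffel term, which grows with the field itself;
  hence the a priori bound \<open>b\<close> on the initial vector.\<close>

lemma tangent_chart_lower:
  assumes c: "c \<in> charts M" and Q: "compact Q" "Q \<subseteq> snd c ` fst c" and b: "0 \<le> b"
  shows "\<exists>C>0. \<exists>\<delta>>0. \<forall>x v y w l. x \<in> fst c \<longrightarrow> snd c x \<in> Q \<longrightarrow> norm (cc (cat x) c x v) \<le> b \<longrightarrow> l < \<delta> \<longrightarrow>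
    tangent_dist M x v y w < ennreal l \<longrightarrow>
    y \<in> fst c \<and> norm (snd c y - snd c x) \<le> C * l \<and> norm (cc (cat y) c y w - cc (cat x) c x v) \<le> C * l"
proof -
  obtain r Q' where r: "0 < r" "compact Q'" "Q' \<subseteq> snd c ` fst c" "\<And>x. x \<in> Q \<Longrightarrow> cball x r \<subseteq> Q'"
    using compact_thickening[OF Q(1) chart_open(2)[OF chart[OF c]] Q(2)] by blast
  obtain C0 where C0: "0 < C0" "\<And>y u. y \<in> Q' \<Longrightarrow> norm u \<le> C0 * chart_norm c y u"
    using chart_norm_compare[OF c r(2,3)] by blast
  obtain K where K: "0 \<le> K" "\<And>y u v. y \<in> Q' \<Longrightarrow> norm (christoffel M c y u v) \<le> K * (norm u * norm v)"
    using christoffel_bound[OF c r(2,3)] by blast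
  \<comment> \<open>One \<open>C0\<close> for the velocity, one for the covariant derivative, and
    the Christoffel bound \<open>K\<close> times the velocity times a field of norm at most
    \<open>b + r\<close> while trapped.\<close>
  define C where "C = C0 + C0 + K * (C0 * (b + r))"
  have C: "0 < C" using C0 K(1) b r(1) unfolding C_def by (intro add_pos_nonneg) auto
  have "y \<in> fst c \<and> norm (snd c y - snd c x) \<le> C * l \<and> norm (cc (cat y) c y w - cc (cat x) c x v) \<le> C * l"
    if x: "x \<in> fst c" "snd c x \<in> Q" "norm (cc (cat x) c x v) \<le> b" and l: "l < r / C"
      and d: "tangent_dist M x v y w < ennreal l" for x v y w l
  proof -
    obtain \<gamma> V where \<gamma>: "pw_C1_tcurve M \<gamma> V" "\<gamma> 0 = x" "V 0 = v" "\<gamma> 1 = y" "V 1 = w" "sasaki_length M \<gamma> V < ennreal l"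
      using d unfolding tangent_dist_def Inf_less_iff by blast
    obtain S where S: "finite S" "0 \<in> S" "1 \<in> S" "\<forall>c\<in>charts M.
        (snd c \<circ> \<gamma>) C1_differentiable_on ({t\<in>{0..1}. \<gamma> t \<in> fst c} - S) \<and>
        continuous_on {t\<in>{0..1}. \<gamma> t \<in> fst c} (fc c \<gamma> V) \<and>
        fc c \<gamma> V C1_differentiable_on ({t\<in>{0..1}. \<gamma> t \<in> fst c} - S)"
      using pw_C1_tcurve_exceptions[OF \<gamma>(1)] by blast
    have cont: "continuous_on {0..1} \<gamma>" using \<gamma>(1) by (simp add: pw_C1_curve_def pw_C1_tcurve_def)
    have l0: "0 \<le> l" using d by (metis ennreal_neg linorder_le_cases not_less_zero)
    define T where "T = {t\<in>{0..1}. \<gamma> t \<in> fst c}"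
    define Z where "Z t = (snd c (\<gamma> t), fc c \<gamma> V t)" for t
    define W where "W t = vector_derivative (fc c \<gamma> V) (at t)" for t
    define \<sigma> where "\<sigma> t = sqrt ((tnorm M (\<gamma> t) (velocity M \<gamma> t))\<^sup>2 + (tnorm M (\<gamma> t) (cov_deriv M \<gamma> V t))\<^sup>2)" for t
    note Sc = S(4)[rule_format]
    have dif: "(snd c' \<circ> \<gamma>) differentiable (at t)" "fc c' \<gamma> V differentiable (at t)"
      if "c' \<in> charts M" "t \<in> {0..1} - S" "\<gamma> t \<in> fst c'" for c' t
      using Sc[OF that(1)] that(2,3) unfolding C1_differentiable_on_eq by auto
    have conts: "continuous_on (T - S) (vel c \<gamma>)" "continuous_on (T - S) W" "continuous_on T (fc c \<gamma> V)"
      using Sc[OF c] unfolding C1_differentiable_on_eq T_def vel_def W_def by auto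
    have sub: "T \<inter> {0<..<1} - S \<subseteq> T - S" by auto
    have cT: "continuous_on T Z"
      unfolding Z_def using conts(3) coord_curve_cont[OF cont c] by (intro continuous_on_Pair) (auto simp: T_def o_def)
    have nb: "norm (fst (Z t) - snd c x) \<le> r \<and> norm (snd (Z t) - cc (cat x) c x v) \<le> r" if "norm (Z t - Z 0) \<le> r" for t
    proof -
      have Z0: "Z 0 = (snd c x, cc (cat x) c x v)" using \<gamma> by (simp add: Z_def field_coords_def)
      have "Z t - Z 0 = (fst (Z t) - snd c x, snd (Z t) - cc (cat x) c x v)" by (simp add: Z0 prod_eq_iff)
      then show ?thesis
        using norm_fst_le[of "fst (Z t) - snd c x" "snd (Z t) - cc (cat x) c x v"]
          norm_snd_le[of "snd (Z t) - cc (cat x) c x v" "fst (Z t) - snd c x"] that by simp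
    qed
    have "1 \<in> T \<and> norm (Z 1 - Z 0) \<le> C * l"
    proof (rule curve_trapped[where S=S and Z'="\<lambda>t. (vel c \<gamma> t, W t)" and r=r and \<sigma>=\<sigma>])
      show "0 \<in> T" using x(1) \<gamma>(2) by (simp add: T_def)
      show "T \<subseteq> {0..1}" unfolding T_def by (rule Collect_restrict)
      show "1 \<in> {0..1::real}" by simp
      show "openin (top_of_set {0..1}) T" unfolding T_def by (rule curve_domain_open[OF cont c])
      show "continuous_on T Z" by (rule cT)
      show "continuous_on (T \<inter> {0<..<1} - S) (\<lambda>t. (vel c \<gamma> t, W t))"
        by (intro continuous_on_Pair continuous_on_subset[OF conts(1) sub] continuous_on_subset[OF conts(2) sub])
      show "(Z has_vector_derivative (vel c \<gamma> t, W t)) (at t)" if t: "t \<in> T \<inter> {0<..<1} - S" for t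
      proof -
        have tt: "t \<in> {0..1} - S" "\<gamma> t \<in> fst c" using t by (auto simp: T_def)
        have "((\<lambda>t. snd c (\<gamma> t)) has_vector_derivative vel c \<gamma> t) (at t)" "(fc c \<gamma> V has_vector_derivative W t) (at t)"
          using dif[OF c tt] unfolding vel_def W_def by (simp_all add: vector_derivative_works o_def)
        then show ?thesis unfolding Z_def by (rule has_vector_derivative_Pair)
      qed
      show "norm (vel c \<gamma> t, W t) \<le> C * \<sigma> t"
        if t: "t \<in> T \<inter> {0<..<1} - S" and n: "norm (Z t - Z 0) \<le> r" for t
      proof -
        have tt: "t \<in> {0..1} - S" "t \<in> {0<..<1}" "\<gamma> t \<in> fst c" using t by (auto simp: T_def)
        let ?c = "cat (\<gamma> t)"
        have \<sigma>1: "tnorm M (\<gamma> t) (velocity M \<gamma> t) \<le> \<sigma> t" "tnorm M (\<gamma> t) (cov_deriv M \<gamma> V t) \<le> \<sigma> t"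
          unfolding \<sigma>_def using tnorm_nonneg by (auto intro: real_le_rsqrt)
        have "fst (Z t) \<in> cball (snd c x) r" using nb[OF n] by (simp add: dist_norm norm_minus_commute)
        then have q: "snd c (\<gamma> t) \<in> Q'" using r(4)[OF x(2)] by (auto simp: Z_def)
        have "norm (vel c \<gamma> t) \<le> C0 * tnorm M (\<gamma> t) (velocity M \<gamma> t)"
          using C0(2)[OF q] tnorm_velocity(1)[OF cont tt(2) c tt(3) dif(1)[OF c tt(1,3)]] by simp
        also have "\<dots> \<le> C0 * \<sigma> t" using \<sigma>1 C0(1) by (intro mult_left_mono) auto
        finally have v: "norm (vel c \<gamma> t) \<le> C0 * \<sigma> t" .
        have "cov c \<gamma> V t = cc ?c c (\<gamma> t) (cov_deriv M \<gamma> V t)"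
          unfolding cov_deriv_cov
          by (rule cov_change[OF cont tt(2) cat(1) c cat(2) tt(3) dif[OF cat(1) tt(1) cat(2)]])
        then have "norm (cov c \<gamma> V t) \<le> C0 * tnorm M (\<gamma> t) (cov_deriv M \<gamma> V t)"
          using C0(2)[OF q] tnorm_chart_norm[OF c tt(3)] by simp
        also have "\<dots> \<le> C0 * \<sigma> t" using \<sigma>1 C0(1) by (intro mult_left_mono) auto
        finally have cv: "norm (cov c \<gamma> V t) \<le> C0 * \<sigma> t" .
        have "norm (fc c \<gamma> V t) \<le> b + r"
          using nb[OF n] x(3) norm_triangle_sub[of "fc c \<gamma> V t" "cc (cat x) c x v"] by (simp add: Z_def)
        then have "K * (norm (vel c \<gamma> t) * norm (fc c \<gamma> V t)) \<le> K * ((C0 * \<sigma> t) * (b + r))"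
          using v K(1) by (intro mult_left_mono mult_mono) (auto intro: order_trans[OF norm_ge_zero])
        then have ch: "norm (christoffel M c (snd c (\<gamma> t)) (vel c \<gamma> t) (fc c \<gamma> V t)) \<le> K * ((C0 * \<sigma> t) * (b + r))"
          using K(2)[OF q] order_trans by blast
        have "W t = cov c \<gamma> V t - christoffel M c (snd c (\<gamma> t)) (vel c \<gamma> t) (fc c \<gamma> V t)"
          by (simp add: cov_def W_def)
        then have "norm (W t) = norm (cov c \<gamma> V t - christoffel M c (snd c (\<gamma> t)) (vel c \<gamma> t) (fc c \<gamma> V t))"
          by (rule arg_cong)
        then have "norm (W t) \<le> C0 * \<sigma> t + K * ((C0 * \<sigma> t) * (b + r))"
          using norm_triangle_ineq4[of "cov c \<gamma> V t" "christoffel M c (snd c (\<gamma> t)) (vel c \<gamma> t) (fc c \<gamma> V t)"] cv ch by linarith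
        then show ?thesis
          using norm_Pair_le[of "vel c \<gamma> t" "W t"] v unfolding C_def by (simp add: algebra_simps)
      qed
      \<comment> \<open>Closedness in two steps: the base point is confined to a compact coordinate
        ball, whose parameter set is closed, and on that set the field coordinates are
        continuous.\<close>
      let ?A = "{t\<in>{0..1}. \<gamma> t \<in> fst c \<and> snd c (\<gamma> t) \<in> cball (snd c x) r}"
      have A: "closed ?A"
        by (rule curve_ball_closed[OF cont c compact_cball]) (use r(3) r(4)[OF x(2)] in auto)
      have "continuous_on ?A (\<lambda>t. Z t - Z 0)"
        by (intro continuous_on_diff continuous_on_const continuous_on_subset[OF cT]) (auto simp: T_def)
      then have "closed (?A \<inter> (\<lambda>t. Z t - Z 0) -` cball 0 r)"
        using A by (rule continuous_closed_preimage) simp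
      moreover have "{t \<in> T. norm (Z t - Z 0) \<le> r} = ?A \<inter> (\<lambda>t. Z t - Z 0) -` cball 0 r"
      proof -
        have "norm (snd c (\<gamma> t) - snd c x) \<le> r" if "norm (Z t - Z 0) \<le> r" for t
          using nb[OF that] by (simp add: Z_def)
        then show ?thesis by (auto simp: T_def dist_commute[of "snd c x"] dist_norm[of _ "snd c x"])
      qed
      ultimately show "closed {t \<in> T. norm (Z t - Z 0) \<le> r}" by simp
      show "(\<integral>\<^sup>+t\<in>{0..1}. ennreal (\<sigma> t) \<partial>lborel) \<le> ennreal l"
        using \<gamma>(6) by (simp add: sasaki_length_def \<sigma>_def)
      show "C * l < r" using l C by (simp add: field_simps)
    qed (use S C l0 in auto)
    then have n: "1 \<in> T" "norm (Z 1 - Z 0) \<le> C * l" by auto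
    have Z: "Z 0 = (snd c x, cc (cat x) c x v)" "Z 1 = (snd c y, cc (cat y) c y w)"
      using \<gamma> by (simp_all add: Z_def field_coords_def)
    have "norm (snd c y - snd c x) \<le> C * l" "norm (cc (cat y) c y w - cc (cat x) c x v) \<le> C * l"
      using norm_fst_le[of "snd c y - snd c x" "cc (cat y) c y w - cc (cat x) c x v"]
        norm_snd_le[of "cc (cat y) c y w - cc (cat x) c x v" "snd c y - snd c x"] n(2)
      unfolding Z by simp_all
    then show ?thesis using n(1) \<gamma> by (simp add: T_def)
  qed
  then show ?thesis using C r by (intro exI[of _ C] conjI exI[of _ "r / C"]) auto
qed

lemma rdist_le_tangent_dist: "rdist M p q \<le> tangent_dist M p v q w"
  unfolding tangent_dist_def
proof (rule Inf_greatest, clarify)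
  fix \<gamma> V assume \<gamma>: "pw_C1_tcurve M \<gamma> V"
  have "rdist M (\<gamma> 0) (\<gamma> 1) \<le> curve_length M \<gamma>"
    unfolding rdist_def by (rule Inf_lower) (use \<gamma> in \<open>auto simp: pw_C1_tcurve_def\<close>)
  also have "\<dots> \<le> sasaki_length M \<gamma> V"
    unfolding curve_length_def sasaki_length_def
    by (intro nn_integral_mono mult_right_mono ennreal_leI) (auto intro: real_le_rsqrt)
  finally show "rdist M (\<gamma> 0) (\<gamma> 1) \<le> sasaki_length M \<gamma> V" .
qed

text \<open>Symmetry of the tangent distance rests on this; through \<open>seq_dist_sym\<close> it
  permits exchanging the two sequences when the inverse of the conjugacy is built.\<close>

lemma sasaki_reverse:
  assumes "pw_C1_tcurve M \<gamma> V"
  defines "\<gamma>' \<equiv> \<lambda>t. \<gamma> (1 + (- 1) * t)" and "V' \<equiv> \<lambda>t. V (1 + (- 1) * t)"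
  shows "pw_C1_tcurve M \<gamma>' V'" "sasaki_length M \<gamma>' V' = sasaki_length M \<gamma> V"
proof -
  obtain S where S: "finite S" "0 \<in> S" "1 \<in> S" "\<forall>c\<in>charts M.
      (snd c \<circ> \<gamma>) C1_differentiable_on ({t\<in>{0..1}. \<gamma> t \<in> fst c} - S) \<and>
      continuous_on {t\<in>{0..1}. \<gamma> t \<in> fst c} (fc c \<gamma> V) \<and>
      fc c \<gamma> V C1_differentiable_on ({t\<in>{0..1}. \<gamma> t \<in> fst c} - S)"
    using pw_C1_tcurve_exceptions[OF assms(1)] by blast
  note Sc = S(4)[rule_format]
  have fc': "fc c \<gamma>' V' = (\<lambda>t. fc c \<gamma> V (1 + (- 1) * t))" for c
    by (simp add: field_coords_def \<gamma>'_def V'_def fun_eq_iff)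
  have pw: "pw_C1_curve M \<gamma>" using assms(1) unfolding pw_C1_tcurve_def by blast
  have "continuous_on {t\<in>{0..1}. \<gamma>' t \<in> fst c} (fc c \<gamma>' V')" if "c \<in> charts M" for c
    unfolding fc'
    by (rule continuous_on_compose2[OF Sc[OF that, THEN conjunct2, THEN conjunct1]])
      (auto simp: \<gamma>'_def intro!: continuous_intros)
  moreover have "fc c \<gamma>' V' C1_differentiable_on ({t\<in>{0..1}. \<gamma>' t \<in> fst c} - (\<lambda>t. 1 - t) ` S)" if "c \<in> charts M" for c
    unfolding fc'
    by (rule C1_differentiable_on_affine[OF Sc[OF that, THEN conjunct2, THEN conjunct2]])
      (auto simp: image_iff \<gamma>'_def)
  ultimately show "pw_C1_tcurve M \<gamma>' V'"
    using pw_C1_curve_reverse[OF pw] S(1) unfolding pw_C1_tcurve_def \<gamma>'_def by blast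
  let ?F = "\<lambda>t. ennreal (sqrt ((tnorm M (\<gamma> t) (velocity M \<gamma> t))\<^sup>2 + (tnorm M (\<gamma> t) (cov_deriv M \<gamma> V t))\<^sup>2)) * indicator {0..1} t"
  have "sasaki_length M \<gamma>' V' = (\<integral>\<^sup>+t. ?F (1 + (- 1) * t) \<partial>lborel)"
    unfolding sasaki_length_def
  proof (rule nn_integral_cong_AE)
    have "AE t in lborel. t \<notin> (\<lambda>t. 1 - t) ` S" using S(1) by (intro AE_lborel_not_in_finite) auto
    then show "AE t in lborel. ennreal (sqrt ((tnorm M (\<gamma>' t) (velocity M \<gamma>' t))\<^sup>2 + (tnorm M (\<gamma>' t) (cov_deriv M \<gamma>' V' t))\<^sup>2)) * indicator {0..1} t
      = ?F (1 + (- 1) * t)"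
    proof eventually_elim
      case (elim t)
      show ?case
      proof (cases "t \<in> {0..1}")
        case True
        define s where "s = 1 + (- 1) * t"
        have s: "s \<in> {0..1} - S" using elim True by (auto simp: image_iff s_def)
        let ?c = "cat (\<gamma> s)"
        have g': "\<gamma>' t = \<gamma> s" by (simp add: \<gamma>'_def s_def)
        have dif: "(snd ?c \<circ> \<gamma>) differentiable (at s)" "fc ?c \<gamma> V differentiable (at s)"
          using Sc[OF cat(1)[of "\<gamma> s"]] s cat(2)[of "\<gamma> s"] unfolding C1_differentiable_on_eq by auto
        have sp: "velocity M \<gamma>' t = (- 1) *\<^sub>R velocity M \<gamma> (1 + (- 1) * t)"
          "tnorm M (\<gamma>' t) (velocity M \<gamma>' t) = \<bar>- 1\<bar> * tnorm M (\<gamma> (1 + (- 1) * t)) (velocity M \<gamma> (1 + (- 1) * t))"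
          using speed_affine[of \<gamma> 1 "- 1" t UNIV \<gamma>'] dif(1) unfolding s_def by (simp_all add: \<gamma>'_def)
        have "((\<lambda>t. 1 + (- 1) * t) has_vector_derivative - 1) (at t)" by (auto intro!: derivative_eq_intros)
        from vector_diff_chain_at[OF this, of "fc ?c \<gamma> V"] dif(2)[unfolded vector_derivative_works]
        have "(fc ?c \<gamma>' V' has_vector_derivative - vector_derivative (fc ?c \<gamma> V) (at s)) (at t)"
          unfolding fc' s_def by (simp add: o_def)
        then have "cov_deriv M \<gamma>' V' t = - cov_deriv M \<gamma> V s"
          unfolding cov_deriv_def Let_def g' using sp(1) christoffel_minus[OF cat(1), of "snd ?c (\<gamma> s)" "\<gamma> s"] cat(2)[of "\<gamma> s"]
          by (simp add: vector_derivative_at V'_def s_def)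
        then have "tnorm M (\<gamma>' t) (cov_deriv M \<gamma>' V' t) = tnorm M (\<gamma> s) (cov_deriv M \<gamma> V s)"
          using tnorm_scale[of "\<gamma> s" "- 1" "cov_deriv M \<gamma> V s"] g' by simp
        then show ?thesis using sp(2) True by (simp add: indicator_def s_def)
      qed (auto simp: indicator_def)
    qed
  qed
  also have "\<dots> = (\<integral>\<^sup>+t. ?F t \<partial>lborel)"
    using nn_integral_lborel_affine[of "- 1" ?F 1] by simp
  finally show "sasaki_length M \<gamma>' V' = sasaki_length M \<gamma> V" unfolding sasaki_length_def .
qed

lemma tangent_dist_sym: "tangent_dist M p v q w = tangent_dist M q w p v"
proof -
  have "tangent_dist M p v q w \<le> tangent_dist M q w p v" for p v q w
    unfolding tangent_dist_def[of M q w]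
  proof (rule Inf_greatest, clarify)
    fix \<gamma> V assume \<gamma>: "pw_C1_tcurve M \<gamma> V"
    show "tangent_dist M (\<gamma> 1) (V 1) (\<gamma> 0) (V 0) \<le> sasaki_length M \<gamma> V"
      unfolding tangent_dist_def sasaki_reverse(2)[OF \<gamma>, symmetric]
      by (rule Inf_lower) (use sasaki_reverse(1)[OF \<gamma>] in force)
  qed
  then show ?thesis by (intro antisym)
qed

end

section \<open>Hyperbolicity along orbits\<close>

definition ziter :: "('a \<Rightarrow> 'a) \<Rightarrow> int \<Rightarrow> 'a \<Rightarrow> 'a" where
  "ziter f n = (if 0 \<le> n then f ^^ nat n else inv f ^^ nat (- n))"

lemma ziter_0 [simp]: "ziter f 0 = id"
  by (simp add: ziter_def)

lemma ziter_nat: "ziter f (int n) = f ^^ n" "ziter f (- int n) = inv f ^^ n"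
  by (auto simp: ziter_def)

lemma ziter_Suc:
  assumes "bij f" shows "ziter f (n + 1) = f \<circ> ziter f n"
proof (cases "0 \<le> n")
  case True
  then show ?thesis by (simp add: ziter_def nat_add_distrib)
next
  case False
  define m where "m = nat (- n - 1)"
  have m: "n = - int (Suc m)" using False by (simp add: m_def)
  have "f \<circ> (inv f ^^ Suc m) = inv f ^^ m"
    using surj_f_inv_f[OF bij_is_surj[OF assms]] by (simp add: fun_eq_iff)
  moreover have "n + 1 = - int m" using m by simp
  ultimately show ?thesis unfolding m using ziter_nat(2)[of f m] ziter_nat(2)[of f "Suc m"] by simp
qed

lemma ziter_pred:
  assumes "bij f" shows "ziter f (n - 1) = inv f \<circ> ziter f n"
  using ziter_Suc[OF assms, of "n - 1"] inv_f_f[OF bij_is_inj[OF assms]] by (simp add: fun_eq_iff)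

lemma ziter_add:
  assumes "bij f" shows "ziter f (m + n) = ziter f m \<circ> ziter f n"
proof (induction m rule: int_induct[where k=0])
  case base then show ?case by simp
next
  case (step1 m)
  have "ziter f (m + 1 + n) = f \<circ> ziter f (m + n)" using ziter_Suc[OF assms, of "m + n"] by (simp add: algebra_simps)
  then show ?case using step1 ziter_Suc[OF assms, of m] by (simp add: o_assoc)
next
  case (step2 m)
  have "ziter f (m - 1 + n) = inv f \<circ> ziter f (m + n)" using ziter_pred[OF assms, of "m + n"] by (simp add: algebra_simps)
  then show ?case using step2 ziter_pred[OF assms, of m] by (simp add: o_assoc)
qed

lemma ziter_orbit:
  assumes f: "bij f" and y: "\<And>n. y (n + 1) = f (y n)"
  shows "y (m + n) = ziter f n (y m)"
proof (induction n rule: int_induct[where k=0])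
  case base then show ?case by simp
next
  case (step1 n) then show ?case using y[of "m + n"] ziter_Suc[OF f, of n] by (simp add: algebra_simps)
next
  case (step2 n)
  have "y (m + n) = f (y (m + (n - 1)))" using y[of "m + (n - 1)"] by (simp add: algebra_simps)
  then have "y (m + (n - 1)) = inv f (y (m + n))" using inv_f_f[OF bij_is_inj[OF f]] by simp
  then show ?case using step2 ziter_pred[OF f, of n] by simp
qed

section \<open>Derivatives of maps in charts\<close>

context riem
begin

definition chart_rep :: "('a, 'e) chart \<Rightarrow> ('a, 'e) chart \<Rightarrow> ('a \<Rightarrow> 'a) \<Rightarrow> 'e \<Rightarrow> 'e" where
  "chart_rep c c' g = snd c' \<circ> g \<circ> chart_inv c"

definition chart_deriv :: "('a, 'e) chart \<Rightarrow> ('a, 'e) chart \<Rightarrow> ('a \<Rightarrow> 'a) \<Rightarrow> 'a \<Rightarrow> 'e \<Rightarrow> 'e" where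
  "chart_deriv c c' g x = frechet_derivative (chart_rep c c' g) (at (snd c x))"

text \<open>Pointwise differentiability suffices for the chain rule of \<open>tmap\<close> and
  passes to compositions at once. Continuity is included because it makes preimages of chart domains
  open.\<close>

definition diffable :: "('a \<Rightarrow> 'a) \<Rightarrow> bool" where
  "diffable g \<longleftrightarrow> continuous_on UNIV g \<and> (\<forall>c\<in>charts M. \<forall>c'\<in>charts M. \<forall>x. x \<in> fst c \<longrightarrow> g x \<in> fst c' \<longrightarrow>
     chart_rep c c' g differentiable (at (snd c x)))"

lemma tmap_chart_deriv: "tmap M g x = chart_deriv (cat x) (cat (g x)) g x"
  unfolding tmap_def chart_deriv_def chart_rep_def ..

lemma chart_deriv_has:
  assumes "diffable g" "c \<in> charts M" "c' \<in> charts M" "x \<in> fst c" "g x \<in> fst c'"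
  shows "(chart_rep c c' g has_derivative chart_deriv c c' g x) (at (snd c x))"
  unfolding chart_deriv_def frechet_derivative_works[symmetric] using assms unfolding diffable_def by blast

lemma chart_deriv_linear:
  assumes "diffable g" "c \<in> charts M" "c' \<in> charts M" "x \<in> fst c" "g x \<in> fst c'"
  shows "linear (chart_deriv c c' g x)"
  using chart_deriv_has[OF assms] has_derivative_linear by blast

lemma chart_rep_apply: "c \<in> charts M \<Longrightarrow> x \<in> fst c \<Longrightarrow> chart_rep c c' g (snd c x) = snd c' (g x)"
  unfolding chart_rep_def by (simp add: chart_inv_left chart)

lemma chart_rep_chain:
  assumes c: "c \<in> charts M" "c' \<in> charts M" "x \<in> fst c" "h x \<in> fst c'"
    and h: "continuous_on UNIV h" "(chart_rep c c' h has_derivative A) (at (snd c x))"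
    and g: "(chart_rep c' c'' g has_derivative B) (at (snd c' (h x)))"
  shows "(chart_rep c c'' (g \<circ> h) has_derivative (\<lambda>v. B (A v))) (at (snd c x))"
proof -
  let ?O = "snd c ` (fst c \<inter> h -` fst c')"
  have "open (h -` fst c')" using h(1) chart_open(1)[OF chart[OF c(2)]] by (rule open_vimage[rotated])
  then have op: "open ?O" by (rule chart_open_image[OF chart[OF c(1)]])
  have "((\<lambda>y. chart_rep c' c'' g (chart_rep c c' h y)) has_derivative (\<lambda>v. B (A v))) (at (snd c x))"
    by (rule has_derivative_compose[OF h(2)]) (use g c in \<open>simp add: chart_rep_apply\<close>)
  then show ?thesis
  proof (rule has_derivative_transform_within_open[OF _ op])
    show "snd c x \<in> ?O" using c by auto
    fix y assume "y \<in> ?O"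
    then obtain z where z: "y = snd c z" "z \<in> fst c" "h z \<in> fst c'" by auto
    show "chart_rep c' c'' g (chart_rep c c' h y) = chart_rep c c'' (g \<circ> h) y"
      unfolding z(1) chart_rep_apply[OF c(1) z(2)] chart_rep_apply[OF c(2) z(3)] by simp
  qed
qed

lemma diffable_comp:
  assumes "diffable g" "diffable h" shows "diffable (g \<circ> h)"
  unfolding diffable_def
proof (intro conjI ballI allI impI)
  have cg: "continuous_on UNIV g" "continuous_on UNIV h" using assms unfolding diffable_def by auto
  then show "continuous_on UNIV (g \<circ> h)" by (intro continuous_on_compose continuous_on_subset[OF cg(1)]) auto
  fix c c' x assume c: "c \<in> charts M" "c' \<in> charts M" "x \<in> fst c" "(g \<circ> h) x \<in> fst c'"
  have gx: "g (h x) \<in> fst c'" using c(4) by simp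
  show "chart_rep c c' (g \<circ> h) differentiable at (snd c x)"
    using chart_rep_chain[OF c(1) cat(1) c(3) cat(2) cg(2) chart_deriv_has[OF assms(2) c(1) cat(1) c(3) cat(2)] chart_deriv_has[OF assms(1) cat(1) c(2) cat(2) gx]]
    by (rule differentiableI)
qed

lemma chart_deriv_comp:
  assumes g: "diffable g" and h: "diffable h"
    and c: "c \<in> charts M" "c' \<in> charts M" "c'' \<in> charts M" "x \<in> fst c" "h x \<in> fst c'" "g (h x) \<in> fst c''"
  shows "chart_deriv c c'' (g \<circ> h) x v = chart_deriv c' c'' g (h x) (chart_deriv c c' h x v)"
proof -
  have "continuous_on UNIV h" using h unfolding diffable_def by blast
  from chart_rep_chain[OF c(1,2,4,5) this chart_deriv_has[OF h c(1,2,4,5)] chart_deriv_has[OF g c(2,3,5,6)]]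
  show ?thesis unfolding chart_deriv_def[of c c'' "g \<circ> h"] by (simp add: frechet_derivative_at[symmetric])
qed

lemma chart_deriv_id: "chart_deriv c c' id x = cc c c' x"
  unfolding chart_deriv_def chart_rep_def cc_eq transition_def by simp

lemma diffable_id: "diffable id"
  unfolding diffable_def
proof (intro conjI ballI allI impI)
  fix c c' x assume c: "c \<in> charts M" "c' \<in> charts M" "x \<in> fst c" "id x \<in> fst c'"
  have "(chart_rep c c' id has_derivative cc c c' x) (at (snd c x))"
    using transition_deriv[OF c(1-3)] c(4) unfolding chart_rep_def transition_def by simp
  then show "chart_rep c c' id differentiable at (snd c x)" by (rule differentiableI)
qed (simp add: continuous_on_id)

text \<open>Writing \<open>g\<close> as \<open>id \<circ> (g \<circ> id)\<close> and applying the
  chain rule with the selected charts in the middle inserts the coordinate changes on both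
  sides.\<close>

lemma chart_deriv_change:
  assumes g: "diffable g" and c: "c \<in> charts M" "c' \<in> charts M" "x \<in> fst c" "g x \<in> fst c'"
  shows "chart_deriv c c' g x v = cc (cat (g x)) c' (g x) (tmap M g x (cc c (cat x) x v))"
proof -
  have "chart_deriv c c' (id \<circ> (g \<circ> id)) x v = chart_deriv (cat (g x)) c' id (g x) (chart_deriv c (cat (g x)) (g \<circ> id) x v)"
    using chart_deriv_comp[OF diffable_id diffable_comp[OF g diffable_id] c(1) cat(1) c(2,3), of "g x" v] cat(2) c(4) by simp
  also have "chart_deriv c (cat (g x)) (g \<circ> id) x v = chart_deriv (cat x) (cat (g x)) g x (chart_deriv c (cat x) id x v)"
    using chart_deriv_comp[OF g diffable_id c(1) cat(1)[of x] cat(1)[of "g x"] c(3), of v] cat(2) by simp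
  finally show ?thesis by (simp only: chart_deriv_id tmap_chart_deriv id_o o_id)
qed

lemma tmap_comp:
  assumes "diffable g" "diffable h"
  shows "tmap M (g \<circ> h) x v = tmap M g (h x) (tmap M h x v)"
  unfolding tmap_chart_deriv using chart_deriv_comp[OF assms cat(1) cat(1) cat(1) cat(2) cat(2) cat(2)] by simp

lemma tmap_id: "tmap M id x v = v"
  unfolding tmap_chart_deriv chart_deriv_id using cc_id[OF cat] by simp

lemma tmap_linear: "diffable g \<Longrightarrow> linear (tmap M g x)"
  unfolding tmap_chart_deriv by (rule chart_deriv_linear[OF _ cat(1) cat(1) cat(2) cat(2)])

lemma C1_map_diffable: assumes "C1_map M g" shows "diffable g"
  unfolding diffable_def
proof (intro conjI ballI allI impI)
  show "continuous_on UNIV g" using assms unfolding C1_map_def by blast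
  fix c c' x assume c: "c \<in> charts M" "c' \<in> charts M" "x \<in> fst c" "g x \<in> fst c'"
  have "Ck_on 1 (chart_rep c c' g) (snd c ` (fst c \<inter> g -` fst c'))"
    using assms c unfolding C1_map_def chart_rep_def by blast
  then show "chart_rep c c' g differentiable at (snd c x)" using c by auto
qed

lemma C1_map_chart_deriv_cont:
  assumes "C1_map M g" "c \<in> charts M" "c' \<in> charts M"
  shows "continuous_on (snd c ` (fst c \<inter> g -` fst c')) (\<lambda>y. frechet_derivative (chart_rep c c' g) (at y) v)"
proof -
  have "Ck_on 1 (chart_rep c c' g) (snd c ` (fst c \<inter> g -` fst c'))"
    using assms unfolding C1_map_def chart_rep_def by blast
  then show ?thesis by simp
qed

lemma ziter_diffable:
  assumes "C1_diffeo M f" shows "diffable (ziter f n)"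
proof -
  have d: "diffable f" "diffable (inv f)" using assms C1_map_diffable unfolding C1_diffeo_def by auto
  have "diffable (h ^^ k)" if "diffable h" for h k
    by (induction k) (use that in \<open>simp_all only: funpow.simps diffable_id diffable_comp\<close>)
  then show ?thesis unfolding ziter_def using d by auto
qed

end

section \<open>The derivative cocycle of an Anosov map and its splitting\<close>

locale anosov_map = riem M for M :: "('a::t2_space, 'e::euclidean_space) rspace" +
  fixes f :: "'a \<Rightarrow> 'a" and Es Eu :: "'a \<Rightarrow> 'e set" and C \<mu> :: real
  assumes diffeo: "C1_diffeo M f" and C: "0 < C" and \<mu>: "0 < \<mu>" "\<mu> < 1"
    and split: "\<And>x. subspace (Es x)" "\<And>x. subspace (Eu x)" "\<And>x. Es x \<inter> Eu x = {0}"
      "\<And>x. {u + v |u v. u \<in> Es x \<and> v \<in> Eu x} = UNIV"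
    and invar: "\<And>x. tmap M f x ` Es x = Es (f x)" "\<And>x. tmap M f x ` Eu x = Eu (f x)"
    and contr: "\<And>x n v. v \<in> Es x \<Longrightarrow> tnorm M ((f ^^ n) x) (tmap M (f ^^ n) x v) \<le> C * \<mu> ^ n * tnorm M x v"
      "\<And>x n v. v \<in> Eu x \<Longrightarrow> tnorm M ((inv f ^^ n) x) (tmap M (inv f ^^ n) x v) \<le> C * \<mu> ^ n * tnorm M x v"
begin

abbreviation "zf \<equiv> ziter f"

lemma bij: "bij f" using diffeo unfolding C1_diffeo_def by blast

definition D :: "int \<Rightarrow> 'a \<Rightarrow> 'e \<Rightarrow> 'e" where "D n x = tmap M (zf n) x"

lemma D_linear: "linear (D n x)"
  unfolding D_def by (intro tmap_linear ziter_diffable diffeo)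

lemma D_0: "D 0 x v = v"
  by (simp add: D_def tmap_id)

lemma D_add: "D (m + n) x v = D m (zf n x) (D n x v)"
  unfolding D_def ziter_add[OF bij] by (intro tmap_comp ziter_diffable diffeo)

lemma zf_1: "zf 1 = f"
  using ziter_nat(1)[of f 1] by simp

lemma D_1: "D 1 x = tmap M f x"
  by (simp add: D_def zf_1)

lemma zf_add: "zf m (zf n x) = zf (m + n) x"
  by (simp add: ziter_add[OF bij])

lemma D_inv: "D (- n) (zf n x) (D n x v) = v"
  using D_add[of "- n" n x v] by (simp add: D_0)

lemma D_invar_aux:
  assumes E: "\<And>x. tmap M f x ` E x = E (f x)"
  shows "v \<in> E x \<Longrightarrow> D n x v \<in> E (zf n x)"
proof (induction n arbitrary: rule: int_induct[where k=0])
  case base then show ?case by (simp add: D_0)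
next
  case (step1 n)
  have "D (n + 1) x v = tmap M f (zf n x) (D n x v)" using D_add[of 1 n x v] by (simp add: D_1 add.commute)
  moreover have "zf (n + 1) x = f (zf n x)" by (simp add: ziter_Suc[OF bij])
  ultimately show ?case using step1 E[of "zf n x"] by auto
next
  case (step2 n)
  let ?y = "zf (n - 1) x"
  have y: "zf n x = f ?y" using ziter_Suc[OF bij, of "n - 1"] by simp
  then have "D n x v \<in> tmap M f ?y ` E ?y" using step2 E[of ?y] by simp
  then obtain w where w: "w \<in> E ?y" "D n x v = tmap M f ?y w" by blast
  have "D n x v = tmap M f ?y (D (n - 1) x v)" using D_add[of 1 "n - 1" x v] by (simp add: D_1)
  then have "D (- 1) (zf 1 ?y) (D 1 ?y w) = D (- 1) (zf 1 ?y) (D 1 ?y (D (n - 1) x v))" using w(2) by (simp only: D_1)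
  then have "w = D (n - 1) x v" unfolding D_inv .
  then show ?case using w by simp
qed

lemma D_Es: "v \<in> Es x \<Longrightarrow> D n x v \<in> Es (zf n x)"
  by (rule D_invar_aux[OF invar(1)])

lemma D_Eu: "v \<in> Eu x \<Longrightarrow> D n x v \<in> Eu (zf n x)"
  by (rule D_invar_aux[OF invar(2)])

lemma D_contr:
  "v \<in> Es x \<Longrightarrow> tnorm M (zf (int n) x) (D (int n) x v) \<le> C * \<mu> ^ n * tnorm M x v"
  "v \<in> Eu x \<Longrightarrow> tnorm M (zf (- int n) x) (D (- int n) x v) \<le> C * \<mu> ^ n * tnorm M x v"
  unfolding D_def ziter_nat by (fact contr)+

definition stable_proj :: "'a \<Rightarrow> 'e \<Rightarrow> 'e" where
  "stable_proj x v = (THE s. s \<in> Es x \<and> v - s \<in> Eu x)"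

lemma split_unique: "\<exists>!s. s \<in> Es x \<and> v - s \<in> Eu x"
proof -
  have "v \<in> {u + v |u v. u \<in> Es x \<and> v \<in> Eu x}" using split(4) by simp
  then obtain s u where su: "s \<in> Es x" "u \<in> Eu x" "v = s + u" by blast
  show ?thesis
  proof (rule ex1I[of _ s])
    show "s \<in> Es x \<and> v - s \<in> Eu x" using su by simp
    fix s' assume s': "s' \<in> Es x \<and> v - s' \<in> Eu x"
    have "s' - s \<in> Es x" using subspace_diff[OF split(1)[of x], of s' s] s' su by simp
    moreover have "(v - s) - (v - s') \<in> Eu x" using subspace_diff[OF split(2)[of x], of "v - s" "v - s'"] s' su by simp
    ultimately have "s' - s \<in> Es x \<inter> Eu x" by simp
    then show "s' = s" using split(3) by simp
  qed
qed

lemma stable_proj_in: "stable_proj x v \<in> Es x" "v - stable_proj x v \<in> Eu x"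
  unfolding stable_proj_def using theI'[OF split_unique[of x v]] by blast+

lemma stable_proj_eq: "s \<in> Es x \<Longrightarrow> v - s \<in> Eu x \<Longrightarrow> stable_proj x v = s"
  unfolding stable_proj_def using the1_equality[OF split_unique] by blast

lemma stable_proj_linear: "linear (stable_proj x)"
proof (rule linearI)
  fix a b
  have "(a + b) - (stable_proj x a + stable_proj x b) = (a - stable_proj x a) + (b - stable_proj x b)" by simp
  then have "(a + b) - (stable_proj x a + stable_proj x b) \<in> Eu x" using stable_proj_in(2) split(2) subspace_add by metis
  then show "stable_proj x (a + b) = stable_proj x a + stable_proj x b" using stable_proj_in(1) split(1) by (intro stable_proj_eq subspace_add)
next
  fix r a
  have "r *\<^sub>R a - r *\<^sub>R stable_proj x a = r *\<^sub>R (a - stable_proj x a)" by (simp add: scaleR_diff_right)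
  then have "r *\<^sub>R a - r *\<^sub>R stable_proj x a \<in> Eu x" using stable_proj_in(2) split(2) subspace_scale by metis
  then show "stable_proj x (r *\<^sub>R a) = r *\<^sub>R stable_proj x a" using stable_proj_in(1) split(1) by (intro stable_proj_eq subspace_scale)
qed

lemma D_stable_proj: "D n x (stable_proj x v) = stable_proj (zf n x) (D n x v)"
proof (rule stable_proj_eq[symmetric])
  show "D n x (stable_proj x v) \<in> Es (zf n x)" by (intro D_Es stable_proj_in)
  have "D n x v - D n x (stable_proj x v) = D n x (v - stable_proj x v)" by (rule linear_diff[OF D_linear, symmetric])
  then show "D n x v - D n x (stable_proj x v) \<in> Eu (zf n x)" using D_Eu[OF stable_proj_in(2)] by simp
qed

lemma tnorm_triangle: "tnorm M x (u + v) \<le> tnorm M x u + tnorm M x v"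
proof -
  have B: "bilinear (riem_metric M x)" and s: "\<And>u v. riem_metric M x u v = riem_metric M x v u"
    using riem_inner[of x] unfolding inner_product_def by auto
  have p: "0 \<le> riem_metric M x v v" for v using tnorm_nonneg[of x v] unfolding tnorm_def by simp
  let ?a = "riem_metric M x u u" and ?b = "riem_metric M x u v" and ?d = "riem_metric M x v v"
  have q: "0 \<le> ?a + 2 * t * ?b + t\<^sup>2 * ?d" for t
    using p[of "u + t *\<^sub>R v"] s[of v u]
    by (simp add: bilinear_ladd[OF B] bilinear_radd[OF B] bilinear_lmul[OF B] bilinear_rmul[OF B] power2_eq_square algebra_simps)
  have "?b\<^sup>2 \<le> ?a * ?d"
  proof (cases "?d = 0")
    case True
    have "v = 0" using True riem_inner[of x] unfolding inner_product_def by force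
    then show ?thesis by (simp add: bilinear_rzero[OF B])
  next
    case False
    then have "0 < ?d" using p[of v] by simp
    then show ?thesis using q[of "- ?b / ?d"] by (simp add: field_simps power2_eq_square)
  qed
  then have "\<bar>?b\<bar> \<le> sqrt ?a * sqrt ?d" by (metis real_sqrt_abs real_sqrt_le_iff real_sqrt_mult)
  then have "?a + 2 * ?b + ?d \<le> (sqrt ?a + sqrt ?d)\<^sup>2"
    using p[of u] p[of v] by (simp add: power2_sum)
  then have "riem_metric M x (u + v) (u + v) \<le> (sqrt ?a + sqrt ?d)\<^sup>2"
    using s[of v u] by (simp add: bilinear_ladd[OF B] bilinear_radd[OF B])
  then show ?thesis unfolding tnorm_def using p by (intro real_le_lsqrt) auto
qed

text \<open>The angle between the stable and unstable spaces is bounded away from 0, because a bounded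
  number of steps suffices to make the two components of a vector of different size.\<close>

lemma stable_proj_bounded:
  assumes B: "1 \<le> B" "\<And>x v. tnorm M (zf 1 x) (D 1 x v) \<le> B * tnorm M x v"
    "\<And>x v. tnorm M (zf (- 1) x) (D (- 1) x v) \<le> B * tnorm M x v"
  shows "\<exists>K>0. \<forall>x v. tnorm M x (stable_proj x v) \<le> K * tnorm M x v \<and> tnorm M x (v - stable_proj x v) \<le> K * tnorm M x v"
proof -
  have Bn: "tnorm M (zf (int n) x) (D (int n) x v) \<le> B ^ n * tnorm M x v" for n x v
  proof (induction n)
    case 0 then show ?case by (simp add: D_0)
  next
    case (Suc n)
    have "tnorm M (zf (int (Suc n)) x) (D (int (Suc n)) x v)
        = tnorm M (zf 1 (zf (int n) x)) (D 1 (zf (int n) x) (D (int n) x v))"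
      using D_add[of 1 "int n" x v] by (simp add: zf_add)
    also have "\<dots> \<le> B * (B ^ n * tnorm M x v)"
      using B(2)[of "zf (int n) x"] Suc B(1) by (meson mult_left_mono order_trans zero_le_one)
    finally show ?case by (simp add: mult.assoc)
  qed
  have Bn': "tnorm M (zf (- int n) x) (D (- int n) x v) \<le> B ^ n * tnorm M x v" for n x v
  proof (induction n)
    case 0 then show ?case by (simp add: D_0)
  next
    case (Suc n)
    have "tnorm M (zf (- int (Suc n)) x) (D (- int (Suc n)) x v)
        = tnorm M (zf (- 1) (zf (- int n) x)) (D (- 1) (zf (- int n) x) (D (- int n) x v))"
      using D_add[of "- 1" "- int n" x v] by (simp add: zf_add)
    also have "\<dots> \<le> B * (B ^ n * tnorm M x v)"
      using B(3)[of "zf (- int n) x"] Suc B(1) by (meson mult_left_mono order_trans zero_le_one)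
    finally show ?case by (simp add: mult.assoc)
  qed
  have tm: "tnorm M x (- w) = tnorm M x w" for x w using tnorm_scale[of x "- 1" w] by simp
  \<comment> \<open>After \<open>N\<close> steps the factor \<open>C * \<mu> ^ N\<close> is at most
    1/3. In the right time direction one component grows at least threefold while the other shrinks
    to a third, so the image of their sum cannot be small.\<close>
  obtain N where N: "\<mu> ^ N < 1 / (3 * C + 3)" using real_arch_pow_inv[of "1 / (3 * C + 3)" \<mu>] C \<mu> by auto
  have CN: "C * \<mu> ^ N \<le> 1 / 3"
  proof -
    have "\<mu> ^ N * (3 * C + 3) < 1" using N C by (simp add: field_simps)
    moreover have "0 \<le> \<mu> ^ N" using \<mu> by simp
    ultimately show ?thesis by (simp add: algebra_simps)
  qed
  text \<open>The larger component \<open>a\<close> dominates after \<open>N\<close> steps in the direction in which \<open>b\<close> contracts.\<close>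
  have key: "tnorm M x a \<le> B ^ N * tnorm M x (a + b)"
    if ab: "tnorm M x b \<le> tnorm M x a" and
      a: "tnorm M x a \<le> C * \<mu> ^ N * tnorm M y (T a)" and b: "tnorm M y (T b) \<le> C * \<mu> ^ N * tnorm M x b"
      and T: "linear T" "tnorm M y (T (a + b)) \<le> B ^ N * tnorm M x (a + b)" for a b x y T
  proof -
    have "tnorm M y (T a) \<le> tnorm M y (T (a + b)) + tnorm M y (T b)"
      using tnorm_triangle[of y "T (a + b)" "- T b"] tm linear_add[OF T(1)] by simp
    moreover have "C * \<mu> ^ N * tnorm M x b \<le> 1 / 3 * tnorm M x a"
      using CN ab C \<mu> tnorm_nonneg by (intro mult_mono) auto
    moreover have "tnorm M x a \<le> 1 / 3 * tnorm M y (T a)"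
      using order_trans[OF a mult_right_mono[OF CN tnorm_nonneg]] by simp
    ultimately show ?thesis using T(2) b tnorm_nonneg[of x a] by linarith
  qed
  \<comment> \<open>If the unstable part dominates, look forward in time, otherwise backward: the
    dominating part is expanded in that direction.\<close>
  have "tnorm M x s \<le> B ^ N * tnorm M x (s + u) \<and> tnorm M x u \<le> B ^ N * tnorm M x (s + u)"
    if s: "s \<in> Es x" and u: "u \<in> Eu x" for x s u
  proof (cases "tnorm M x s \<le> tnorm M x u")
    case True
    have "u = D (- int N) (zf (int N) x) (D (int N) x u)" by (rule D_inv[symmetric])
    then have "tnorm M x u \<le> C * \<mu> ^ N * tnorm M (zf (int N) x) (D (int N) x u)"
      using D_contr(2)[OF D_Eu[OF u, of "int N"], of N] by (simp add: zf_add)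
    from key[OF True this D_contr(1)[OF s] D_linear Bn] True show ?thesis by (simp add: add.commute)
  next
    case False
    then have le: "tnorm M x u \<le> tnorm M x s" by simp
    have "s = D (int N) (zf (- int N) x) (D (- int N) x s)" using D_inv[of "- int N" x s] by simp
    then have "tnorm M x s \<le> C * \<mu> ^ N * tnorm M (zf (- int N) x) (D (- int N) x s)"
      using D_contr(1)[OF D_Es[OF s, of "- int N"], of N] by (simp add: zf_add)
    from key[OF le this D_contr(2)[OF u] D_linear Bn'] le show ?thesis by simp
  qed
  note aux = this
  have "tnorm M x (stable_proj x v) \<le> B ^ N * tnorm M x v \<and> tnorm M x (v - stable_proj x v) \<le> B ^ N * tnorm M x v" for x v
    using aux[OF stable_proj_in(1)[where x=x and v=v] stable_proj_in(2)[where x=x and v=v]] by simp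
  then show ?thesis using B(1) by (intro exI[of _ "B ^ N"]) auto
qed

text \<open>All times are transported to the tangent space at \<open>y 0\<close>, so that one
  projection serves the whole orbit; \<open>D_stable_proj\<close> moves the estimates back to
  \<open>y n\<close>. In \<open>K * C * B * K\<close> the outer factors convert between coordinates
  and Riemannian norm, \<open>C\<close> comes from the hyperbolicity and \<open>B\<close> bounds the
  projections.\<close>

lemma orbit_admissible:
  assumes y: "\<And>n. y (n + 1) = f (y n)"
    and c: "\<And>n. c n \<in> charts M" "\<And>n. y n \<in> fst (c n)"
    and K: "0 < K" "\<And>n v. norm (cc (cat (y n)) (c n) (y n) v) \<le> K * tnorm M (y n) v"
      "\<And>n v. tnorm M (y n) v \<le> K * norm (cc (cat (y n)) (c n) (y n) v)"
    and B: "0 < B" "\<And>x v. tnorm M x (stable_proj x v) \<le> B * tnorm M x v" "\<And>x v. tnorm M x (v - stable_proj x v) \<le> B * tnorm M x v"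
  shows "admissible (2 * (K * C * B * K) / (1 - \<mu>)) (\<lambda>n. chart_deriv (c n) (c (n + 1)) f (y n))"
proof -
  have yz: "y (m + n) = zf n (y m)" for m n by (rule ziter_orbit[of f y, OF bij y])
  have y0: "y n = zf n (y 0)" for n using yz[of 0 n] by simp
  define L where "L n w = cc (cat (y n)) (c n) (y n) (D n (y 0) w)" for n w
  define L' where "L' n w = D (- n) (y n) (cc (c n) (cat (y n)) (y n) w)" for n w
  have lin1: "linear (cc (cat (y n)) (c n) (y n))" "linear (cc (c n) (cat (y n)) (y n))" for n
    by (intro cc_linear c cat)+
  have ci: "cc (cat (y n)) (c n) (y n) (cc (c n) (cat (y n)) (y n) w) = w"
    "cc (c n) (cat (y n)) (y n) (cc (cat (y n)) (c n) (y n) w) = w" for n w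
    by (intro cc_inv c cat)+
  have Di: "D n (y 0) (D (- n) (y n) w) = w" for n w
    using D_inv[of "- n" "y n" w] yz[of n "- n"] by simp
  have Di': "D (- n) (y n) (D n (y 0) w) = w" for n w
    using D_inv[of n "y 0" w] y0[of n] by simp
  have DD: "D (n + k) (y 0) (D (- n) (y n) w) = D k (y n) w" for n k w
    using D_add[of k n "y 0" "D (- n) (y n) w"] unfolding y0[of n, symmetric] Di by (simp add: add.commute)
  have tnE: "tnorm M (y n) (cc (c n) (cat (y n)) (y n) w) \<le> K * norm w" for n w
    using K(3)[of n "cc (c n) (cat (y n)) (y n) w"] ci by simp
  have PB: "tnorm M (y n) (stable_proj (y n) (cc (c n) (cat (y n)) (y n) w)) \<le> B * (K * norm w)"
    "tnorm M (y n) (cc (c n) (cat (y n)) (y n) w - stable_proj (y n) (cc (c n) (cat (y n)) (y n) w)) \<le> B * (K * norm w)" for n w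
    by (rule order_trans[OF B(2) mult_left_mono[OF tnE]] order_trans[OF B(3) mult_left_mono[OF tnE]], use B(1) in simp)+
  have "admissible (2 * (K * C * B * K) / (1 - \<mu>)) (\<lambda>n w. L (n + 1) (L' n w))"
  proof (rule dichotomy_admissible[where L=L and L'=L' and P="stable_proj (y 0)"])
    show "linear (L n)" "linear (L' n)" for n
      using linear_compose[OF D_linear lin1(1)] linear_compose[OF lin1(2) D_linear]
      unfolding L_def L'_def o_def by auto
    show "linear (stable_proj (y 0))" by (rule stable_proj_linear)
    show "L n (L' n w) = w" "L' n (L n w) = w" for n w unfolding L_def L'_def by (simp_all add: ci Di Di')
    show "0 \<le> K * C * B * K" using K C B by simp
    show "0 < \<mu>" "\<mu> < 1" by (fact \<mu>)+
    fix n k w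
    let ?z = "\<lambda>n. cc (c n) (cat (y n)) (y n) w"
    have "stable_proj (y 0) (L' n w) = D (- n) (y n) (stable_proj (y n) (?z n))"
      unfolding L'_def using D_stable_proj[of "- n" "y n" "?z n"] yz[of n "- n"] by simp
    then have "L (n + int k) (stable_proj (y 0) (L' n w)) = cc (cat (y (n + int k))) (c (n + int k)) (y (n + int k)) (D (int k) (y n) (stable_proj (y n) (?z n)))"
      unfolding L_def by (simp add: DD)
    then have "norm (L (n + int k) (stable_proj (y 0) (L' n w))) \<le> K * tnorm M (y (n + int k)) (D (int k) (y n) (stable_proj (y n) (?z n)))"
      using K(2) by simp
    also have "\<dots> \<le> K * (C * \<mu> ^ k * tnorm M (y n) (stable_proj (y n) (?z n)))"
      using D_contr(1)[OF stable_proj_in(1), of k "y n" "?z n"] yz[of n "int k"] K(1) by (intro mult_left_mono) auto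
    also have "\<dots> \<le> K * (C * \<mu> ^ k * (B * (K * norm w)))"
      using PB(1)[of n w] K(1) C \<mu> by (intro mult_left_mono) auto
    finally show "norm (L (n + int k) (stable_proj (y 0) (L' n w))) \<le> K * C * B * K * \<mu> ^ k * norm w" by (simp add: mult_ac)
    let ?m = "n + int k"
    have "L' ?m w - stable_proj (y 0) (L' ?m w) = D (- ?m) (y ?m) (?z ?m - stable_proj (y ?m) (?z ?m))"
      unfolding L'_def using D_stable_proj[of "- ?m" "y ?m" "?z ?m"] yz[of ?m "- ?m"] linear_diff[OF D_linear] by simp
    moreover have "D n (y 0) (D (- ?m) (y ?m) u) = D (- int k) (y ?m) u" for u
      using DD[of ?m "- int k" u] by simp
    ultimately have "L n (L' ?m w - stable_proj (y 0) (L' ?m w)) = cc (cat (y n)) (c n) (y n) (D (- int k) (y ?m) (?z ?m - stable_proj (y ?m) (?z ?m)))"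
      unfolding L_def by simp
    then have "norm (L n (L' ?m w - stable_proj (y 0) (L' ?m w))) \<le> K * tnorm M (y n) (D (- int k) (y ?m) (?z ?m - stable_proj (y ?m) (?z ?m)))"
      using K(2) by simp
    also have "\<dots> \<le> K * (C * \<mu> ^ k * tnorm M (y ?m) (?z ?m - stable_proj (y ?m) (?z ?m)))"
      using D_contr(2)[OF stable_proj_in(2), of k "y ?m" "?z ?m"] yz[of ?m "- int k"] K(1) by (intro mult_left_mono) auto
    also have "\<dots> \<le> K * (C * \<mu> ^ k * (B * (K * norm w)))"
      using PB(2)[of ?m w] K(1) C \<mu> by (intro mult_left_mono) auto
    finally show "norm (L n (L' ?m w - stable_proj (y 0) (L' ?m w))) \<le> K * C * B * K * \<mu> ^ k * norm w" by (simp add: mult_ac)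
  qed
  moreover have "L (n + 1) (L' n w) = chart_deriv (c n) (c (n + 1)) f (y n) w" for n w
  proof -
    have df: "diffable f" using diffeo C1_map_diffable unfolding C1_diffeo_def by blast
    have "f (y n) \<in> fst (c (n + 1))" using c(2)[of "n + 1"] y by simp
    from chart_deriv_change[OF df c(1) c(1) c(2) this] show ?thesis
      unfolding L_def L'_def by (simp add: DD D_1 y)
  qed
  ultimately show ?thesis by simp
qed

end

section \<open>Uniform constants from a finite atlas\<close>

text \<open>\<open>C\<close> may grow and \<open>\<delta>\<close> may shrink, so maximum and minimum
  over the finite index set work. Applications with a single constant pass a dummy for the
  other.\<close>

lemma finite_uniform_constants:
  fixes Q :: "'i \<Rightarrow> real \<Rightarrow> real \<Rightarrow> bool"
  assumes "finite I" and ex: "\<And>i. i \<in> I \<Longrightarrow> \<exists>C>0. \<exists>\<delta>>0. Q i C \<delta>"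
    and mono: "\<And>i C C' \<delta> \<delta>'. Q i C \<delta> \<Longrightarrow> C \<le> C' \<Longrightarrow> 0 < \<delta>' \<Longrightarrow> \<delta>' \<le> \<delta> \<Longrightarrow> Q i C' \<delta>'"
  shows "\<exists>C>0. \<exists>\<delta>>0. \<forall>i\<in>I. Q i C \<delta>"
  using assms(1,2)
proof (induction I)
  case empty show ?case using zero_less_one by blast
next
  case (insert i I)
  obtain C \<delta> where C: "0 < C" "0 < \<delta>" "\<forall>i\<in>I. Q i C \<delta>" using insert by blast
  obtain C' \<delta>' where C': "0 < C'" "0 < \<delta>'" "Q i C' \<delta>'" using insert.prems[of i] by blast
  have "Q j (max C C') (min \<delta> \<delta>')" if "j \<in> insert i I" for j
  proof (cases "j = i")
    case True
    show ?thesis unfolding True by (rule mono[OF C'(3)]) (use C C' in auto)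
  next
    case False
    then have "Q j C \<delta>" using that C(3) by auto
    then show ?thesis by (rule mono) (use C C' in auto)
  qed
  then show ?case using C C' by (intro exI[of _ "max C C'"] conjI exI[of _ "min \<delta> \<delta>'"]) auto
qed

lemma linear_family_basis_bound:
  fixes A :: "'e::euclidean_space \<Rightarrow> 'f::real_normed_vector"
  assumes "linear A" "\<And>b. b \<in> Basis \<Longrightarrow> norm (A b) \<le> \<kappa>"
  shows "norm (A v) \<le> real DIM('e) * \<kappa> * norm v"
proof -
  have "A v = A (\<Sum>b\<in>Basis. (v \<bullet> b) *\<^sub>R b)" by (simp add: euclidean_representation)
  also have "\<dots> = (\<Sum>b\<in>Basis. (v \<bullet> b) *\<^sub>R A b)" by (simp add: linear_sum[OF assms(1)] linear_scale[OF assms(1)])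
  also have "norm \<dots> \<le> (\<Sum>b\<in>(Basis :: 'e set). \<kappa> * norm v)"
  proof (rule sum_norm_le)
    fix b :: 'e assume b: "b \<in> Basis"
    have "\<bar>v \<bullet> b\<bar> * norm (A b) \<le> norm v * \<kappa>"
      using Basis_le_norm[OF b, of v] assms(2)[OF b] by (intro mult_mono) auto
    then show "norm ((v \<bullet> b) *\<^sub>R A b) \<le> \<kappa> * norm v" by (simp add: mult.commute)
  qed
  finally show ?thesis by simp
qed

lemma linear_family_bounded:
  fixes A :: "'e::euclidean_space \<Rightarrow> 'e \<Rightarrow> 'e"
  assumes Q: "compact Q" and lin: "\<And>y. y \<in> Q \<Longrightarrow> linear (A y)" and cont: "\<And>v. continuous_on Q (\<lambda>y. A y v)"
  shows "\<exists>a>0. \<forall>y\<in>Q. \<forall>v. norm (A y v) \<le> a * norm v"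
proof -
  have "bounded ((\<lambda>y. A y v) ` Q)" for v
    by (intro compact_imp_bounded compact_continuous_image cont Q)
  then have "\<exists>k. \<forall>y\<in>Q. norm (A y v) \<le> k" for v unfolding bounded_iff by auto
  then obtain k where k: "\<And>v y. y \<in> Q \<Longrightarrow> norm (A y v) \<le> k v" by metis
  define k0 where "k0 = (\<Sum>b\<in>Basis. \<bar>k b\<bar>)"
  have kb: "k b \<le> k0" if "b \<in> Basis" for b
    unfolding k0_def using member_le_sum[OF that, of "\<lambda>b. \<bar>k b\<bar>"] by auto
  have k0: "0 \<le> k0" unfolding k0_def by (intro sum_nonneg) auto
  have "norm (A y v) \<le> (real DIM('e) * k0 + 1) * norm v" if y: "y \<in> Q" for y v
  proof -
    have "norm (A y v) \<le> real DIM('e) * k0 * norm v"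
      by (rule linear_family_basis_bound[OF lin[OF y]]) (use k[OF y] kb order_trans in blast)
    then show ?thesis by (simp add: distrib_right add_increasing2)
  qed
  then show ?thesis using k0 by (intro exI[of _ "real DIM('e) * k0 + 1"]) (auto intro: add_nonneg_pos)
qed

text \<open>Uniform continuity on a compact thickening, applied to the finitely many basis vectors;
  the dimension factor lost in passing to all vectors is put into \<open>e\<close>.\<close>

lemma linear_family_uniform:
  fixes A :: "'e::euclidean_space \<Rightarrow> 'e \<Rightarrow> 'e"
  assumes \<Omega>: "open \<Omega>" and \<Xi>: "compact \<Xi>" "\<Xi> \<subseteq> \<Omega>" and lin: "\<And>y. y \<in> \<Omega> \<Longrightarrow> linear (A y)"
    and cont: "\<And>v. continuous_on \<Omega> (\<lambda>y. A y v)" and \<kappa>: "0 < \<kappa>"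
  shows "\<exists>\<rho>>0. \<forall>\<xi>\<in>\<Xi>. \<forall>\<eta>. norm (\<eta> - \<xi>) \<le> \<rho> \<longrightarrow> \<eta> \<in> \<Omega> \<and> (\<forall>v. norm (A \<eta> v - A \<xi> v) \<le> \<kappa> * norm v)"
proof -
  obtain r Q where r: "0 < r" "compact Q" "Q \<subseteq> \<Omega>" "\<And>x. x \<in> \<Xi> \<Longrightarrow> cball x r \<subseteq> Q"
    using compact_thickening[OF \<Xi>(1) \<Omega> \<Xi>(2)] by blast
  define e where "e = \<kappa> / real DIM('e)"
  have e: "0 < e" using \<kappa> by (simp add: e_def)
  have "\<exists>d>0. \<forall>x\<in>Q. \<forall>y\<in>Q. dist y x < d \<longrightarrow> dist (A y v) (A x v) < e" for v
    using compact_uniformly_continuous[OF continuous_on_subset[OF cont r(3)] r(2), of v] e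
    unfolding uniformly_continuous_on_def by blast
  then obtain d where d: "\<And>v. 0 < d v" "\<And>v x y. x \<in> Q \<Longrightarrow> y \<in> Q \<Longrightarrow> dist y x < d v \<Longrightarrow> dist (A y v) (A x v) < e" by metis
  define \<rho> where "\<rho> = min r (Min (d ` Basis) / 2)"
  have Min: "0 < Min (d ` Basis)" using d(1) by (subst Min_gr_iff) auto
  have \<rho>: "0 < \<rho>" "\<rho> \<le> r" using r Min by (auto simp: \<rho>_def)
  have \<rho>d: "\<rho> < d b" if "b \<in> Basis" for b
  proof -
    have "Min (d ` Basis) \<le> d b" using that by (intro Min_le) auto
    then show ?thesis using Min unfolding \<rho>_def by linarith
  qed
  have "\<eta> \<in> \<Omega> \<and> (\<forall>v. norm (A \<eta> v - A \<xi> v) \<le> \<kappa> * norm v)" if \<xi>: "\<xi> \<in> \<Xi>" and \<eta>: "norm (\<eta> - \<xi>) \<le> \<rho>" for \<xi> \<eta>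
  proof -
    have "\<eta> \<in> cball \<xi> r" using \<eta> \<rho>(2) by (simp add: dist_norm norm_minus_commute)
    then have \<eta>Q: "\<eta> \<in> Q" using r(4)[OF \<xi>] by blast
    have \<xi>Q: "\<xi> \<in> Q" using r(4)[OF \<xi>] r(1) by auto
    have lin': "linear (\<lambda>v. A \<eta> v - A \<xi> v)" using lin \<eta>Q \<xi>Q r(3) by (intro linear_compose_sub) auto
    have "norm (A \<eta> v - A \<xi> v) \<le> real DIM('e) * e * norm v" for v
    proof (rule linear_family_basis_bound[OF lin'])
      fix b :: 'e assume "b \<in> Basis"
      then have "dist \<eta> \<xi> < d b" using \<eta> \<rho>d[of b] by (simp add: dist_norm)
      from d(2)[OF \<xi>Q \<eta>Q this] show "norm (A \<eta> b - A \<xi> b) \<le> e" by (simp add: dist_norm)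
    qed
    then show ?thesis using \<eta>Q r(3) by (auto simp: e_def)
  qed
  then show ?thesis using \<rho>(1) by blast
qed

context riem
begin

text \<open>Each chart contains a coordinate ball of radius \<open>3 * rad i\<close>; one third is
  used for the cover, and the rest leaves a common margin \<open>2 * r0\<close>, since
  \<open>r0\<close> is the smallest of the finitely many radii.\<close>

lemma exists_finite_atlas:
  assumes cpt: "compact (UNIV :: 'a set)"
  shows "\<exists>(I :: 'a set) rad r0. finite I \<and> 0 < (r0 :: real) \<and>
    (\<forall>i\<in>I. cball (snd (cat i) i) (rad i + 2 * r0) \<subseteq> snd (cat i) ` fst (cat i)) \<and>
    (\<forall>x. \<exists>i\<in>I. x \<in> fst (cat i) \<and> norm (snd (cat i) x - snd (cat i) i) \<le> rad i)"
proof -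
  have "\<exists>r>0. cball (snd (cat i) i) (3 * r) \<subseteq> snd (cat i) ` fst (cat i)" for i
  proof -
    have "snd (cat i) i \<in> snd (cat i) ` fst (cat i)" using cat(2) by blast
    then obtain e where "0 < e" "cball (snd (cat i) i) e \<subseteq> snd (cat i) ` fst (cat i)"
      using chart_open(2)[OF chart[OF cat(1)]] open_contains_cball by blast
    then show ?thesis by (intro exI[of _ "e / 3"]) auto
  qed
  then obtain rad where rad: "\<And>i. 0 < rad i" "\<And>i. cball (snd (cat i) i) (3 * rad i) \<subseteq> snd (cat i) ` fst (cat i)" by metis
  define V where "V i = fst (cat i) \<inter> snd (cat i) -` ball (snd (cat i) i) (rad i)" for i
  have V: "open (V i)" for i unfolding V_def by (rule chart_vimage_open[OF chart[OF cat(1)] open_ball])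
  have iV: "i \<in> V i" for i unfolding V_def using cat(2) rad(1) by simp
  then have cov: "UNIV \<subseteq> (\<Union>i\<in>UNIV. V i)" by blast
  have "\<exists>K\<subseteq>UNIV. finite K \<and> UNIV \<subseteq> (\<Union>i\<in>K. V i)"
    by (rule compactE_image[OF cpt V cov]) (intro exI conjI)
  then obtain I where I: "finite I" "UNIV \<subseteq> (\<Union>i\<in>I. V i)" by blast
  have Ine: "I \<noteq> {}" using I(2) by auto
  define r0 where "r0 = Min (rad ` I)"
  have r0: "0 < r0" "\<And>i. i \<in> I \<Longrightarrow> r0 \<le> rad i" using I Ine rad(1) by (auto simp: r0_def)
  show ?thesis
  proof (intro exI[of _ I] exI[of _ rad] exI[of _ r0] conjI ballI allI)
    fix i assume "i \<in> I"
    then have "cball (snd (cat i) i) (rad i + 2 * r0) \<subseteq> cball (snd (cat i) i) (3 * rad i)"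
      using r0(2)[of i] by (intro subset_cball) simp
    then show "cball (snd (cat i) i) (rad i + 2 * r0) \<subseteq> snd (cat i) ` fst (cat i)" using rad(2) by blast
  next
    fix x
    obtain i where "i \<in> I" "x \<in> V i" using I(2) by blast
    then show "\<exists>i\<in>I. x \<in> fst (cat i) \<and> norm (snd (cat i) x - snd (cat i) i) \<le> rad i"
      by (intro bexI[of _ i]) (auto simp: V_def dist_norm norm_minus_commute)
  qed (fact I(1), fact r0(1))
qed

end

locale fin_atlas = riem M for M :: "('a::t2_space, 'e::euclidean_space) rspace" +
  fixes I :: "'a set" and rad :: "'a \<Rightarrow> real" and r0 :: real
  assumes fin: "finite I" and r0: "0 < r0"
    and ball_in: "\<And>i. i \<in> I \<Longrightarrow> cball (snd (cat i) i) (rad i + 2 * r0) \<subseteq> snd (cat i) ` fst (cat i)"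
    and cover: "\<And>x. \<exists>i\<in>I. x \<in> fst (cat i) \<and> norm (snd (cat i) x - snd (cat i) i) \<le> rad i"
begin

abbreviation "ph i \<equiv> snd (cat i)"
abbreviation "phi i \<equiv> chart_inv (cat i)"

text \<open>The second argument measures how much of the margin is used: 0 for points of the cover,
  \<open>r0 / 2\<close> for images of pseudo-orbit points, \<open>r0\<close> where perturbations are
  compared with \<open>f\<close>, and \<open>2 * r0\<close> for the images that result.\<close>

definition chart_ball :: "'a \<Rightarrow> real \<Rightarrow> 'a set" where
  "chart_ball i s = {x \<in> fst (cat i). norm (ph i x - ph i i) \<le> rad i + s}"

lemma chart_ball_cover: "\<exists>i\<in>I. x \<in> chart_ball i 0"
  using cover[of x] by (simp add: chart_ball_def)

lemma chart_ball_dom: "x \<in> chart_ball i s \<Longrightarrow> x \<in> fst (cat i)"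
  by (simp add: chart_ball_def)

lemma chart_ball_mono: "x \<in> chart_ball i s \<Longrightarrow> s \<le> t \<Longrightarrow> x \<in> chart_ball i t"
  by (simp add: chart_ball_def)

lemma chart_ball_cball: "x \<in> chart_ball i s \<Longrightarrow> ph i x \<in> cball (ph i i) (rad i + s)"
  by (simp add: chart_ball_def dist_norm norm_minus_commute)

lemma chart_ball_near:
  assumes "x \<in> chart_ball i s" "y \<in> fst (cat i)" "norm (ph i y - ph i x) \<le> t" shows "y \<in> chart_ball i (s + t)"
proof -
  have "norm (ph i y - ph i i) \<le> norm (ph i y - ph i x) + norm (ph i x - ph i i)"
    using norm_triangle_ineq[of "ph i y - ph i x" "ph i x - ph i i"] by simp
  then show ?thesis using assms by (simp add: chart_ball_def)
qed

lemma phi_ph: "x \<in> fst (cat i) \<Longrightarrow> phi i (ph i x) = x"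
  by (rule chart_inv_left[OF chart[OF cat(1)]])

lemma cball_image: "i \<in> I \<Longrightarrow> s \<le> 2 * r0 \<Longrightarrow> cball (ph i i) (rad i + s) \<subseteq> ph i ` fst (cat i)"
  by (rule order_trans[OF subset_cball ball_in]) auto

lemma phi_chart_ball:
  assumes "i \<in> I" "s \<le> 2 * r0" "\<eta> \<in> cball (ph i i) (rad i + s)"
  shows "phi i \<eta> \<in> chart_ball i s" "ph i (phi i \<eta>) = \<eta>"
proof -
  have e: "\<eta> \<in> ph i ` fst (cat i)" using cball_image[OF assms(1,2)] assms(3) by blast
  show r: "ph i (phi i \<eta>) = \<eta>" by (rule chart_inv_right[OF chart[OF cat(1)] e])
  show "phi i \<eta> \<in> chart_ball i s"
    unfolding chart_ball_def using chart_inv_in[OF chart[OF cat(1)] e] assms(3) r by (simp add: dist_norm norm_minus_commute)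
qed

lemma chart_ball_closed: "i \<in> I \<Longrightarrow> s \<le> 2 * r0 \<Longrightarrow> closed (chart_ball i s)"
  using chart_compact_vimage[OF chart[OF cat(1)] compact_cball cball_image, of i s]
  by (simp add: chart_ball_def dist_norm norm_minus_commute)

lemma norm_comparison:
  "\<exists>K>0. \<forall>i\<in>I. \<forall>x\<in>chart_ball i (2 * r0). \<forall>v. norm (cc (cat x) (cat i) x v) \<le> K * tnorm M x v \<and>
      tnorm M x v \<le> K * norm (cc (cat x) (cat i) x v)"
proof -
  define Q where "Q i K \<delta> \<longleftrightarrow> (\<forall>x\<in>chart_ball i (2 * r0). \<forall>v. norm (cc (cat x) (cat i) x v) \<le> K * tnorm M x v \<and>
      tnorm M x v \<le> K * norm (cc (cat x) (cat i) x v))" for i and K \<delta> :: real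
  have "\<exists>K>0. \<exists>\<delta>>0. \<forall>i\<in>I. Q i K \<delta>"
  proof (rule finite_uniform_constants[OF fin])
    fix i assume i: "i \<in> I"
    obtain C where C: "0 < C" "\<And>y u. y \<in> cball (ph i i) (rad i + 2 * r0) \<Longrightarrow> norm u \<le> C * chart_norm (cat i) y u"
      "\<And>y u. y \<in> cball (ph i i) (rad i + 2 * r0) \<Longrightarrow> chart_norm (cat i) y u \<le> C * norm u"
      using chart_norm_compare[OF cat(1) compact_cball ball_in[OF i]] by blast
    have "Q i C 1" unfolding Q_def
    proof (intro ballI allI conjI)
      fix x v assume x: "x \<in> chart_ball i (2 * r0)"
      note t = tnorm_chart_norm[OF cat(1)[of i] chart_ball_dom[OF x], of v]
      show "norm (cc (cat x) (cat i) x v) \<le> C * tnorm M x v" unfolding t by (rule C(2)[OF chart_ball_cball[OF x]])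
      show "tnorm M x v \<le> C * norm (cc (cat x) (cat i) x v)" unfolding t by (rule C(3)[OF chart_ball_cball[OF x]])
    qed
    then show "\<exists>K>0. \<exists>\<delta>>0. Q i K \<delta>" using C(1) by (intro exI[of _ C] conjI exI[of _ 1]) auto
  next
    fix i and K K' \<delta> \<delta>' :: real assume q: "Q i K \<delta>" "K \<le> K'"
    have "K * tnorm M x v \<le> K' * tnorm M x v" "K * norm w \<le> K' * norm w" for x v and w :: 'e
      using q(2) tnorm_nonneg by (auto intro: mult_right_mono)
    then show "Q i K' \<delta>'" using q(1) unfolding Q_def by (meson order_trans)
  qed
  then show ?thesis unfolding Q_def by blast
qed

lemma rdist_lower:
  "\<exists>C>0. \<exists>\<delta>>0. \<forall>i\<in>I. \<forall>x y l. x \<in> chart_ball i (2 * r0) \<longrightarrow> l < \<delta> \<longrightarrow> rdist M x y < ennreal l \<longrightarrow>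
      y \<in> fst (cat i) \<and> norm (ph i y - ph i x) \<le> C * l"
proof (rule finite_uniform_constants[OF fin])
  fix i assume i: "i \<in> I"
  obtain C \<delta> where C: "0 < C" "0 < \<delta>" "\<And>x y l. x \<in> fst (cat i) \<Longrightarrow> ph i x \<in> cball (ph i i) (rad i + 2 * r0) \<Longrightarrow> l < \<delta> \<Longrightarrow>
      rdist M x y < ennreal l \<Longrightarrow> y \<in> fst (cat i) \<and> norm (ph i y - ph i x) \<le> C * l"
    using rdist_chart_lower[OF cat(1) compact_cball ball_in[OF i]] by blast
  show "\<exists>C>0. \<exists>\<delta>>0. \<forall>x y l. x \<in> chart_ball i (2 * r0) \<longrightarrow> l < \<delta> \<longrightarrow> rdist M x y < ennreal l \<longrightarrow>
      y \<in> fst (cat i) \<and> norm (ph i y - ph i x) \<le> C * l"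
    using C chart_ball_cball chart_ball_dom by blast
next
  fix i and C C' \<delta> \<delta>' :: real
  assume a: "\<forall>x y l. x \<in> chart_ball i (2 * r0) \<longrightarrow> l < \<delta> \<longrightarrow> rdist M x y < ennreal l \<longrightarrow>
      y \<in> fst (cat i) \<and> norm (ph i y - ph i x) \<le> C * l" "C \<le> C'" "0 < \<delta>'" "\<delta>' \<le> \<delta>"
  show "\<forall>x y l. x \<in> chart_ball i (2 * r0) \<longrightarrow> l < \<delta>' \<longrightarrow> rdist M x y < ennreal l \<longrightarrow>
      y \<in> fst (cat i) \<and> norm (ph i y - ph i x) \<le> C' * l"
  proof (intro allI impI)
    fix x y and l :: real assume x: "x \<in> chart_ball i (2 * r0)" "l < \<delta>'" "rdist M x y < ennreal l"
    have "0 \<le> l" using x(3) by (metis ennreal_neg linorder_le_cases not_less_zero)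
    then have "C * l \<le> C' * l" using a(2) by (rule mult_right_mono[rotated])
    moreover have "y \<in> fst (cat i) \<and> norm (ph i y - ph i x) \<le> C * l"
      using a(1)[rule_format, OF x(1) _ x(3)] x(2) a(4) by simp
    ultimately show "y \<in> fst (cat i) \<and> norm (ph i y - ph i x) \<le> C' * l" by auto
  qed
qed

lemma rdist_upper:
  "\<exists>C>0. \<forall>i\<in>I. \<forall>x\<in>chart_ball i (2 * r0). \<forall>y\<in>chart_ball i (2 * r0). rdist M x y \<le> ennreal (C * norm (ph i y - ph i x))"
proof -
  define Q where "Q i C \<delta> \<longleftrightarrow> (\<forall>x\<in>chart_ball i (2 * r0). \<forall>y\<in>chart_ball i (2 * r0). rdist M x y \<le> ennreal (C * norm (ph i y - ph i x)))"
    for i and C \<delta> :: real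
  have "\<exists>C>0. \<exists>\<delta>>0. \<forall>i\<in>I. Q i C \<delta>"
  proof (rule finite_uniform_constants[OF fin])
    fix i assume i: "i \<in> I"
    obtain C where C: "0 < C" "\<And>\<xi> \<eta>. \<xi> \<in> cball (ph i i) (rad i + 2 * r0) \<Longrightarrow> \<eta> \<in> cball (ph i i) (rad i + 2 * r0) \<Longrightarrow>
        rdist M (phi i \<xi>) (phi i \<eta>) \<le> ennreal (C * norm (\<eta> - \<xi>))"
      using rdist_chart_upper[OF cat(1) compact_cball convex_cball ball_in[OF i]] by blast
    have "Q i C 1" unfolding Q_def
    proof (intro ballI)
      fix x y assume xy: "x \<in> chart_ball i (2 * r0)" "y \<in> chart_ball i (2 * r0)"
      from C(2)[OF chart_ball_cball[OF xy(1)] chart_ball_cball[OF xy(2)]]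
      show "rdist M x y \<le> ennreal (C * norm (ph i y - ph i x))" by (simp add: phi_ph chart_ball_dom[OF xy(1)] chart_ball_dom[OF xy(2)])
    qed
    then show "\<exists>C>0. \<exists>\<delta>>0. Q i C \<delta>" using C(1) by (intro exI[of _ C] conjI exI[of _ 1]) auto
  next
    fix i and C C' \<delta> \<delta>' :: real assume q: "Q i C \<delta>" "C \<le> C'"
    have "ennreal (C * norm w) \<le> ennreal (C' * norm w)" for w :: 'e
      using q(2) by (intro ennreal_leI mult_right_mono) auto
    then show "Q i C' \<delta>'" using q(1) unfolding Q_def by (meson order_trans)
  qed
  then show ?thesis unfolding Q_def by blast
qed

lemma tangent_lower:
  assumes b: "0 \<le> b"
  shows "\<exists>C>0. \<exists>\<delta>>0. \<forall>i\<in>I. \<forall>x v y w l. x \<in> chart_ball i (2 * r0) \<longrightarrow> norm (cc (cat x) (cat i) x v) \<le> b \<longrightarrow> l < \<delta> \<longrightarrow>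
      tangent_dist M x v y w < ennreal l \<longrightarrow>
      y \<in> fst (cat i) \<and> norm (ph i y - ph i x) \<le> C * l \<and> norm (cc (cat y) (cat i) y w - cc (cat x) (cat i) x v) \<le> C * l"
proof (rule finite_uniform_constants[OF fin])
  fix i assume i: "i \<in> I"
  obtain C \<delta> where C: "0 < C" "0 < \<delta>" "\<And>x v y w l. x \<in> fst (cat i) \<Longrightarrow> ph i x \<in> cball (ph i i) (rad i + 2 * r0) \<Longrightarrow>
      norm (cc (cat x) (cat i) x v) \<le> b \<Longrightarrow> l < \<delta> \<Longrightarrow> tangent_dist M x v y w < ennreal l \<Longrightarrow>
      y \<in> fst (cat i) \<and> norm (ph i y - ph i x) \<le> C * l \<and> norm (cc (cat y) (cat i) y w - cc (cat x) (cat i) x v) \<le> C * l"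
    using tangent_chart_lower[OF cat(1) compact_cball ball_in[OF i] b] by blast
  show "\<exists>C>0. \<exists>\<delta>>0. \<forall>x v y w l. x \<in> chart_ball i (2 * r0) \<longrightarrow> norm (cc (cat x) (cat i) x v) \<le> b \<longrightarrow> l < \<delta> \<longrightarrow>
      tangent_dist M x v y w < ennreal l \<longrightarrow>
      y \<in> fst (cat i) \<and> norm (ph i y - ph i x) \<le> C * l \<and> norm (cc (cat y) (cat i) y w - cc (cat x) (cat i) x v) \<le> C * l"
    using C(1,2) C(3)[OF chart_ball_dom chart_ball_cball] by blast
next
  fix i and C C' \<delta> \<delta>' :: real
  assume a: "\<forall>x v y w l. x \<in> chart_ball i (2 * r0) \<longrightarrow> norm (cc (cat x) (cat i) x v) \<le> b \<longrightarrow> l < \<delta> \<longrightarrow>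
      tangent_dist M x v y w < ennreal l \<longrightarrow>
      y \<in> fst (cat i) \<and> norm (ph i y - ph i x) \<le> C * l \<and> norm (cc (cat y) (cat i) y w - cc (cat x) (cat i) x v) \<le> C * l"
    "C \<le> C'" "0 < \<delta>'" "\<delta>' \<le> \<delta>"
  show "\<forall>x v y w l. x \<in> chart_ball i (2 * r0) \<longrightarrow> norm (cc (cat x) (cat i) x v) \<le> b \<longrightarrow> l < \<delta>' \<longrightarrow>
      tangent_dist M x v y w < ennreal l \<longrightarrow>
      y \<in> fst (cat i) \<and> norm (ph i y - ph i x) \<le> C' * l \<and> norm (cc (cat y) (cat i) y w - cc (cat x) (cat i) x v) \<le> C' * l"
  proof (intro allI impI)
    fix x v y w and l :: real
    assume x: "x \<in> chart_ball i (2 * r0)" "norm (cc (cat x) (cat i) x v) \<le> b" "l < \<delta>'" "tangent_dist M x v y w < ennreal l"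
    have "0 \<le> l" using x(4) by (metis ennreal_neg linorder_le_cases not_less_zero)
    then have "C * l \<le> C' * l" using a(2) by (rule mult_right_mono[rotated])
    moreover have "y \<in> fst (cat i) \<and> norm (ph i y - ph i x) \<le> C * l \<and> norm (cc (cat y) (cat i) y w - cc (cat x) (cat i) x v) \<le> C * l"
      using a(1)[rule_format, OF x(1,2) _ x(4)] x(3) a(4) by simp
    ultimately show "y \<in> fst (cat i) \<and> norm (ph i y - ph i x) \<le> C' * l \<and> norm (cc (cat y) (cat i) y w - cc (cat x) (cat i) x v) \<le> C' * l"
      by auto
  qed
qed

abbreviation "DI i j g x \<equiv> chart_deriv (cat i) (cat j) g x"

text \<open>Derivatives of \<open>g\<close> are read in pairs of charts; closed margins make the
  points relevant for a pair compact in coordinates, as the bounds on derivatives below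
  require.\<close>

lemma preimage_compact:
  assumes g: "continuous_on UNIV g" and ij: "i \<in> I" "j \<in> I" and st: "s \<le> 2 * r0" "t \<le> 2 * r0"
  shows "compact (ph i ` {x \<in> chart_ball i s. g x \<in> chart_ball j t})"
proof -
  let ?B = "cball (ph i i) (rad i + s)"
  have "ph i ` {x \<in> chart_ball i s. g x \<in> chart_ball j t} = ?B \<inter> (\<lambda>\<xi>. g (phi i \<xi>)) -` chart_ball j t"
  proof (intro set_eqI iffI)
    fix \<xi> assume "\<xi> \<in> ph i ` {x \<in> chart_ball i s. g x \<in> chart_ball j t}"
    then obtain x where "\<xi> = ph i x" "x \<in> chart_ball i s" "g x \<in> chart_ball j t" by blast
    then show "\<xi> \<in> ?B \<inter> (\<lambda>\<xi>. g (phi i \<xi>)) -` chart_ball j t" using chart_ball_cball[of x i s] phi_ph[OF chart_ball_dom, of x i s] by simp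
  next
    fix \<xi> assume \<xi>: "\<xi> \<in> ?B \<inter> (\<lambda>\<xi>. g (phi i \<xi>)) -` chart_ball j t"
    then have "phi i \<xi> \<in> chart_ball i s" "ph i (phi i \<xi>) = \<xi>" using phi_chart_ball[OF ij(1) st(1)] by auto
    then show "\<xi> \<in> ph i ` {x \<in> chart_ball i s. g x \<in> chart_ball j t}" using \<xi> by (intro image_eqI[of _ _ "phi i \<xi>"]) auto
  qed
  moreover have "continuous_on ?B (\<lambda>\<xi>. g (phi i \<xi>))"
    by (rule continuous_on_compose2[OF g continuous_on_subset[OF chart_cont(2)[OF chart[OF cat(1)]] cball_image[OF ij(1) st(1)]]]) simp
  then have "closed (?B \<inter> (\<lambda>\<xi>. g (phi i \<xi>)) -` chart_ball j t)"
    using chart_ball_closed[OF ij(2) st(2)] by (intro continuous_closed_preimage) auto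
  then have "compact (?B \<inter> (?B \<inter> (\<lambda>\<xi>. g (phi i \<xi>)) -` chart_ball j t))" by (rule compact_Int_closed[OF compact_cball])
  ultimately show ?thesis by (simp add: Int_assoc[symmetric])
qed

lemma DI_bounded:
  assumes g: "C1_map M g"
  shows "\<exists>a>0. \<forall>i\<in>I. \<forall>j\<in>I. \<forall>x. x \<in> chart_ball i r0 \<longrightarrow> g x \<in> chart_ball j r0 \<longrightarrow> (\<forall>v. norm (DI i j g x v) \<le> a * norm v)"
proof -
  have cg: "continuous_on UNIV g" using g unfolding C1_map_def by blast
  define Q where "Q p a \<delta> \<longleftrightarrow> (\<forall>x. x \<in> chart_ball (fst p) r0 \<longrightarrow> g x \<in> chart_ball (snd p) r0 \<longrightarrow> (\<forall>v. norm (DI (fst p) (snd p) g x v) \<le> a * norm v))"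
    for p and a \<delta> :: real
  have "\<exists>a>0. \<exists>\<delta>>0. \<forall>p\<in>I \<times> I. Q p a \<delta>"
  proof (rule finite_uniform_constants)
    show "finite (I \<times> I)" using fin by simp
    fix p assume "p \<in> I \<times> I"
    then obtain i j where p: "p = (i, j)" "i \<in> I" "j \<in> I" by auto
    let ?X = "{x \<in> chart_ball i r0. g x \<in> chart_ball j r0}" and ?A = "\<lambda>y. frechet_derivative (chart_rep (cat i) (cat j) g) (at y)"
    have sub: "ph i ` ?X \<subseteq> ph i ` (fst (cat i) \<inter> g -` fst (cat j))" using chart_ball_dom by blast
    have "\<exists>a>0. \<forall>y\<in>ph i ` ?X. \<forall>v. norm (?A y v) \<le> a * norm v"
    proof (rule linear_family_bounded)
      show "compact (ph i ` ?X)" by (rule preimage_compact[OF cg p(2,3)]) (use r0 in auto)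
      show "continuous_on (ph i ` ?X) (\<lambda>y. ?A y v)" for v
        by (rule continuous_on_subset[OF C1_map_chart_deriv_cont[OF g cat(1) cat(1)] sub])
      show "linear (?A y)" if y: "y \<in> ph i ` ?X" for y
      proof -
        obtain x where "y = ph i x" "x \<in> fst (cat i)" "g x \<in> fst (cat j)" using y chart_ball_dom by blast
        then show ?thesis using chart_deriv_linear[OF C1_map_diffable[OF g] cat(1) cat(1)] unfolding chart_deriv_def by blast
      qed
    qed
    then obtain a where a: "0 < a" "\<And>x v. x \<in> chart_ball i r0 \<Longrightarrow> g x \<in> chart_ball j r0 \<Longrightarrow> norm (DI i j g x v) \<le> a * norm v"
      unfolding chart_deriv_def by blast
    have "Q p a 1" unfolding Q_def p(1) fst_conv snd_conv using a(2) by blast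
    then show "\<exists>a>0. \<exists>\<delta>>0. Q p a \<delta>" using a(1) zero_less_one by blast
  next
    fix p and a a' \<delta> \<delta>' :: real assume q: "Q p a \<delta>" "a \<le> a'"
    have "a * norm v \<le> a' * norm v" for v :: 'e using q(2) by (intro mult_right_mono) auto
    then show "Q p a' \<delta>'" using q(1) unfolding Q_def by (meson order_trans)
  qed
  \<comment> \<open>\<open>Q\<close> does not depend on its last argument; the \<open>SOME\<close>
    term merely fills the slot.\<close>
  then obtain a where "0 < a" "\<forall>p\<in>I \<times> I. Q p a (SOME \<delta>. True)" unfolding Q_def by blast
  then show ?thesis unfolding Q_def by (intro exI[of _ a]) auto
qed

text \<open>The displaced point and its image also stay in balls with more margin: the open balls of
  margin \<open>r0\<close> contain the closed ones of margin 0 and \<open>r0 / 2\<close>, and a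
  compact set has uniform room in an open one.\<close>

lemma DI_uniform:
  assumes g: "C1_map M g" and \<kappa>: "0 < \<kappa>"
  shows "\<exists>\<rho>>0. \<forall>i\<in>I. \<forall>j\<in>I. \<forall>x. x \<in> chart_ball i 0 \<longrightarrow> g x \<in> chart_ball j (r0 / 2) \<longrightarrow> (\<forall>\<eta>. norm (\<eta> - ph i x) \<le> \<rho> \<longrightarrow>
      phi i \<eta> \<in> chart_ball i r0 \<and> ph i (phi i \<eta>) = \<eta> \<and> g (phi i \<eta>) \<in> chart_ball j r0 \<and>
      (\<forall>v. norm (DI i j g (phi i \<eta>) v - DI i j g x v) \<le> \<kappa> * norm v))"
proof -
  have cg: "continuous_on UNIV g" using g unfolding C1_map_def by blast
  define Q where "Q p C \<rho> \<longleftrightarrow> (\<forall>x. x \<in> chart_ball (fst p) 0 \<longrightarrow> g x \<in> chart_ball (snd p) (r0 / 2) \<longrightarrow> (\<forall>\<eta>. norm (\<eta> - ph (fst p) x) \<le> \<rho> \<longrightarrow>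
      phi (fst p) \<eta> \<in> chart_ball (fst p) r0 \<and> ph (fst p) (phi (fst p) \<eta>) = \<eta> \<and> g (phi (fst p) \<eta>) \<in> chart_ball (snd p) r0 \<and>
      (\<forall>v. norm (DI (fst p) (snd p) g (phi (fst p) \<eta>) v - DI (fst p) (snd p) g x v) \<le> \<kappa> * norm v)))" for p and C \<rho> :: real
  have "\<exists>C>0. \<exists>\<rho>>0. \<forall>p\<in>I \<times> I. Q p C \<rho>"
  proof (rule finite_uniform_constants)
    show "finite (I \<times> I)" using fin by simp
    fix p assume "p \<in> I \<times> I"
    then obtain i j where p: "p = (i, j)" "i \<in> I" "j \<in> I" by auto
    let ?O = "\<lambda>i. fst (cat i) \<inter> ph i -` ball (ph i i) (rad i + r0)"
    let ?U = "?O i \<inter> g -` ?O j"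
    let ?\<Omega> = "ph i ` (fst (cat i) \<inter> ?U)" and ?\<Xi> = "ph i ` {x \<in> chart_ball i 0. g x \<in> chart_ball j (r0 / 2)}"
    let ?A = "\<lambda>y. frechet_derivative (chart_rep (cat i) (cat j) g) (at y)"
    have opO: "open (?O i)" for i by (rule chart_vimage_open[OF chart[OF cat(1)] open_ball])
    have "open ?U" using opO[of i] open_vimage[OF opO[of j] cg] by (rule open_Int)
    then have op: "open ?\<Omega>" by (rule chart_open_image[OF chart[OF cat(1)]])
    have sub: "?\<Omega> \<subseteq> ph i ` (fst (cat i) \<inter> g -` fst (cat j))" by blast
    have "chart_ball i 0 \<subseteq> ?O i" "chart_ball j (r0 / 2) \<subseteq> ?O j"
      using r0 by (auto simp: chart_ball_def dist_norm norm_minus_commute)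
    then have \<Xi>\<Omega>: "?\<Xi> \<subseteq> ?\<Omega>" by blast
    have "\<exists>\<rho>>0. \<forall>\<xi>\<in>?\<Xi>. \<forall>\<eta>. norm (\<eta> - \<xi>) \<le> \<rho> \<longrightarrow> \<eta> \<in> ?\<Omega> \<and> (\<forall>v. norm (?A \<eta> v - ?A \<xi> v) \<le> \<kappa> * norm v)"
    proof (rule linear_family_uniform[OF op _ \<Xi>\<Omega> _ _ \<kappa>])
      show "compact ?\<Xi>" by (rule preimage_compact[OF cg p(2,3)]) (use r0 in auto)
      show "continuous_on ?\<Omega> (\<lambda>y. ?A y v)" for v
        by (rule continuous_on_subset[OF C1_map_chart_deriv_cont[OF g cat(1) cat(1)] sub])
      show "linear (?A y)" if y: "y \<in> ?\<Omega>" for y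
      proof -
        obtain x where "y = ph i x" "x \<in> fst (cat i)" "g x \<in> fst (cat j)" using y by blast
        then show ?thesis using chart_deriv_linear[OF C1_map_diffable[OF g] cat(1) cat(1)] unfolding chart_deriv_def by blast
      qed
    qed
    then obtain \<rho> where \<rho>: "0 < \<rho>" "\<And>x \<eta>. x \<in> chart_ball i 0 \<Longrightarrow> g x \<in> chart_ball j (r0 / 2) \<Longrightarrow> norm (\<eta> - ph i x) \<le> \<rho> \<Longrightarrow>
        \<eta> \<in> ?\<Omega> \<and> (\<forall>v. norm (?A \<eta> v - ?A (ph i x) v) \<le> \<kappa> * norm v)" by blast
    have "Q p 1 \<rho>" unfolding Q_def p(1) fst_conv snd_conv
    proof (intro allI impI)
      fix x \<eta> assume x: "x \<in> chart_ball i 0" "g x \<in> chart_ball j (r0 / 2)" and \<eta>: "norm (\<eta> - ph i x) \<le> \<rho>"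
      note h = \<rho>(2)[OF x \<eta>]
      then obtain z where z: "\<eta> = ph i z" "z \<in> fst (cat i)" "z \<in> ?O i" "g z \<in> ?O j" by blast
      have pz: "phi i \<eta> = z" unfolding z(1) by (rule phi_ph[OF z(2)])
      have kz: "z \<in> chart_ball i r0" "g z \<in> chart_ball j r0" using z(3,4) by (auto simp: chart_ball_def dist_norm norm_minus_commute)
      have "\<forall>v. norm (DI i j g z v - DI i j g x v) \<le> \<kappa> * norm v"
        using conjunct2[OF h] unfolding chart_deriv_def z(1) .
      then show "phi i \<eta> \<in> chart_ball i r0 \<and> ph i (phi i \<eta>) = \<eta> \<and> g (phi i \<eta>) \<in> chart_ball j r0 \<and>
        (\<forall>v. norm (DI i j g (phi i \<eta>) v - DI i j g x v) \<le> \<kappa> * norm v)"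
        unfolding pz using kz z(1) by simp
    qed
    then show "\<exists>C>0. \<exists>\<rho>>0. Q p C \<rho>" using \<rho>(1) zero_less_one by blast
  next
    fix p and C C' \<rho> \<rho>' :: real assume q: "Q p C \<rho>" "\<rho>' \<le> \<rho>"
    show "Q p C' \<rho>'" unfolding Q_def
    proof (intro allI impI)
      fix x \<eta> assume x: "x \<in> chart_ball (fst p) 0" "g x \<in> chart_ball (snd p) (r0 / 2)" "norm (\<eta> - ph (fst p) x) \<le> \<rho>'"
      have "norm (\<eta> - ph (fst p) x) \<le> \<rho>" using x(3) q(2) by simp
      from q(1)[unfolded Q_def, rule_format, OF x(1,2) this]
      show "phi (fst p) \<eta> \<in> chart_ball (fst p) r0 \<and> ph (fst p) (phi (fst p) \<eta>) = \<eta> \<and> g (phi (fst p) \<eta>) \<in> chart_ball (snd p) r0 \<and>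
      (\<forall>v. norm (DI (fst p) (snd p) g (phi (fst p) \<eta>) v - DI (fst p) (snd p) g x v) \<le> \<kappa> * norm v)" by blast
    qed
  qed
  then obtain \<rho> where \<rho>: "0 < \<rho>" "\<forall>p\<in>I \<times> I. Q p (SOME C. True) \<rho>" unfolding Q_def by blast
  show ?thesis
  proof (intro exI[of _ \<rho>] conjI ballI)
    fix i j assume "i \<in> I" "j \<in> I"
    then have "Q (i, j) (SOME C. True) \<rho>" using \<rho>(2) by blast
    then show "\<forall>x. x \<in> chart_ball i 0 \<longrightarrow> g x \<in> chart_ball j (r0 / 2) \<longrightarrow> (\<forall>\<eta>. norm (\<eta> - ph i x) \<le> \<rho> \<longrightarrow>
      phi i \<eta> \<in> chart_ball i r0 \<and> ph i (phi i \<eta>) = \<eta> \<and> g (phi i \<eta>) \<in> chart_ball j r0 \<and>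
      (\<forall>v. norm (DI i j g (phi i \<eta>) v - DI i j g x v) \<le> \<kappa> * norm v))" unfolding Q_def by simp
  qed (fact \<rho>(1))
qed

lemma tnorm_tmap_bounded:
  assumes g: "C1_map M g"
  shows "\<exists>B>0. \<forall>x v. tnorm M (g x) (tmap M g x v) \<le> B * tnorm M x v"
proof -
  obtain K where K: "0 < K" "\<And>i x v. i \<in> I \<Longrightarrow> x \<in> chart_ball i (2 * r0) \<Longrightarrow> norm (cc (cat x) (cat i) x v) \<le> K * tnorm M x v"
    "\<And>i x v. i \<in> I \<Longrightarrow> x \<in> chart_ball i (2 * r0) \<Longrightarrow> tnorm M x v \<le> K * norm (cc (cat x) (cat i) x v)"
    using norm_comparison by blast
  obtain a where a: "0 < a" "\<And>i j x v. i \<in> I \<Longrightarrow> j \<in> I \<Longrightarrow> x \<in> chart_ball i r0 \<Longrightarrow> g x \<in> chart_ball j r0 \<Longrightarrow> norm (DI i j g x v) \<le> a * norm v"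
    using DI_bounded[OF g] by blast
  have "tnorm M (g x) (tmap M g x v) \<le> (K * a * K) * tnorm M x v" for x v
  proof -
    obtain i where i: "i \<in> I" "x \<in> chart_ball i 0" using chart_ball_cover[of x] by blast
    obtain j where j: "j \<in> I" "g x \<in> chart_ball j 0" using chart_ball_cover[of "g x"] by blast
    have lev: "x \<in> chart_ball i r0" "x \<in> chart_ball i (2 * r0)" "g x \<in> chart_ball j r0" "g x \<in> chart_ball j (2 * r0)"
      using chart_ball_mono[OF i(2)] chart_ball_mono[OF j(2)] r0 by auto
    let ?w = "cc (cat x) (cat i) x v"
    have "DI i j g x ?w = cc (cat (g x)) (cat j) (g x) (tmap M g x v)"
      using chart_deriv_change[OF C1_map_diffable[OF g] cat(1)[of i] cat(1)[of j] chart_ball_dom[OF i(2)] chart_ball_dom[OF j(2)], of ?w]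
        cc_inv[OF cat(1) cat(1)[of i] cat(2) chart_ball_dom[OF i(2)], of v] by simp
    then have "tnorm M (g x) (tmap M g x v) \<le> K * norm (DI i j g x ?w)" using K(3)[OF j(1) lev(4)] by simp
    also have "\<dots> \<le> K * (a * norm ?w)" using a(2)[OF i(1) j(1) lev(1,3)] K(1) by (intro mult_left_mono) auto
    also have "\<dots> \<le> K * (a * (K * tnorm M x v))" using K(2)[OF i(1) lev(2)] K(1) a(1) by (intro mult_left_mono) auto
    finally show ?thesis by (simp add: mult_ac)
  qed
  then show ?thesis using K(1) a(1) by (intro exI[of _ "K * a * K"]) auto
qed

end

context riem
begin

lemma tangent_dist_less_C1_dist:
  assumes "C1_dist M g h < l" "tnorm M x v = 1"
  shows "tangent_dist M (g x) (tmap M g x v) (h x) (tmap M h x v) < l"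
proof -
  have "tangent_dist M (g x) (tmap M g x v) (h x) (tmap M h x v)
      \<le> (SUP v\<in>{v. tnorm M x v = 1}. tangent_dist M (g x) (tmap M g x v) (h x) (tmap M h x v))"
    using assms(2) by (intro SUP_upper) simp
  also have "\<dots> \<le> C1_dist M g h" unfolding C1_dist_def by (rule SUP_upper) simp
  finally show ?thesis using assms(1) by (rule le_less_trans)
qed

lemma tnorm_pos: "v \<noteq> 0 \<Longrightarrow> 0 < tnorm M x v"
  using riem_inner[of x] unfolding inner_product_def tnorm_def by simp

text \<open>\<open>C1_dist\<close> takes a supremum over unit vectors. As the model space has a
  nonempty basis, that set is never empty, so \<open>C1_dist\<close> dominates the distance of the
  image points.\<close>

lemma exists_unit_vector: "\<exists>v. tnorm M x v = 1"
proof -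
  obtain b :: 'e where "b \<in> Basis" using nonempty_Basis by blast
  then have "b \<noteq> 0" by (rule nonzero_Basis)
  then have p: "0 < tnorm M x b" by (rule tnorm_pos)
  have "tnorm M x ((1 / tnorm M x b) *\<^sub>R b) = 1" using p by (simp add: tnorm_scale)
  then show ?thesis ..
qed

lemma rdist_le_C1_dist: "rdist M (g x) (h x) \<le> C1_dist M g h"
proof -
  obtain v where v: "tnorm M x v = 1" using exists_unit_vector by blast
  have "rdist M (g x) (h x) \<le> tangent_dist M (g x) (tmap M g x v) (h x) (tmap M h x v)"
    by (rule rdist_le_tangent_dist)
  also have "\<dots> \<le> (SUP v\<in>{v. tnorm M x v = 1}. tangent_dist M (g x) (tmap M g x v) (h x) (tmap M h x v))"
    using v by (intro SUP_upper) simp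
  also have "\<dots> \<le> C1_dist M g h" unfolding C1_dist_def by (rule SUP_upper) simp
  finally show ?thesis .
qed

lemma continuous_rdist_uniform:
  assumes cpt: "compact (UNIV :: 'a set)" and f: "continuous_on UNIV f" and \<epsilon>: "0 < \<epsilon>"
  shows "\<exists>\<delta>>0. \<forall>p q. rdist M p q < ennreal \<delta> \<longrightarrow> rdist M (f p) (f q) < ennreal \<epsilon>"
proof (rule rdist_uniform[OF cpt])
  fix x
  obtain U where U: "open U" "f x \<in> U" "\<And>y. y \<in> U \<Longrightarrow> rdist M (f x) y < ennreal (\<epsilon> / 2)"
    using rdist_nbhd[of "\<epsilon> / 2" "f x"] \<epsilon> by auto
  have "rdist M (f p) (f q) < ennreal \<epsilon>" if "f p \<in> U" "f q \<in> U" for p q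
  proof -
    have "rdist M (f p) (f q) \<le> rdist M (f p) (f x) + rdist M (f x) (f q)" by (rule rdist_triangle)
    also have "\<dots> < ennreal (\<epsilon> / 2) + ennreal (\<epsilon> / 2)"
      using U(3)[OF that(1)] U(3)[OF that(2)] rdist_sym[of "f p" "f x"] by (intro add_strict_mono) simp_all
    also have "\<dots> = ennreal \<epsilon>" using \<epsilon> by (simp add: ennreal_plus[symmetric] del: ennreal_plus)
    finally show ?thesis .
  qed
  then show "\<exists>U. open U \<and> x \<in> U \<and> (\<forall>p\<in>U. \<forall>q\<in>U. rdist M (f p) (f q) < ennreal \<epsilon>)"
    using open_vimage[OF U(1) f] U(2) by (intro exI[of _ "f -` U"]) auto
qed

text \<open>Uniform continuity is used once per step, so \<open>\<eta>\<close> depends on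
  \<open>m\<close>: the comparison with a true orbit covers only a length fixed in advance.\<close>

lemma pseudo_orbit_window:
  assumes cpt: "compact (UNIV :: 'a set)" and f: "continuous_on UNIV f" and \<epsilon>: "0 < \<epsilon>"
  shows "\<exists>\<eta>>0. \<forall>x :: int \<Rightarrow> 'a. (\<forall>n. rdist M (f (x n)) (x (n + 1)) < ennreal \<eta>) \<longrightarrow>
    (\<forall>j. \<forall>k\<le>m. rdist M ((f ^^ k) (x j)) (x (j + int k)) < ennreal \<epsilon>)"
  using \<epsilon>
proof (induction m arbitrary: \<epsilon>)
  case 0
  then show ?case by (intro exI[of _ 1]) (auto simp: rdist_self)
next
  case (Suc m)
  obtain \<delta> where \<delta>: "0 < \<delta>" "\<And>p q. rdist M p q < ennreal \<delta> \<Longrightarrow> rdist M (f p) (f q) < ennreal (\<epsilon> / 2)"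
    using continuous_rdist_uniform[OF cpt f, of "\<epsilon> / 2"] Suc.prems by auto
  obtain \<eta> where \<eta>: "0 < \<eta>" "\<And>x j k. (\<forall>n. rdist M (f (x n)) (x (n + 1)) < ennreal \<eta>) \<Longrightarrow> k \<le> m \<Longrightarrow>
      rdist M ((f ^^ k) (x j)) (x (j + int k)) < ennreal (min \<delta> \<epsilon>)"
    using Suc.IH[of "min \<delta> \<epsilon>"] \<delta>(1) Suc.prems by auto
  show ?case
  proof (intro exI[of _ "min \<eta> (\<epsilon> / 2)"] conjI allI impI)
    show "0 < min \<eta> (\<epsilon> / 2)" using \<eta>(1) Suc.prems by simp
    fix x :: "int \<Rightarrow> 'a" and j k
    assume x: "\<forall>n. rdist M (f (x n)) (x (n + 1)) < ennreal (min \<eta> (\<epsilon> / 2))" and k: "k \<le> Suc m"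
    have le: "ennreal (min \<eta> (\<epsilon> / 2)) \<le> ennreal \<eta>" "ennreal (min \<eta> (\<epsilon> / 2)) \<le> ennreal (\<epsilon> / 2)"
      "ennreal (min \<delta> \<epsilon>) \<le> ennreal \<delta>" "ennreal (min \<delta> \<epsilon>) \<le> ennreal \<epsilon>" by (auto intro: ennreal_leI)
    have x\<eta>: "\<forall>n. rdist M (f (x n)) (x (n + 1)) < ennreal \<eta>" using x le(1) less_le_trans by blast
    show "rdist M ((f ^^ k) (x j)) (x (j + int k)) < ennreal \<epsilon>"
    proof (cases "k \<le> m")
      case True
      then show ?thesis using \<eta>(2)[OF x\<eta> True, of j] le(4) less_le_trans by blast
    next
      case False
      then have k: "k = Suc m" using k by simp
      have "rdist M ((f ^^ m) (x j)) (x (j + int m)) < ennreal \<delta>"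
        using \<eta>(2)[OF x\<eta> order_refl, of j] le(3) less_le_trans by blast
      then have 1: "rdist M ((f ^^ k) (x j)) (f (x (j + int m))) < ennreal (\<epsilon> / 2)" using \<delta>(2) k by simp
      have 2: "rdist M (f (x (j + int m))) (x (j + int k)) < ennreal (\<epsilon> / 2)"
        using less_le_trans[OF x[rule_format, of "j + int m"] le(2)] k by (simp add: algebra_simps)
      have "rdist M ((f ^^ k) (x j)) (x (j + int k)) \<le> rdist M ((f ^^ k) (x j)) (f (x (j + int m))) + rdist M (f (x (j + int m))) (x (j + int k))"
        by (rule rdist_triangle)
      also have "\<dots> < ennreal (\<epsilon> / 2) + ennreal (\<epsilon> / 2)" using 1 2 by (rule add_strict_mono)
      also have "\<dots> = ennreal \<epsilon>" using Suc.prems by (simp add: ennreal_plus[symmetric] del: ennreal_plus)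
      finally show ?thesis .
    qed
  qed
qed

end

section \<open>The shadowing estimate\<close>

locale anosov_atlas = anosov_map M f Es Eu C \<mu> + fin_atlas M I rad r0
  for M :: "('a::t2_space, 'e::euclidean_space) rspace" and f Es Eu C \<mu> I rad r0 +
  assumes cpt: "compact (UNIV :: 'a set)"
begin

lemma f_C1: "C1_map M f" "C1_map M (inv f)" "diffable f" "continuous_on UNIV f"
  using diffeo C1_map_diffable unfolding C1_diffeo_def C1_map_def by auto

text \<open>The constant depends neither on the orbit nor on the charts chosen along it, so an orbit
  may be read in the charts of a nearby pseudo-orbit on part of its course.\<close>

lemma orbits_admissible:
  "\<exists>C1>0. \<forall>y k. (\<forall>n. y (n + 1) = f (y n)) \<longrightarrow> (\<forall>n. k n \<in> I \<and> y n \<in> chart_ball (k n) (2 * r0)) \<longrightarrow>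
     admissible C1 (\<lambda>n. DI (k n) (k (n + 1)) f (y n))"
proof -
  obtain K where K: "0 < K" "\<And>i x v. i \<in> I \<Longrightarrow> x \<in> chart_ball i (2 * r0) \<Longrightarrow> norm (cc (cat x) (cat i) x v) \<le> K * tnorm M x v"
    "\<And>i x v. i \<in> I \<Longrightarrow> x \<in> chart_ball i (2 * r0) \<Longrightarrow> tnorm M x v \<le> K * norm (cc (cat x) (cat i) x v)"
    using norm_comparison by blast
  obtain B1 where B1: "0 < B1" "\<And>x v. tnorm M (f x) (tmap M f x v) \<le> B1 * tnorm M x v"
    using tnorm_tmap_bounded[OF f_C1(1)] by blast
  obtain B2 where B2: "0 < B2" "\<And>x v. tnorm M (inv f x) (tmap M (inv f) x v) \<le> B2 * tnorm M x v"
    using tnorm_tmap_bounded[OF f_C1(2)] by blast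
  define B where "B = 1 + B1 + B2"
  have zm: "zf (- 1) = inv f" using ziter_nat(2)[of f 1] by simp
  have le: "B1 * tnorm M x v \<le> B * tnorm M x v" "B2 * tnorm M x v \<le> B * tnorm M x v" for x v
    using tnorm_nonneg B1(1) B2(1) by (auto simp: B_def intro!: mult_right_mono)
  obtain K' where K': "0 < K'" "\<And>x v. tnorm M x (stable_proj x v) \<le> K' * tnorm M x v" "\<And>x v. tnorm M x (v - stable_proj x v) \<le> K' * tnorm M x v"
  proof -
    have "1 \<le> B" using B1(1) B2(1) by (simp add: B_def)
    moreover have "tnorm M (zf 1 x) (D 1 x v) \<le> B * tnorm M x v" for x v
      unfolding D_1 zf_1 by (rule order_trans[OF B1(2) le(1)])
    moreover have "tnorm M (zf (- 1) x) (D (- 1) x v) \<le> B * tnorm M x v" for x v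
      unfolding D_def zm by (rule order_trans[OF B2(2) le(2)])
    ultimately have "\<exists>K>0. \<forall>x v. tnorm M x (stable_proj x v) \<le> K * tnorm M x v \<and> tnorm M x (v - stable_proj x v) \<le> K * tnorm M x v"
      by (rule stable_proj_bounded)
    then show ?thesis using that by blast
  qed
  show ?thesis
  proof (intro exI[of _ "2 * (K * C * K' * K) / (1 - \<mu>)"] conjI allI impI)
    show "0 < 2 * (K * C * K' * K) / (1 - \<mu>)" using K(1) K'(1) C \<mu> by simp
    fix y k :: "int \<Rightarrow> 'a" assume y: "\<forall>n. y (n + 1) = f (y n)" and k: "\<forall>n. k n \<in> I \<and> y n \<in> chart_ball (k n) (2 * r0)"
    show "admissible (2 * (K * C * K' * K) / (1 - \<mu>)) (\<lambda>n. DI (k n) (k (n + 1)) f (y n))"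
    proof (rule orbit_admissible[where c="\<lambda>n. cat (k n)"])
      show "y n \<in> fst (cat (k n))" for n using k chart_ball_dom by blast
      show "norm (cc (cat (y n)) (cat (k n)) (y n) v) \<le> K * tnorm M (y n) v"
        "tnorm M (y n) v \<le> K * norm (cc (cat (y n)) (cat (k n)) (y n) v)" for n v
        using K(2,3) k by auto
    qed (use y cat(1) K(1) K' in auto)
  qed
qed

definition C1_close :: "real \<Rightarrow> ('a \<Rightarrow> 'a) \<Rightarrow> bool" where
  "C1_close s g \<longleftrightarrow> (\<forall>i\<in>I. \<forall>j\<in>I. \<forall>x. x \<in> chart_ball i r0 \<longrightarrow> f x \<in> chart_ball j r0 \<longrightarrow>
     g x \<in> fst (cat j) \<and> norm (ph j (g x) - ph j (f x)) \<le> s \<and>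
     (\<forall>v. norm (DI i j g x v - DI i j f x v) \<le> s * norm v))"

text \<open>The strict gap between \<open>s\<close> and \<open>\<kappa>\<close> is what a further
  perturbation may use up; openness is gained from it.\<close>

definition C1_nbhd :: "real \<Rightarrow> ('a \<Rightarrow> 'a) set" where
  "C1_nbhd \<kappa> = {g. C1_diffeo M g \<and> (\<exists>s<\<kappa>. 0 \<le> s \<and> C1_close s g)}"

lemma f_in_C1_nbhd: "0 < \<kappa> \<Longrightarrow> f \<in> C1_nbhd \<kappa>"
  unfolding C1_nbhd_def C1_close_def using diffeo chart_ball_dom by (auto intro!: exI[of _ 0])

lemma C1_nbhd_open:
  assumes \<kappa>: "0 < \<kappa>" "\<kappa> \<le> r0"
  shows "C1_open M (C1_nbhd \<kappa>)"
  unfolding C1_open_def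
proof (intro conjI ballI)
  show "C1_nbhd \<kappa> \<subseteq> {f. C1_diffeo M f}" unfolding C1_nbhd_def by auto
  fix g assume "g \<in> C1_nbhd \<kappa>"
  then obtain s where g: "C1_diffeo M g" and s: "0 \<le> s" "s < \<kappa>" "C1_close s g" unfolding C1_nbhd_def by auto
  have dg: "diffable g" using g C1_map_diffable unfolding C1_diffeo_def by blast
  obtain K where K: "0 < K" "\<And>i x v. i \<in> I \<Longrightarrow> x \<in> chart_ball i (2 * r0) \<Longrightarrow> norm (cc (cat x) (cat i) x v) \<le> K * tnorm M x v"
    "\<And>i x v. i \<in> I \<Longrightarrow> x \<in> chart_ball i (2 * r0) \<Longrightarrow> tnorm M x v \<le> K * norm (cc (cat x) (cat i) x v)"
    using norm_comparison by blast
  obtain a where a: "0 < a" "\<And>i j x v. i \<in> I \<Longrightarrow> j \<in> I \<Longrightarrow> x \<in> chart_ball i r0 \<Longrightarrow> f x \<in> chart_ball j r0 \<Longrightarrow> norm (DI i j f x v) \<le> a * norm v"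
    using DI_bounded[OF f_C1(1)] by blast
  \<comment> \<open>A Riemannian unit vector has coordinates of norm at most \<open>K\<close>, and
    the derivatives of \<open>g\<close> and \<open>f\<close> differ by at most \<open>s\<close>: so
    \<open>b\<close> bounds the coordinates of the image vector, as \<open>tangent_lower\<close>
    demands.\<close>
  define b where "b = (a + s) * K"
  have b: "0 \<le> b" using a(1) s K(1) by (simp add: b_def)
  obtain Ct \<delta> where Ct: "0 < Ct" "0 < \<delta>" "\<And>i x v y w l. i \<in> I \<Longrightarrow> x \<in> chart_ball i (2 * r0) \<Longrightarrow> norm (cc (cat x) (cat i) x v) \<le> b \<Longrightarrow>
      l < \<delta> \<Longrightarrow> tangent_dist M x v y w < ennreal l \<Longrightarrow>
      y \<in> fst (cat i) \<and> norm (ph i y - ph i x) \<le> Ct * l \<and> norm (cc (cat y) (cat i) y w - cc (cat x) (cat i) x v) \<le> Ct * l"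
    using tangent_lower[OF b] by blast
  \<comment> \<open>The displacement of points costs \<open>Ct * r\<close>, that of derivatives
    \<open>Ct * r * K\<close>; both must fit into half of the gap \<open>\<kappa> - s\<close>, which
    leads to the midpoint \<open>s'\<close> below.\<close>
  define r where "r = min (\<delta> / 2) ((\<kappa> - s) / (2 * Ct * (1 + K)))"
  have r: "0 < r" "r < \<delta>" using Ct s K(1) by (auto simp: r_def)
  have Cr: "Ct * r * (1 + K) \<le> (\<kappa> - s) / 2"
  proof -
    have "Ct * r * (1 + K) \<le> Ct * ((\<kappa> - s) / (2 * Ct * (1 + K))) * (1 + K)"
      using Ct(1) K(1) by (intro mult_right_mono mult_left_mono) (auto simp: r_def)
    also have "\<dots> = (\<kappa> - s) / 2"
    proof -
      have "1 + K \<noteq> 0" using K(1) by simp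
      then show ?thesis using Ct(1) by (simp add: divide_simps)
    qed
    finally show ?thesis .
  qed
  define s' where "s' = (\<kappa> + s) / 2"
  have s': "0 \<le> s'" "s' < \<kappa>" using s by (auto simp: s'_def)
  show "\<exists>r>0. \<forall>h. C1_diffeo M h \<and> C1_dist M g h < ennreal r \<longrightarrow> h \<in> C1_nbhd \<kappa>"
  proof (intro exI[of _ r] conjI allI impI)
    show "0 < r" by (fact r)
    fix h assume h: "C1_diffeo M h \<and> C1_dist M g h < ennreal r"
    have dh: "diffable h" using h C1_map_diffable unfolding C1_diffeo_def by blast
    have "C1_close s' h" unfolding C1_close_def
    proof (intro ballI allI impI)
      fix i j x assume ij: "i \<in> I" "j \<in> I" and x: "x \<in> chart_ball i r0" "f x \<in> chart_ball j r0"
      have gx: "g x \<in> fst (cat j)" "norm (ph j (g x) - ph j (f x)) \<le> s" "\<And>v. norm (DI i j g x v - DI i j f x v) \<le> s * norm v"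
        using s(3) ij x unfolding C1_close_def by blast+
      have "g x \<in> chart_ball j (r0 + s)" by (rule chart_ball_near[OF x(2) gx(1,2)])
      then have gK: "g x \<in> chart_ball j (2 * r0)" by (rule chart_ball_mono) (use s \<kappa> in simp)
      have xK: "x \<in> chart_ball i (2 * r0)" by (rule chart_ball_mono[OF x(1)]) (use r0 in simp)
      have unit: "h x \<in> fst (cat j) \<and> norm (ph j (h x) - ph j (g x)) \<le> Ct * r \<and>
          norm (DI i j h x (cc (cat x) (cat i) x v) - DI i j g x (cc (cat x) (cat i) x v)) \<le> Ct * r"
        if v: "tnorm M x v = 1" for v
      proof -
        let ?w = "cc (cat x) (cat i) x v"
        have inv_w: "cc (cat i) (cat x) x ?w = v" by (rule cc_inv[OF cat(1) cat(1) cat(2) chart_ball_dom[OF x(1)]])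
        have Dg: "DI i j g x ?w = cc (cat (g x)) (cat j) (g x) (tmap M g x v)"
          using chart_deriv_change[OF dg cat(1) cat(1) chart_ball_dom[OF x(1)] gx(1), of ?w] inv_w by simp
        have w: "norm ?w \<le> K" using K(2)[OF ij(1) xK, of v] v by simp
        have "norm (DI i j g x ?w) \<le> norm (DI i j g x ?w - DI i j f x ?w) + norm (DI i j f x ?w)"
          using norm_triangle_ineq[of "DI i j g x ?w - DI i j f x ?w" "DI i j f x ?w"] by simp
        also have "\<dots> \<le> s * norm ?w + a * norm ?w" by (intro add_mono gx(3) a(2)[OF ij x])
        also have "\<dots> = (a + s) * norm ?w" by (simp add: algebra_simps)
        also have "\<dots> \<le> b" unfolding b_def using w a(1) s by (intro mult_left_mono) auto
        finally have bb: "norm (cc (cat (g x)) (cat j) (g x) (tmap M g x v)) \<le> b" unfolding Dg .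
        have "tangent_dist M (g x) (tmap M g x v) (h x) (tmap M h x v) < ennreal r"
          by (rule tangent_dist_less_C1_dist[OF _ v]) (use h in blast)
        note tl = Ct(3)[OF ij(2) gK bb r(2) this]
        have "DI i j h x ?w = cc (cat (h x)) (cat j) (h x) (tmap M h x v)"
          using chart_deriv_change[OF dh cat(1) cat(1) chart_ball_dom[OF x(1)], of j ?w] inv_w tl by simp
        then show ?thesis using tl Dg by simp
      qed
      obtain v0 where v0: "tnorm M x v0 = 1" using exists_unit_vector by blast
      have Crs: "Ct * r \<le> (\<kappa> - s) / 2" "Ct * r * K \<le> (\<kappa> - s) / 2"
      proof -
        have "Ct * r * (1 + K) = Ct * r + Ct * r * K" by (simp add: algebra_simps)
        moreover have "0 \<le> Ct * r * K" "0 \<le> Ct * r" using Ct(1) r(1) K(1) by auto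
        ultimately show "Ct * r \<le> (\<kappa> - s) / 2" "Ct * r * K \<le> (\<kappa> - s) / 2" using Cr by linarith+
      qed
      have hx: "h x \<in> fst (cat j)" using unit[OF v0] by blast
      have 1: "norm (ph j (h x) - ph j (f x)) \<le> s'"
        using norm_triangle_ineq[of "ph j (h x) - ph j (g x)" "ph j (g x) - ph j (f x)"] unit[OF v0] gx(2) Crs(1)
        by (simp add: s'_def field_simps)
      \<comment> \<open>\<open>C1_dist\<close> sees only Riemannian unit vectors; other vectors are
        normalised by their Riemannian norm, and 0 is treated apart.\<close>
      have 2: "norm (DI i j h x w - DI i j f x w) \<le> s' * norm w" for w
      proof (cases "w = 0")
        case True
        have "linear (DI i j h x)" "linear (DI i j f x)"
          by (intro chart_deriv_linear dh f_C1 cat chart_ball_dom[OF x(1)] hx chart_ball_dom[OF x(2)])+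
        then show ?thesis using True by (simp add: linear_0)
      next
        case False
        define u where "u = cc (cat i) (cat x) x w"
        have wu: "cc (cat x) (cat i) x u = w" unfolding u_def by (rule cc_inv[OF cat(1) cat(1) chart_ball_dom[OF x(1)] cat(2)])
        have lu: "linear (cc (cat x) (cat i) x)" by (intro cc_linear cat chart_ball_dom[OF x(1)])
        have "u \<noteq> 0" using wu False linear_0[OF lu] by auto
        then have t: "0 < tnorm M x u" by (rule tnorm_pos)
        let ?t = "tnorm M x u"
        have "tnorm M x ((1 / ?t) *\<^sub>R u) = 1" using t by (simp add: tnorm_scale)
        from unit[OF this] have n: "norm (DI i j h x ((1 / ?t) *\<^sub>R w) - DI i j g x ((1 / ?t) *\<^sub>R w)) \<le> Ct * r"
          unfolding linear_scale[OF lu] wu by blast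
        have lh: "linear (DI i j h x)" "linear (DI i j g x)"
          by (intro chart_deriv_linear dh dg cat chart_ball_dom[OF x(1)] hx gx(1))+
        have "norm ((1 / ?t) *\<^sub>R (DI i j h x w - DI i j g x w)) \<le> Ct * r"
          using n unfolding linear_scale[OF lh(1)] linear_scale[OF lh(2)] scaleR_diff_right .
        then have "norm (DI i j h x w - DI i j g x w) \<le> Ct * r * ?t" using t by (simp add: divide_le_eq)
        also have "\<dots> \<le> Ct * r * (K * norm w)"
          using K(3)[OF ij(1) xK, of u] Ct(1) r(1) unfolding wu by (intro mult_left_mono) auto
        also have "\<dots> = (Ct * r * K) * norm w" by simp
        also have "\<dots> \<le> (\<kappa> - s) / 2 * norm w" using Crs(2) by (intro mult_right_mono) auto
        finally have "norm (DI i j h x w - DI i j g x w) \<le> (\<kappa> - s) / 2 * norm w" .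
        then have "norm (DI i j h x w - DI i j f x w) \<le> (\<kappa> - s) / 2 * norm w + s * norm w"
          using norm_triangle_ineq[of "DI i j h x w - DI i j g x w" "DI i j g x w - DI i j f x w"] gx(3)[of w] by simp
        then show ?thesis by (simp add: s'_def field_simps)
      qed
      show "h x \<in> fst (cat j) \<and> norm (ph j (h x) - ph j (f x)) \<le> s' \<and> (\<forall>v. norm (DI i j h x v - DI i j f x v) \<le> s' * norm v)"
        using hx 1 2 by blast
    qed
    then show "h \<in> C1_nbhd \<kappa>" unfolding C1_nbhd_def using h s' by blast
  qed
qed

text \<open>\<open>i n\<close> is the chart used at \<open>x n\<close>, and \<open>A' j\<close> is the derivative of \<open>f\<close> along the true orbit
  through \<open>x j\<close>: it is admissible, and it approximates the derivative along the pseudo-orbit \<open>x\<close> on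
  a window of length \<open>2 N\<close>.\<close>

definition charted :: "real \<Rightarrow> real \<Rightarrow> nat \<Rightarrow> real \<Rightarrow> real \<Rightarrow> (int \<Rightarrow> 'a) \<Rightarrow> (int \<Rightarrow> 'a) \<Rightarrow> (int \<Rightarrow> int \<Rightarrow> 'e \<Rightarrow> 'e) \<Rightarrow> bool" where
  "charted C1 a N \<kappa> \<rho> x i A' \<longleftrightarrow>
      (\<forall>n. i n \<in> I \<and> x n \<in> chart_ball (i n) 0 \<and> f (x n) \<in> chart_ball (i (n + 1)) (r0 / 2)) \<and>
      (\<forall>j. admissible C1 (A' j)) \<and> (\<forall>j n w. norm (A' j n w) \<le> a * norm w) \<and>
      (\<forall>n w. norm (DI (i n) (i (n + 1)) f (x n) w) \<le> a * norm w) \<and>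
      (\<forall>j n w. j \<le> n \<longrightarrow> n \<le> j + 2 * int N \<longrightarrow> norm (A' j n w - DI (i n) (i (n + 1)) f (x n) w) \<le> \<kappa> * norm w) \<and>
      (\<forall>n \<xi>. norm (\<xi> - ph (i n) (x n)) \<le> \<rho> \<longrightarrow> phi (i n) \<xi> \<in> chart_ball (i n) r0 \<and> ph (i n) (phi (i n) \<xi>) = \<xi> \<and>
         f (phi (i n) \<xi>) \<in> chart_ball (i (n + 1)) r0 \<and>
         (\<forall>v. norm (DI (i n) (i (n + 1)) f (phi (i n) \<xi>) v - DI (i n) (i (n + 1)) f (x n) v) \<le> \<kappa> / 2 * norm v))"

lemma chartedD:
  assumes "charted C1 a N \<kappa> \<rho> x i A'"
  shows "i n \<in> I" "x n \<in> chart_ball (i n) 0" "f (x n) \<in> chart_ball (i (n + 1)) (r0 / 2)"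
    "admissible C1 (A' j)" "norm (A' j n w) \<le> a * norm w"
    "norm (DI (i n) (i (n + 1)) f (x n) w) \<le> a * norm w"
    "j \<le> n \<Longrightarrow> n \<le> j + 2 * int N \<Longrightarrow> norm (A' j n w - DI (i n) (i (n + 1)) f (x n) w) \<le> \<kappa> * norm w"
    "norm (\<xi> - ph (i n) (x n)) \<le> \<rho> \<Longrightarrow> phi (i n) \<xi> \<in> chart_ball (i n) r0 \<and> ph (i n) (phi (i n) \<xi>) = \<xi> \<and>
       f (phi (i n) \<xi>) \<in> chart_ball (i (n + 1)) r0 \<and>
       (\<forall>v. norm (DI (i n) (i (n + 1)) f (phi (i n) \<xi>) v - DI (i n) (i (n + 1)) f (x n) v) \<le> \<kappa> / 2 * norm v)"
  using assms unfolding charted_def by blast+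

text \<open>The order of choices matters: \<open>C1\<close> and \<open>a\<close> come from the
  orbits of \<open>f\<close>, then \<open>\<kappa>\<close> and \<open>N\<close> are fixed so that
  both errors are absorbed, then \<open>\<rho>\<close> from the uniform continuity of the
  derivative, and last \<open>\<eta>\<close>, small enough for the whole window.\<close>

lemma pseudo_orbit_charted:
  "\<exists>C1>0. \<exists>a>0. \<exists>N>0. \<exists>\<kappa>>0. \<exists>\<rho>>0. \<exists>\<eta>>0. C1 * (2 * \<kappa> + 2 * a / real N) \<le> 1 / 2 \<and>
    (\<forall>x. (\<forall>n :: int. rdist M (f (x n)) (x (n + 1)) < ennreal \<eta>) \<longrightarrow> (\<exists>i A'. charted C1 a N \<kappa> \<rho> x i A'))"
proof -
  obtain C1 where C1: "0 < C1" "\<And>y k. (\<And>n. y (n + 1) = f (y n)) \<Longrightarrow> (\<And>n. k n \<in> I \<and> y n \<in> chart_ball (k n) (2 * r0)) \<Longrightarrow>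
     admissible C1 (\<lambda>n. DI (k n) (k (n + 1)) f (y n))" using orbits_admissible by blast
  obtain a where a: "0 < a" "\<And>i j x v. i \<in> I \<Longrightarrow> j \<in> I \<Longrightarrow> x \<in> chart_ball i r0 \<Longrightarrow> f x \<in> chart_ball j r0 \<Longrightarrow> norm (DI i j f x v) \<le> a * norm v"
    using DI_bounded[OF f_C1(1)] by blast
  \<comment> \<open>After multiplication by \<open>C1\<close>, the terms \<open>2 * \<kappa>\<close>
    and \<open>2 * a / real N\<close> contribute at most 1/4 each.\<close>
  define \<kappa> where "\<kappa> = 1 / (8 * C1)"
  have \<kappa>: "0 < \<kappa>" using C1 by (simp add: \<kappa>_def)
  obtain N where N: "8 * C1 * a < real N" using reals_Archimedean2 by blast
  have N0: "0 < N" using N C1(1) a(1) by (metis gr0I mult_pos_pos of_nat_0 less_asym zero_less_numeral)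
  have small: "C1 * (2 * \<kappa> + 2 * a / real N) \<le> 1 / 2"
  proof -
    have "C1 * (2 * a / real N) \<le> 1 / 4" using N N0 C1(1) by (simp add: field_simps)
    moreover have "C1 * (2 * \<kappa>) = 1 / 4" using C1(1) by (simp add: \<kappa>_def)
    ultimately show ?thesis unfolding distrib_left by linarith
  qed
  obtain \<rho> where \<rho>: "0 < \<rho>" "\<And>i j x \<xi>. i \<in> I \<Longrightarrow> j \<in> I \<Longrightarrow> x \<in> chart_ball i 0 \<Longrightarrow> f x \<in> chart_ball j (r0 / 2) \<Longrightarrow> norm (\<xi> - ph i x) \<le> \<rho> \<Longrightarrow>
      phi i \<xi> \<in> chart_ball i r0 \<and> ph i (phi i \<xi>) = \<xi> \<and> f (phi i \<xi>) \<in> chart_ball j r0 \<and>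
      (\<forall>v. norm (DI i j f (phi i \<xi>) v - DI i j f x v) \<le> \<kappa> / 2 * norm v)"
    using DI_uniform[OF f_C1(1), of "\<kappa> / 2"] \<kappa> by auto
  obtain Cl \<delta> where Cl: "0 < Cl" "0 < \<delta>" "\<And>i x y l. i \<in> I \<Longrightarrow> x \<in> chart_ball i (2 * r0) \<Longrightarrow> l < \<delta> \<Longrightarrow> rdist M x y < ennreal l \<Longrightarrow>
      y \<in> fst (cat i) \<and> norm (ph i y - ph i x) \<le> Cl * l" using rdist_lower by blast
  \<comment> \<open>In coordinates the true orbit stays within \<rho> of the pseudo-orbit, where the
    derivative varies by at most \<open>\<kappa> / 2\<close>, and \<open>f (x n)\<close> stays
    within \<open>r0 / 2\<close> of \<open>x (n + 1)\<close>.\<close>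
  define \<epsilon> where "\<epsilon> = min (\<delta> / 2) (min \<rho> (r0 / 2) / Cl)"
  have \<epsilon>: "0 < \<epsilon>" "\<epsilon> < \<delta>" using Cl \<rho>(1) r0 by (auto simp: \<epsilon>_def)
  have Cl\<epsilon>: "Cl * \<epsilon> \<le> \<rho>" "Cl * \<epsilon> \<le> r0 / 2"
  proof -
    have "Cl * \<epsilon> \<le> Cl * (min \<rho> (r0 / 2) / Cl)" using Cl(1) by (intro mult_left_mono) (auto simp: \<epsilon>_def)
    then show "Cl * \<epsilon> \<le> \<rho>" "Cl * \<epsilon> \<le> r0 / 2" using Cl(1) by auto
  qed
  \<comment> \<open>One step more than the window: the derivative at
    \<open>n = j + 2 * int N\<close> also involves the chart at time \<open>n + 1\<close>.\<close>
  obtain \<eta>0 where \<eta>0: "0 < \<eta>0" "\<And>x :: int \<Rightarrow> 'a. \<And>j k. (\<forall>n. rdist M (f (x n)) (x (n + 1)) < ennreal \<eta>0) \<Longrightarrow> k \<le> 2 * N + 1 \<Longrightarrow>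
      rdist M ((f ^^ k) (x j)) (x (j + int k)) < ennreal \<epsilon>"
    using pseudo_orbit_window[OF cpt f_C1(4) \<epsilon>(1), of "2 * N + 1"] by blast
  define \<eta> where "\<eta> = min \<eta>0 \<epsilon>"
  have \<eta>: "0 < \<eta>" "ennreal \<eta> \<le> ennreal \<eta>0" "ennreal \<eta> \<le> ennreal \<epsilon>" using \<eta>0(1) \<epsilon>(1) by (auto simp: \<eta>_def intro: ennreal_leI)
  have main: "\<exists>i A'. charted C1 a N \<kappa> \<rho> x i A'"
    if x: "\<forall>n. rdist M (f (x n)) (x (n + 1)) < ennreal \<eta>" for x :: "int \<Rightarrow> 'a"
  proof -
    have x\<eta>0: "\<forall>n. rdist M (f (x n)) (x (n + 1)) < ennreal \<eta>0" using x \<eta>(2) less_le_trans by blast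
    have "\<forall>z. \<exists>i\<in>I. z \<in> chart_ball i 0" using chart_ball_cover by blast
    then obtain ix where ix: "\<And>z. ix z \<in> I" "\<And>z. z \<in> chart_ball (ix z) 0" by metis
    define i where "i n = ix (x n)" for n
    have iI: "i n \<in> I" "x n \<in> chart_ball (i n) 0" for n using ix by (auto simp: i_def)
    have xK: "x n \<in> chart_ball (i n) (2 * r0)" "x n \<in> chart_ball (i n) r0" for n using chart_ball_mono[OF iI(2)] r0 by auto
    have fx: "f (x n) \<in> chart_ball (i (n + 1)) (r0 / 2)" for n
    proof -
      have "rdist M (x (n + 1)) (f (x n)) < ennreal \<epsilon>"
        using x \<eta>(3) rdist_sym less_le_trans by metis
      from Cl(3)[OF iI(1) xK(1) \<epsilon>(2) this]
      have "f (x n) \<in> chart_ball (i (n + 1)) (0 + r0 / 2)" using Cl\<epsilon>(2) by (intro chart_ball_near[OF iI(2)]) auto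
      then show ?thesis by simp
    qed
    have fxr: "f (x n) \<in> chart_ball (i (n + 1)) r0" for n using chart_ball_mono[OF fx] r0 by auto
    define y where "y j n = zf (n - j) (x j)" for j n
    have yf: "y j (n + 1) = f (y j n)" for j n
      unfolding y_def using ziter_Suc[OF bij, of "n - j"] by (simp add: algebra_simps)
    \<comment> \<open>On the window the orbit is read in the charts of the pseudo-orbit, elsewhere
      in any chart around it, since only admissibility and the bound \<open>a\<close> are asked for
      there.\<close>
    define k where "k j n = (if j \<le> n \<and> n \<le> j + 2 * int N + 1 then i n else ix (y j n))" for j n
    have ywin: "norm (ph (i n) (y j n) - ph (i n) (x n)) \<le> \<rho> \<and> y j n \<in> fst (cat (i n))"
      if "j \<le> n" "n \<le> j + 2 * int N + 1" for j n
    proof -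
      define t where "t = nat (n - j)"
      have t: "t \<le> 2 * N + 1" "n = j + int t" using that by (auto simp: t_def)
      have "y j n = (f ^^ t) (x j)" unfolding y_def t(2) by (simp add: ziter_nat)
      then have "rdist M (x n) (y j n) < ennreal \<epsilon>" using \<eta>0(2)[OF x\<eta>0 t(1), of j] t(2) rdist_sym by metis
      from Cl(3)[OF iI(1) xK(1) \<epsilon>(2) this] Cl\<epsilon>(1) show ?thesis by auto
    qed
    have loc: "phi (i n) \<xi> \<in> chart_ball (i n) r0 \<and> ph (i n) (phi (i n) \<xi>) = \<xi> \<and> f (phi (i n) \<xi>) \<in> chart_ball (i (n + 1)) r0 \<and>
      (\<forall>v. norm (DI (i n) (i (n + 1)) f (phi (i n) \<xi>) v - DI (i n) (i (n + 1)) f (x n) v) \<le> \<kappa> / 2 * norm v)"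
      if "norm (\<xi> - ph (i n) (x n)) \<le> \<rho>" for n \<xi> by (rule \<rho>(2)[OF iI(1) iI(1) iI(2) fx that])
    have yK: "k j n \<in> I \<and> y j n \<in> chart_ball (k j n) r0" for j n
    proof (cases "j \<le> n \<and> n \<le> j + 2 * int N + 1")
      case True
      then have "phi (i n) (ph (i n) (y j n)) \<in> chart_ball (i n) r0" using loc ywin by blast
      then show ?thesis using True ywin iI(1) by (simp add: k_def phi_ph)
    next
      case False
      then show ?thesis unfolding k_def if_not_P[OF False] using ix(1) chart_ball_mono[OF ix(2)[of "y j n"]] r0 by auto
    qed
    define A' where "A' j n = DI (k j n) (k j (n + 1)) f (y j n)" for j n
    have adm: "admissible C1 (A' j)" for j
      unfolding A'_def
    proof (rule C1(2)[where y="y j" and k="k j"])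
      show "y j (n + 1) = f (y j n)" for n by (rule yf)
      have "r0 \<le> 2 * r0" using r0 by simp
      then show "k j n \<in> I \<and> y j n \<in> chart_ball (k j n) (2 * r0)" for n
        using yK[of j n] chart_ball_mono[of "y j n" "k j n" r0 "2 * r0"] by simp
    qed
    have A'a: "norm (A' j n w) \<le> a * norm w" for j n w
      unfolding A'_def using yK[of j n] yK[of j "n + 1"] by (intro a(2)) (auto simp: yf)
    have Aa: "norm (DI (i n) (i (n + 1)) f (x n) w) \<le> a * norm w" for n w
      by (rule a(2)[OF iI(1) iI(1) xK(2) fxr])
    have near: "norm (A' j n w - DI (i n) (i (n + 1)) f (x n) w) \<le> \<kappa> * norm w" if jn: "j \<le> n" "n \<le> j + 2 * int N" for j n w
    proof -
      have k: "k j n = i n" "k j (n + 1) = i (n + 1)" using jn by (auto simp: k_def)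
      have yw: "norm (ph (i n) (y j n) - ph (i n) (x n)) \<le> \<rho>" "y j n \<in> fst (cat (i n))" using ywin[of j n] jn by auto
      have "norm (DI (i n) (i (n + 1)) f (phi (i n) (ph (i n) (y j n))) w - DI (i n) (i (n + 1)) f (x n) w) \<le> \<kappa> / 2 * norm w"
        using loc[OF yw(1)] by blast
      then have "norm (A' j n w - DI (i n) (i (n + 1)) f (x n) w) \<le> \<kappa> / 2 * norm w"
        unfolding A'_def k phi_ph[OF yw(2)] .
      also have "\<dots> \<le> \<kappa> * norm w" using \<kappa> by (intro mult_right_mono) auto
      finally show ?thesis .
    qed
    show ?thesis unfolding charted_def using iI fx adm A'a Aa near loc by (intro exI[of _ i] exI[of _ A']) blast
  qed
  show ?thesis
    by (rule exI[of _ C1], rule conjI[OF C1(1)], rule exI[of _ a], rule conjI[OF a(1)],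
      rule exI[of _ N], rule conjI[OF N0], rule exI[of _ \<kappa>], rule conjI[OF \<kappa>],
      rule exI[of _ \<rho>], rule conjI[OF \<rho>(1)], rule exI[of _ \<eta>], rule conjI[OF \<eta>(1)], rule conjI[OF small])
      (rule allI, rule impI, erule main)
qed

end

context anosov_atlas
begin

lemma C1_nbhd_rdist:
  "\<exists>Cu>0. \<forall>\<kappa> g. \<kappa> \<le> r0 \<longrightarrow> g \<in> C1_nbhd \<kappa> \<longrightarrow> (\<forall>x. rdist M (f x) (g x) \<le> ennreal (Cu * \<kappa>))"
proof -
  obtain Cu where Cu: "0 < Cu" "\<And>i x y. i \<in> I \<Longrightarrow> x \<in> chart_ball i (2 * r0) \<Longrightarrow> y \<in> chart_ball i (2 * r0) \<Longrightarrow>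
      rdist M x y \<le> ennreal (Cu * norm (ph i y - ph i x))" using rdist_upper by blast
  have "rdist M (f x) (g x) \<le> ennreal (Cu * \<kappa>)" if \<kappa>: "\<kappa> \<le> r0" and g: "g \<in> C1_nbhd \<kappa>" for \<kappa> g x
  proof -
    obtain s where s: "s < \<kappa>" "0 \<le> s" "C1_close s g" using g unfolding C1_nbhd_def by auto
    obtain i where i: "i \<in> I" "x \<in> chart_ball i 0" using chart_ball_cover by blast
    obtain j where j: "j \<in> I" "f x \<in> chart_ball j 0" using chart_ball_cover by blast
    have "x \<in> chart_ball i r0" "f x \<in> chart_ball j r0" using chart_ball_mono[OF i(2)] chart_ball_mono[OF j(2)] r0 by auto
    then have gx: "g x \<in> fst (cat j)" "norm (ph j (g x) - ph j (f x)) \<le> s"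
      using s(3) i(1) j(1) unfolding C1_close_def by blast+
    have "g x \<in> chart_ball j (0 + s)" by (rule chart_ball_near[OF j(2) gx])
    then have "g x \<in> chart_ball j (2 * r0)" by (rule chart_ball_mono) (use s \<kappa> in simp)
    moreover have "f x \<in> chart_ball j (2 * r0)" by (rule chart_ball_mono[OF j(2)]) (use r0 in simp)
    ultimately have "rdist M (f x) (g x) \<le> ennreal (Cu * norm (ph j (g x) - ph j (f x)))" using Cu(2)[OF j(1)] by blast
    also have "\<dots> \<le> ennreal (Cu * \<kappa>)" using gx(2) s Cu(1) by (intro ennreal_leI mult_left_mono) auto
    finally show ?thesis .
  qed
  then show ?thesis using Cu(1) by blast
qed

text \<open>The mean value inequality on the ball of radius \<open>\<rho>\<close>. The derivative of
  the remainder splits into the difference of the derivatives of \<open>g\<close> and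
  \<open>f\<close> at the moved point, at most \<open>s\<close>, and the variation of the derivative
  of \<open>f\<close>, at most \<open>\<kappa> / 2\<close>.\<close>

lemma remainder_lipschitz:
  assumes g: "C1_diffeo M g" "C1_close s g" "s \<le> \<kappa> / 2" and ij: "i \<in> I" "j \<in> I"
    and x: "x \<in> chart_ball i r0" "f x \<in> chart_ball j r0"
    and loc: "\<And>\<xi>. norm (\<xi> - ph i x) \<le> \<rho> \<Longrightarrow> phi i \<xi> \<in> chart_ball i r0 \<and> ph i (phi i \<xi>) = \<xi> \<and>
         f (phi i \<xi>) \<in> chart_ball j r0 \<and> (\<forall>v. norm (DI i j f (phi i \<xi>) v - DI i j f x v) \<le> \<kappa> / 2 * norm v)"
    and v: "norm v \<le> \<rho>" "norm w \<le> \<rho>"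
  shows "norm ((ph j (g (phi i (ph i x + v))) - DI i j f x v) - (ph j (g (phi i (ph i x + w))) - DI i j f x w)) \<le> \<kappa> * norm (v - w)"
proof -
  let ?h = "\<lambda>v. chart_rep (cat i) (cat j) g (ph i x + v) - DI i j f x v"
  have dg: "diffable g" using g(1) C1_map_diffable unfolding C1_diffeo_def by blast
  have lf: "linear (DI i j f x)" by (intro chart_deriv_linear f_C1 cat chart_ball_dom[OF x(1)] chart_ball_dom[OF x(2)])
  have "norm (?h v - ?h w) \<le> \<kappa> * norm (v - w)"
  proof (rule differentiable_bound[of "cball 0 \<rho>" ?h "\<lambda>u v. DI i j g (phi i (ph i x + u)) v - DI i j f x v"])
    fix u :: 'e assume "u \<in> cball 0 \<rho>"
    then have "norm ((ph i x + u) - ph i x) \<le> \<rho>" by simp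
    note l = loc[OF this]
    let ?z = "phi i (ph i x + u)"
    have gz: "g ?z \<in> fst (cat j)" "\<And>v. norm (DI i j g ?z v - DI i j f ?z v) \<le> s * norm v"
      using g(2) ij l unfolding C1_close_def by blast+
    have "(chart_rep (cat i) (cat j) g has_derivative DI i j g ?z) (at (ph i x + u))"
      using chart_deriv_has[OF dg cat(1) cat(1) chart_ball_dom gz(1), of i] l by metis
    then have "((\<lambda>v. chart_rep (cat i) (cat j) g (ph i x + v)) has_derivative DI i j g ?z) (at u)"
      by (rule has_derivative_compose[rotated]) (auto intro!: derivative_eq_intros)
    then have "(?h has_derivative (\<lambda>v. DI i j g ?z v - DI i j f x v)) (at u)"
      by (intro has_derivative_diff linear_imp_has_derivative lf)
    then show "(?h has_derivative (\<lambda>v. DI i j g ?z v - DI i j f x v)) (at u within cball 0 \<rho>)"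
      by (rule has_derivative_at_withinI)
    show "onorm (\<lambda>v. DI i j g ?z v - DI i j f x v) \<le> \<kappa>"
    proof (rule onorm_le)
      fix v
      have "norm (DI i j g ?z v - DI i j f x v) \<le> norm (DI i j g ?z v - DI i j f ?z v) + norm (DI i j f ?z v - DI i j f x v)"
        using norm_triangle_ineq[of "DI i j g ?z v - DI i j f ?z v" "DI i j f ?z v - DI i j f x v"] by simp
      also have "\<dots> \<le> s * norm v + \<kappa> / 2 * norm v" using gz(2) l by (intro add_mono) auto
      also have "\<dots> \<le> \<kappa> / 2 * norm v + \<kappa> / 2 * norm v" using g(3) by (intro add_right_mono mult_right_mono) auto
      finally show "norm (DI i j g ?z v - DI i j f x v) \<le> \<kappa> * norm v" by simp
    qed
  qed (use v in auto)
  then show ?thesis by (simp add: chart_rep_def)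
qed

text \<open>Stated for orbits \<open>p\<close> rather than initial points, to match the sequences of
  \<open>perturbed_solution\<close> and \<open>perturbed_unique\<close>. The bound
  \<open>Cs * \<delta>\<close> is linear in \<delta>, which Lipschitz shadowing and the estimate for
  the conjugacy both need.\<close>

lemma shadowing_core:
  "\<exists>\<kappa>0>0. \<kappa>0 \<le> r0 \<and> (\<exists>Cs>0. \<exists>\<delta>0>0. \<exists>\<beta>0>0. \<forall>F :: int \<Rightarrow> 'a \<Rightarrow> 'a. (\<forall>n. F n \<in> C1_nbhd \<kappa>0) \<longrightarrow>
     (\<forall>x \<delta>. \<delta> \<le> \<delta>0 \<longrightarrow> (\<forall>n. rdist M (F n (x n)) (x (n + 1)) < ennreal \<delta>) \<longrightarrow>
        (\<exists>p. (\<forall>n. p (n + 1) = F n (p n)) \<and> (\<forall>n. rdist M (p n) (x n) \<le> ennreal (Cs * \<delta>)))) \<and>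
     (\<forall>p q. (\<forall>n. p (n + 1) = F n (p n)) \<longrightarrow> (\<forall>n. q (n + 1) = F n (q n)) \<longrightarrow>
        (\<forall>n. rdist M (p n) (q n) < ennreal \<beta>0) \<longrightarrow> p = q))"
proof -
  obtain C1 a N \<kappa> \<rho> \<eta> where pos: "0 < C1" "0 < a" "0 < (N :: nat)" "0 < \<kappa>" "0 < \<rho>" "0 < \<eta>"
    and small: "C1 * (2 * \<kappa> + 2 * a / real N) \<le> 1 / 2"
    and charts_at: "\<And>x. \<forall>n :: int. rdist M (f (x n)) (x (n + 1)) < ennreal \<eta> \<Longrightarrow> \<exists>i A'. charted C1 a N \<kappa> \<rho> x i A'"
    using pseudo_orbit_charted by metis
  obtain Cu where Cu: "0 < Cu" "\<And>\<kappa> g x. \<kappa> \<le> r0 \<Longrightarrow> g \<in> C1_nbhd \<kappa> \<Longrightarrow> rdist M (f x) (g x) \<le> ennreal (Cu * \<kappa>)"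
    using C1_nbhd_rdist by blast
  obtain Ck where Ck: "0 < Ck" "\<And>i x y. i \<in> I \<Longrightarrow> x \<in> chart_ball i (2 * r0) \<Longrightarrow> y \<in> chart_ball i (2 * r0) \<Longrightarrow>
      rdist M x y \<le> ennreal (Ck * norm (ph i y - ph i x))" using rdist_upper by blast
  obtain Cl \<delta>l where Cl: "0 < Cl" "0 < \<delta>l" "\<And>i x y l. i \<in> I \<Longrightarrow> x \<in> chart_ball i (2 * r0) \<Longrightarrow> l < \<delta>l \<Longrightarrow> rdist M x y < ennreal l \<Longrightarrow>
      y \<in> fst (cat i) \<and> norm (ph i y - ph i x) \<le> Cl * l" using rdist_lower by blast
  \<comment> \<open>\<open>r0\<close> keeps images in the charts, \<open>\<kappa> / 2\<close> is the
    share of the perturbation in \<open>remainder_lipschitz\<close>, and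
    \<open>\<eta> / 2 / Cu\<close> makes orbits of \<open>F\<close> into pseudo-orbits of
    \<open>f\<close> with half of \<open>\<eta>\<close> to spare.\<close>
  define \<kappa>0 where "\<kappa>0 = min (min r0 (\<kappa> / 2)) (\<eta> / 2 / Cu)"
  have \<kappa>0: "0 < \<kappa>0" "\<kappa>0 \<le> r0" "\<kappa>0 \<le> \<kappa> / 2" "\<kappa>0 \<le> \<eta> / 2 / Cu"
    using pos r0 Cu(1) by (auto simp: \<kappa>0_def)
  have Cu\<kappa>: "Cu * \<kappa>0 \<le> \<eta> / 2" using mult_left_mono[OF \<kappa>0(4), of Cu] Cu(1) by simp
  \<comment> \<open>\<open>Cl\<close> turns the error of the pseudo-orbit into coordinates,
    \<open>2 * C1\<close> is the loss in solving, \<open>Ck\<close> turns the correction back into a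
    distance.\<close>
  define Cs where "Cs = Ck * (2 * C1 * Cl)"
  define \<delta>0 where "\<delta>0 = min (min (\<eta> / 2) (\<delta>l / 2)) (\<rho> / (2 * C1 * Cl))"
  have \<delta>0: "0 < \<delta>0" "\<delta>0 \<le> \<eta> / 2" "\<delta>0 < \<delta>l" "\<delta>0 \<le> \<rho> / (2 * C1 * Cl)"
    using pos Cl by (auto simp: \<delta>0_def)
  define \<beta>0 where "\<beta>0 = min (\<delta>l / 2) (\<rho> / Cl)"
  have \<beta>0: "0 < \<beta>0" "\<beta>0 < \<delta>l" "\<beta>0 \<le> \<rho> / Cl" using pos Cl by (auto simp: \<beta>0_def)
  have Cl\<beta>: "Cl * \<beta>0 \<le> \<rho>" using mult_left_mono[OF \<beta>0(3), of Cl] Cl(1) by simp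
  show ?thesis
  proof (rule exI[of _ \<kappa>0], intro conjI \<kappa>0(1,2), rule exI[of _ Cs], rule conjI, goal_cases)
    case 1 show "0 < Cs" using Ck(1) pos Cl(1) by (simp add: Cs_def)
  next
    case 2
    show ?case
    proof (rule exI[of _ \<delta>0], intro conjI \<delta>0(1), rule exI[of _ \<beta>0], intro conjI \<beta>0(1), rule allI, rule impI)
      fix F :: "int \<Rightarrow> 'a \<Rightarrow> 'a" assume F: "\<forall>n. F n \<in> C1_nbhd \<kappa>0"
      have Fcl: "C1_diffeo M (F n) \<and> (\<exists>s\<le>\<kappa> / 2. C1_close s (F n))" for n
      proof -
        obtain s where "C1_diffeo M (F n)" "s < \<kappa>0" "C1_close s (F n)" using F unfolding C1_nbhd_def by blast
        moreover have "s \<le> \<kappa> / 2" using \<open>s < \<kappa>0\<close> \<kappa>0(3) by simp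
        ultimately show ?thesis by blast
      qed
      have Fdom: "F n z \<in> fst (cat j)" if "i \<in> I" "j \<in> I" "z \<in> chart_ball i r0" "f z \<in> chart_ball j r0" for n i j z
        using Fcl[of n] that unfolding C1_close_def by blast
      have near_f: "\<forall>n. rdist M (f (x n)) (x (n + 1)) < ennreal \<eta>"
        if x: "\<forall>n. rdist M (F n (x n)) (x (n + 1)) < ennreal \<delta>" and \<delta>: "\<delta> \<le> \<eta> / 2" for x \<delta>
      proof
        fix n
        have "rdist M (f (x n)) (x (n + 1)) \<le> rdist M (f (x n)) (F n (x n)) + rdist M (F n (x n)) (x (n + 1))"
          by (rule rdist_triangle)
        also have "\<dots> \<le> ennreal (\<eta> / 2) + rdist M (F n (x n)) (x (n + 1))"
        proof (rule add_right_mono)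
          show "rdist M (f (x n)) (F n (x n)) \<le> ennreal (\<eta> / 2)"
            using order_trans[OF Cu(2)[OF \<kappa>0(2) F[rule_format]] ennreal_leI[OF Cu\<kappa>]] .
        qed
        also have "\<dots> < ennreal (\<eta> / 2) + ennreal (\<eta> / 2)"
          using less_le_trans[OF x[rule_format, of n] ennreal_leI[OF \<delta>]] by (simp add: ennreal_add_left_cancel_less)
        also have "\<dots> = ennreal \<eta>" using pos by (simp add: ennreal_plus[symmetric] del: ennreal_plus)
        finally show "rdist M (f (x n)) (x (n + 1)) < ennreal \<eta>" .
      qed
      show "(\<forall>x \<delta>. \<delta> \<le> \<delta>0 \<longrightarrow> (\<forall>n. rdist M (F n (x n)) (x (n + 1)) < ennreal \<delta>) \<longrightarrow>
        (\<exists>p. (\<forall>n. p (n + 1) = F n (p n)) \<and> (\<forall>n. rdist M (p n) (x n) \<le> ennreal (Cs * \<delta>)))) \<and>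
       (\<forall>p q. (\<forall>n. p (n + 1) = F n (p n)) \<longrightarrow> (\<forall>n. q (n + 1) = F n (q n)) \<longrightarrow>
        (\<forall>n. rdist M (p n) (q n) < ennreal \<beta>0) \<longrightarrow> p = q)"
      proof (intro conjI allI impI)
        fix x :: "int \<Rightarrow> 'a" and \<delta> assume \<delta>: "\<delta> \<le> \<delta>0" and x: "\<forall>n. rdist M (F n (x n)) (x (n + 1)) < ennreal \<delta>"
        have "\<forall>n. rdist M (f (x n)) (x (n + 1)) < ennreal \<eta>" by (rule near_f[OF x]) (use \<delta> \<delta>0(2) in simp)
        then obtain i A' where ch: "charted C1 a N \<kappa> \<rho> x i A'" using charts_at by blast
        note i = chartedD(1-3)[OF ch] and A' = chartedD(4,5)[OF ch] and A = chartedD(6)[OF ch]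
          and near = chartedD(7)[OF ch] and loc = chartedD(8)[OF ch]
        have lev: "x n \<in> chart_ball (i n) r0" "x n \<in> chart_ball (i n) (2 * r0)" "f (x n) \<in> chart_ball (i (n + 1)) r0" for n
          using chart_ball_mono[OF i(2)[of n]] chart_ball_mono[OF i(3)[of n]] r0 by auto
        define A where "A n = DI (i n) (i (n + 1)) f (x n)" for n
        \<comment> \<open>The recursion \<open>v (n + 1) = A n (v n) + r n (v n)\<close> says in
          coordinates that \<open>x n\<close> corrected by \<open>v n\<close> is an orbit of
          \<open>F\<close>; \<open>r n 0\<close> is the error of the pseudo-orbit.\<close>
        define r where "r n v = (ph (i (n + 1)) (F n (phi (i n) (ph (i n) (x n) + v))) - A n v) - ph (i (n + 1)) (x (n + 1))" for n v
        have linA: "linear (A n)" for n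
          unfolding A_def by (intro chart_deriv_linear f_C1 cat chart_ball_dom[OF lev(1)] chart_ball_dom[OF lev(3)])
        have \<delta>p: "0 \<le> \<delta>" using x[rule_format, of 0] by (metis ennreal_neg linorder_le_cases not_less_zero)
        have r0': "norm (r n 0) \<le> Cl * \<delta>" for n
        proof -
          have "rdist M (x (n + 1)) (F n (x n)) < ennreal \<delta>" using x rdist_sym by metis
          from Cl(3)[OF i(1) lev(2) _ this] have "norm (ph (i (n + 1)) (F n (x n)) - ph (i (n + 1)) (x (n + 1))) \<le> Cl * \<delta>"
            using \<delta> \<delta>0(3) by simp
          then show ?thesis unfolding r_def by (simp add: linear_0[OF linA] phi_ph[OF chart_ball_dom[OF i(2)]])
        qed
        have rL: "norm (r n v - r n w) \<le> \<kappa> * norm (v - w)" if "norm v \<le> \<rho>" "norm w \<le> \<rho>" for n v w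
        proof -
          obtain s where s: "C1_diffeo M (F n)" "s \<le> \<kappa> / 2" "C1_close s (F n)" using Fcl by blast
          show ?thesis
            using remainder_lipschitz[OF s(1,3,2) i(1) i(1) lev(1) lev(3) loc that, of n] unfolding r_def A_def by simp
        qed
        have "2 * C1 * (Cl * \<delta>) \<le> \<rho>"
        proof -
          have "2 * C1 * Cl * \<delta> \<le> 2 * C1 * Cl * (\<rho> / (2 * C1 * Cl))"
            using \<delta> \<delta>0(4) pos Cl(1) by (intro mult_left_mono) auto
          then show ?thesis using pos Cl(1) by (simp add: mult.assoc)
        qed
        note \<rho>b = this
        have "\<exists>v. (\<forall>n. norm (v n) \<le> 2 * C1 * (Cl * \<delta>)) \<and> (\<forall>n. v (n + 1) = A n (v n) + r n (v n))"
        proof (rule perturbed_solution[where A'=A' and a=a and N=N and \<kappa>=\<kappa> and \<rho>=\<rho>])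
          show "norm (A' j n w - A n w) \<le> \<kappa> * norm w" if "j \<le> n" "n \<le> j + int N" for j n w
            unfolding A_def by (rule near) (use that in auto)
          show "norm (A n w) \<le> a * norm w" for n w unfolding A_def by (rule A)
        qed (use A' linA pos r0' rL small \<rho>b in auto)
        then obtain v where v: "\<And>n. norm (v n) \<le> 2 * C1 * (Cl * \<delta>)" "\<And>n. v (n + 1) = A n (v n) + r n (v n)" by blast
        define p where "p n = phi (i n) (ph (i n) (x n) + v n)" for n
        have nv: "norm ((ph (i n) (x n) + v n) - ph (i n) (x n)) \<le> \<rho>" for n using v(1)[of n] \<rho>b by simp
        note lp = loc[OF nv]
        have pK: "p n \<in> chart_ball (i n) r0" "ph (i n) (p n) = ph (i n) (x n) + v n" "f (p n) \<in> chart_ball (i (n + 1)) r0" for n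
          using lp[of n] unfolding p_def by blast+
        have "p (n + 1) = F n (p n)" for n
        proof -
          have "F n (p n) \<in> fst (cat (i (n + 1)))" by (rule Fdom[OF i(1) i(1) pK(1) pK(3)])
          then have "F n (p n) = phi (i (n + 1)) (ph (i (n + 1)) (F n (p n)))" by (simp add: phi_ph)
          also have "ph (i (n + 1)) (F n (p n)) = ph (i (n + 1)) (x (n + 1)) + v (n + 1)"
            unfolding v(2) r_def p_def by simp
          finally show ?thesis unfolding p_def[of "n + 1"] by simp
        qed
        moreover have "rdist M (p n) (x n) \<le> ennreal (Cs * \<delta>)" for n
        proof -
          have "p n \<in> chart_ball (i n) (2 * r0)" by (rule chart_ball_mono[OF pK(1)]) (use r0 in simp)
          then have "rdist M (p n) (x n) \<le> ennreal (Ck * norm (ph (i n) (x n) - ph (i n) (p n)))"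
            using Ck(2)[OF i(1) _ lev(2)] by blast
          also have "\<dots> \<le> ennreal (Cs * \<delta>)"
            using v(1)[of n] Ck(1) unfolding pK(2) Cs_def by (intro ennreal_leI) (simp add: mult.assoc)
          finally show ?thesis .
        qed
        ultimately show "\<exists>p. (\<forall>n. p (n + 1) = F n (p n)) \<and> (\<forall>n. rdist M (p n) (x n) \<le> ennreal (Cs * \<delta>))" by blast
      next
        fix x q assume x: "\<forall>n. x (n + 1) = F n (x n)" and q: "\<forall>n. q (n + 1) = F n (q n)"
          and xq: "\<forall>n. rdist M (x n) (q n) < ennreal \<beta>0"
        have "\<forall>n. rdist M (F n (x n)) (x (n + 1)) < ennreal (\<eta> / 2)" using x pos by (simp add: rdist_self)
        then have "\<forall>n. rdist M (f (x n)) (x (n + 1)) < ennreal \<eta>" by (rule near_f) simp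
        then obtain i A' where ch: "charted C1 a N \<kappa> \<rho> x i A'" using charts_at by blast
        note i = chartedD(1-3)[OF ch] and A' = chartedD(4,5)[OF ch] and A = chartedD(6)[OF ch]
          and near = chartedD(7)[OF ch] and loc = chartedD(8)[OF ch]
        have lev: "x n \<in> chart_ball (i n) r0" "x n \<in> chart_ball (i n) (2 * r0)" "f (x n) \<in> chart_ball (i (n + 1)) r0" for n
          using chart_ball_mono[OF i(2)[of n]] chart_ball_mono[OF i(3)[of n]] r0 by auto
        define d where "d n = ph (i n) (q n) - ph (i n) (x n)" for n
        have qd: "q n \<in> fst (cat (i n))" "norm (d n) \<le> \<rho>" for n
          using Cl(3)[OF i(1) lev(2) \<beta>0(2) xq[rule_format]] Cl\<beta> unfolding d_def by (blast, meson order_trans)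
        have q_eq: "q n = phi (i n) (ph (i n) (x n) + d n)" for n
          unfolding d_def using phi_ph[OF qd(1)] by simp
        have x_eq: "x n = phi (i n) (ph (i n) (x n) + 0)" for n
          using phi_ph[OF chart_ball_dom[OF i(2)]] by simp
        \<comment> \<open>Both sequences are orbits of \<open>F\<close>, so the constant error
          cancels and \<open>remainder_lipschitz\<close>, taken at \<open>d n\<close> and 0, leaves
          a term proportional to \<open>d n\<close>.\<close>
        have d1: "norm (d (n + 1) - DI (i n) (i (n + 1)) f (x n) (d n)) \<le> \<kappa> * norm (d n)" for n
        proof -
          obtain s where s: "C1_diffeo M (F n)" "s \<le> \<kappa> / 2" "C1_close s (F n)" using Fcl by blast
          have lin: "linear (DI (i n) (i (n + 1)) f (x n))"
            by (intro chart_deriv_linear f_C1 cat chart_ball_dom[OF lev(1)] chart_ball_dom[OF lev(3)])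
          have "norm (0 :: 'e) \<le> \<rho>" using pos by simp
          from remainder_lipschitz[OF s(1,3,2) i(1) i(1) lev(1) lev(3) loc qd(2)[of n] this, of n]
          have nd: "norm ((ph (i (n + 1)) (F n (q n)) - DI (i n) (i (n + 1)) f (x n) (d n)) - ph (i (n + 1)) (F n (x n))) \<le> \<kappa> * norm (d n)"
            unfolding q_eq[symmetric] x_eq[symmetric] linear_0[OF lin] by simp
          have e: "d (n + 1) = ph (i (n + 1)) (F n (q n)) - ph (i (n + 1)) (F n (x n))"
            unfolding d_def q[rule_format] x[rule_format] ..
          have "d (n + 1) - DI (i n) (i (n + 1)) f (x n) (d n)
              = (ph (i (n + 1)) (F n (q n)) - DI (i n) (i (n + 1)) f (x n) (d n)) - ph (i (n + 1)) (F n (x n))"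
            unfolding e by simp
          then show ?thesis using nd by (simp only:)
        qed
        have "d n = 0" for n
          by (rule perturbed_unique[where A'=A' and a=a and N=N and \<kappa>=\<kappa> and C=C1 and b=\<rho> and A="\<lambda>n. DI (i n) (i (n + 1)) f (x n)"])
            (use A' near pos small qd(2) d1 in auto)
        then show "x = q" using q_eq x_eq by (metis ext)
      qed
    qed
  qed
qed

end

section \<open>Shadowing and conjugacies for sequences\<close>

lemma seq_iter_0 [simp]: "seq_iter F 0 x = x"
  by (simp add: seq_iter_def)

lemma seq_iter_Suc:
  assumes "\<And>n. bij (F n)" shows "seq_iter F (n + 1) x = F n (seq_iter F n x)"
proof (cases "0 \<le> n")
  case True
  then show ?thesis by (simp add: seq_iter_def nat_add_distrib)
next
  case False
  define k where "k = nat (- n - 1)"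
  have n: "n = - int (Suc k)" using False by (simp add: k_def)
  have "backward_iter F k x = F n (backward_iter F (Suc k) x)"
    using surj_f_inv_f[OF bij_is_surj[OF assms[of n]]] unfolding n by simp
  moreover have "seq_iter F n x = backward_iter F (Suc k) x"
  proof -
    have "nat (- n) = Suc k" "\<not> 0 \<le> n" using False by (simp_all add: k_def)
    then show ?thesis unfolding seq_iter_def by simp
  qed
  moreover have "seq_iter F (n + 1) x = backward_iter F k x"
  proof (cases "k = 0")
    case True
    then show ?thesis by (simp add: n seq_iter_def)
  next
    case False
    then have "nat (- (n + 1)) = k" "\<not> 0 \<le> n + 1" by (simp_all add: n)
    then show ?thesis unfolding seq_iter_def by simp
  qed
  ultimately show ?thesis by simp
qed

lemma seq_iter_orbit:
  assumes F: "\<And>n. bij (F n)" and y: "\<And>n. y (n + 1) = F n (y n)"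
  shows "y n = seq_iter F n (y 0)"
proof (induction n rule: int_induct[where k=0])
  case base then show ?case by simp
next
  case (step1 n) then show ?case using y[of n] seq_iter_Suc[of F, OF F, of n "y 0"] by simp
next
  case (step2 n)
  have "F (n - 1) (y (n - 1)) = F (n - 1) (seq_iter F (n - 1) (y 0))"
    using step2 y[of "n - 1"] seq_iter_Suc[of F, OF F, of "n - 1" "y 0"] by simp
  then show ?case using bij_is_inj[OF F[of "n - 1"]] by (simp add: inj_eq)
qed

text \<open>As a function of \<open>k\<close> the right-hand side is an orbit of the shifted
  sequence, and orbits are determined by their value at 0; this treats all signs of \<open>m\<close>
  and \<open>k\<close> at once.\<close>

lemma seq_iter_shift:
  assumes F: "\<And>n. bij (F n)"
  shows "seq_iter (seq_shift m F) k (seq_iter F m x) = seq_iter F (m + k) x"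
proof -
  have "seq_iter F (m + k) x = seq_iter (seq_shift m F) k (seq_iter F (m + 0) x)"
  proof (rule seq_iter_orbit[where y="\<lambda>k. seq_iter F (m + k) x"])
    show "bij (seq_shift m F n)" for n by (simp add: seq_shift_def F)
    show "seq_iter F (m + (n + 1)) x = seq_shift m F n (seq_iter F (m + n) x)" for n
      using seq_iter_Suc[of F, OF F, of "m + n" x] by (simp add: seq_shift_def algebra_simps)
  qed
  then show ?thesis by simp
qed

lemma seq_shift_shift: "seq_shift m (seq_shift k F) = seq_shift (m + k) F"
  by (simp add: seq_shift_def algebra_simps)

lemma seq_shift_0 [simp]: "seq_shift 0 F = F"
  by (simp add: seq_shift_def)

lemma seq_dist_shift: "seq_dist M (seq_shift m F) (seq_shift m G) = seq_dist M F G"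
  unfolding seq_dist_def seq_shift_def
proof (rule antisym)
  show "(SUP n. C1_dist M (F (n + m)) (G (n + m))) \<le> (SUP n. C1_dist M (F n) (G n))"
    by (intro SUP_least SUP_upper) simp
  show "(SUP n. C1_dist M (F n) (G n)) \<le> (SUP n. C1_dist M (F (n + m)) (G (n + m)))"
  proof (rule SUP_least)
    fix n show "C1_dist M (F n) (G n) \<le> (SUP n. C1_dist M (F (n + m)) (G (n + m)))"
      using SUP_upper[of "n - m" UNIV "\<lambda>n. C1_dist M (F (n + m)) (G (n + m))"] by simp
  qed
qed

context riem
begin

lemma seq_dist_sym: "seq_dist M F G = seq_dist M G F"
  unfolding seq_dist_def C1_dist_def using tangent_dist_sym by simp

lemma rdist_le_seq_dist: "rdist M (F n x) (G n x) \<le> seq_dist M F G"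
  using rdist_le_C1_dist[of "F n" x "G n"] SUP_upper[of n UNIV "\<lambda>n. C1_dist M (F n) (G n)"]
  unfolding seq_dist_def by (meson UNIV_I order_trans)

end

text \<open>Linear shadowing and expansiveness, uniform over all sequences in \<open>U\<close>, are
  the only consequences of hyperbolicity used from here on. Shifts and both sequences of a pair run
  in \<open>U\<close>, so the same constants serve them all.\<close>

locale shadowing_family = riem M for M :: "('a::t2_space, 'e::euclidean_space) rspace" +
  fixes U :: "('a \<Rightarrow> 'a) set" and Cs \<delta>0 \<beta>0 :: real
  assumes cpt: "compact (UNIV :: 'a set)" and U_diffeo: "\<And>g. g \<in> U \<Longrightarrow> C1_diffeo M g"
    and pos: "0 < Cs" "0 < \<delta>0" "0 < \<beta>0"
    and shadow: "\<And>F x \<delta>. (\<And>n. F n \<in> U) \<Longrightarrow> \<delta> \<le> \<delta>0 \<Longrightarrow> (\<And>n :: int. rdist M (F n (x n)) (x (n + 1)) < ennreal \<delta>) \<Longrightarrow>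
        \<exists>p. (\<forall>n. p (n + 1) = F n (p n)) \<and> (\<forall>n. rdist M (p n) (x n) \<le> ennreal (Cs * \<delta>))"
    and expansive: "\<And>F p q. (\<And>n. F n \<in> U) \<Longrightarrow> (\<And>n :: int. p (n + 1) = F n (p n)) \<Longrightarrow> (\<And>n. q (n + 1) = F n (q n)) \<Longrightarrow>
        (\<And>n. rdist M (p n) (q n) < ennreal \<beta>0) \<Longrightarrow> p = q"
begin

lemma U_bij: "g \<in> U \<Longrightarrow> bij g"
  using U_diffeo unfolding C1_diffeo_def by blast

lemma U_cont: "g \<in> U \<Longrightarrow> continuous_on UNIV g" "g \<in> U \<Longrightarrow> continuous_on UNIV (inv g)"
  using U_diffeo unfolding C1_diffeo_def C1_map_def by blast+

context
  fixes F :: "int \<Rightarrow> 'a \<Rightarrow> 'a" assumes F: "\<And>n. F n \<in> U"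
begin

lemma F_bij: "bij (F n)"
  by (rule U_bij[OF F])

lemma iter_Suc: "seq_iter F (n + 1) x = F n (seq_iter F n x)"
  by (rule seq_iter_Suc[of F, OF F_bij])

lemma iter_shift: "seq_iter (seq_shift m F) k (seq_iter F m x) = seq_iter F (m + k) x"
  by (rule seq_iter_shift[of F, OF F_bij])

lemma shift_U: "seq_shift m F n \<in> U"
  by (simp add: seq_shift_def F)

lemma iter_cont: "continuous_on UNIV (seq_iter F n)"
proof -
  have "continuous_on UNIV (forward_iter F k)" for k
  proof (induction k)
    case (Suc k)
    then show ?case using continuous_on_compose[OF Suc continuous_on_subset[OF U_cont(1)[OF F[of "int k"]]]] by (simp add: o_def)
  qed (simp add: id_def)
  moreover have "continuous_on UNIV (backward_iter F k)" for k
  proof (induction k)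
    case (Suc k)
    then show ?case using continuous_on_compose[OF Suc continuous_on_subset[OF U_cont(2)[OF F[of "- int (Suc k)"]]]] by (simp add: o_def)
  qed (simp add: id_def)
  ultimately show ?thesis unfolding seq_iter_def by auto
qed

lemma iter_shadow:
  assumes "\<delta> \<le> \<delta>0" "\<And>n. rdist M (F n (x n)) (x (n + 1)) < ennreal \<delta>"
  shows "\<exists>p. \<forall>n. rdist M (seq_iter F n p) (x n) \<le> ennreal (Cs * \<delta>)"
proof -
  obtain p where p: "\<And>n. p (n + 1) = F n (p n)" "\<And>n. rdist M (p n) (x n) \<le> ennreal (Cs * \<delta>)"
    using shadow[of F, OF F assms] by blast
  have "p n = seq_iter F n (p 0)" for n by (rule seq_iter_orbit[of F p, OF F_bij p(1)])
  then show ?thesis using p(2) by metis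
qed

lemma iter_expansive:
  assumes "\<And>n. rdist M (seq_iter F n p) (seq_iter F n q) < ennreal \<beta>0"
  shows "p = q"
proof -
  have "(\<lambda>n. seq_iter F n p) = (\<lambda>n. seq_iter F n q)"
    by (rule expansive[of F]) (use F iter_Suc assms in auto)
  from fun_cong[OF this, of 0] show ?thesis by simp
qed

lemma iter_shadow_unique:
  assumes "\<And>n. rdist M (seq_iter F n p) (x n) < ennreal \<beta>" "\<And>n. rdist M (seq_iter F n q) (x n) < ennreal \<beta>" "2 * \<beta> \<le> \<beta>0"
  shows "p = q"
proof (rule iter_expansive)
  fix n
  have b: "0 < \<beta>" using assms(1)[of 0] by (metis ennreal_neg linorder_not_le not_less_zero)
  have "rdist M (seq_iter F n p) (seq_iter F n q) \<le> rdist M (seq_iter F n p) (x n) + rdist M (x n) (seq_iter F n q)"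
    by (rule rdist_triangle)
  also have "\<dots> < ennreal \<beta> + ennreal \<beta>"
    using assms(1)[of n] assms(2)[of n] rdist_sym[of "x n"] by (intro add_strict_mono) auto
  also have "\<dots> = ennreal (2 * \<beta>)" using b by (simp add: ennreal_plus[symmetric] del: ennreal_plus)
  also have "\<dots> \<le> ennreal \<beta>0" using assms(3) by (rule ennreal_leI)
  finally show "rdist M (seq_iter F n p) (seq_iter F n q) < ennreal \<beta>0" .
qed

text \<open>The orbits of two points that \<beta>-shadow the same pseudo-orbit are less than
  \<open>2 * \<beta>\<close> apart at all times, so expansiveness gives uniqueness when
  \<open>2 * \<beta> \<le> \<beta>0\<close>.\<close>

lemma infinite_shadowing:
  "\<exists>\<beta>\<^sub>0>0. \<forall>\<beta>>0. \<exists>\<zeta>>0. \<forall>x. pseudo_orbit M F \<zeta> x \<longrightarrow>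
     (\<exists>p. shadows M F \<beta> p x) \<and> (\<beta> \<le> \<beta>\<^sub>0 \<longrightarrow> (\<exists>!p. shadows M F \<beta> p x))"
proof (rule exI[of _ "\<beta>0 / 2"], intro conjI allI impI)
  show "0 < \<beta>0 / 2" using pos by simp
  fix \<beta> :: real assume \<beta>: "0 < \<beta>"
  \<comment> \<open>The 2 in the denominator turns the non-strict bound \<open>Cs * \<zeta>\<close>
    into one strictly below \<beta>.\<close>
  define \<zeta> where "\<zeta> = min \<delta>0 (\<beta> / (2 * Cs))"
  have \<zeta>: "0 < \<zeta>" "\<zeta> \<le> \<delta>0" using pos \<beta> by (auto simp: \<zeta>_def)
  have C\<zeta>: "Cs * \<zeta> < \<beta>"
  proof -
    have "Cs * \<zeta> \<le> Cs * (\<beta> / (2 * Cs))" using pos by (intro mult_left_mono) (auto simp: \<zeta>_def)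
    also have "\<dots> = \<beta> / 2" using pos by simp
    finally show ?thesis using \<beta> by simp
  qed
  show "\<exists>\<zeta>>0. \<forall>x. pseudo_orbit M F \<zeta> x \<longrightarrow> (\<exists>p. shadows M F \<beta> p x) \<and> (\<beta> \<le> \<beta>0 / 2 \<longrightarrow> (\<exists>!p. shadows M F \<beta> p x))"
  proof (intro exI[of _ \<zeta>] conjI \<zeta>(1) allI impI)
    fix x assume "pseudo_orbit M F \<zeta> x"
    then have "rdist M (F n (x n)) (x (n + 1)) < ennreal \<zeta>" for n unfolding pseudo_orbit_def by blast
    from iter_shadow[OF \<zeta>(2) this] obtain p where p: "\<And>n. rdist M (seq_iter F n p) (x n) \<le> ennreal (Cs * \<zeta>)" by blast
    have "rdist M (seq_iter F n p) (x n) < ennreal \<beta>" for n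
      using p[of n] ennreal_lessI[OF \<beta> C\<zeta>] by (rule le_less_trans)
    then have ps: "shadows M F \<beta> p x" unfolding shadows_def by blast
    then show "\<exists>p. shadows M F \<beta> p x" ..
    assume le: "\<beta> \<le> \<beta>0 / 2"
    show "\<exists>!p. shadows M F \<beta> p x"
    proof (rule ex1I[where a=p])
      show "shadows M F \<beta> p x" by (fact ps)
      fix q assume q: "shadows M F \<beta> q x"
      show "q = p"
      proof (rule iter_shadow_unique)
        show "rdist M (seq_iter F n q) (x n) < ennreal \<beta>" "rdist M (seq_iter F n p) (x n) < ennreal \<beta>" for n
          using q ps unfolding shadows_def by blast+
        show "2 * \<beta> \<le> \<beta>0" using le by simp
      qed
    qed
  qed
qed

text \<open>The Lipschitz condition is demanded for every positive \<epsilon>, while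
  \<open>iter_shadow\<close> needs \<open>L * \<epsilon> \<le> \<delta>0\<close>. Above the bound
  \<open>D\<close> for all finite distances, shadowing only means staying in the right
  component.\<close>

lemma finite_shadowing: "lipschitz_shadowing M F"
proof -
  obtain D where D: "0 < D" "\<And>x y. rdist M x y < top \<Longrightarrow> rdist M x y \<le> ennreal D"
    using rdist_bounded[OF cpt] by blast
  \<comment> \<open>The first entry makes \<open>Cs * (L * \<epsilon>) < \<epsilon>\<close>, the
    second makes \<open>L * \<epsilon> \<le> \<delta>0\<close> for all
    \<open>\<epsilon> \<le> D + 1\<close>.\<close>
  define L where "L = min (1 / (2 * Cs)) (\<delta>0 / (D + 1))"
  have L: "0 < L" "L \<le> 1 / (2 * Cs)" "L \<le> \<delta>0 / (D + 1)" using pos D(1) by (auto simp: L_def)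
  have "\<exists>p. fin_shadows M F \<epsilon> k p x" if \<epsilon>: "0 < \<epsilon>" and po: "fin_pseudo_orbit M F (L * \<epsilon>) k x" for \<epsilon> k x
  proof (cases "\<epsilon> \<le> D + 1")
    case True
    have \<delta>: "L * \<epsilon> \<le> \<delta>0"
    proof -
      have "L * \<epsilon> \<le> \<delta>0 / (D + 1) * (D + 1)" using L True \<epsilon> by (intro mult_mono) auto
      then show ?thesis using D(1) by simp
    qed
    have CL: "Cs * (L * \<epsilon>) < \<epsilon>"
    proof -
      have "Cs * L * \<epsilon> \<le> Cs * (1 / (2 * Cs)) * \<epsilon>" using L pos \<epsilon> by (intro mult_right_mono mult_left_mono) auto
      also have "\<dots> = \<epsilon> / 2" using pos by simp
      finally show ?thesis using \<epsilon> by (simp add: mult.assoc)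
    qed
    text \<open>A finite pseudo-orbit is continued by true orbits on both sides.\<close>
    define X where "X n = (if n < 0 then seq_iter F n (x 0) else if n \<le> int k then x (nat n)
       else seq_iter (seq_shift (int k) F) (n - int k) (x k))" for n
    have sh: "seq_iter (seq_shift (int k) F) (j + 1) z = F (int k + j) (seq_iter (seq_shift (int k) F) j z)" for j z
      using seq_iter_Suc[of "seq_shift (int k) F", OF U_bij[OF shift_U], of j z] by (simp add: seq_shift_def add.commute)
    have "rdist M (F n (X n)) (X (n + 1)) < ennreal (L * \<epsilon>)" for n
    proof -
      consider "n < 0" | "0 \<le> n" "n < int k" | "int k \<le> n" by linarith
      then show ?thesis
      proof cases
        case 1
        then have "X n = seq_iter F n (x 0)" "X (n + 1) = seq_iter F (n + 1) (x 0)"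
          by (cases "n = - 1"; simp add: X_def)+
        then have "F n (X n) = X (n + 1)" by (simp add: iter_Suc)
        then show ?thesis using L \<epsilon> by (simp add: rdist_self)
      next
        case 2
        then have "X n = x (nat n)" "X (n + 1) = x (Suc (nat n))" "nat n < k" "n = int (nat n)"
          by (auto simp: X_def nat_add_distrib)
        then show ?thesis using po unfolding fin_pseudo_orbit_def by metis
      next
        case 3
        have "X n = seq_iter (seq_shift (int k) F) (n - int k) (x k)"
          using 3 by (cases "n = int k") (simp_all add: X_def)
        moreover have "X (n + 1) = seq_iter (seq_shift (int k) F) (n - int k + 1) (x k)"
          using 3 by (simp add: X_def algebra_simps)
        ultimately have "F n (X n) = X (n + 1)" using sh[of "n - int k" "x k"] by simp
        then show ?thesis using L \<epsilon> by (simp add: rdist_self)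
      qed
    qed
    from iter_shadow[OF \<delta> this] obtain p where p: "\<And>n. rdist M (seq_iter F n p) (X n) \<le> ennreal (Cs * (L * \<epsilon>))" by blast
    have "rdist M (seq_iter F (int n) p) (x n) < ennreal \<epsilon>" if "n \<le> k" for n
      using le_less_trans[OF p[of "int n"] ennreal_lessI[OF \<epsilon> CL]] that by (simp add: X_def)
    then show ?thesis unfolding fin_shadows_def by blast
  next
    text \<open>For large \<open>\<epsilon>\<close> it suffices to stay in the right connected components.\<close>
    case False
    have "rdist M (seq_iter F (int n) (x 0)) (x n) < top" if "n \<le> k" for n
      using that
    proof (induction n)
      case 0 then show ?case by (simp add: rdist_self)
    next
      case (Suc n)
      have 1: "rdist M (F (int n) (seq_iter F (int n) (x 0))) (F (int n) (x n)) < top"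
        using rdist_finite_image[OF U_cont(1)[OF F]] Suc by simp
      have 2: "rdist M (F (int n) (x n)) (x (Suc n)) < top"
        using po Suc.prems unfolding fin_pseudo_orbit_def by (metis Suc_le_lessD ennreal_less_top order_less_trans)
      have "seq_iter F (int (Suc n)) (x 0) = F (int n) (seq_iter F (int n) (x 0))"
        using iter_Suc[of "int n" "x 0"] by (simp add: add.commute)
      then have "rdist M (seq_iter F (int (Suc n)) (x 0)) (x (Suc n))
          \<le> rdist M (F (int n) (seq_iter F (int n) (x 0))) (F (int n) (x n)) + rdist M (F (int n) (x n)) (x (Suc n))"
        using rdist_triangle by simp
      also have "\<dots> < top" using 1 2 by simp
      finally show ?case .
    qed
    moreover have "ennreal D < ennreal \<epsilon>" using False D(1) by (intro ennreal_lessI) auto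
    ultimately have "fin_shadows M F \<epsilon> k (x 0) x"
      unfolding fin_shadows_def using D(2) le_less_trans by blast
    then show ?thesis ..
  qed
  then show ?thesis unfolding lipschitz_shadowing_def using L(1) by blast
qed

end

text \<open>Exchanging the two sequences exchanges the roles of \<open>x\<close> and
  \<open>p\<close>, and this symmetry gives the inverse of the shadowing map for free. The bound is
  the exact multiple of \<open>seq_dist\<close>, with nothing added.\<close>

definition linked :: "(int \<Rightarrow> 'a \<Rightarrow> 'a) \<Rightarrow> (int \<Rightarrow> 'a \<Rightarrow> 'a) \<Rightarrow> 'a \<Rightarrow> 'a \<Rightarrow> bool" where
  "linked A B x p \<longleftrightarrow> (\<forall>n. rdist M (seq_iter A n p) (seq_iter B n x) \<le> ennreal Cs * seq_dist M A B)"

definition shadow_map :: "(int \<Rightarrow> 'a \<Rightarrow> 'a) \<Rightarrow> (int \<Rightarrow> 'a \<Rightarrow> 'a) \<Rightarrow> 'a \<Rightarrow> 'a" where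
  "shadow_map A B x = (THE p. linked A B x p)"

text \<open>Below \<delta>0, orbits of one sequence can be shadowed by the other, and
  \<open>2 * (Cs * \<epsilon>1) < \<beta>0\<close> makes the shadowing point unique; the outer half
  makes both inequalities strict.\<close>

definition \<epsilon>1 :: real where "\<epsilon>1 = min \<delta>0 (\<beta>0 / (2 * Cs)) / 2"

lemma \<epsilon>1: "0 < \<epsilon>1" "\<epsilon>1 < \<delta>0" "2 * (Cs * \<epsilon>1) < \<beta>0"
proof -
  show "0 < \<epsilon>1" "\<epsilon>1 < \<delta>0" using pos by (auto simp: \<epsilon>1_def)
  have "\<epsilon>1 \<le> \<beta>0 / (2 * Cs) / 2" by (simp add: \<epsilon>1_def)
  then have "2 * (Cs * \<epsilon>1) \<le> 2 * (Cs * (\<beta>0 / (2 * Cs) / 2))" using pos by (intro mult_left_mono) auto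
  also have "\<dots> = \<beta>0 / 2" using pos by simp
  finally show "2 * (Cs * \<epsilon>1) < \<beta>0" using pos by simp
qed

lemma linked_sym: "linked A B x p \<longleftrightarrow> linked B A p x"
proof -
  have "rdist M (seq_iter A n p) (seq_iter B n x) = rdist M (seq_iter B n x) (seq_iter A n p)" for n by (rule rdist_sym)
  then show ?thesis unfolding linked_def seq_dist_sym[of A B] by simp
qed

context
  fixes A B :: "int \<Rightarrow> 'a \<Rightarrow> 'a"
  assumes A: "\<And>n. A n \<in> U" and B: "\<And>n. B n \<in> U" and close: "seq_dist M A B < ennreal \<epsilon>1"
begin

lemma seq_dist_real: "\<exists>e. 0 \<le> e \<and> e < \<epsilon>1 \<and> seq_dist M A B = ennreal e"
proof (cases "seq_dist M A B" rule: ennreal_cases)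
  case (real e)
  then show ?thesis using close by (auto simp: ennreal_less_iff)
next
  case top
  then show ?thesis using close by simp
qed

lemma linked_unique: "linked A B x p \<Longrightarrow> linked A B x q \<Longrightarrow> p = q"
proof (rule iter_shadow_unique[of A, OF A])
  obtain e where e: "0 \<le> e" "e < \<epsilon>1" "seq_dist M A B = ennreal e" using seq_dist_real by blast
  have lt: "ennreal Cs * seq_dist M A B < ennreal (Cs * \<epsilon>1)"
    unfolding e(3) using e pos by (simp add: ennreal_mult[symmetric] ennreal_lessI)
  assume l: "linked A B x p" "linked A B x q"
  show "rdist M (seq_iter A n p) (seq_iter B n x) < ennreal (Cs * \<epsilon>1)"
    "rdist M (seq_iter A n q) (seq_iter B n x) < ennreal (Cs * \<epsilon>1)" for n
    using l le_less_trans[OF _ lt] unfolding linked_def by blast+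
  show "2 * (Cs * \<epsilon>1) \<le> \<beta>0" using \<epsilon>1(3) by simp
qed

text \<open>A pseudo-orbit has a strict error bound, so shadowing gives \<open>Cs * \<delta>\<close>
  only for \<delta> above the distance \<open>e\<close>. By uniqueness the shadowing point is the
  same for all these \<delta>, and letting \<delta> tend to \<open>e\<close> yields the exact bound,
  also for \<open>e = 0\<close>.\<close>

lemma linked_exists: "\<exists>p. linked A B x p"
proof -
  obtain e where e: "0 \<le> e" "e < \<epsilon>1" "seq_dist M A B = ennreal e" using seq_dist_real by blast
  have ex: "\<exists>p. \<forall>n. rdist M (seq_iter A n p) (seq_iter B n x) \<le> ennreal (Cs * \<delta>)" if \<delta>: "e < \<delta>" "\<delta> \<le> \<epsilon>1" for \<delta>
  proof (rule iter_shadow[of A, OF A])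
    show "\<delta> \<le> \<delta>0" using \<delta> \<epsilon>1(2) by simp
    fix n
    have "rdist M (A n (seq_iter B n x)) (B n (seq_iter B n x)) \<le> ennreal e"
      unfolding e(3)[symmetric] by (rule rdist_le_seq_dist)
    also have "\<dots> < ennreal \<delta>" using e \<delta> by (simp add: ennreal_lessI)
    finally show "rdist M (A n (seq_iter B n x)) (seq_iter B (n + 1) x) < ennreal \<delta>" by (simp add: iter_Suc[of B, OF B])
  qed
  obtain p where p: "\<And>n. rdist M (seq_iter A n p) (seq_iter B n x) \<le> ennreal (Cs * \<epsilon>1)" using ex[OF e(2)] by blast
  have "\<beta>0 / 2 > Cs * \<epsilon>1" using \<epsilon>1(3) by simp
  then have lt: "ennreal (Cs * \<epsilon>1) < ennreal (\<beta>0 / 2)" using pos by (intro ennreal_lessI) auto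
  have le: "rdist M (seq_iter A n p) (seq_iter B n x) \<le> ennreal (Cs * \<delta>)" if \<delta>: "e < \<delta>" "\<delta> \<le> \<epsilon>1" for \<delta> n
  proof -
    obtain q where q: "\<And>n. rdist M (seq_iter A n q) (seq_iter B n x) \<le> ennreal (Cs * \<delta>)" using ex[OF \<delta>] by blast
    have le': "ennreal (Cs * \<delta>) \<le> ennreal (Cs * \<epsilon>1)" using \<delta> pos by (intro ennreal_leI mult_left_mono) auto
    have "p = q"
    proof (rule iter_shadow_unique[of A, OF A])
      show "rdist M (seq_iter A n p) (seq_iter B n x) < ennreal (\<beta>0 / 2)" for n using p lt by (rule le_less_trans)
      show "rdist M (seq_iter A n q) (seq_iter B n x) < ennreal (\<beta>0 / 2)" for n
        using order_trans[OF q le'] lt by (rule le_less_trans)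
    qed simp
    then show ?thesis using q by simp
  qed
  have "rdist M (seq_iter A n p) (seq_iter B n x) \<le> ennreal (Cs * e)" for n
  proof (rule ennreal_le_epsilon)
    fix t :: real assume t: "0 < t"
    define \<delta> where "\<delta> = min \<epsilon>1 (e + t / Cs)"
    have \<delta>: "e < \<delta>" "\<delta> \<le> \<epsilon>1" using e t pos by (auto simp: \<delta>_def)
    have "Cs * \<delta> \<le> Cs * (e + t / Cs)" using pos by (intro mult_left_mono) (auto simp: \<delta>_def)
    also have "\<dots> = Cs * e + t" using pos by (simp add: distrib_left)
    finally have "ennreal (Cs * \<delta>) \<le> ennreal (Cs * e + t)" by (rule ennreal_leI)
    with le[OF \<delta>, of n] have "rdist M (seq_iter A n p) (seq_iter B n x) \<le> ennreal (Cs * e + t)" by (rule order_trans)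
    also have "\<dots> = ennreal (Cs * e) + ennreal t" using e(1) pos(1) t by (intro ennreal_plus) auto
    finally show "rdist M (seq_iter A n p) (seq_iter B n x) \<le> ennreal (Cs * e) + ennreal t" .
  qed
  then have "linked A B x p" unfolding linked_def e(3) using e pos by (simp add: ennreal_mult)
  then show ?thesis ..
qed

lemma linked_shadow_map: "linked A B x (shadow_map A B x)"
  unfolding shadow_map_def by (rule theI') (use linked_exists linked_unique in blast)

lemma shadow_map_eq: "linked A B x p \<Longrightarrow> shadow_map A B x = p"
  using linked_unique[OF linked_shadow_map] .

lemma shadow_map_C0: "C0_dist M (shadow_map A B) id \<le> ennreal Cs * seq_dist M A B"
  unfolding C0_dist_def
proof (rule SUP_least)
  fix x show "rdist M (shadow_map A B x) (id x) \<le> ennreal Cs * seq_dist M A B"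
    using linked_shadow_map[of x] unfolding linked_def by (elim allE[of _ 0]) simp
qed

lemma linked_closed: "closed {(x, p). linked A B x p}"
proof -
  have "{(x, p). linked A B x p} = (\<Inter>n. (\<lambda>(x, p). (seq_iter A n p, seq_iter B n x)) -` {(p, q). rdist M p q \<le> ennreal Cs * seq_dist M A B})"
    unfolding linked_def by auto
  moreover {
    fix n
    have "continuous_on UNIV (\<lambda>(x, p). (seq_iter A n p, seq_iter B n x))"
      unfolding case_prod_unfold
      by (intro continuous_on_Pair continuous_on_compose2[OF iter_cont[of A, OF A]] continuous_on_compose2[OF iter_cont[of B, OF B]]
          continuous_on_fst continuous_on_snd continuous_on_id) auto
    then have "closed ((\<lambda>(x, p). (seq_iter A n p, seq_iter B n x)) -` {(p, q). rdist M p q \<le> ennreal Cs * seq_dist M A B})"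
      by (rule closed_vimage[OF rdist_le_closed])
  }
  ultimately show ?thesis by (simp only:) (intro closed_INT ballI)
qed

text \<open>Closed graph argument: the preimage of a closed \<open>T\<close> is the projection of
  the part of the graph with values in \<open>T\<close>, which is compact.\<close>

lemma shadow_map_cont: "continuous_on UNIV (shadow_map A B)"
  unfolding continuous_on_closed_vimage[OF closed_UNIV]
proof (intro allI impI)
  fix T :: "'a set" assume T: "closed T"
  have "compact (UNIV :: ('a \<times> 'a) set)" using compact_Times[OF cpt cpt] by simp
  moreover have "closed ({(x, p). linked A B x p} \<inter> UNIV \<times> T)"
    by (intro closed_Int linked_closed closed_Times closed_UNIV T)
  ultimately have "compact ({(x, p). linked A B x p} \<inter> UNIV \<times> T)"
    using compact_Int_closed[of UNIV] by (metis Int_UNIV_left)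
  then have "compact (fst ` ({(x, p). linked A B x p} \<inter> UNIV \<times> T))"
    by (rule compact_continuous_image[OF continuous_on_fst[OF continuous_on_id]])
  moreover have "fst ` ({(x, p). linked A B x p} \<inter> UNIV \<times> T) = shadow_map A B -` T \<inter> UNIV"
  proof (intro set_eqI iffI)
    fix x assume "x \<in> fst ` ({(x, p). linked A B x p} \<inter> UNIV \<times> T)"
    then show "x \<in> shadow_map A B -` T \<inter> UNIV" using shadow_map_eq by auto
  next
    fix x assume "x \<in> shadow_map A B -` T \<inter> UNIV"
    then show "x \<in> fst ` ({(x, p). linked A B x p} \<inter> UNIV \<times> T)"
      using linked_shadow_map[of x] by (intro image_eqI[of _ _ "(x, shadow_map A B x)"]) auto
  qed
  ultimately show "closed (shadow_map A B -` T \<inter> UNIV)" using compact_imp_closed by metis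
qed

end

lemma shadow_map_inverse:
  assumes "\<And>n. A n \<in> U" "\<And>n. B n \<in> U" "seq_dist M A B < ennreal \<epsilon>1"
  shows "shadow_map B A (shadow_map A B x) = x"
proof (rule shadow_map_eq[of B A])
  show "seq_dist M B A < ennreal \<epsilon>1" using assms(3) seq_dist_sym by metis
  have "linked A B x (shadow_map A B x)" by (rule linked_shadow_map) (fact assms)+
  then show "linked B A (shadow_map A B x) x" by (subst linked_sym)
qed (fact assms)+

lemma shadow_map_homeomorphism:
  assumes "\<And>n. A n \<in> U" "\<And>n. B n \<in> U" "seq_dist M A B < ennreal \<epsilon>1"
  shows "\<exists>k. homeomorphism UNIV UNIV (shadow_map A B) k"
proof (intro exI[of _ "shadow_map B A"])
  have BA: "seq_dist M B A < ennreal \<epsilon>1" using assms(3) seq_dist_sym by metis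
  have i: "shadow_map B A (shadow_map A B x) = x" "shadow_map A B (shadow_map B A x) = x" for x
    using shadow_map_inverse[of A B x, OF assms] shadow_map_inverse[of B A x, OF assms(2) assms(1) BA] .
  have "shadow_map A B ` UNIV = UNIV" "shadow_map B A ` UNIV = UNIV" using i surjI by metis+
  then show "homeomorphism UNIV UNIV (shadow_map A B) (shadow_map B A)"
    unfolding homeomorphism_def
    using i shadow_map_cont[of A B, OF assms] shadow_map_cont[of B A, OF assms(2) assms(1) BA] by simp
qed

text \<open>The \<open>B\<close>-orbit of \<open>x\<close> and the \<open>A\<close>-orbit of its
  image remain linked when time 0 is moved to \<open>m\<close>, and linked points are
  unique.\<close>

lemma shadow_map_equivariant:
  assumes A: "\<And>n. A n \<in> U" and B: "\<And>n. B n \<in> U" and close: "seq_dist M A B < ennreal \<epsilon>1"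
  shows "shadow_map (seq_shift m A) (seq_shift m B) (seq_iter B m x) = seq_iter A m (shadow_map A B x)"
proof (rule shadow_map_eq[of "seq_shift m A" "seq_shift m B"])
  show "seq_shift m A n \<in> U" "seq_shift m B n \<in> U" for n by (simp_all add: seq_shift_def A B)
  show "seq_dist M (seq_shift m A) (seq_shift m B) < ennreal \<epsilon>1" using close by (simp add: seq_dist_shift)
  show "linked (seq_shift m A) (seq_shift m B) (seq_iter B m x) (seq_iter A m (shadow_map A B x))"
    using linked_shadow_map[of A B x, OF A B close] unfolding linked_def
    by (simp add: seq_dist_shift iter_shift[of A, OF A] iter_shift[of B, OF B])
qed

lemma shadow_map_conj_family:
  assumes A: "\<And>n. A n \<in> U" and B: "\<And>n. B n \<in> U" and close: "seq_dist M A B < ennreal \<epsilon>1"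
  shows "conj_family M Cs A B (\<lambda>m. shadow_map (seq_shift m A) (seq_shift m B))"
proof -
  have s: "seq_shift m A n \<in> U" "seq_shift m B n \<in> U" for m n
    by (simp_all add: seq_shift_def A B)
  have s3: "seq_dist M (seq_shift m A) (seq_shift m B) < ennreal \<epsilon>1" for m
    using close by (simp add: seq_dist_shift)
  show ?thesis
    unfolding conj_family_def
  proof (intro conjI allI)
    fix m
    show "\<exists>k. homeomorphism UNIV UNIV (shadow_map (seq_shift m A) (seq_shift m B)) k"
      by (rule shadow_map_homeomorphism) (rule s s3)+
    show "C0_dist M (shadow_map (seq_shift m A) (seq_shift m B)) id \<le> ennreal Cs * seq_dist M (seq_shift m A) (seq_shift m B)"
      by (rule shadow_map_C0) (rule s s3)+
    fix n :: nat
    have "shadow_map (seq_shift (int n + m) A) (seq_shift (int n + m) B) (seq_iter (seq_shift m B) (int n) x)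
        = seq_iter (seq_shift m A) (int n) (shadow_map (seq_shift m A) (seq_shift m B) x)" for x
      using shadow_map_equivariant[of "seq_shift m A" "seq_shift m B" "int n" x, OF s s3] by (simp add: seq_shift_shift)
    then show "shadow_map (seq_shift (m + int n) A) (seq_shift (m + int n) B) \<circ> seq_iter (seq_shift m B) (int n) =
      seq_iter (seq_shift m A) (int n) \<circ> shadow_map (seq_shift m A) (seq_shift m B)"
      by (simp add: fun_eq_iff add.commute)
  qed
qed

text \<open>The relation carries a family \<open>H\<close> along whole orbits: \<open>H k\<close>
  maps the point of the \<open>B\<close>-orbit of \<open>x\<close> at time \<open>k\<close> to that
  of the \<open>A\<close>-orbit of \<open>h x\<close>. The bound on each \<open>H k\<close> then
  makes \<open>x\<close> and \<open>h x\<close> linked, so uniqueness goes back to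
  expansiveness.\<close>

lemma is_conj_homeo_eq:
  assumes A: "\<And>n. A n \<in> U" and B: "\<And>n. B n \<in> U" and close: "seq_dist M A B < ennreal \<epsilon>1"
    and h: "is_conj_homeo M Cs A B h"
  shows "h = shadow_map A B"
proof
  fix x
  obtain H where H: "conj_family M Cs A B H" "H 0 = h" using h unfolding is_conj_homeo_def by blast
  have small: "rdist M (H m z) z \<le> ennreal Cs * seq_dist M A B" for m z
  proof -
    have "rdist M (H m z) (id z) \<le> C0_dist M (H m) id" unfolding C0_dist_def by (rule SUP_upper) simp
    also have "\<dots> \<le> ennreal Cs * seq_dist M (seq_shift m A) (seq_shift m B)" using H(1) unfolding conj_family_def by blast
    finally show ?thesis by (simp add: seq_dist_shift)
  qed
  have eqv: "H (m + int n) (seq_iter (seq_shift m B) (int n) z) = seq_iter (seq_shift m A) (int n) (H m z)" for m n z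
    proof -
    have "H (m + int n) \<circ> seq_iter (seq_shift m B) (int n) = seq_iter (seq_shift m A) (int n) \<circ> H m"
      using H(1) unfolding conj_family_def by blast
    from fun_cong[OF this, of z] show ?thesis by simp
  qed
  have "linked A B x (h x)" unfolding linked_def
  proof
    fix k :: int
    have "seq_iter A k (h x) = H k (seq_iter B k x)"
    proof (cases "0 \<le> k")
      case True
      then show ?thesis using eqv[of 0 "nat k" x] H(2) by simp
    next
      \<comment> \<open>Negative times are reached from behind: the relation for the pair shifted by
        \<open>k\<close>, applied over \<open>- k\<close> steps, ends at time 0.\<close>
      case False
      then have k: "int (nat (- k)) = - k" by simp
      let ?z = "seq_iter B k x"
      have "seq_iter (seq_shift k B) (- k) ?z = x" using iter_shift[of B, OF B, of k "- k" x] by simp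
      then have hx: "h x = seq_iter (seq_shift k A) (- k) (H k ?z)" using eqv[of k "nat (- k)" ?z] H(2) k by simp
      have sA: "seq_shift k A n \<in> U" for n by (simp add: seq_shift_def A)
      have "seq_shift (- k) (seq_shift k A) = A" by (simp add: seq_shift_shift)
      then show ?thesis unfolding hx using iter_shift[of "seq_shift k A", OF sA, of "- k" k "H k ?z"] by simp
    qed
    then show "rdist M (seq_iter A k (h x)) (seq_iter B k x) \<le> ennreal Cs * seq_dist M A B" using small by simp
  qed
  then show "h x = shadow_map A B x" using shadow_map_eq[of A B x "h x", OF A B close] by simp
qed

lemma unique_conj_homeo:
  assumes A: "\<And>n. A n \<in> U" and B: "\<And>n. B n \<in> U" and close: "seq_dist M A B < ennreal \<epsilon>1"
  shows "\<exists>!h. is_conj_homeo M Cs A B h" "conj_homeo M Cs A B = shadow_map A B"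
proof -
  have 1: "is_conj_homeo M Cs A B (shadow_map A B)"
    unfolding is_conj_homeo_def using shadow_map_conj_family[of A B, OF A B close] by force
  show "\<exists>!h. is_conj_homeo M Cs A B h"
    by (rule ex1I[of _ "shadow_map A B"], rule 1) (rule is_conj_homeo_eq[of A B, OF A B close])
  show "conj_homeo M Cs A B = shadow_map A B"
    unfolding conj_homeo_def by (rule the_equality, rule 1) (rule is_conj_homeo_eq[of A B, OF A B close])
qed

text \<open>The witnesses \<open>Cs\<close> for \<open>K\<close> and \<open>\<epsilon>1\<close> for
  \<open>\<epsilon>\<^sub>0\<close> do not depend on \<open>F\<close>, so the same \<open>K\<close>
  serves the shifted and the exchanged pairs in the conjugacy relation.\<close>

lemma conjugation:
  assumes F: "\<And>n. F n \<in> U"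
  shows "\<exists>K>0. \<exists>\<epsilon>\<^sub>0>0.
          (\<forall>\<epsilon>. 0 < \<epsilon> \<and> \<epsilon> < \<epsilon>\<^sub>0 \<longrightarrow>
            (\<forall>G. (\<forall>n. G n \<in> U) \<and> seq_dist M F G < ennreal \<epsilon> \<longrightarrow>
               (\<forall>m. (\<exists>!h. is_conj_homeo M K (seq_shift m F) (seq_shift m G) h) \<and>
                    (\<exists>!h. is_conj_homeo M K (seq_shift m G) (seq_shift m F) h)) \<and>
               (\<exists>k. homeomorphism UNIV UNIV (conj_homeo M K F G) k) \<and>
               C0_dist M (conj_homeo M K F G) id \<le> ennreal K * seq_dist M F G \<and>
               (\<forall>n::nat. conj_homeo M K (seq_shift (int n) G) (seq_shift (int n) F) \<circ> seq_iter F (int n)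
                         = seq_iter G (int n) \<circ> conj_homeo M K G F))) \<and>
          (\<forall>\<eta>>0. \<exists>\<delta>>0. \<delta> \<le> \<epsilon>\<^sub>0 \<and>
            (\<forall>G. (\<forall>n. G n \<in> U) \<and> seq_dist M F G < ennreal \<delta> \<longrightarrow>
               C0_dist M (conj_homeo M K F G) id < ennreal \<eta>))"
proof (rule exI[of _ Cs], rule conjI[OF pos(1)], rule exI[of _ \<epsilon>1], rule conjI[OF \<epsilon>1(1)], intro conjI allI impI; (elim conjE)?)
  fix \<epsilon> G assume \<epsilon>: "0 < \<epsilon>" "\<epsilon> < \<epsilon>1" and G: "\<forall>n. G n \<in> U" "seq_dist M F G < ennreal \<epsilon>"
  have FG: "seq_dist M F G < ennreal \<epsilon>1" using G(2) ennreal_leI[of \<epsilon> \<epsilon>1] \<epsilon>(2) less_le_trans by fastforce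
  have GF: "seq_dist M G F < ennreal \<epsilon>1" using FG seq_dist_sym by metis
  have sF: "seq_shift m F n \<in> U" and sG: "seq_shift m G n \<in> U" for m n using F G(1) by (simp_all add: seq_shift_def)
  have sFG: "seq_dist M (seq_shift m F) (seq_shift m G) < ennreal \<epsilon>1"
    and sGF: "seq_dist M (seq_shift m G) (seq_shift m F) < ennreal \<epsilon>1" for m using FG GF by (simp_all add: seq_dist_shift)
  have G': "\<And>n. G n \<in> U" using G(1) by blast
  show "\<exists>!h. is_conj_homeo M Cs (seq_shift m F) (seq_shift m G) h" for m by (rule unique_conj_homeo(1)[OF sF sG sFG])
  show "\<exists>!h. is_conj_homeo M Cs (seq_shift m G) (seq_shift m F) h" for m by (rule unique_conj_homeo(1)[OF sG sF sGF])
  note cFG = unique_conj_homeo(2)[of F G, OF F G' FG] and cGF = unique_conj_homeo(2)[of G F, OF G' F GF]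
  show "\<exists>k. homeomorphism UNIV UNIV (conj_homeo M Cs F G) k" unfolding cFG by (rule shadow_map_homeomorphism[of F G, OF F G' FG])
  show "C0_dist M (conj_homeo M Cs F G) id \<le> ennreal Cs * seq_dist M F G" unfolding cFG by (rule shadow_map_C0[of F G, OF F G' FG])
  show "conj_homeo M Cs (seq_shift (int n) G) (seq_shift (int n) F) \<circ> seq_iter F (int n) = seq_iter G (int n) \<circ> conj_homeo M Cs G F" for n
    unfolding cGF unique_conj_homeo(2)[OF sG sF sGF]
    using shadow_map_equivariant[of G F "int n", OF G' F GF] by (simp add: fun_eq_iff)
next
  fix \<eta> :: real assume \<eta>: "0 < \<eta>"
  \<comment> \<open>\<open>\<eta> / Cs\<close> serves the displacement bound, and
    \<open>\<epsilon>1\<close> keeps \<open>conj_homeo\<close> equal to the shadowing map.\<close>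
  define \<delta> where "\<delta> = min \<epsilon>1 (\<eta> / Cs)"
  have \<delta>: "0 < \<delta>" "\<delta> \<le> \<epsilon>1" using \<epsilon>1(1) \<eta> pos by (auto simp: \<delta>_def)
  show "\<exists>\<delta>>0. \<delta> \<le> \<epsilon>1 \<and> (\<forall>G. (\<forall>n. G n \<in> U) \<and> seq_dist M F G < ennreal \<delta> \<longrightarrow> C0_dist M (conj_homeo M Cs F G) id < ennreal \<eta>)"
  proof (intro exI[of _ \<delta>] conjI \<delta> allI impI; elim conjE)
    fix G assume G: "\<forall>n. G n \<in> U" "seq_dist M F G < ennreal \<delta>"
    have FG: "seq_dist M F G < ennreal \<epsilon>1" using G(2) ennreal_leI[OF \<delta>(2)] by (rule less_le_trans)
    have G': "\<And>n. G n \<in> U" using G(1) by blast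
    obtain e where e: "0 \<le> e" "seq_dist M F G = ennreal e" using seq_dist_real[of F G, OF F G' FG] by blast
    have "e < \<delta>" using G(2) e by (simp add: ennreal_less_iff)
    then have "Cs * e < Cs * \<delta>" using pos by simp
    also have "\<dots> \<le> \<eta>"
    proof -
      have "Cs * \<delta> \<le> Cs * (\<eta> / Cs)" using pos by (intro mult_left_mono) (auto simp: \<delta>_def)
      then show ?thesis using pos by simp
    qed
    finally have "ennreal Cs * seq_dist M F G < ennreal \<eta>" unfolding e(2) using e(1) pos \<eta> by (simp add: ennreal_mult[symmetric] ennreal_lessI)
    then show "C0_dist M (conj_homeo M Cs F G) id < ennreal \<eta>"
      unfolding unique_conj_homeo(2)[of F G, OF F G' FG] using shadow_map_C0[of F G, OF F G' FG] by (rule le_less_trans[rotated])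
  qed
qed

end

theorem theorem2p4:
  fixes M :: "('a::t2_space, 'e::euclidean_space) rspace" and f :: "'a \<Rightarrow> 'a"
  assumes "riemannian_manifold M" and "compact (UNIV :: 'a set)" and "anosov M f"
  shows "\<exists>U. C1_open M U \<and> f \<in> U \<and>
    (\<forall>F :: int \<Rightarrow> 'a \<Rightarrow> 'a. (\<forall>n. F n \<in> U) \<longrightarrow>
       lipschitz_shadowing M F \<and>
       (\<exists>\<beta>\<^sub>0>0. \<forall>\<beta>>0. \<exists>\<zeta>>0. \<forall>x. pseudo_orbit M F \<zeta> x \<longrightarrow>
          (\<exists>p. shadows M F \<beta> p x) \<and> (\<beta> \<le> \<beta>\<^sub>0 \<longrightarrow> (\<exists>!p. shadows M F \<beta> p x))) \<and>
       (\<exists>K>0. \<exists>\<epsilon>\<^sub>0>0.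
          (\<forall>\<epsilon>. 0 < \<epsilon> \<and> \<epsilon> < \<epsilon>\<^sub>0 \<longrightarrow>
            (\<forall>G. (\<forall>n. G n \<in> U) \<and> seq_dist M F G < ennreal \<epsilon> \<longrightarrow>
               (\<forall>m. (\<exists>!h. is_conj_homeo M K (seq_shift m F) (seq_shift m G) h) \<and>
                    (\<exists>!h. is_conj_homeo M K (seq_shift m G) (seq_shift m F) h)) \<and>
               (\<exists>k. homeomorphism UNIV UNIV (conj_homeo M K F G) k) \<and>
               C0_dist M (conj_homeo M K F G) id \<le> ennreal K * seq_dist M F G \<and>
               (\<forall>n::nat. conj_homeo M K (seq_shift (int n) G) (seq_shift (int n) F) \<circ> seq_iter F (int n)
                         = seq_iter G (int n) \<circ> conj_homeo M K G F))) \<and>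
          (\<forall>\<eta>>0. \<exists>\<delta>>0. \<delta> \<le> \<epsilon>\<^sub>0 \<and>
            (\<forall>G. (\<forall>n. G n \<in> U) \<and> seq_dist M F G < ennreal \<delta> \<longrightarrow>
               C0_dist M (conj_homeo M K F G) id < ennreal \<eta>))))"
proof -
  interpret riem M by unfold_locales (rule assms(1))
  obtain I rad r0 where atlas: "finite I" "0 < (r0 :: real)"
    "\<forall>i\<in>I. cball (snd (cat i) i) (rad i + 2 * r0) \<subseteq> snd (cat i) ` fst (cat i)"
    "\<forall>x. \<exists>i\<in>I. x \<in> fst (cat i) \<and> norm (snd (cat i) x - snd (cat i) i) \<le> rad i"
    using exists_finite_atlas[OF assms(2)] by blast
  obtain Es Eu C \<mu> where an: "C1_diffeo M f" "0 < C" "0 < \<mu>" "\<mu> < 1" and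
    split: "\<forall>x. subspace (Es x) \<and> subspace (Eu x) \<and>
             Es x \<inter> Eu x = {0} \<and> {u + v |u v. u \<in> Es x \<and> v \<in> Eu x} = UNIV \<and>
             tmap M f x ` Es x = Es (f x) \<and> tmap M f x ` Eu x = Eu (f x) \<and>
             (\<forall>n. \<forall>v\<in>Es x. tnorm M ((f ^^ n) x) (tmap M (f ^^ n) x v) \<le> C * \<mu> ^ n * tnorm M x v) \<and>
             (\<forall>n. \<forall>v\<in>Eu x. tnorm M ((inv f ^^ n) x) (tmap M (inv f ^^ n) x v) \<le> C * \<mu> ^ n * tnorm M x v)"
    using assms(3)[unfolded anosov_def] by (elim conjE exE) (rule that)
  note sp2 = split[THEN spec, THEN conjunct2]
  note sp3 = sp2[THEN conjunct2]
  note sp4 = sp3[THEN conjunct2]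
  note sp5 = sp4[THEN conjunct2]
  note sp6 = sp5[THEN conjunct2]
  note sp7 = sp6[THEN conjunct2]
  note sp = split[THEN spec, THEN conjunct1] sp2 sp3 sp4 sp5 sp6
  have splitting: "subspace (Es x)" "subspace (Eu x)" "Es x \<inter> Eu x = {0}" "{u + v |u v. u \<in> Es x \<and> v \<in> Eu x} = UNIV"
    "tmap M f x ` Es x = Es (f x)" "tmap M f x ` Eu x = Eu (f x)" for x
    by (rule sp(1) sp(2)[THEN conjunct1] sp(3)[THEN conjunct1] sp(4)[THEN conjunct1] sp(5)[THEN conjunct1] sp(6)[THEN conjunct1])+
  have contraction: "\<And>v. v \<in> Es x \<Longrightarrow> tnorm M ((f ^^ n) x) (tmap M (f ^^ n) x v) \<le> C * \<mu> ^ n * tnorm M x v"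
    "\<And>v. v \<in> Eu x \<Longrightarrow> tnorm M ((inv f ^^ n) x) (tmap M (inv f ^^ n) x v) \<le> C * \<mu> ^ n * tnorm M x v" for x n
    by (rule sp7[THEN conjunct1, THEN spec, THEN bspec] sp7[THEN conjunct2, THEN spec, THEN bspec], assumption)+
  interpret anosov_atlas M f Es Eu C \<mu> I rad r0
  proof unfold_locales
    show "cball (snd (cat i) i) (rad i + 2 * r0) \<subseteq> snd (cat i) ` fst (cat i)" if "i \<in> I" for i
      using atlas(3) that by (rule bspec)
    show "\<exists>i\<in>I. x \<in> fst (cat i) \<and> norm (snd (cat i) x - snd (cat i) i) \<le> rad i" for x
      using atlas(4) by (rule spec)
  qed (fact an splitting contraction atlas assms(2))+
  obtain \<kappa> Cs \<delta>0 \<beta>0 where \<kappa>: "0 < \<kappa>" "\<kappa> \<le> r0" and pos: "0 < Cs" "0 < \<delta>0" "0 < \<beta>0"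
    and core: "\<forall>F :: int \<Rightarrow> 'a \<Rightarrow> 'a. (\<forall>n. F n \<in> C1_nbhd \<kappa>) \<longrightarrow>
     (\<forall>x \<delta>. \<delta> \<le> \<delta>0 \<longrightarrow> (\<forall>n. rdist M (F n (x n)) (x (n + 1)) < ennreal \<delta>) \<longrightarrow>
        (\<exists>p. (\<forall>n. p (n + 1) = F n (p n)) \<and> (\<forall>n. rdist M (p n) (x n) \<le> ennreal (Cs * \<delta>)))) \<and>
     (\<forall>p q. (\<forall>n. p (n + 1) = F n (p n)) \<longrightarrow> (\<forall>n. q (n + 1) = F n (q n)) \<longrightarrow>
        (\<forall>n. rdist M (p n) (q n) < ennreal \<beta>0) \<longrightarrow> p = q)"
    using shadowing_core by (elim exE conjE) (rule that)
  \<comment> \<open>The neighbourhood is fixed here, before any sequence is chosen, and no later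
    constant for conjugacies depends on the sequence.\<close>
  interpret shadowing_family M "C1_nbhd \<kappa>" Cs \<delta>0 \<beta>0
  proof
    show "compact (UNIV :: 'a set)" by (rule assms(2))
    show "C1_diffeo M g" if "g \<in> C1_nbhd \<kappa>" for g using that unfolding C1_nbhd_def by blast
    show "0 < Cs" "0 < \<delta>0" "0 < \<beta>0" by (fact pos)+
    show "\<exists>p. (\<forall>n. p (n + 1) = F n (p n)) \<and> (\<forall>n. rdist M (p n) (x n) \<le> ennreal (Cs * \<delta>))"
      if "\<And>n. F n \<in> C1_nbhd \<kappa>" "\<delta> \<le> \<delta>0" "\<And>n :: int. rdist M (F n (x n)) (x (n + 1)) < ennreal \<delta>" for F x \<delta>
    proof -
      have "\<forall>n. F n \<in> C1_nbhd \<kappa>" "\<forall>n. rdist M (F n (x n)) (x (n + 1)) < ennreal \<delta>" using that(1,3) by blast+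
      from core[THEN spec, of F, THEN mp, OF this(1), THEN conjunct1, THEN spec, THEN spec, THEN mp, OF that(2), THEN mp, OF this(2)]
      show ?thesis .
    qed
    show "p = q" if "\<And>n. F n \<in> C1_nbhd \<kappa>" "\<And>n :: int. p (n + 1) = F n (p n)" "\<And>n. q (n + 1) = F n (q n)"
      "\<And>n. rdist M (p n) (q n) < ennreal \<beta>0" for F p q
    proof -
      have "\<forall>n. F n \<in> C1_nbhd \<kappa>" "\<forall>n. p (n + 1) = F n (p n)" "\<forall>n. q (n + 1) = F n (q n)"
        "\<forall>n. rdist M (p n) (q n) < ennreal \<beta>0" using that by blast+
      from core[THEN spec, of F, THEN mp, OF this(1), THEN conjunct2, THEN spec, THEN spec, THEN mp, OF this(2), THEN mp, OF this(3), THEN mp, OF this(4)]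
      show ?thesis .
    qed
  qed
  show ?thesis
  proof (intro exI[of _ "C1_nbhd \<kappa>"] conjI allI impI C1_nbhd_open[OF \<kappa>] f_in_C1_nbhd[OF \<kappa>(1)])
    fix F :: "int \<Rightarrow> 'a \<Rightarrow> 'a" assume "\<forall>n. F n \<in> C1_nbhd \<kappa>"
    then have F: "\<And>n. F n \<in> C1_nbhd \<kappa>" by blast
    show "lipschitz_shadowing M F" by (rule finite_shadowing[of F, OF F])
    show "\<exists>\<beta>\<^sub>0>0. \<forall>\<beta>>0. \<exists>\<zeta>>0. \<forall>x. pseudo_orbit M F \<zeta> x \<longrightarrow>
          (\<exists>p. shadows M F \<beta> p x) \<and> (\<beta> \<le> \<beta>\<^sub>0 \<longrightarrow> (\<exists>!p. shadows M F \<beta> p x))"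
      by (rule infinite_shadowing[of F, OF F])
  qed (rule conjugation, blast)
qed

end
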